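(* Let $M$ be a closed oriented Riemannian surface, $N=\Gamma\backslash\mathbb H$ a closed oriented hyperbolic surface, $p>2$, $1/p+1/q=1$, and let $u\in W^{1,p}(M,N)$ satisfy the $J_p$-Euler–Lagrange equations. Let $V=*S_{p-1}(du)\times u$ with $S_{p-1}(du)=Q(du)^{p-2}du$, a 1-form with values in $ad(E)$. For sections $\psi$ of $ad(E)$ let $$J_q(\psi)=\int_M\mathrm{Tr}\,Q\bigl(V+(d\psi)_u\bigr)^q*1 .$$ Then the minimum of $J_q$ over all sections $\psi$ of $ad(E)$ with $\psi=\psi_u$ is attained at $\psi=0$. Furthermore, in the weak sense, $$D_u*Q(V)^{q-2}V=0 .$$
   Context: For a linear map $A$ of inner product spaces, $Q(A)=(AA^T)^{1/2}$; $Q(A)^{r-1}A$ ($r>0$) is defined through the singular value decomposition: if $A=\sum_js_jB_j\otimes b_j$ then $Q(A)^{r-1}A=\sum_js_j^rB_j\otimes b_j$. The $J_p$-Euler–Lagrange equations of $J_p(u)=\int_M\mathrm{Tr}\,Q(du)^p*1$ are $D^*Q(du)^{p-2}du=0$ weakly, i.e. $\int_M(Q(du)^{p-2}du;D\xi)^\sharp*1=0$ for all $W^{1,p}$ sections $\xi$ of $u^{-1}(TN)$, $D$ being the pullback of the Levi-Civita connection. $\mathbb R^{2,1}$ carries $(X,Y)^\sharp=X_1Y_1+X_2Y_2-X_3Y_3=X^\sharp Y$, $X^\sharp=(\mathrm{diag}(1,1,-1)X)^T$; $\mathbb H=\{(X,X)^\sharp=-1,X_3\ge1\}$; $\mathfrak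 g=so(2,1)$ has the form $(A,B)^\sharp=\mathrm{Tr}(AB)$; $X\times Y=YX^\sharp-XY^\sharp\in\mathfrak g$. With $\rho:\pi_1(M)\to\Gamma\subset SO^+(2,1)$ induced by $u$, $E=\tilde M\times_\rho\mathbb R^{2,1}$ and $ad(E)=\tilde M\times_{Ad(\rho)}\mathfrak g$ are flat bundles with flat connection $d$; $u$ is identified with the section of $E$ given by its equivariant lift to $\mathbb H$, and $u^{-1}(TN)\subset E$. For $\psi$ with values in $ad(E)$, $\psi_u=(\psi u)\times u$ is the orthogonal projection of $\psi$ onto $\mathfrak p_u=\{v\times u:v\in u^{-1}(TN)\}\subset ad(E)$, on which $(\cdot,\cdot)^\sharp$ is positive definite; for 1-forms $A$ with values in $\mathfrak p_u$, $Q(A)$ is computed with this inner product and the metric of $M$. Sections $\psi=\psi_u$ are taken of class $W^{1,p}$. $D_u=(d\,\cdot)_u$ is the induced connection on $\mathfrak p_u$, acting on $\mathfrak p_u$-valued 1-forms as the exterior covariant derivative. $*$ is the Hodge star on forms on $M$. *)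

theory Defs
  imports "HOL-Analysis.Analysis"
begin

section \<open>Powers of linear maps between inner product spaces\<close>

text \<open>
  The target space is a linear subspace \<open>W\<close> of an ambient vector space, with inner product the
  restriction of a symmetric bilinear form \<open>h\<close> which need only be positive definite on \<open>W\<close>.  The
  source space is a whole type with inner product \<open>g\<close>.
\<close>

definition orthonormal_on ::
    "'v::real_vector set \<Rightarrow> ('v \<Rightarrow> 'v \<Rightarrow> real) \<Rightarrow> nat \<Rightarrow> (nat \<Rightarrow> 'v) \<Rightarrow> bool" where
  "orthonormal_on W h n e \<longleftrightarrow>
     (\<forall>i<n. e i \<in> W) \<and> (\<forall>i<n. \<forall>j<n. h (e i) (e j) = (if i = j then 1 else 0))"

definition orthonormal_basis_on ::
    "'v::real_vector set \<Rightarrow> ('v \<Rightarrow> 'v \<Rightarrow> real) \<Rightarrow> nat \<Rightarrow> (nat \<Rightarrow> 'v) \<Rightarrow> bool" where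
  "orthonormal_basis_on W h n e \<longleftrightarrow> orthonormal_on W h n e \<and> span (e ` {..<n}) = W"

text \<open>\<open>P\<^sup>r\<close> for a positive semidefinite self-adjoint operator \<open>P\<close> of \<open>W\<close>, by spectral decomposition.\<close>

definition op_powr ::
    "'v::real_vector set \<Rightarrow> ('v \<Rightarrow> 'v \<Rightarrow> real) \<Rightarrow> ('v \<Rightarrow> 'v) \<Rightarrow> real \<Rightarrow> ('v \<Rightarrow> 'v)" where
  "op_powr W h P r = (THE R. \<exists>n e l. orthonormal_basis_on W h n e \<and> (\<forall>j<n. 0 \<le> l j) \<and>
     (\<forall>w\<in>W. P w = (\<Sum>j<n. (l j * h (e j) w) *\<^sub>R e j)) \<and>
     R = (\<lambda>w. \<Sum>j<n. (l j powr r * h (e j) w) *\<^sub>R e j))"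

definition op_trace ::
    "'v::real_vector set \<Rightarrow> ('v \<Rightarrow> 'v \<Rightarrow> real) \<Rightarrow> ('v \<Rightarrow> 'v) \<Rightarrow> real" where
  "op_trace W h P = (THE t. \<exists>n e. orthonormal_basis_on W h n e \<and> t = (\<Sum>j<n. h (P (e j)) (e j)))"

definition adjoint_wrt ::
    "('a \<Rightarrow> 'a \<Rightarrow> real) \<Rightarrow> ('v \<Rightarrow> 'v \<Rightarrow> real) \<Rightarrow> ('a \<Rightarrow> 'v) \<Rightarrow> ('v \<Rightarrow> 'a)" where
  "adjoint_wrt g h A = (\<lambda>w. THE v. \<forall>v'. g v v' = h w (A v'))"

text \<open>\<open>Q(A) = (A A\<^sup>T)\<^bsup>1/2\<^esup>\<close>\<close>

definition Qop ::
    "('a \<Rightarrow> 'a \<Rightarrow> real) \<Rightarrow> 'v::real_vector set \<Rightarrow> ('v \<Rightarrow> 'v \<Rightarrow> real) \<Rightarrow> ('a \<Rightarrow> 'v) \<Rightarrow> ('v \<Rightarrow> 'v)" where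
  "Qop g W h A = op_powr W h (A \<circ> adjoint_wrt g h A) (1/2)"

text \<open>\<open>Tr Q(A)\<^sup>r\<close>\<close>

definition TrQ_powr ::
    "('a \<Rightarrow> 'a \<Rightarrow> real) \<Rightarrow> 'v::real_vector set \<Rightarrow> ('v \<Rightarrow> 'v \<Rightarrow> real) \<Rightarrow> real \<Rightarrow> ('a \<Rightarrow> 'v) \<Rightarrow> real" where
  "TrQ_powr g W h r A = op_trace W h (op_powr W h (Qop g W h A) r)"

text \<open>\<open>A = \<Sum>\<^sub>j s\<^sub>j B\<^sub>j \<otimes> b\<^sub>j\<close>\<close>

definition singular_value_decomp ::
    "('a::real_vector \<Rightarrow> 'a \<Rightarrow> real) \<Rightarrow> 'v::real_vector set \<Rightarrow> ('v \<Rightarrow> 'v \<Rightarrow> real) \<Rightarrow> ('a \<Rightarrow> 'v) \<Rightarrow>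
     nat \<Rightarrow> (nat \<Rightarrow> real) \<Rightarrow> (nat \<Rightarrow> 'v) \<Rightarrow> (nat \<Rightarrow> 'a) \<Rightarrow> bool" where
  "singular_value_decomp g W h A n s B b \<longleftrightarrow>
     orthonormal_on UNIV g n b \<and> orthonormal_on W h n B \<and> (\<forall>j<n. 0 \<le> s j) \<and>
     A = (\<lambda>v. \<Sum>j<n. (s j * g (b j) v) *\<^sub>R B j)"

text \<open>\<open>Q(A)\<^bsup>r-1\<^esup> A = \<Sum>\<^sub>j s\<^sub>j\<^sup>r B\<^sub>j \<otimes> b\<^sub>j\<close>; the exponent passed is \<open>r\<close>.\<close>

definition Q_powr_map ::
    "('a::real_vector \<Rightarrow> 'a \<Rightarrow> real) \<Rightarrow> 'v::real_vector set \<Rightarrow> ('v \<Rightarrow> 'v \<Rightarrow> real) \<Rightarrow> real \<Rightarrow>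
     ('a \<Rightarrow> 'v) \<Rightarrow> ('a \<Rightarrow> 'v)" where
  "Q_powr_map g W h r A = (THE C. \<exists>n s B b. singular_value_decomp g W h A n s B b \<and>
     C = (\<lambda>v. \<Sum>j<n. (s j powr r * g (b j) v) *\<^sub>R B j))"


section \<open>The hyperboloid model\<close>

definition sharp :: "real^3 \<Rightarrow> real^3" where
  "sharp X = vector [X$1, X$2, - (X$3)]"

definition lor :: "real^3 \<Rightarrow> real^3 \<Rightarrow> real" where
  "lor X Y = X$1 * Y$1 + X$2 * Y$2 - X$3 * Y$3"

definition hyperboloid :: "(real^3) set" where
  "hyperboloid = {X. lor X X = -1 \<and> X$3 \<ge> 1}"

definition SO21_plus :: "(real^3^3) set" where
  "SO21_plus = {L. (\<forall>X Y. lor (L *v X) (L *v Y) = lor X Y) \<and> det L = 1 \<and> L$3$3 > 0}"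

definition so21 :: "(real^3^3) set" where
  "so21 = {A. \<forall>X Y. lor (A *v X) Y + lor X (A *v Y) = 0}"

definition trace_form :: "real^3^3 \<Rightarrow> real^3^3 \<Rightarrow> real" where
  "trace_form A B = trace (A ** B)"

text \<open>\<open>X \<times> Y = Y X\<^sup>\<sharp> - X Y\<^sup>\<sharp>\<close>, a matrix in \<open>so(2,1)\<close>\<close>

definition mcross :: "real^3 \<Rightarrow> real^3 \<Rightarrow> real^3^3" where
  "mcross X Y = (\<chi> i j. Y$i * sharp X $ j - X$i * sharp Y $ j)"

definition tangent_H :: "real^3 \<Rightarrow> (real^3) set" where
  "tangent_H X = {v. lor v X = 0}"

text \<open>Orthogonal projection \<open>\<real>\<^bsup>2,1\<^esup> \<rightarrow> T\<^sub>X \<H>\<close> for \<open>X \<in> \<H>\<close>; recall \<open>(X,X)\<^sup>\<sharp> = -1\<close>.\<close>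

definition tangent_proj :: "real^3 \<Rightarrow> real^3 \<Rightarrow> real^3" where
  "tangent_proj X v = v + lor v X *\<^sub>R X"

definition p_space :: "real^3 \<Rightarrow> (real^3^3) set" where
  "p_space X = {mcross v X |v. v \<in> tangent_H X}"

definition p_proj :: "real^3 \<Rightarrow> real^3^3 \<Rightarrow> real^3^3" where
  "p_proj X A = mcross (A *v X) X"

text \<open>\<open>\<Gamma>\<close> such that \<open>\<Gamma>\<setminus>\<H>\<close> is a closed hyperbolic surface, oriented since \<open>\<Gamma> \<subseteq> SO\<^sup>+(2,1)\<close>\<close>

definition closed_surface_group :: "(real^3^3) set \<Rightarrow> bool" where
  "closed_surface_group \<Gamma> \<longleftrightarrow>
     \<Gamma> \<subseteq> SO21_plus \<and> mat 1 \<in> \<Gamma> \<and> (\<forall>L\<in>\<Gamma>. \<forall>L'\<in>\<Gamma>. L ** L' \<in> \<Gamma>) \<and> (\<forall>L\<in>\<Gamma>. matrix_inv L \<in> \<Gamma>) \<and>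
     (\<forall>L\<in>\<Gamma>. \<forall>X\<in>hyperboloid. L *v X = X \<longrightarrow> L = mat 1) \<and>
     (\<forall>K. compact K \<and> K \<subseteq> hyperboloid \<longrightarrow> finite {L\<in>\<Gamma>. (*v) L ` K \<inter> K \<noteq> {}}) \<and>
     (\<exists>K. compact K \<and> K \<subseteq> hyperboloid \<and> (\<Union>L\<in>\<Gamma>. (*v) L ` K) = hyperboloid)"

definition orbit :: "(real^3^3) set \<Rightarrow> real^3 \<Rightarrow> (real^3) set" where
  "orbit \<Gamma> X = (\<lambda>L. L *v X) ` \<Gamma>"

text \<open>The points of \<open>N = \<Gamma>\<setminus>\<H>\<close>\<close>

definition hyp_quotient :: "(real^3^3) set \<Rightarrow> (real^3) set set" where
  "hyp_quotient \<Gamma> = orbit \<Gamma> ` hyperboloid"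


section \<open>Closed oriented Riemannian surfaces\<close>

primrec ck_on :: "nat \<Rightarrow> (real^2) set \<Rightarrow> (real^2 \<Rightarrow> 'b::real_normed_vector) \<Rightarrow> bool" where
  "ck_on 0 S f = continuous_on S f"
| "ck_on (Suc k) S f =
     (f differentiable_on S \<and> (\<forall>v. ck_on k S (\<lambda>x. frechet_derivative f (at x) v)))"

text \<open>For open \<open>S\<close> only\<close>

definition smooth_on :: "(real^2) set \<Rightarrow> (real^2 \<Rightarrow> 'b::real_normed_vector) \<Rightarrow> bool" where
  "smooth_on S f \<longleftrightarrow> (\<forall>k. ck_on k S f)"

type_synonym 'm chart = "'m set \<times> ('m \<Rightarrow> real^2)"

text \<open>
  \<open>gram M c m\<close> is the Gram matrix of the metric at \<open>m\<close> in the coordinates of the chart \<open>c\<close>;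
  \<open>area M\<close> is the Riemannian area measure, which the last condition below determines.
\<close>

record 'm rsurface =
  charts :: "'m chart set"
  gram :: "'m chart \<Rightarrow> 'm \<Rightarrow> real^2^2"
  area :: "'m measure"

definition transition :: "'m chart \<Rightarrow> 'm chart \<Rightarrow> real^2 \<Rightarrow> real^2" where
  "transition c c' = snd c' \<circ> inv_into (fst c) (snd c)"

definition trans_jac :: "'m chart \<Rightarrow> 'm chart \<Rightarrow> 'm \<Rightarrow> real^2^2" where
  "trans_jac c c' m = matrix (frechet_derivative (transition c c') (at (snd c m)))"

definition oriented_smooth_atlas :: "'m::topological_space chart set \<Rightarrow> bool" where
  "oriented_smooth_atlas \<A> \<longleftrightarrow>
     (\<forall>(U, \<phi>)\<in>\<A>. open U \<and> open (\<phi> ` U) \<and> (\<exists>\<phi>'. homeomorphism U (\<phi> ` U) \<phi> \<phi>')) \<and>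
     (\<Union>c\<in>\<A>. fst c) = UNIV \<and>
     (\<forall>c\<in>\<A>. \<forall>c'\<in>\<A>. smooth_on (snd c ` (fst c \<inter> fst c')) (transition c c') \<and>
        (\<forall>m \<in> fst c \<inter> fst c'. det (trans_jac c c' m) > 0))"

definition riemannian_metric :: "'m rsurface \<Rightarrow> bool" where
  "riemannian_metric M \<longleftrightarrow>
     (\<forall>c\<in>charts M. smooth_on (snd c ` fst c) (\<lambda>y. gram M c (inv_into (fst c) (snd c) y)) \<and>
        (\<forall>m\<in>fst c. transpose (gram M c m) = gram M c m \<and>
           (\<forall>v. v \<noteq> 0 \<longrightarrow> v \<bullet> (gram M c m *v v) > 0))) \<and>
     (\<forall>c\<in>charts M. \<forall>c'\<in>charts M. \<forall>m \<in> fst c \<inter> fst c'.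
        gram M c m = transpose (trans_jac c c' m) ** gram M c' m ** trans_jac c c' m)"

definition riemannian_area :: "'m::topological_space rsurface \<Rightarrow> bool" where
  "riemannian_area M \<longleftrightarrow> sets (area M) = sets borel \<and>
     (\<forall>(U, \<phi>)\<in>charts M. \<forall>S \<in> sets borel. S \<subseteq> U \<longrightarrow>
        emeasure (area M) S =
          (\<integral>\<^sup>+ y. ennreal (sqrt (det (gram M (U, \<phi>) (inv_into U \<phi> y)))) * indicator (\<phi> ` S) y \<partial>lborel))"

definition closed_oriented_riemannian_surface ::
    "'m::{t2_space,second_countable_topology} rsurface \<Rightarrow> bool" where
  "closed_oriented_riemannian_surface M \<longleftrightarrow>
     compact (UNIV :: 'm set) \<and> connected (UNIV :: 'm set) \<and>
     oriented_smooth_atlas (charts M) \<and> riemannian_metric M \<and> riemannian_area M"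

definition universal_covering :: "('c::topological_space \<Rightarrow> 'm::topological_space) \<Rightarrow> bool" where
  "universal_covering \<pi> \<longleftrightarrow> covering_space UNIV \<pi> UNIV \<and> simply_connected (UNIV :: 'c set)"

text \<open>The deck group, i.e. \<open>\<pi>\<^sub>1(M)\<close> acting on the universal cover\<close>

definition deck :: "('c::topological_space \<Rightarrow> 'm) \<Rightarrow> ('c \<Rightarrow> 'c) set" where
  "deck \<pi> = {\<gamma>. (\<exists>\<gamma>'. homeomorphism UNIV UNIV \<gamma> \<gamma>') \<and> \<pi> \<circ> \<gamma> = \<pi>}"


section \<open>Sections and one-forms with values in flat bundles\<close>

text \<open>
  A flat bundle over \<open>M\<close> is given by an action \<open>act\<close> of the deck group on its fibre \<open>'v\<close>; its sections
  are the equivariant maps \<open>'c \<Rightarrow> 'v\<close>.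
\<close>

definition std_act :: "(('c \<Rightarrow> 'c) \<Rightarrow> real^3^3) \<Rightarrow> ('c \<Rightarrow> 'c) \<Rightarrow> real^3 \<Rightarrow> real^3" where
  "std_act \<rho> \<gamma> X = \<rho> \<gamma> *v X"

definition ad_act :: "(('c \<Rightarrow> 'c) \<Rightarrow> real^3^3) \<Rightarrow> ('c \<Rightarrow> 'c) \<Rightarrow> real^3^3 \<Rightarrow> real^3^3" where
  "ad_act \<rho> \<gamma> A = \<rho> \<gamma> ** A ** matrix_inv (\<rho> \<gamma>)"

definition bundle_section ::
    "('c::topological_space \<Rightarrow> 'm) \<Rightarrow> (('c \<Rightarrow> 'c) \<Rightarrow> 'v \<Rightarrow> 'v) \<Rightarrow> ('c \<Rightarrow> 'v) \<Rightarrow> bool" where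
  "bundle_section \<pi> act s \<longleftrightarrow> (\<forall>\<gamma>\<in>deck \<pi>. \<forall>x. s (\<gamma> x) = act \<gamma> (s x))"

text \<open>
  If \<open>c = (U, \<phi>)\<close> is a chart of \<open>M\<close> then \<open>\<phi> \<circ> \<pi>\<close> is a local coordinate on the cover near each \<open>x\<close> with
  \<open>\<pi> x \<in> U\<close>, and deck transformations are the identity in these coordinates.  The value \<open>\<alpha> c x v\<close> of a
  one-form \<open>\<alpha>\<close> is its value at \<open>x\<close> on the tangent vector with coordinates \<open>v\<close>; it is meaningful for
  \<open>c \<in> charts M\<close>, \<open>\<pi> x \<in> fst c\<close> only.
\<close>

type_synonym ('m, 'c, 'v) form1 = "'m chart \<Rightarrow> 'c \<Rightarrow> real^2 \<Rightarrow> 'v"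

definition one_form ::
    "'m rsurface \<Rightarrow> ('c::topological_space \<Rightarrow> 'm) \<Rightarrow> (('c \<Rightarrow> 'c) \<Rightarrow> 'v::real_vector \<Rightarrow> 'v) \<Rightarrow>
     ('m, 'c, 'v) form1 \<Rightarrow> bool" where
  "one_form M \<pi> act \<alpha> \<longleftrightarrow>
     (\<forall>c\<in>charts M. \<forall>x. \<pi> x \<in> fst c \<longrightarrow> linear (\<alpha> c x) \<and>
        (\<forall>\<gamma>\<in>deck \<pi>. \<forall>v. \<alpha> c (\<gamma> x) v = act \<gamma> (\<alpha> c x v)) \<and>
        (\<forall>c'\<in>charts M. \<pi> x \<in> fst c' \<longrightarrow> (\<forall>v. \<alpha> c x v = \<alpha> c' x (trans_jac c c' (\<pi> x) *v v))))"

definition loc_Lp :: "(real^2) set \<Rightarrow> real \<Rightarrow> (real^2 \<Rightarrow> 'v::euclidean_space) \<Rightarrow> bool" where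
  "loc_Lp \<Omega> p f \<longleftrightarrow> set_borel_measurable borel \<Omega> f \<and>
     (\<forall>K. compact K \<and> K \<subseteq> \<Omega> \<longrightarrow> set_integrable lborel K (\<lambda>y. norm (f y) powr p))"

definition test_function :: "(real^2) set \<Rightarrow> (real^2 \<Rightarrow> real) \<Rightarrow> bool" where
  "test_function \<Omega> \<eta> \<longleftrightarrow> smooth_on UNIV \<eta> \<and> (\<exists>K. compact K \<and> K \<subseteq> \<Omega> \<and> (\<forall>y. y \<notin> K \<longrightarrow> \<eta> y = 0))"

text \<open>\<open>f'\<close> is the weak partial derivative of \<open>f\<close> in direction \<open>e\<^sub>i\<close>.\<close>

definition weak_partial ::
    "(real^2) set \<Rightarrow> 2 \<Rightarrow> (real^2 \<Rightarrow> 'v::euclidean_space) \<Rightarrow> (real^2 \<Rightarrow> 'v) \<Rightarrow> bool" where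
  "weak_partial \<Omega> i f f' \<longleftrightarrow> loc_Lp \<Omega> 1 f \<and> loc_Lp \<Omega> 1 f' \<and>
     (\<forall>\<eta>. test_function \<Omega> \<eta> \<longrightarrow>
        (LINT y:\<Omega>|lborel. frechet_derivative \<eta> (at y) (axis i 1) *\<^sub>R f y) =
        - (LINT y:\<Omega>|lborel. \<eta> y *\<^sub>R f' y))"

text \<open>Open subsets \<open>W\<close> of the cover on which \<open>snd c \<circ> \<pi>\<close> is a coordinate chart\<close>

definition patch ::
    "'m rsurface \<Rightarrow> ('c::topological_space \<Rightarrow> 'm) \<Rightarrow> 'm chart \<Rightarrow> 'c set \<Rightarrow> bool" where
  "patch M \<pi> c W \<longleftrightarrow> c \<in> charts M \<and> open W \<and> inj_on \<pi> W \<and> \<pi> ` W \<subseteq> fst c"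

definition patch_dom :: "('c \<Rightarrow> 'm) \<Rightarrow> 'm chart \<Rightarrow> 'c set \<Rightarrow> (real^2) set" where
  "patch_dom \<pi> c W = (snd c \<circ> \<pi>) ` W"

definition patch_inv :: "('c \<Rightarrow> 'm) \<Rightarrow> 'm chart \<Rightarrow> 'c set \<Rightarrow> real^2 \<Rightarrow> 'c" where
  "patch_inv \<pi> c W = inv_into W (snd c \<circ> \<pi>)"

definition weak_differential ::
    "'m rsurface \<Rightarrow> ('c::topological_space \<Rightarrow> 'm) \<Rightarrow> ('c \<Rightarrow> 'v::euclidean_space) \<Rightarrow>
     ('m, 'c, 'v) form1 \<Rightarrow> bool" where
  "weak_differential M \<pi> s \<alpha> \<longleftrightarrow> (\<forall>c W i. patch M \<pi> c W \<longrightarrow>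
     weak_partial (patch_dom \<pi> c W) i (\<lambda>y. s (patch_inv \<pi> c W y))
       (\<lambda>y. \<alpha> c (patch_inv \<pi> c W y) (axis i 1)))"

text \<open>Since \<open>M\<close> is compact, \<open>L\<^sup>p\<close> is the same as \<open>L\<^sup>p\<close> locally in charts.\<close>

definition W1p_section ::
    "'m rsurface \<Rightarrow> ('c::topological_space \<Rightarrow> 'm) \<Rightarrow> (('c \<Rightarrow> 'c) \<Rightarrow> 'v \<Rightarrow> 'v) \<Rightarrow> real \<Rightarrow>
     ('c \<Rightarrow> 'v::euclidean_space) \<Rightarrow> bool" where
  "W1p_section M \<pi> act p s \<longleftrightarrow> bundle_section \<pi> act s \<and>
     (\<exists>\<alpha>. one_form M \<pi> act \<alpha> \<and> weak_differential M \<pi> s \<alpha> \<and>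
        (\<forall>c W. patch M \<pi> c W \<longrightarrow>
           loc_Lp (patch_dom \<pi> c W) p (\<lambda>y. s (patch_inv \<pi> c W y)) \<and>
           (\<forall>i. loc_Lp (patch_dom \<pi> c W) p (\<lambda>y. \<alpha> c (patch_inv \<pi> c W y) (axis i 1)))))"

text \<open>The weak differential for the flat connection, unique up to null sets\<close>

definition weak_d ::
    "'m rsurface \<Rightarrow> ('c::topological_space \<Rightarrow> 'm) \<Rightarrow> (('c \<Rightarrow> 'c) \<Rightarrow> 'v \<Rightarrow> 'v) \<Rightarrow>
     ('c \<Rightarrow> 'v::euclidean_space) \<Rightarrow> ('m, 'c, 'v) form1" where
  "weak_d M \<pi> act s = (SOME \<alpha>. one_form M \<pi> act \<alpha> \<and> weak_differential M \<pi> s \<alpha>)"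

text \<open>
  A function on \<open>M\<close> is given as \<open>F c x\<close> with the same convention as for one-forms, where \<open>F c x\<close> depends
  only on \<open>\<pi> x\<close> (up to null sets), so that the choices of \<open>c\<close> and \<open>x\<close> below do not matter.
  The completed measure is used since such functions are defined only almost everywhere.
\<close>

definition descend ::
    "'m rsurface \<Rightarrow> ('c \<Rightarrow> 'm) \<Rightarrow> ('m chart \<Rightarrow> 'c \<Rightarrow> real) \<Rightarrow> 'm \<Rightarrow> real" where
  "descend M \<pi> F m = F (SOME c. c \<in> charts M \<and> m \<in> fst c) (SOME x. \<pi> x = m)"

definition surf_integrable ::
    "'m rsurface \<Rightarrow> ('c \<Rightarrow> 'm) \<Rightarrow> ('m chart \<Rightarrow> 'c \<Rightarrow> real) \<Rightarrow> bool" where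
  "surf_integrable M \<pi> F \<longleftrightarrow> integrable (completion (area M)) (descend M \<pi> F)"

definition surf_integral ::
    "'m rsurface \<Rightarrow> ('c \<Rightarrow> 'm) \<Rightarrow> ('m chart \<Rightarrow> 'c \<Rightarrow> real) \<Rightarrow> real" where
  "surf_integral M \<pi> F = integral\<^sup>L (completion (area M)) (descend M \<pi> F)"

definition tan_ip :: "'m rsurface \<Rightarrow> 'm chart \<Rightarrow> 'm \<Rightarrow> real^2 \<Rightarrow> real^2 \<Rightarrow> real" where
  "tan_ip M c m v w = v \<bullet> (gram M c m *v w)"

text \<open>\<open>(\<alpha>;\<beta>)\<^sup>\<sharp> = \<Sum>\<^sub>i\<^sub>j g\<^bsup>ij\<^esup> (\<alpha>\<^sub>i, \<beta>\<^sub>j)\<^sup>\<sharp>\<close>\<close>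

definition form_ip ::
    "'m rsurface \<Rightarrow> ('c \<Rightarrow> 'm) \<Rightarrow> ('v \<Rightarrow> 'v \<Rightarrow> real) \<Rightarrow> ('m, 'c, 'v) form1 \<Rightarrow> ('m, 'c, 'v) form1 \<Rightarrow>
     'm chart \<Rightarrow> 'c \<Rightarrow> real" where
  "form_ip M \<pi> h \<alpha> \<beta> c x = (\<Sum>i\<in>UNIV. \<Sum>j\<in>UNIV.
     matrix_inv (gram M c (\<pi> x)) $ i $ j * h (\<alpha> c x (axis i 1)) (\<beta> c x (axis j 1)))"

text \<open>
  Hodge star: \<open>(*\<alpha>)(v) = \<Sum>\<^sub>i \<alpha>\<^sub>i dA(g\<^bsup>i\<^esup>, v)\<close>, where \<open>g\<^bsup>i\<^esup>\<close> is the vector with components \<open>g\<^bsup>ij\<^esup>\<close> and \<open>dA\<close>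
  the area form.  In the Euclidean plane, \<open>*dx = dy\<close> and \<open>*dy = -dx\<close>.
\<close>

definition hodge ::
    "'m rsurface \<Rightarrow> ('c \<Rightarrow> 'm) \<Rightarrow> ('m, 'c, 'v::real_vector) form1 \<Rightarrow> ('m, 'c, 'v) form1" where
  "hodge M \<pi> \<alpha> c x v = (\<Sum>i\<in>UNIV.
     (sqrt (det (gram M c (\<pi> x))) *
      (matrix_inv (gram M c (\<pi> x)) $ i $ 1 * v$2 - matrix_inv (gram M c (\<pi> x)) $ i $ 2 * v$1))
     *\<^sub>R \<alpha> c x (axis i 1))"

text \<open>The real 2-form \<open>(\<alpha> \<and> \<beta>)\<^sup>\<sharp>\<close>, divided by the area form\<close>

definition wedge_density ::
    "'m rsurface \<Rightarrow> ('c \<Rightarrow> 'm) \<Rightarrow> ('v \<Rightarrow> 'v \<Rightarrow> real) \<Rightarrow> ('m, 'c, 'v) form1 \<Rightarrow> ('m, 'c, 'v) form1 \<Rightarrow>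
     'm chart \<Rightarrow> 'c \<Rightarrow> real" where
  "wedge_density M \<pi> h \<alpha> \<beta> c x =
     (h (\<alpha> c x (axis 1 1)) (\<beta> c x (axis 2 1)) - h (\<alpha> c x (axis 2 1)) (\<beta> c x (axis 1 1)))
     / sqrt (det (gram M c (\<pi> x)))"


section \<open>Maps to \<open>N\<close>\<close>

text \<open>\<open>U\<close> is a continuous lift of \<open>u : M \<rightarrow> \<Gamma>\<setminus>\<H>\<close>, and \<open>\<rho>\<close> is the representation induced by \<open>u\<close>.\<close>

definition equivariant_lift ::
    "('c::topological_space \<Rightarrow> 'm) \<Rightarrow> (real^3^3) set \<Rightarrow> ('m \<Rightarrow> (real^3) set) \<Rightarrow>
     (('c \<Rightarrow> 'c) \<Rightarrow> real^3^3) \<Rightarrow> ('c \<Rightarrow> real^3) \<Rightarrow> bool" where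
  "equivariant_lift \<pi> \<Gamma> u \<rho> U \<longleftrightarrow>
     continuous_on UNIV U \<and> range U \<subseteq> hyperboloid \<and> (\<forall>x. u (\<pi> x) = orbit \<Gamma> (U x)) \<and>
     \<rho> ` deck \<pi> \<subseteq> \<Gamma> \<and> (\<forall>\<gamma>\<in>deck \<pi>. \<forall>\<delta>\<in>deck \<pi>. \<rho> (\<gamma> \<circ> \<delta>) = \<rho> \<gamma> ** \<rho> \<delta>) \<and>
     bundle_section \<pi> (std_act \<rho>) U"

text \<open>
  \<open>u \<in> W\<^bsup>1,p\<^esup>(M, N)\<close> for \<open>p > 2\<close>.  Such maps are continuous, hence lift to the universal cover; as
  \<open>\<H> \<rightarrow> N\<close> is a local isometry, the Sobolev class is read off from the lift.
\<close>

definition sobolev_map ::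
    "'m rsurface \<Rightarrow> ('c::topological_space \<Rightarrow> 'm) \<Rightarrow> (real^3^3) set \<Rightarrow> real \<Rightarrow>
     ('m \<Rightarrow> (real^3) set) \<Rightarrow> bool" where
  "sobolev_map M \<pi> \<Gamma> p u \<longleftrightarrow> range u \<subseteq> hyp_quotient \<Gamma> \<and>
     (\<exists>\<rho> U. equivariant_lift \<pi> \<Gamma> u \<rho> U \<and> W1p_section M \<pi> (std_act \<rho>) p U)"

text \<open>
  \<open>S\<^bsub>p-1\<^esub>(du) = Q(du)\<^bsup>p-2\<^esup> du\<close>, where \<open>du\<close> at \<open>x\<close> is a map from the tangent plane of \<open>M\<close> to \<open>T\<^bsub>U x\<^esub> \<H>\<close>
\<close>

definition S_form ::
    "'m rsurface \<Rightarrow> ('c::topological_space \<Rightarrow> 'm) \<Rightarrow> (('c \<Rightarrow> 'c) \<Rightarrow> real^3^3) \<Rightarrow> ('c \<Rightarrow> real^3) \<Rightarrow>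
     real \<Rightarrow> ('m, 'c, real^3) form1" where
  "S_form M \<pi> \<rho> U p c x =
     Q_powr_map (tan_ip M c (\<pi> x)) (tangent_H (U x)) lor (p - 1) (weak_d M \<pi> (std_act \<rho>) U c x)"

text \<open>
  \<open>D\<xi>\<close> for sections \<open>\<xi>\<close> of \<open>u\<^sup>-\<^sup>1(TN)\<close>: the Levi-Civita connection of \<open>\<H> \<subset> \<real>\<^bsup>2,1\<^esup>\<close> is the
  tangential part of the flat connection.
\<close>

definition D_form ::
    "'m rsurface \<Rightarrow> ('c::topological_space \<Rightarrow> 'm) \<Rightarrow> (('c \<Rightarrow> 'c) \<Rightarrow> real^3^3) \<Rightarrow> ('c \<Rightarrow> real^3) \<Rightarrow>
     ('c \<Rightarrow> real^3) \<Rightarrow> ('m, 'c, real^3) form1" where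
  "D_form M \<pi> \<rho> U \<xi> c x v = tangent_proj (U x) (weak_d M \<pi> (std_act \<rho>) \<xi> c x v)"

definition Jp_euler_lagrange ::
    "'m rsurface \<Rightarrow> ('c::topological_space \<Rightarrow> 'm) \<Rightarrow> (('c \<Rightarrow> 'c) \<Rightarrow> real^3^3) \<Rightarrow> ('c \<Rightarrow> real^3) \<Rightarrow>
     real \<Rightarrow> bool" where
  "Jp_euler_lagrange M \<pi> \<rho> U p \<longleftrightarrow>
     (\<forall>\<xi>. W1p_section M \<pi> (std_act \<rho>) p \<xi> \<and> (\<forall>x. \<xi> x \<in> tangent_H (U x)) \<longrightarrow>
        surf_integral M \<pi> (form_ip M \<pi> lor (S_form M \<pi> \<rho> U p) (D_form M \<pi> \<rho> U \<xi>)) = 0)"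

text \<open>\<open>V = *S\<^bsub>p-1\<^esub>(du) \<times> u\<close>\<close>

definition V_form ::
    "'m rsurface \<Rightarrow> ('c::topological_space \<Rightarrow> 'm) \<Rightarrow> (('c \<Rightarrow> 'c) \<Rightarrow> real^3^3) \<Rightarrow> ('c \<Rightarrow> real^3) \<Rightarrow>
     real \<Rightarrow> ('m, 'c, real^3^3) form1" where
  "V_form M \<pi> \<rho> U p c x v = mcross (hodge M \<pi> (S_form M \<pi> \<rho> U p) c x v) (U x)"

text \<open>The \<open>W\<^bsup>1,p\<^esup>\<close> sections \<open>\<psi>\<close> of \<open>ad(E)\<close> with \<open>\<psi> = \<psi>\<^sub>u\<close>\<close>

definition p_sections ::
    "'m rsurface \<Rightarrow> ('c::topological_space \<Rightarrow> 'm) \<Rightarrow> (('c \<Rightarrow> 'c) \<Rightarrow> real^3^3) \<Rightarrow> ('c \<Rightarrow> real^3) \<Rightarrow>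
     real \<Rightarrow> ('c \<Rightarrow> real^3^3) set" where
  "p_sections M \<pi> \<rho> U p = {\<psi>. W1p_section M \<pi> (ad_act \<rho>) p \<psi> \<and>
     (\<forall>x. \<psi> x \<in> so21) \<and> (\<forall>x. \<psi> x = p_proj (U x) (\<psi> x))}"

text \<open>\<open>D\<^sub>u \<psi> = (d\<psi>)\<^sub>u\<close>\<close>

definition Du_form ::
    "'m rsurface \<Rightarrow> ('c::topological_space \<Rightarrow> 'm) \<Rightarrow> (('c \<Rightarrow> 'c) \<Rightarrow> real^3^3) \<Rightarrow> ('c \<Rightarrow> real^3) \<Rightarrow>
     ('c \<Rightarrow> real^3^3) \<Rightarrow> ('m, 'c, real^3^3) form1" where
  "Du_form M \<pi> \<rho> U \<psi> c x v = p_proj (U x) (weak_d M \<pi> (ad_act \<rho>) \<psi> c x v)"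

definition Jq ::
    "'m rsurface \<Rightarrow> ('c::topological_space \<Rightarrow> 'm) \<Rightarrow> (('c \<Rightarrow> 'c) \<Rightarrow> real^3^3) \<Rightarrow> ('c \<Rightarrow> real^3) \<Rightarrow>
     real \<Rightarrow> real \<Rightarrow> ('c \<Rightarrow> real^3^3) \<Rightarrow> real" where
  "Jq M \<pi> \<rho> U p q \<psi> = surf_integral M \<pi> (\<lambda>c x.
     TrQ_powr (tan_ip M c (\<pi> x)) (p_space (U x)) trace_form q
       (\<lambda>v. V_form M \<pi> \<rho> U p c x v + Du_form M \<pi> \<rho> U \<psi> c x v))"

text \<open>\<open>Q(V)\<^bsup>q-2\<^esup> V\<close>\<close>

definition QV_form ::
    "'m rsurface \<Rightarrow> ('c::topological_space \<Rightarrow> 'm) \<Rightarrow> (('c \<Rightarrow> 'c) \<Rightarrow> real^3^3) \<Rightarrow> ('c \<Rightarrow> real^3) \<Rightarrow>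
     real \<Rightarrow> real \<Rightarrow> ('m, 'c, real^3^3) form1" where
  "QV_form M \<pi> \<rho> U p q c x =
     Q_powr_map (tan_ip M c (\<pi> x)) (p_space (U x)) trace_form (q - 1) (V_form M \<pi> \<rho> U p c x)"

text \<open>
  \<open>D\<^sub>u \<omega> = 0\<close> weakly for a one-form \<open>\<omega>\<close> with values in \<open>\<pp>\<^sub>u\<close>: \<open>\<integral>\<^sub>M (D\<^sub>u\<phi> \<and> \<omega>)\<^sup>\<sharp> = 0\<close> for all \<open>W\<^bsup>1,p\<^esup>\<close>
  sections \<open>\<phi>\<close> of \<open>\<pp>\<^sub>u\<close>, the integrals being convergent
\<close>

definition weakly_Du_closed ::
    "'m rsurface \<Rightarrow> ('c::topological_space \<Rightarrow> 'm) \<Rightarrow> (('c \<Rightarrow> 'c) \<Rightarrow> real^3^3) \<Rightarrow> ('c \<Rightarrow> real^3) \<Rightarrow>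
     real \<Rightarrow> ('m, 'c, real^3^3) form1 \<Rightarrow> bool" where
  "weakly_Du_closed M \<pi> \<rho> U p \<omega> \<longleftrightarrow> (\<forall>\<phi>\<in>p_sections M \<pi> \<rho> U p.
     surf_integrable M \<pi> (wedge_density M \<pi> trace_form (Du_form M \<pi> \<rho> U \<phi>) \<omega>) \<and>
     surf_integral M \<pi> (wedge_density M \<pi> trace_form (Du_form M \<pi> \<rho> U \<phi>) \<omega>) = 0)"

end

theory Submission
 imports Defs "HOL-Computational_Algebra.Polynomial"
begin

text \<open>If \<open>du = \<Sum>s\<^sub>j B\<^sub>j \<otimes> b\<^sub>j\<close> then \<open>V = \<Sum>s\<^sub>j\<^bsup>p-1\<^esup> (B\<^sub>j \<times> u) \<otimes> *b\<^sub>j\<close>, and since \<open>(p - 1) (q - 1) = 1\<close>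
 the form \<open>Q(V)\<^bsup>q-2\<^esup>V\<close> is a constant multiple of \<open>*(du \<times> u)\<close>, so \<open>*Q(V)\<^bsup>q-2\<^esup>V\<close> is a multiple of \<open>du \<times> u\<close>.
 Now \<open>(D\<^sub>u\<phi> \<and> du \<times> u)\<^sup>\<sharp>\<close> is twice the differential of \<open>(\<phi> u, du)\<^sup>\<sharp>\<close>, as \<open>\<phi>\<close> is skew and \<open>(\<phi> du \<and> du)\<^sup>\<sharp> = 0\<close> for
 \<open>\<phi> = \<phi>\<^sub>u\<close>, so its integral vanishes; this is \<open>D\<^sub>u * Q(V)\<^bsup>q-2\<^esup>V = 0\<close>.
 As \<open>A \<mapsto> Tr Q(A)\<^sup>q\<close> is convex with differential \<open>q (Q(V)\<^bsup>q-2\<^esup>V; \<cdot>)\<close> at \<open>V\<close>, it follows that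
 \<open>J\<^sub>q(\<psi>) \<ge> J\<^sub>q(0)\<close>.\<close>

text \<open>In the Stokes argument \<open>U\<close> is continuous, hence locally bounded, but \<phi>
  and all derivatives are used only through local square integrability, so \<phi> dU dU is a product
  of three such functions. Multiplying \<phi> by the bounded scalar \<open>kap\<close> makes every
  term integrable. Being a scalar it preserves \<phi> = \<open>\<phi>\<^sub>u\<close>, so the
  critical terms still cancel and the truncation can be released. Functions on M are defined by
  choosing a chart and a point of the fibre. Independence of the choice rests on transitivity of the
  deck group on fibres, hence the theory of lifts. It holds only at \<open>good\<close> points,
  where dU is tangent to the hyperboloid, so integrals are taken with the completed measure, and
  measurability comes from an explicit formula in traces and determinants.\<close>

type_synonym plane = "real^2 => real"

abbreviation bor :: "('a::topological_space => 'b::topological_space) set" where "bor \<equiv> borel_measurable borel"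
abbreviation lint :: "('a::euclidean_space => 'b::{banach,second_countable_topology}) => bool" where "lint \<equiv> integrable lborel"
abbreviation Lint :: "('a::euclidean_space => 'b::{banach,second_countable_topology}) => 'b" (binder "LI " 10)
 where "Lint f \<equiv> integral\<^sup>L lborel f"
abbreviation cont :: "('a::topological_space => 'b::topological_space) => bool" where "cont \<equiv> continuous_on UNIV"
abbreviation lim_to :: "(nat => 'a::topological_space) => 'a => bool" (infixr "\<leadsto>" 60)
 where "f \<leadsto> l \<equiv> (f \<longlongrightarrow> l) sequentially"
abbreviation ax1 :: "real^2" where "ax1 \<equiv> axis 1 1"
abbreviation ax2 :: "real^2" where "ax2 \<equiv> axis 2 1"
abbreviation pd :: "2 => plane => plane" where "pd i f y \<equiv> frechet_derivative f (at y) (axis i 1)"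

section \<open>Smooth functions of one real variable\<close>

primrec Ck1 :: "nat => (real => real) => bool" where
 "Ck1 0 f = True"
| "Ck1 (Suc k) f = (\<exists>f'. (ALL x. (f has_real_derivative f' x) (at x)) & Ck1 k f')"

definition smooth1 :: "(real => real) => bool" where
 "smooth1 f \<longleftrightarrow> (ALL k. Ck1 k f)"

lemma Ck1_Suc: "Ck1 (Suc k) f ==> Ck1 k f"
proof (induction k arbitrary: f)
 case (Suc k)
 then obtain f' where "ALL x. (f has_real_derivative f' x) (at x)" "Ck1 (Suc k) f'" by auto
 thus ?case using Suc.IH[of f'] by auto
qed simp

lemma Ck1_add: "Ck1 k f ==> Ck1 k g ==> Ck1 k (%x. f x + g x)"
proof (induction k arbitrary: f g)
 case (Suc k)
 then obtain f' g' where "ALL x. (f has_real_derivative f' x) (at x)" "Ck1 k f'"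
  "ALL x. (g has_real_derivative g' x) (at x)" "Ck1 k g'" by auto
 thus ?case using Suc.IH[of f' g'] by (auto intro!: exI[of _ "%x. f' x + g' x"] derivative_intros)
qed simp

lemma Ck1_mult: "Ck1 k f ==> Ck1 k g ==> Ck1 k (%x. f x * g x)"
proof (induction k arbitrary: f g)
 case (Suc k)
 then obtain f' g' where d: "ALL x. (f has_real_derivative f' x) (at x)" "Ck1 k f'"
  "ALL x. (g has_real_derivative g' x) (at x)" "Ck1 k g'" by auto
 have "Ck1 k (%x. f' x * g x + g' x * f x)"
  using Suc.IH[of f' g] Suc.IH[of g' f] d Suc.prems Ck1_Suc by (auto intro!: Ck1_add)
 thus ?case using d
  by (auto intro!: exI[of _ "%x. f' x * g x + g' x * f x"] derivative_eq_intros)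
qed simp

lemma Ck1_const: "Ck1 k (%x. c)"
 by (induction k arbitrary: c) (auto intro!: exI[of _ "%x. 0"])

lemma Ck1_affine: "Ck1 k f ==> Ck1 k (%x. f (a * x + b))"
proof (induction k arbitrary: f)
 case (Suc k)
 then obtain f' where d: "!!x. (f has_real_derivative f' x) (at x)" "Ck1 k f'" by auto
 have "((%x. f (a * x + b)) has_real_derivative (f' (a * x + b) * a)) (at x)" for x
  by (rule DERIV_chain'[where f="%x. a * x + b" and g=f]) (auto intro!: derivative_eq_intros d simp: algebra_simps)
 moreover have "Ck1 k (%x. f' (a * x + b) * a)" using Suc.IH[OF d(2)] by (intro Ck1_mult Ck1_const)
 ultimately show ?case by (auto intro!: exI[of _ "%x. f' (a * x + b) * a"])
qed simp

lemma smooth1_mult: "smooth1 f ==> smooth1 g ==> smooth1 (%x. f x * g x)"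
 and smooth1_affine: "smooth1 f ==> smooth1 (%x. f (a * x + b))"
 by (simp_all add: smooth1_def Ck1_mult Ck1_affine)

lemma smooth1_deriv:
 assumes "smooth1 f"
 shows "(f has_real_derivative deriv f x) (at x)" (is ?P1) "smooth1 (deriv f)"
proof -
 have *: "\<exists>f'. (ALL x. (f has_real_derivative f' x) (at x)) & Ck1 k f'" for k
  using assms[unfolded smooth1_def, rule_format, of "Suc k"] by simp
 show ?P1 using *[of 0] by (metis DERIV_imp_deriv)
 have "Ck1 k (deriv f)" for k
 proof -
  obtain f' where "ALL x. (f has_real_derivative f' x) (at x)" "Ck1 k f'" using *[of k] by blast
  moreover hence "f' = deriv f" by (metis DERIV_imp_deriv ext)
  ultimately show ?thesis by simp
 qed
 thus "smooth1 (deriv f)" by (simp add: smooth1_def)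
qed

lemma smooth1_continuous: "smooth1 f ==> continuous_on S f"
 by (meson smooth1_deriv(1) DERIV_isCont continuous_at_imp_continuous_on)

lemma deriv_zero_outside:
 assumes "smooth1 a" "!!t. \<bar>t\<bar> > e ==> a t = 0" "\<bar>t\<bar> > e"
 shows "deriv a t = 0"
proof -
 have "open {t::real. \<bar>t\<bar> > e}" by (intro open_Collect_less continuous_intros)
 hence "(a has_real_derivative 0) (at t)"
  using has_field_derivative_transform_within_open[of "%_. 0" 0 t "{t. \<bar>t\<bar> > e}" a] assms by auto
 thus ?thesis by (rule DERIV_imp_deriv)
qed

text \<open>The classical flat function times a polynomial in 1/t. The polynomial is carried along
  because differentiation stays in the family: P becomes X^2 (P - P').\<close>

definition flat :: "real poly => real => real" where
 "flat P t = (if t > 0 then poly P (inverse t) * exp (- inverse t) else 0)"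

lemma poly_exp_tendsto_0: "((%s. poly P s * exp (- s)) \<longlongrightarrow> (0::real)) at_top"
proof -
 have "((%s. \<Sum>i\<le>degree P. coeff P i * (s ^ i / exp s)) \<longlongrightarrow> (\<Sum>i\<le>degree P. coeff P i * 0)) at_top"
  by (intro tendsto_sum tendsto_mult tendsto_const tendsto_power_div_exp_0)
 thus ?thesis by (simp add: poly_altdef sum_distrib_right exp_minus divide_inverse mult.assoc)
qed

lemma flat_DERIV: "(flat P has_real_derivative flat ([:0,0,1:] * (P - pderiv P)) t) (at t)"
proof -
 consider "t < 0" | "t > 0" | "t = 0" by linarith
 thus ?thesis
 proof cases
  case 1
  have "(flat P has_real_derivative 0) (at t)"
   by (rule has_field_derivative_transform_within_open[of "%_. 0" _ _ "{..<0}"])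
    (use 1 in "auto simp: flat_def")
  with 1 show ?thesis by (simp add: flat_def)
 next
  case 2
  have "((%t. poly P (inverse t) * exp (- inverse t)) has_real_derivative
    flat ([:0,0,1:] * (P - pderiv P)) t) (at t)"
   using 2 by (auto intro!: derivative_eq_intros simp: flat_def algebra_simps power2_eq_square)
  thus ?thesis
   by (rule has_field_derivative_transform_within_open[of _ _ _ "{0<..}"])
    (use 2 in "auto simp: flat_def")
 next
  case 3
  \<comment> \<open>For x > 0 the difference quotient at 0 is \<open>flat\<close> for the polynomial
    X * P, so decay of a polynomial against exp (- s) at infinity suffices.\<close>
  have "((%x. poly ([:0,1:] * P) (inverse x) * exp (- inverse x)) \<longlongrightarrow> 0) (at_right 0)"
   using filterlim_compose[OF poly_exp_tendsto_0 filterlim_inverse_at_top_right] .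
  moreover have "\<forall>\<^sub>F x in at_right 0. poly ([:0,1:] * P) (inverse x) * exp (- inverse x) = flat P x / x"
   by (rule eventually_at_rightI[of _ 1]) (auto simp: flat_def field_simps)
  ultimately have r: "((%x. flat P x / x) \<longlongrightarrow> 0) (at_right 0)" by (rule Lim_transform_eventually)
  have l: "((%x. flat P x / x) \<longlongrightarrow> 0) (at_left 0)"
  proof (rule Lim_transform_eventually[OF tendsto_const])
   show "\<forall>\<^sub>F x in at_left 0. 0 = flat P x / x"
    by (rule eventually_at_leftI[of "-1"]) (auto simp: flat_def)
  qed
  have "((%x. flat P x / x) \<longlongrightarrow> 0) (at 0)" using l r filterlim_at_split by blast
  with 3 show ?thesis by (simp add: has_field_derivative_iff flat_def)
 qed
qed

lemma smooth1_flat: "smooth1 (flat P)"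
proof -
 have "Ck1 k (flat P)" for k by (induction k arbitrary: P) (auto intro: flat_DERIV)
 thus ?thesis by (simp add: smooth1_def)
qed

definition bump :: "real => real => real" where
 "bump e t = flat 1 (e - t) * flat 1 (e + t)"

lemma bump_props:
 shows smooth1_bump: "smooth1 (bump e)" and bump_nonneg: "bump e t >= 0"
  and bump_zero: "\<bar>t\<bar> >= e ==> bump e t = 0" and bump_pos: "\<bar>t\<bar> < e ==> bump e t > 0"
  and bump_even: "bump e (- t) = bump e t"
proof -
 have "bump e = (%t. flat 1 ((-1) * t + e) * flat 1 (1 * t + e))" by (auto simp: bump_def fun_eq_iff add.commute)
 thus "smooth1 (bump e)" by (simp only: smooth1_mult smooth1_affine smooth1_flat)
qed (auto simp: bump_def flat_def)

section \<open>Continuously differentiable functions on the plane\<close>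

definition tensor :: "(real => real) => (real => real) => real^2 => real" where
 "tensor a b x = a (x$1) * b (x$2)"

text \<open>The partial derivatives are arguments, so a rule for \<open>C1\<close> also computes
  them. Equality of mixed second derivatives is expressed by sharing one function:
  \<open>C1 f1 f11 f12\<close> and \<open>C1 f2 f12 f22\<close>.\<close>

definition C1 :: "plane => plane => plane => bool" where
 "C1 f f1 f2 \<longleftrightarrow> (ALL x. (f has_derivative (%v. v$1 * f1 x + v$2 * f2 x)) (at x)) &
  cont f1 & cont f2"

definition supp_in :: "(real^2) set => plane => bool" where
 "supp_in K f \<longleftrightarrow> (ALL x. x \<notin> K --> f x = 0)"

lemma C1_continuous: "C1 f f1 f2 ==> continuous_on S f"
 by (meson C1_def has_derivative_continuous continuous_at_imp_continuous_on)

lemma C1_mult: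
 assumes "C1 f f1 f2" "C1 g g1 g2"
 shows "C1 (%x. f x * g x) (%x. f1 x * g x + f x * g1 x) (%x. f2 x * g x + f x * g2 x)"
 using assms C1_continuous[OF assms(1), of UNIV] C1_continuous[OF assms(2), of UNIV] unfolding C1_def
 by (auto intro!: continuous_intros derivative_eq_intros simp: algebra_simps)

lemma C1_supp_deriv:
 assumes "C1 f f1 f2" "compact K" "supp_in K f"
 shows "supp_in K f1" "supp_in K f2"
proof -
 have "f1 x = 0 & f2 x = 0" if "x \<notin> K" for x
 proof -
  have "(f has_derivative (%v. 0)) (at x)"
   by (rule has_derivative_transform_within_open[of "%_. 0" _ _ _ "- K"])
    (use assms that in "auto simp: supp_in_def compact_imp_closed open_Compl")
  moreover have "(f has_derivative (%v. v$1 * f1 x + v$2 * f2 x)) (at x)" using assms by (simp add: C1_def)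
  ultimately have "(%v::real^2. v$1 * f1 x + v$2 * f2 x) = (%v. 0)" by (rule has_derivative_unique[symmetric])
  from fun_cong[OF this, of "axis 1 1"] fun_cong[OF this, of "axis 2 1"]
  show ?thesis by (simp add: axis_def)
 qed
 thus "supp_in K f1" "supp_in K f2" by (auto simp: supp_in_def)
qed

lemma uniformly_continuous_compact_supp:
 fixes f :: plane
 assumes "cont f" "compact K" "supp_in K f" "e > 0"
 obtains d where "d > 0" "!!x y. dist x y < d ==> \<bar>f x - f y\<bar> < e"
proof -
 obtain r where r: "!!x. x \<in> K ==> norm x <= r"
  using assms(2) compact_imp_bounded bounded_iff by metis
 have "uniformly_continuous_on (cball 0 (r+1)) f"
  by (rule compact_uniformly_continuous) (use assms continuous_on_subset in auto)
 then obtain d where d: "d > 0" "!!x y. x \<in> cball 0 (r+1) ==> y \<in> cball 0 (r+1) ==> dist y x < d ==> dist (f y) (f x) < e"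
  unfolding uniformly_continuous_on_def using \<open>e > 0\<close> by metis
 show ?thesis
 proof (rule that[of "min d 1"])
  fix x y :: "real^2" assume xy: "dist x y < min d 1"
  show "\<bar>f x - f y\<bar> < e"
  proof (cases "x \<in> K \<or> y \<in> K")
   case True
   hence "norm x <= r + 1 & norm y <= r + 1"
    using r xy norm_triangle_sub[of x y] norm_triangle_sub[of y x] by (force simp: dist_norm norm_minus_commute)
   thus ?thesis using d(2)[of y x] xy by (auto simp: dist_real_def)
  next
   case False thus ?thesis using assms by (auto simp: supp_in_def)
  qed
 qed (use d in auto)
qed

lemma bounded_compact_supp:
 fixes f :: plane
 assumes "cont f" "compact K" "supp_in K f"
 obtains B where "B >= 0" "!!x. \<bar>f x\<bar> <= B"
proof -
 have "bounded (f ` K)" using assms compact_continuous_image compact_imp_bounded continuous_on_subset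
  by (metis subset_UNIV)
 then obtain B where "!!x. x \<in> K ==> \<bar>f x\<bar> <= B" by (auto simp: bounded_iff)
 hence "\<bar>f x\<bar> <= max B 0" for x using assms(3) by (cases "x \<in> K") (auto simp: supp_in_def intro: le_max_iff_disj[THEN iffD2])
 thus ?thesis using that[of "max B 0"] by auto
qed

text \<open>The mean value theorem on the segment from x to x + h, and uniform continuity of the two
  partial derivatives, each contributing e / 2. Uniformity in x is what differentiation under a
  convolution integral requires.\<close>

lemma C1_uniform:
 assumes f: "C1 f f1 f2" "compact K" "supp_in K f" and e: "e > 0"
 obtains d where "d > 0"
  "!!x h. norm h < d ==> \<bar>f (x + h) - f x - (h$1 * f1 x + h$2 * f2 x)\<bar> <= e * norm h"
proof -
 note s = C1_supp_deriv[OF f]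
 have c: "cont f1" "cont f2" using f by (auto simp: C1_def)
 obtain d1 where d1: "d1 > 0" "!!x y. dist x y < d1 ==> \<bar>f1 x - f1 y\<bar> < e/2"
  using uniformly_continuous_compact_supp[OF c(1) f(2) s(1), of "e/2"] e by (metis half_gt_zero)
 obtain d2 where d2: "d2 > 0" "!!x y. dist x y < d2 ==> \<bar>f2 x - f2 y\<bar> < e/2"
  using uniformly_continuous_compact_supp[OF c(2) f(2) s(2), of "e/2"] e by (metis half_gt_zero)
 show ?thesis
 proof (rule that[of "min d1 d2"])
  fix x h :: "real^2" assume h: "norm h < min d1 d2"
  have D: "((%t. f (x + t *\<^sub>R h)) has_derivative
    (%s. (s *\<^sub>R h)$1 * f1 (x + t *\<^sub>R h) + (s *\<^sub>R h)$2 * f2 (x + t *\<^sub>R h))) (at t)" for t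
   by (rule has_derivative_compose[where f="%t. x + t *\<^sub>R h" and g=f])
    (use f(1) in "auto intro!: derivative_eq_intros simp: C1_def")
  have "\<exists>t\<in>{0<..<1::real}. f (x + 1 *\<^sub>R h) - f (x + 0 *\<^sub>R h) =
    (%s. (s *\<^sub>R h)$1 * f1 (x + t *\<^sub>R h) + (s *\<^sub>R h)$2 * f2 (x + t *\<^sub>R h)) (1 - 0)"
   by (rule mvt_simple[where f="%t. f (x + t *\<^sub>R h)"
      and f'="%t s. (s *\<^sub>R h)$1 * f1 (x + t *\<^sub>R h) + (s *\<^sub>R h)$2 * f2 (x + t *\<^sub>R h)"])
    (use D in "auto intro: has_derivative_at_withinI")
  then obtain t where t: "0 < t" "t < 1"
   "f (x + h) - f x = h$1 * f1 (x + t *\<^sub>R h) + h$2 * f2 (x + t *\<^sub>R h)" by auto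
  have dt: "dist (x + t *\<^sub>R h) x < min d1 d2"
   using t h mult_left_le_one_le[of "norm h" t] by (simp add: dist_norm)
  have eq: "f (x + h) - f x - (h$1 * f1 x + h$2 * f2 x)
    = h$1 * (f1 (x + t *\<^sub>R h) - f1 x) + h$2 * (f2 (x + t *\<^sub>R h) - f2 x)"
   using t(3) by (simp add: algebra_simps)
  have "\<bar>h$1 * (f1 (x + t *\<^sub>R h) - f1 x)\<bar> <= norm h * (e/2)"
   "\<bar>h$2 * (f2 (x + t *\<^sub>R h) - f2 x)\<bar> <= norm h * (e/2)"
   unfolding abs_mult using dt
   by (intro mult_mono component_le_norm_cart less_imp_le[OF d1(2)] less_imp_le[OF d2(2)]; simp)+
  thus "\<bar>f (x + h) - f x - (h$1 * f1 x + h$2 * f2 x)\<bar> <= e * norm h"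
   unfolding eq by (simp add: mult.commute)
 qed (use d1 d2 in auto)
qed

section \<open>Convolution\<close>

definition conv :: "plane => plane => real^2 => real" where
 "conv k F x = (LI y. k (x - y) * F y)"

lemma lborel_reflect: "distr lborel borel (%y::real^2. x - y) = lborel"
proof -
 have "lborel = density (distr lborel borel (%y::real^2. x + (-1) *\<^sub>R y)) (%_. \<bar>-1::real\<bar> ^ DIM(real^2))"
  using lborel_affine[of "-1" x] by simp
 thus ?thesis by (simp add: density_1)
qed

lemma integral_reflect:
 fixes f :: plane
 assumes "f \<in> bor"
 shows "(LI y. f (x - y)) = (LI y. f y)"
 using integral_distr[of "%y. x - y" lborel borel f] assms lborel_reflect[of x] by simp

lemma integrable_reflect:
 fixes f :: plane
 assumes "lint f"
 shows "lint (%y. f (x - y))"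
 using integrable_distr_eq[of "%y. x - y" lborel borel f] assms lborel_reflect[of x]
 by (auto dest: borel_measurable_integrable)

lemma conv_commute:
 assumes "k \<in> bor" "F \<in> bor"
 shows "conv k F x = conv F k x"
 unfolding conv_def using integral_reflect[of "%y. k (x - y) * F y" x] assms by (simp add: mult.commute)

lemma integrable_bounded_mult:
 fixes k F :: plane
 assumes "k \<in> bor" "!!x. \<bar>k x\<bar> <= B" "lint F"
 shows "lint (%y. k y * F y)"
proof (rule Bochner_Integration.integrable_bound[of _ "%y. B * F y"])
 show "AE x in lborel. norm (k x * F x) <= norm (B * F x)"
 proof (rule AE_I2)
  fix x
  have "\<bar>k x\<bar> <= \<bar>B\<bar>" using assms(2)[of x] by linarith
  thus "norm (k x * F x) <= norm (B * F x)"
   by (simp add: abs_mult mult_right_mono)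
 qed
qed (use assms in "auto dest: borel_measurable_integrable")

lemma conv_integrable:
 assumes "cont k" "compact K" "supp_in K k" "lint F"
 shows "lint (%y. k (x - y) * F y)"
proof -
 obtain B where "!!x. \<bar>k x\<bar> <= B" using bounded_compact_supp[OF assms(1-3)] by metis
 moreover have "k \<in> bor" using assms(1) by (rule borel_measurable_continuous_onI)
 ultimately show ?thesis using integrable_bounded_mult[of "%y. k (x - y)" B F] assms(4) by simp
qed

lemma norm_integral_le:
 fixes f g :: "'x => real"
 assumes "integrable M f" "integrable M g" "!!x. norm (f x) <= g x"
 shows "norm (\<integral>x. f x \<partial>M) <= (\<integral>x. g x \<partial>M)"
proof -
 have "norm (\<integral>x. f x \<partial>M) <= (\<integral>x. norm (f x) \<partial>M)" by (rule integral_norm_bound)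
 also have "... <= (\<integral>x. g x \<partial>M)" using assms by (intro integral_mono) auto
 finally show ?thesis .
qed

lemma conv_continuous:
 assumes "cont k" "compact K" "supp_in K k" "lint F"
 shows "cont (conv k F)"
 unfolding continuous_on_iff
proof (intro ballI allI impI)
 fix x :: "real^2" and e :: real assume "e > 0"
 \<comment> \<open>The added 1 keeps e / A meaningful when F vanishes almost everywhere.\<close>
 define A where "A = (LI y. \<bar>F y\<bar>) + 1"
 have A: "A > 0" "(LI y. \<bar>F y\<bar>) < A" by (auto simp: A_def add_nonneg_pos)
 obtain d where d: "d > 0" "!!x y. dist x y < d ==> \<bar>k x - k y\<bar> < e / A"
  using uniformly_continuous_compact_supp[OF assms(1-3), of "e/A"] A \<open>e > 0\<close> by (metis divide_pos_pos)
 show "\<exists>d>0. \<forall>x'\<in>UNIV. dist x' x < d --> dist (conv k F x') (conv k F x) < e"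
 proof (intro exI conjI ballI impI)
  fix x' assume x': "dist x' x < d"
  have "conv k F x' - conv k F x = (LI y. (k (x' - y) - k (x - y)) * F y)"
   unfolding conv_def left_diff_distrib
   by (rule Bochner_Integration.integral_diff[symmetric]; rule conv_integrable[OF assms])
  also have "norm ... <= (LI y. e / A * \<bar>F y\<bar>)"
  proof (rule norm_integral_le)
   show "lint (%y. (k (x' - y) - k (x - y)) * F y)"
    unfolding left_diff_distrib by (intro Bochner_Integration.integrable_diff conv_integrable[OF assms])
   show "lint (%y. e / A * \<bar>F y\<bar>)" using assms(4) by simp
   fix y :: "real^2"
   have "\<bar>k (x' - y) - k (x - y)\<bar> <= e / A" using d(2)[of "x' - y" "x - y"] x' by (auto simp: dist_norm)
   thus "norm ((k (x' - y) - k (x - y)) * F y) <= e / A * \<bar>F y\<bar>"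
    unfolding real_norm_def abs_mult by (rule mult_right_mono) simp
  qed
  also have "... = e / A * (LI y. \<bar>F y\<bar>)" by simp
  also have "... < e / A * A" using A \<open>e > 0\<close> by (intro mult_strict_left_mono) auto
  finally show "dist (conv k F x') (conv k F x) < e" using A by (simp add: dist_real_def)
 qed (fact d)
qed

lemma integral_diff_lincomb:
 fixes a b c d :: "'x => real"
 assumes "integrable M a" "integrable M b" "integrable M c" "integrable M d"
 shows "(\<integral>y. a y - b y - (r * c y + s * d y) \<partial>M) =
  (\<integral>y. a y \<partial>M) - (\<integral>y. b y \<partial>M) - (r * (\<integral>y. c y \<partial>M) + s * (\<integral>y. d y \<partial>M))"
 using assms by simp

text \<open>The Taylor remainder of the kernel is at most e / A times the displacement, uniformly in
  its argument, so it can be integrated directly against |F|.\<close>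

lemma conv_C1:
 assumes k: "C1 k k1 k2" "compact K" "supp_in K k" and F: "lint F"
 shows "C1 (conv k F) (conv k1 F) (conv k2 F)"
proof -
 note s = C1_supp_deriv[OF k]
 have c: "cont k" "cont k1" "cont k2"
  using C1_continuous[OF k(1)] k(1) by (simp_all add: C1_def)
 note i = conv_integrable[OF c(1) k(2,3) F] conv_integrable[OF c(2) k(2) s(1) F]
  conv_integrable[OF c(3) k(2) s(2) F]
 have "(conv k F has_derivative (%v. v$1 * conv k1 F x + v$2 * conv k2 F x)) (at x)" for x
  unfolding has_derivative_at_alt
 proof (intro conjI allI impI)
  show "bounded_linear (%v::real^2. v$1 * conv k1 F x + v$2 * conv k2 F x)"
   by (intro bounded_linear_intros bounded_linear_vec_nth)
  fix e :: real assume "e > 0"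
  define A where "A = (LI y. \<bar>F y\<bar>) + 1"
  have A: "A > 0" "(LI y. \<bar>F y\<bar>) < A" by (auto simp: A_def add_nonneg_pos)
  obtain d where d: "d > 0" "!!x h. norm h < d ==>
    \<bar>k (x + h) - k x - (h$1 * k1 x + h$2 * k2 x)\<bar> <= e / A * norm h"
   using C1_uniform[OF k, of "e/A"] A \<open>e > 0\<close> by (metis divide_pos_pos)
  show "\<exists>d>0. ALL y. norm (y - x) < d --> norm (conv k F y - conv k F x -
    ((y - x)$1 * conv k1 F x + (y - x)$2 * conv k2 F x)) <= e * norm (y - x)"
  proof (intro exI conjI allI impI)
   fix z assume z: "norm (z - x) < d"
   let ?R = "%y. k (z - y) - k (x - y) - ((z - x)$1 * k1 (x - y) + (z - x)$2 * k2 (x - y))"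
   have int: "lint (%y. ?R y * F y)"
    unfolding left_diff_distrib distrib_right mult.assoc
    by (intro Bochner_Integration.integrable_diff Bochner_Integration.integrable_add integrable_mult_right i)
   have "conv k F z - conv k F x - ((z - x)$1 * conv k1 F x + (z - x)$2 * conv k2 F x)
     = (LI y. ?R y * F y)"
    unfolding conv_def
    by (rule trans[OF integral_diff_lincomb[OF i(1)[of z] i(1)[of x] i(2)[of x] i(3)[of x], symmetric]])
     (simp only: left_diff_distrib distrib_right mult.assoc)
   also have "norm ... <= (LI y. e / A * norm (z - x) * \<bar>F y\<bar>)"
   proof (rule norm_integral_le[OF int])
    show "lint (%y. e / A * norm (z - x) * \<bar>F y\<bar>)" using F by simp
    fix y
    have "\<bar>?R y\<bar> <= e / A * norm (z - x)" using d(2)[of "z - x" "x - y"] z by simp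
    thus "norm (?R y * F y) <= e / A * norm (z - x) * \<bar>F y\<bar>"
     unfolding real_norm_def abs_mult by (rule mult_right_mono) simp
   qed
   also have "... = e / A * norm (z - x) * (LI y. \<bar>F y\<bar>)" by simp
   also have "... <= e / A * norm (z - x) * A" using A \<open>e > 0\<close> by (intro mult_left_mono) auto
   finally show "norm (conv k F z - conv k F x -
    ((z - x)$1 * conv k1 F x + (z - x)$2 * conv k2 F x)) <= e * norm (z - x)" using A by simp
  qed (fact d)
 qed
 moreover have "cont (conv k1 F)" "cont (conv k2 F)"
  using conv_continuous[OF c(2) k(2) s(1) F] conv_continuous[OF c(3) k(2) s(2) F] by auto
 ultimately show ?thesis by (simp add: C1_def)
qed

lemma C1_tensor:
 assumes "smooth1 a" "smooth1 b"
 shows "C1 (tensor a b) (tensor (deriv a) b) (tensor a (deriv b))"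
 unfolding C1_def
proof (intro conjI allI)
 fix x :: "real^2"
 have a: "((%x::real^2. a (x$1)) has_derivative (%v. v$1 * deriv a (x$1))) (at x)"
  by (rule has_derivative_compose[where f="%x::real^2. x$1" and g=a and g'="%v. v * deriv a (x$1)"])
   (use smooth1_deriv(1)[OF assms(1), of "x$1"] in "auto intro!: bounded_linear_imp_has_derivative
    bounded_linear_vec_nth simp: has_field_derivative_def mult_commute_abs")
 have b: "((%x::real^2. b (x$2)) has_derivative (%v. v$2 * deriv b (x$2))) (at x)"
  by (rule has_derivative_compose[where f="%x::real^2. x$2" and g=b and g'="%v. v * deriv b (x$2)"])
   (use smooth1_deriv(1)[OF assms(2), of "x$2"] in "auto intro!: bounded_linear_imp_has_derivative
    bounded_linear_vec_nth simp: has_field_derivative_def mult_commute_abs")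
 show "(tensor a b has_derivative (%v. v$1 * tensor (deriv a) b x + v$2 * tensor a (deriv b) x)) (at x)"
  unfolding tensor_def[abs_def]
  by (rule derivative_eq_intros a b refl)+ (simp add: fun_eq_iff algebra_simps)
next
 have "cont (%x::real^2. f (x$i))" if "smooth1 f" for f and i :: 2
  by (rule continuous_on_compose2[OF smooth1_continuous[OF that, of UNIV]]) (auto intro!: continuous_intros)
 thus "cont (tensor (deriv a) b)" "cont (tensor a (deriv b))"
  unfolding tensor_def[abs_def] using assms smooth1_deriv(2) by (auto intro!: continuous_on_mult)
qed

text \<open>The factor 2 comes from bounding the Euclidean norm by the sum of the absolute values of
  the coordinates.\<close>

lemma tensor_supp:
 assumes "!!t. \<bar>t\<bar> > e ==> a t = 0" "!!t. \<bar>t\<bar> > e ==> b t = 0"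
 shows "supp_in (cball 0 (2 * e)) (tensor a b)"
 unfolding supp_in_def
proof (intro allI impI)
 fix x :: "real^2" assume "x \<notin> cball 0 (2 * e)"
 hence "norm x > 2 * e" by simp
 moreover have "norm x <= \<bar>x$1\<bar> + \<bar>x$2\<bar>" using norm_le_l1_cart[of x] by (simp add: sum_2)
 ultimately have "\<bar>x$1\<bar> > e \<or> \<bar>x$2\<bar> > e" by linarith
 thus "tensor a b x = 0" using assms by (auto simp: tensor_def)
qed

lemma C1_frechet:
 assumes "C1 f f1 f2"
 shows "frechet_derivative f (at x) v = v$1 * f1 x + v$2 * f2 x"
proof -
 have "(%v. v$1 * f1 x + v$2 * f2 x) = frechet_derivative f (at x)"
  using assms by (intro frechet_derivative_at) (simp add: C1_def)
 from fun_cong[OF this, of v] show ?thesis by simp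
qed

lemma ck_on_lincomb:
 fixes f g :: plane
 shows "ck_on k UNIV f ==> ck_on k UNIV g ==> ck_on k UNIV (%x. r * f x + s * g x)"
proof (induction k arbitrary: f g)
 case 0 thus ?case by (auto intro!: continuous_intros)
next
 case (Suc k)
 hence d: "f differentiable (at x)" "g differentiable (at x)" for x
  by (auto simp: differentiable_on_def)
 have D: "((%x. r * f x + s * g x) has_derivative
   (%v. r * frechet_derivative f (at x) v + s * frechet_derivative g (at x) v)) (at x)" for x
  using d[of x] unfolding frechet_derivative_works
  by (auto intro!: derivative_eq_intros)
 have "frechet_derivative (%x. r * f x + s * g x) (at x) v =
   r * frechet_derivative f (at x) v + s * frechet_derivative g (at x) v" for x v
  using fun_cong[OF frechet_derivative_at[OF D[of x]], of v] by simp
 moreover have "(%x. r * f x + s * g x) differentiable_on UNIV"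
  using D by (auto simp: differentiable_on_def differentiable_def)
 ultimately show ?case using Suc by auto
qed

text \<open>Smoothness of a whole family follows from closure under both partial derivatives, so
  that no derivative of higher order is ever written down.\<close>

lemma smooth_family:
 assumes cl: "!!f. f \<in> F ==> \<exists>f1\<in>F. \<exists>f2\<in>F. C1 f f1 f2" and f: "f \<in> F"
 shows "smooth_on UNIV f"
proof -
 have "ck_on k UNIV f" if "f \<in> F" for k f using that
 proof (induction k arbitrary: f)
  case 0 thus ?case using cl C1_continuous by fastforce
 next
  case (Suc k)
  then obtain f1 f2 where D: "f1 \<in> F" "f2 \<in> F" "C1 f f1 f2" using cl by blast
  hence "frechet_derivative f (at x) v = v$1 * f1 x + v$2 * f2 x" for x v by (simp add: C1_frechet)
  moreover have "f differentiable_on UNIV"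
   using D(3) unfolding C1_def differentiable_on_def differentiable_def by blast
  ultimately show ?case using ck_on_lincomb[OF Suc.IH[OF D(1)] Suc.IH[OF D(2)]] by simp
 qed
 with f show ?thesis by (simp add: smooth_on_def)
qed

lemma smooth_tensor:
 assumes "smooth1 a" "smooth1 b"
 shows "smooth_on UNIV (tensor a b)"
proof (rule smooth_family[where F="{tensor a b |a b. smooth1 a & smooth1 b}"])
 let ?F = "{tensor a b |a b. smooth1 a & smooth1 b}"
 fix f assume "f \<in> ?F"
 then obtain a b where ab: "f = tensor a b" "smooth1 a" "smooth1 b" by blast
 have "tensor (deriv a) b \<in> ?F" "tensor a (deriv b) \<in> ?F" using ab smooth1_deriv(2) by blast+
 thus "\<exists>f1\<in>?F. \<exists>f2\<in>?F. C1 f f1 f2" using C1_tensor[OF ab(2,3)] ab(1) by blast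
qed (use assms in auto)

text \<open>Derivatives fall on the tensor factors. The bound on their supports is part of the
  family, because differentiating under the integral uses a compactly supported kernel.\<close>

lemma smooth_conv_tensor:
 assumes "smooth1 a" "smooth1 b" "!!t. \<bar>t\<bar> > e ==> a t = 0" "!!t. \<bar>t\<bar> > e ==> b t = 0"
  and F: "lint F"
 shows "smooth_on UNIV (conv (tensor a b) F)"
proof -
 let ?P = "%a. smooth1 a & (ALL t. \<bar>t\<bar> > e --> a t = 0)"
 let ?F = "{conv (tensor a b) F |a b. ?P a & ?P b}"
 have P: "?P (deriv a)" if "?P a" for a using that smooth1_deriv(2) deriv_zero_outside by blast
 show ?thesis
 proof (rule smooth_family[where F="?F"])
  fix f assume "f \<in> ?F"
  then obtain a b where ab: "f = conv (tensor a b) F" "?P a" "?P b" by blast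
  have "C1 f (conv (tensor (deriv a) b) F) (conv (tensor a (deriv b)) F)"
   unfolding ab(1) by (rule conv_C1[OF C1_tensor compact_cball tensor_supp F]) (use ab in auto)
  moreover have "conv (tensor (deriv a) b) F \<in> ?F" "conv (tensor a (deriv b)) F \<in> ?F" using ab P by blast+
  ultimately show "\<exists>f1\<in>?F. \<exists>f2\<in>?F. C1 f f1 f2" by blast
 qed (use assms in auto)
qed

lemma integrable_compact_supp:
 fixes f :: plane
 assumes "cont f" "compact K" "supp_in K f"
 shows "lint f"
proof -
 have "lint (%x. indicator K x *\<^sub>R f x)"
  using borel_integrable_compact[OF assms(2), of f] continuous_on_subset[OF assms(1)]
  by (simp add: set_integrable_def)
 moreover have "(%x. indicator K x *\<^sub>R f x) = f" using assms(3) by (auto simp: supp_in_def indicator_def fun_eq_iff)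
 ultimately show ?thesis by simp
qed

section \<open>Mollifiers\<close>

definition bump2 :: "real => real^2 => real" where
 "bump2 e = tensor (bump e) (bump e)"

text \<open>The normalising constant is absorbed into the first factor, so that the mollifier
  remains a tensor product and inherits the results above.\<close>

definition moll :: "real => real^2 => real" where
 "moll e = tensor (%t. bump e t * inverse (integral\<^sup>L lborel (bump2 e))) (bump e)"

lemma bump2_integral_pos:
 assumes "e > 0"
 shows "integral\<^sup>L lborel (bump2 e) > 0"
proof -
 have c: "cont (bump2 e)"
  unfolding bump2_def by (rule C1_continuous[OF C1_tensor]) (rule smooth1_bump)+
 have i: "lint (bump2 e)"
  by (rule integrable_compact_supp[OF c compact_cball[of 0 "2 * e"]]) (unfold bump2_def, rule tensor_supp; simp add: bump_zero)
 have nn: "bump2 e x >= 0" for x by (simp add: bump2_def tensor_def bump_nonneg)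
 \<comment> \<open>A nonnegative continuous function with integral 0 vanishes almost everywhere; its
   set of nonzero values would be open, nonempty and negligible.\<close>
 have "integral\<^sup>L lborel (bump2 e) ~= 0"
 proof
  assume "integral\<^sup>L lborel (bump2 e) = 0"
  hence "AE x in lborel. bump2 e x = 0" using integral_nonneg_eq_0_iff_AE[OF i] nn by auto
  hence "AE x in lebesgue. bump2 e x = 0" by (rule AE_completion)
  hence "{x. bump2 e x ~= 0} \<in> null_sets lebesgue"
   by (simp add: completion.AE_iff_null_sets)
  hence "negligible {x. bump2 e x ~= 0}" by (simp add: negligible_iff_null_sets)
  moreover have "open {x. bump2 e x ~= 0}"
   by (intro open_Collect_neq c continuous_on_const)
  moreover have "0 \<in> {x. bump2 e x ~= 0}" using bump_pos[of 0 e] assms by (simp add: bump2_def tensor_def)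
  ultimately show False using open_not_negligible by blast
 qed
 moreover have "integral\<^sup>L lborel (bump2 e) >= 0" by (rule integral_nonneg_AE) (use nn in auto)
 ultimately show ?thesis by simp
qed

lemma smooth1_const: "smooth1 (%t. c)" by (simp add: smooth1_def Ck1_const)

lemma moll_props:
 assumes e: "e > 0"
 shows moll_C1: "EX m1 m2 m11 m12 m22. C1 (moll e) m1 m2 & C1 m1 m11 m12 & C1 m2 m12 m22" (is ?P1)
  and moll_continuous: "cont (moll e)"
  and moll_nonneg: "moll e x >= 0"
  and moll_supp: "supp_in (cball 0 (2 * e)) (moll e)" (is ?P2)
  and moll_integral: "integral\<^sup>L lborel (moll e) = 1" (is ?P3)
  and moll_integrable: "lint (moll e)"
  and moll_even: "moll e (- x) = moll e x"
  and smooth_conv_moll: "lint F ==> smooth_on UNIV (conv (moll e) F)"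
  and smooth_moll: "smooth_on UNIV (%y. moll e (z - y))" (is ?P4)
proof -
 let ?c = "inverse (integral\<^sup>L lborel (bump2 e))" let ?a = "%t. bump e t * ?c" let ?b = "bump e"
 have s: "smooth1 ?a" "smooth1 ?b" by (intro smooth1_mult smooth1_bump smooth1_const)+
 have z: "!!t. \<bar>t\<bar> > e ==> ?a t = 0" "!!t. \<bar>t\<bar> > e ==> ?b t = 0" by (simp_all add: bump_zero)
 have m: "moll e = tensor ?a ?b" by (simp add: moll_def)
 show ?P1
  unfolding m using C1_tensor[OF s] C1_tensor[OF smooth1_deriv(2)[OF s(1)] s(2)]
   C1_tensor[OF s(1) smooth1_deriv(2)[OF s(2)]] by blast
 show c: "cont (moll e)" unfolding m by (rule C1_continuous[OF C1_tensor[OF s]])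
 have eq: "moll e = (%x. ?c * bump2 e x)" by (simp add: m bump2_def tensor_def fun_eq_iff)
 show "moll e x >= 0" using bump2_integral_pos[OF e] by (simp add: eq bump2_def tensor_def bump_nonneg)
 show sp: ?P2 unfolding m by (rule tensor_supp[OF z])
 show "lint (moll e)" by (rule integrable_compact_supp[OF c compact_cball sp])
 show ?P3 using bump2_integral_pos[OF e] by (simp add: eq)
 show "moll e (- x) = moll e x" by (simp add: eq bump2_def tensor_def bump_even)
 show "smooth_on UNIV (conv (moll e) F)" if "lint F"
  unfolding m by (rule smooth_conv_tensor[OF s z that])
 have "(%y. moll e (z - y)) = tensor (%t. ?a ((-1) * t + z$1)) (%t. ?b ((-1) * t + z$2))"
  by (simp add: m tensor_def fun_eq_iff)
 thus ?P4
  using smooth_tensor[OF smooth1_affine[OF s(1), of "-1" "z$1"] smooth1_affine[OF s(2), of "-1" "z$2"]] by simp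
qed

text \<open>Room for mollification: a function supported in K, mollified at a scale of at most d /
  2, is supported in K', still inside S.\<close>

lemma compact_nbhd:
 fixes K :: "(real^2) set"
 assumes "compact K" "open S" "K \<subseteq> S"
 obtains d K' where "d > 0" "compact K'" "K \<subseteq> K'" "K' \<subseteq> S" "!!x y. x \<in> K ==> dist x y <= d ==> y \<in> K'"
proof (cases "K = {}")
 case True thus ?thesis using that[of 1 "{}"] by auto
next
 case False
 obtain d where d: "d > 0" "{x. infdist x K <= d} \<subseteq> S"
  using compact_in_open_separated[OF False assms] by blast
 show ?thesis
 proof (rule that[of d "{x. infdist x K <= d}"])
  show "compact {x. infdist x K <= d}" by (rule compact_infdist_le[OF False assms(1) d(1)])
  show "y \<in> {x. infdist x K <= d}" if "x \<in> K" "dist x y <= d" for x y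
   using infdist_le[of x K y] that by (auto simp: dist_commute)
 qed (use d in auto)
qed

lemma conv_moll_supp:
 assumes e: "e > 0" "2 * e <= d" and f: "supp_in K f" and K': "!!x y. x \<in> K ==> dist x y <= d ==> y \<in> K'"
 shows "supp_in K' (conv (moll e) f)"
 unfolding supp_in_def
proof (intro allI impI)
 fix x assume x: "x \<notin> K'"
 have "moll e (x - y) * f y = 0" for y
 proof (cases "y \<in> K")
  case True
  hence "dist y x > d" using K' x by force
  hence "x - y \<notin> cball 0 (2 * e)" using e by (auto simp: dist_norm norm_minus_commute)
  thus ?thesis using moll_supp[OF e(1)] by (auto simp: supp_in_def)
 qed (use f in "auto simp: supp_in_def")
 hence "(%y. moll e (x - y) * f y) = (%y. 0)" by (rule ext)
 thus "conv (moll e) f x = 0" by (simp add: conv_def)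
qed

lemma moll_shift_integral:
 assumes "e > 0"
 shows "(LI y. moll e (x - y)) = 1" "lint (%y. moll e (x - y))"
proof -
 have "moll e \<in> bor" using moll_continuous[OF assms] by (rule borel_measurable_continuous_onI)
 thus "(LI y. moll e (x - y)) = 1"
  using integral_reflect[of "moll e" x] moll_integral[OF assms] by simp
 show "lint (%y. moll e (x - y))" by (rule integrable_reflect[OF moll_integrable[OF assms]])
qed

lemma conv_moll_near:
 assumes f: "cont f" "compact K" "supp_in K f" and e: "e > 0"
  and c: "!!y. dist x y <= 2 * e ==> \<bar>f y - f x\<bar> <= r"
 shows "\<bar>conv (moll e) f x - f x\<bar> <= r"
proof -
 note mi = moll_shift_integral[OF e, of x]
 have fi: "lint f" by (rule integrable_compact_supp[OF f])
 have i: "lint (%y. moll e (x - y) * f y)"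
  by (rule conv_integrable[OF moll_continuous[OF e] compact_cball moll_supp[OF e] fi])
 have "conv (moll e) f x - f x = (LI y. moll e (x - y) * f y - moll e (x - y) * f x)"
  using mi i by (simp add: conv_def)
 also have "norm ... <= (LI y. moll e (x - y) * r)"
 proof (rule norm_integral_le)
  fix y
  show "norm (moll e (x - y) * f y - moll e (x - y) * f x) <= moll e (x - y) * r"
  proof (cases "dist x y <= 2 * e")
   case True
   thus ?thesis using c[OF True] moll_nonneg[OF e, of "x - y"]
    unfolding right_diff_distrib[symmetric] real_norm_def abs_mult by (simp add: mult_left_mono)
  next
   case False
   hence "moll e (x - y) = 0" using moll_supp[OF e] by (auto simp: supp_in_def dist_norm)
   thus ?thesis by simp
  qed
 qed (use mi i in auto)
 also have "... = r" using mi by simp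
 finally show ?thesis by simp
qed

lemma conv_moll_uniform:
 assumes f: "cont f" "compact K" "supp_in K f" and r: "r > 0"
 obtains e0 where "e0 > 0" "!!e x. 0 < e ==> e < e0 ==> \<bar>conv (moll e) f x - f x\<bar> <= r"
proof -
 obtain d where d: "d > 0" "!!x y. dist x y < d ==> \<bar>f x - f y\<bar> < r"
  using uniformly_continuous_compact_supp[OF f r] by metis
 show ?thesis
 proof (rule that[of "d/2"])
  fix e x assume e: "0 < e" "e < d/2"
  show "\<bar>conv (moll e) f x - f x\<bar> <= r"
  proof (rule conv_moll_near[OF f e(1)])
   fix y assume "dist x y <= 2 * e"
   hence "dist y x < d" using e by (simp add: dist_commute)
   from d(2)[OF this] show "\<bar>f y - f x\<bar> <= r" by simp
  qed
 qed (use d in simp)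
qed

section \<open>Local integrability, weak derivatives and the fundamental lemma\<close>

definition loc1 :: "(real^2) set => plane => bool" where
 "loc1 D f \<longleftrightarrow> f \<in> bor &
  (ALL K. compact K & K \<subseteq> D --> lint (%y. indicator K y * f y))"

text \<open>Besides the local boundedness of \<open>U\<close>, this is all that the Stokes argument
  extracts from the class W^{1,p} with p > 2. Measurability is global; local representatives are
  extended by zero.\<close>

definition loc2 :: "(real^2) set => plane => bool" where
 "loc2 D f \<longleftrightarrow> f \<in> bor &
  (ALL K. compact K & K \<subseteq> D --> lint (%y. indicator K y * (f y)^2))"

lemma integrable_indicator_compact:
 "compact K ==> lint (indicator K :: real^2 => real)"
 by (rule integrable_real_indicator)
  (use emeasure_bounded_finite[OF compact_imp_bounded, of K] in "auto simp: borel_compact")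

lemma loc2_imp_loc1:
 assumes "loc2 D f" shows "loc1 D f"
 unfolding loc1_def
proof (intro conjI allI impI)
 show m: "f \<in> bor" using assms by (simp add: loc2_def)
 fix K assume K: "compact K & K \<subseteq> D"
 show "lint (%y. indicator K y * f y)"
 proof (rule Bochner_Integration.integrable_bound[of _ "%y. indicator K y + indicator K y * (f y)^2"])
  show "lint (%y. indicator K y + indicator K y * (f y)^2)"
   using assms K by (intro Bochner_Integration.integrable_add integrable_indicator_compact) (auto simp: loc2_def)
  have "\<bar>t\<bar> <= 1 + t^2" for t :: real
   using zero_le_power2[of "\<bar>t\<bar> - 1"] zero_le_power2[of t] by (simp add: power2_diff)
  thus "AE y in lborel. norm (indicator K y * f y) <= norm (indicator K y + indicator K y * (f y)^2)"
   by (auto simp: indicator_def)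
  show "(%y. indicator K y * f y) \<in> borel_measurable lborel"
   using m K borel_compact[of K] by (intro borel_measurable_times) (auto intro!: borel_measurable_indicator)
 qed
qed

lemma loc1_mult_supp:
 assumes f: "loc1 D f" and g: "g \<in> bor" "!!x. \<bar>g x\<bar> <= B" "supp_in K g" "compact K" "K \<subseteq> D"
 shows "lint (%y. g y * f y)"
proof -
 have "lint (%y. g y * (indicator K y * f y))"
  by (rule integrable_bounded_mult[OF g(1,2)]) (use f g in "auto simp: loc1_def")
 moreover have "(%y. g y * (indicator K y * f y)) = (%y. g y * f y)"
  using g(3) by (auto simp: supp_in_def indicator_def fun_eq_iff)
 ultimately show ?thesis by simp
qed

lemma loc1_tendsto:
 assumes f: "loc1 D f" and K: "compact K" "K \<subseteq> D"
  and g: "!!n. g n \<in> bor" "!!n x. \<bar>g n x\<bar> <= B" "!!n. supp_in K (g n)"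
  and lim: "AE x in lborel. (%n. g n x) \<leadsto> h x" and h: "h \<in> bor"
 shows "(%n. LI y. g n y * f y) \<leadsto> (LI y. h y * f y)"
proof (rule integral_dominated_convergence)
 have fm: "f \<in> bor" and fi: "lint (%y. indicator K y * f y)"
  using f K by (auto simp: loc1_def)
 show "(%y. h y * f y) \<in> borel_measurable lborel" "!!n. (%y. g n y * f y) \<in> borel_measurable lborel"
  using fm h g by auto
 show "lint (%y. B * \<bar>indicator K y * f y\<bar>)" using fi by simp
 show "AE y in lborel. (%n. g n y * f y) \<leadsto> h y * f y"
  using lim by eventually_elim (intro tendsto_intros)
 show "AE y in lborel. norm (g n y * f y) <= B * \<bar>indicator K y * f y\<bar>" for n
 proof (rule AE_I2)
  fix y show "norm (g n y * f y) <= B * \<bar>indicator K y * f y\<bar>"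
   using g(3)[of n] g(2)[of n y] by (cases "y \<in> K") (auto simp: supp_in_def abs_mult mult_right_mono)
 qed
qed

text \<open>A measurable function is an almost everywhere limit of continuous ones. These are
  clipped to [-B, B] and multiplied by a cutoff that is 1 on K, which gives the bound and a common
  compact support.\<close>

lemma bounded_approx:
 fixes s :: plane
 assumes s: "s \<in> bor" "!!x. \<bar>s x\<bar> <= B" "supp_in K s"
  and K: "compact K" "K \<subseteq> D" "open D"
 obtains K' g where "compact K'" "K' \<subseteq> D" "!!n. cont (g n)" "!!n. supp_in K' (g n)"
  "!!n x. \<bar>g n x\<bar> <= B" "AE x in lborel. (%n. g n x) \<leadsto> s x"
proof (cases "K = {}")
 case True
 hence "s = (%x. 0)" using s(3) by (auto simp: supp_in_def)
 thus ?thesis using that[of "{}" "%n x. 0"] s(2) by (auto simp: supp_in_def)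
next
 case False
 obtain d where d: "d > 0" "{x. infdist x K <= d} \<subseteq> D"
  using compact_in_open_separated[OF False K(1,3,2)] by blast
 let ?K' = "{x. infdist x K <= d}"
 have K': "compact ?K'" by (rule compact_infdist_le[OF False K(1) d(1)])
 define c where "c = (%x. max 0 (1 - infdist x K / d))"
 have c: "cont c" unfolding c_def using d
  by (intro continuous_intros) auto
 have c1: "c x = 1" if "x \<in> K" for x using that by (simp add: c_def)
 have c0: "c x = 0" if "x \<notin> ?K'" for x using that d by (simp add: c_def)
 have cb: "0 <= c x" "c x <= 1" for x using d infdist_nonneg[of x K] by (auto simp: c_def)
 have "s \<in> borel_measurable lebesgue" using s(1) by (simp add: measurable_completion)
 hence "s measurable_on UNIV" using measurable_on_iff_borel_measurable[of UNIV s] by simp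
 then obtain N h where h: "negligible N" "!!n. cont (h n)"
  "!!x. x \<notin> N ==> (%n. h n x) \<leadsto> s x" by (auto simp: measurable_on_def)
 define g where "g = (%n x. c x * max (- B) (min B (h n x)))"
 have B: "B >= 0" using s(2)[of 0] by linarith
 have AEN: "AE x in lborel. x \<notin> N"
 proof -
  have "AE x in lebesgue. x \<notin> N" using h(1) by (simp add: negligible_iff_null_sets AE_not_in)
  thus ?thesis by (simp add: AE_completion_iff)
 qed
 show ?thesis
 proof (rule that[of ?K' g])
  show "cont (g n)" for n unfolding g_def by (intro continuous_intros c h)
  show "supp_in ?K' (g n)" for n using c0 by (auto simp: supp_in_def g_def)
  show "\<bar>g n x\<bar> <= B" for n x
  proof -
   have "\<bar>max (- B) (min B (h n x))\<bar> <= B" using B by auto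
   hence "\<bar>c x\<bar> * \<bar>max (- B) (min B (h n x))\<bar> <= 1 * B" using cb[of x] by (intro mult_mono) auto
   thus ?thesis by (simp add: g_def abs_mult)
  qed
  show "AE x in lborel. (%n. g n x) \<leadsto> s x"
   using AEN
  proof eventually_elim
   case (elim x)
   have "(%n. g n x) \<leadsto> c x * max (- B) (min B (s x))"
    unfolding g_def by (intro tendsto_intros h elim)
   moreover have "max (- B) (min B (s x)) = s x" using s(2)[of x] by auto
   moreover have "c x * s x = s x" using c1 s(3) by (cases "x \<in> K") (auto simp: supp_in_def)
   ultimately show ?case by simp
  qed
 qed (use K' d in auto)
qed

definition mollseq :: "nat => real^2 => real" where
 "mollseq n = moll (inverse (real (Suc n)))"

lemma mollseq_pos: "inverse (real (Suc n)) > 0" by simp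

lemma mollseq_eventually:
 assumes "d > 0"
 shows "EX N. \<forall>n\<ge>N. 2 * inverse (real (Suc n)) <= d"
proof -
 obtain N where N: "inverse (real (Suc N)) < d / 2" using reals_Archimedean[of "d/2"] assms by auto
 show ?thesis
 proof (intro exI allI impI)
  fix n assume "N <= n"
  hence "inverse (real (Suc n)) <= inverse (real (Suc N))" by (intro le_imp_inverse_le) auto
  with N show "2 * inverse (real (Suc n)) <= d" by linarith
 qed
qed

lemma mollseq_uniform:
 assumes "cont f" "compact K" "supp_in K f" "r > 0"
 shows "EX N. \<forall>n\<ge>N. ALL x. \<bar>conv (mollseq n) f x - f x\<bar> <= r"
proof -
 obtain e0 where e0: "e0 > 0" "!!e x. 0 < e ==> e < e0 ==> \<bar>conv (moll e) f x - f x\<bar> <= r"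
  using conv_moll_uniform[OF assms] by metis
 obtain N where N: "\<forall>n\<ge>N. 2 * inverse (real (Suc n)) <= e0" using mollseq_eventually[OF e0(1)] by blast
 have "inverse (real (Suc n)) < e0" if "n >= N" for n
  using N[rule_format, OF that] mollseq_pos[of n] by linarith
 thus ?thesis using e0(2) mollseq_pos unfolding mollseq_def by blast
qed

lemma mollseq_pointwise:
 assumes "cont f" "compact K" "supp_in K f"
 shows "(%n. conv (mollseq n) f x) \<leadsto> f x"
 unfolding LIMSEQ_iff
proof (intro allI impI)
 fix r :: real assume "r > 0"
 then obtain N where N: "\<forall>n\<ge>N. ALL x. \<bar>conv (mollseq n) f x - f x\<bar> <= r/2" using mollseq_uniform[OF assms, of "r/2"] by auto
 have "norm (conv (mollseq n) f x - f x) < r" if "n >= N" for n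
 proof -
  have "\<bar>conv (mollseq n) f x - f x\<bar> <= r/2" using N that by blast
  thus ?thesis using \<open>r > 0\<close> by simp
 qed
 thus "EX no. \<forall>n\<ge>no. norm (conv (mollseq n) f x - f x) < r" by blast
qed

lemma conv_moll_bound:
 assumes f: "cont f" "compact K" "supp_in K f" "!!x. \<bar>f x\<bar> <= B"
 shows "\<bar>conv (mollseq n) f x\<bar> <= B"
proof -
 let ?e = "inverse (real (Suc n))"
 note mi = moll_shift_integral[OF mollseq_pos, of n x]
 have fi: "lint f" by (rule integrable_compact_supp[OF f(1-3)])
 have i: "lint (%y. moll ?e (x - y) * f y)"
  by (rule conv_integrable[OF moll_continuous[OF mollseq_pos] compact_cball moll_supp[OF mollseq_pos] fi])
 have "norm (conv (mollseq n) f x) <= (LI y. moll ?e (x - y) * B)"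
  unfolding conv_def mollseq_def
 proof (rule norm_integral_le[OF i])
  show "norm (moll ?e (x - y) * f y) <= moll ?e (x - y) * B" for y
   using f(4)[of y] moll_nonneg[OF mollseq_pos, of n "x - y"] by (simp add: abs_mult mult_left_mono)
 qed (use mi in simp)
 thus ?thesis using mi by simp
qed

text \<open>Differentiability falls on the other factor, so mollifying commutes with differentiation.\<close>

lemma conv_moll_C1:
 assumes k: "C1 k k1 k2" "compact K" "supp_in K k"
 shows "C1 (conv (mollseq n) k) (conv (mollseq n) k1) (conv (mollseq n) k2)"
proof -
 have mm: "moll (inverse (real (Suc n))) \<in> bor"
  by (rule borel_measurable_continuous_onI[OF moll_continuous[OF mollseq_pos]])
 have c: "cont k" "cont k1" "cont k2"
  using C1_continuous[OF k(1)] k(1) by (simp_all add: C1_def)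
 have "conv (mollseq n) f = conv f (mollseq n)" if "cont f" for f
  unfolding mollseq_def using conv_commute[OF mm borel_measurable_continuous_onI[OF that]] by (rule ext)
 thus ?thesis
  using conv_C1[OF k moll_integrable[OF mollseq_pos, of n]] c by (simp add: mollseq_def)
qed

lemma test_function_conv:
 assumes f: "cont f" "compact K" "supp_in K f" and d: "2 * inverse (real (Suc n)) <= d"
  and K': "!!x y. x \<in> K ==> dist x y <= d ==> y \<in> K'" "compact K'" "K' \<subseteq> D"
 shows "test_function D (conv (mollseq n) f)" (is ?P1) "supp_in K' (conv (mollseq n) f)"
proof -
 show s: "supp_in K' (conv (mollseq n) f)"
  unfolding mollseq_def by (rule conv_moll_supp[OF mollseq_pos d f(3) K'(1)])
 show ?P1
  unfolding test_function_def
 proof (intro conjI exI[of _ K'])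
  show "smooth_on UNIV (conv (mollseq n) f)"
   unfolding mollseq_def by (rule smooth_conv_moll[OF mollseq_pos integrable_compact_supp[OF f]])
  show "ALL y. y \<notin> K' --> conv (mollseq n) f y = 0" using s by (simp add: supp_in_def)
 qed (use K' in auto)
qed

lemma conv_mollseq_measurable:
 assumes "cont f" "compact K" "supp_in K f"
 shows "conv (mollseq n) f \<in> bor"
 unfolding mollseq_def
 by (rule borel_measurable_continuous_onI[OF conv_continuous[OF moll_continuous[OF mollseq_pos] compact_cball
    moll_supp[OF mollseq_pos] integrable_compact_supp[OF assms]]])

text \<open>Mollified kernels are uniformly bounded and have a common compact support in D, so
  dominated convergence carries identities from smooth test functions to continuous ones.\<close>

lemma test_limit:
 assumes f: "loc1 D f" and "open D"
  and k: "cont k" "compact K" "supp_in K k" "K \<subseteq> D"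
 shows "(%n. LI y. conv (mollseq n) k y * f y) \<leadsto> (LI y. k y * f y)"
proof -
 obtain d K' where d: "d > 0" "compact K'" "K \<subseteq> K'" "K' \<subseteq> D"
  "!!x y. x \<in> K ==> dist x y <= d ==> y \<in> K'" using compact_nbhd[OF k(2) assms(2) k(4)] by metis
 obtain N where N: "\<forall>n\<ge>N. 2 * inverse (real (Suc n)) <= d" using mollseq_eventually[OF d(1)] by blast
 obtain B where B: "!!x. \<bar>k x\<bar> <= B" using bounded_compact_supp[OF k(1-3)] by metis
 \<comment> \<open>The shift by N keeps all supports inside K'; it is removed at the end.\<close>
 have "(%n. LI y. conv (mollseq (n + N)) k y * f y) \<leadsto> (LI y. k y * f y)"
 proof (rule loc1_tendsto[OF f d(2,4)])
  show "conv (mollseq (n + N)) k \<in> bor" for n by (rule conv_mollseq_measurable[OF k(1-3)])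
  show "\<bar>conv (mollseq (n + N)) k x\<bar> <= B" for n x by (rule conv_moll_bound[OF k(1-3) B])
  show "supp_in K' (conv (mollseq (n + N)) k)" for n
   by (rule test_function_conv(2)[OF k(1-3) N[rule_format] d(5,2,4)]) simp_all
  show "AE x in lborel. (%n. conv (mollseq (n + N)) k x) \<leadsto> k x"
   by (rule AE_I2, rule LIMSEQ_ignore_initial_segment, rule mollseq_pointwise[OF k(1-3)])
  show "k \<in> bor" by (rule borel_measurable_continuous_onI[OF k(1)])
 qed
 thus ?thesis by (rule LIMSEQ_offset)
qed

definition wd :: "(real^2) set => plane => plane => plane => bool" where
 "wd D f f1 f2 \<longleftrightarrow> loc1 D f & loc1 D f1 & loc1 D f2 & (ALL k. test_function D k -->
  (LI y. pd 1 k y * f y) = - (LI y. k y * f1 y) &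
  (LI y. pd 2 k y * f y) = - (LI y. k y * f2 y))"

text \<open>Test functions need only be of class C1, because mollification commutes with their
  partial derivatives. Below, test functions are products of a cutoff with other C1 factors, which
  this class admits directly.\<close>

lemma wd_C1:
 assumes w: "wd D f f1 f2" and "open D"
  and k: "C1 k k1 k2" "compact K" "supp_in K k" "K \<subseteq> D"
 shows "(LI y. k1 y * f y) = - (LI y. k y * f1 y)" (is ?P1)
  and "(LI y. k2 y * f y) = - (LI y. k y * f2 y)" (is ?P2)
proof -
 have l: "loc1 D f" "loc1 D f1" "loc1 D f2" using w by (auto simp: wd_def)
 have c: "cont k" "cont k1" "cont k2"
  using C1_continuous[OF k(1)] k(1) by (simp_all add: C1_def)
 note s = C1_supp_deriv[OF k(1-3)]
 obtain d K' where d: "d > 0" "compact K'" "K \<subseteq> K'" "K' \<subseteq> D"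
  "!!x y. x \<in> K ==> dist x y <= d ==> y \<in> K'" using compact_nbhd[OF k(2) assms(2) k(4)] by metis
 obtain N where N: "\<forall>n\<ge>N. 2 * inverse (real (Suc n)) <= d" using mollseq_eventually[OF d(1)] by blast
 have eq: "(LI y. conv (mollseq n) k1 y * f y) = - (LI y. conv (mollseq n) k y * f1 y)"
  "(LI y. conv (mollseq n) k2 y * f y) = - (LI y. conv (mollseq n) k y * f2 y)" if "n >= N" for n
 proof -
  have "test_function D (conv (mollseq n) k)"
   by (rule test_function_conv(1)[OF c(1) k(2,3) N[rule_format] d(5,2,4)]) (use that in simp_all)
  moreover note C1_frechet[OF conv_moll_C1[OF k(1-3), of n]]
  ultimately show "(LI y. conv (mollseq n) k1 y * f y) = - (LI y. conv (mollseq n) k y * f1 y)"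
   "(LI y. conv (mollseq n) k2 y * f y) = - (LI y. conv (mollseq n) k y * f2 y)"
   using w by (auto simp: wd_def axis_def)
 qed
 note L = test_limit[OF _ assms(2) _ k(2) _ k(4)]
 show ?P1
 proof (rule LIMSEQ_unique[OF L[OF l(1) c(2) s(1)]])
  show "(%n. LI y. conv (mollseq n) k1 y * f y) \<leadsto> - (LI y. k y * f1 y)"
   by (rule Lim_transform_eventually[OF tendsto_minus[OF L[OF l(2) c(1) k(3)]]])
    (auto simp: eventually_sequentially eq intro!: exI[of _ N])
 qed
 show ?P2
 proof (rule LIMSEQ_unique[OF L[OF l(1) c(3) s(2)]])
  show "(%n. LI y. conv (mollseq n) k2 y * f y) \<leadsto> - (LI y. k y * f2 y)"
   by (rule Lim_transform_eventually[OF tendsto_minus[OF L[OF l(3) c(1) k(3)]]])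
    (auto simp: eventually_sequentially eq intro!: exI[of _ N])
 qed
qed

lemma open_compact_exhaustion:
 fixes D :: "(real^2) set"
 assumes "open D"
 obtains C where "!!n::nat. compact (C n)" "!!n. C n \<subseteq> D" "D = (\<Union>n. C n)"
proof (rule open_Union_compact_subsets[OF assms])
 fix C :: "nat => (real^2) set"
 assume "!!n. compact (C n)" "!!n. C n \<subseteq> D" "\<Union> (range C) = D"
 thus thesis by (intro that[of C]) auto
qed

lemma fundamental_lemma:
 assumes f: "loc1 D f" and "open D" and t: "!!k. test_function D k ==> (LI y. k y * f y) = 0"
 shows "AE y\<in>D in lborel. f y = 0"
proof -
 have fm: "f \<in> bor" using f by (simp add: loc1_def)
 have c: "(LI y. k y * f y) = 0"
  if k: "cont k" "compact K" "supp_in K k" "K \<subseteq> D" for k K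
 proof -
  obtain d K' where d: "d > 0" "compact K'" "K \<subseteq> K'" "K' \<subseteq> D"
   "!!x y. x \<in> K ==> dist x y <= d ==> y \<in> K'" using compact_nbhd[OF k(2) assms(2) k(4)] by metis
  obtain N where N: "\<forall>n\<ge>N. 2 * inverse (real (Suc n)) <= d" using mollseq_eventually[OF d(1)] by blast
  have "(LI y. conv (mollseq n) k y * f y) = 0" if "n >= N" for n
   by (rule t, rule test_function_conv(1)[OF k(1-3) N[rule_format] d(5,2,4)]) (use that in simp_all)
  hence "(%n. LI y. conv (mollseq n) k y * f y) \<leadsto> 0"
   by (intro tendsto_eventually) (auto simp: eventually_sequentially)
  thus ?thesis by (rule LIMSEQ_unique[OF test_limit[OF f assms(2) k]])
 qed
 have K0: "AE y\<in>K in lborel. f y = 0" if K: "compact K" "K \<subseteq> D" for K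
 proof -
  \<comment> \<open>Testing with the sign of f on K produces the integral of |f| over K.\<close>
  define s where "s = (%y. indicator K y * sgn (f y))"
  have Km: "K \<in> sets borel" using K(1) by (rule borel_compact)
  have s: "s \<in> bor" "!!x. \<bar>s x\<bar> <= 1" "supp_in K s"
   using fm Km by (auto simp: s_def supp_in_def indicator_def sgn_if)
  obtain K' g
   where g: "compact K'" "K' \<subseteq> D" "!!n. cont (g n)" "!!n. supp_in K' (g n)"
    "!!n x. \<bar>g n x\<bar> <= 1" "AE x in lborel. (%n. g n x) \<leadsto> s x"
   by (rule bounded_approx[OF s K assms(2)]) (blast intro: that)
  have "(%n. LI y. g n y * f y) \<leadsto> (LI y. s y * f y)"
   by (rule loc1_tendsto[OF f g(1,2) _ g(5,4,6) s(1)]) (rule borel_measurable_continuous_onI[OF g(3)])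
  moreover have "(LI y. g n y * f y) = 0" for n by (rule c[OF g(3,1,4,2)])
  ultimately have "(LI y. s y * f y) = 0" by (simp add: LIMSEQ_const_iff)
  moreover have "(%y. s y * f y) = (%y. \<bar>indicator K y * f y\<bar>)"
   by (auto simp: s_def indicator_def abs_sgn mult.commute fun_eq_iff)
  moreover have "lint (%y. \<bar>indicator K y * f y\<bar>)" using f K by (auto simp: loc1_def)
  ultimately have "AE y in lborel. \<bar>indicator K y * f y\<bar> = 0"
   using integral_nonneg_eq_0_iff_AE[of lborel "%y. \<bar>indicator K y * f y\<bar>"] by auto
  thus ?thesis by eventually_elim auto
 qed
 obtain C
  where C: "!!n::nat. compact (C n)" "!!n. C n \<subseteq> D" "D = (\<Union>n. C n)"
   by (rule open_compact_exhaustion[OF assms(2)]) (blast intro: that)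
 have "AE y in lborel. ALL n. y \<in> C n --> f y = 0" unfolding AE_all_countable using K0[OF C(1,2)] by blast
 thus ?thesis by eventually_elim (use C(3) in auto)
qed

section \<open>Square integrable functions and mollification in mean square\<close>

definition sqi :: "plane => bool" where
 "sqi f \<longleftrightarrow> f \<in> bor & lint (%y. (f y)^2)"

lemma sqi_mult:
 assumes "sqi f" "sqi g" shows "lint (%y. f y * g y)"
proof (rule Bochner_Integration.integrable_bound[of _ "%y. (f y)^2 + (g y)^2"])
 have "\<bar>a * b\<bar> <= a^2 + b^2" for a b :: real
 proof -
  have "2 * (\<bar>a\<bar> * \<bar>b\<bar>) <= a^2 + b^2"
   using zero_le_power2[of "\<bar>a\<bar> - \<bar>b\<bar>"] by (simp add: power2_diff algebra_simps)
  moreover have "0 <= \<bar>a\<bar> * \<bar>b\<bar>" by simp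
  ultimately show ?thesis unfolding abs_mult by linarith
 qed
 thus "AE y in lborel. norm (f y * g y) <= norm ((f y)^2 + (g y)^2)" by auto
qed (use assms in "auto simp: sqi_def")

lemma sqi_bound:
 assumes "f \<in> bor" "sqi g" "!!y. \<bar>f y\<bar> <= c * \<bar>g y\<bar>"
 shows "sqi f"
 unfolding sqi_def
proof (intro conjI)
 show "lint (%y. (f y)^2)"
 proof (rule Bochner_Integration.integrable_bound[of _ "%y. c\<^sup>2 * (g y)^2"])
  have "(f y)^2 <= (c * \<bar>g y\<bar>)^2" for y using assms(3)[of y] by (metis abs_le_square_iff abs_of_nonneg abs_ge_zero order_trans)
  thus "AE y in lborel. norm ((f y)^2) <= norm (c^2 * (g y)^2)" by (auto simp: power_mult_distrib)
 qed (use assms in "auto simp: sqi_def")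
qed fact

lemma sqi_add:
 assumes "sqi f" "sqi g" shows "sqi (%y. f y + g y)"
proof -
 have "(%y. (f y + g y)^2) = (%y. (f y)^2 + (2 * (f y * g y) + (g y)^2))" by (auto simp: power2_sum fun_eq_iff)
 thus ?thesis using assms sqi_mult[OF assms] by (auto simp: sqi_def)
qed

lemma sqi_cmult: "sqi f ==> sqi (%y. c * f y)"
 by (auto simp: sqi_def power_mult_distrib)

lemma sqi_diff:
 assumes "sqi f" "sqi g" shows "sqi (%y. f y - g y)"
 using sqi_add[OF assms(1) sqi_cmult[OF assms(2), of "-1"]] by simp

lemma sqi_continuous: "cont f ==> compact K ==> supp_in K f ==> sqi f"
 unfolding sqi_def using integrable_compact_supp[of "%y. (f y)^2" K]
 by (auto intro!: borel_measurable_continuous_onI continuous_intros simp: supp_in_def)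

lemma sqi_integrable:
 assumes "sqi f" "compact K" "supp_in K f" shows "lint f"
proof -
 have "(%y::real^2. (indicator K y)^2) = (indicator K :: real^2 => real)" by (auto simp: indicator_def fun_eq_iff)
 hence "sqi (indicator K)"
  using integrable_indicator_compact[OF assms(2)] borel_compact[OF assms(2)] by (simp add: sqi_def)
 hence "lint (%y. indicator K y * f y)" using assms(1) by (rule sqi_mult)
 moreover have "(%y. indicator K y * f y) = f" using assms(3) by (auto simp: supp_in_def indicator_def fun_eq_iff)
 ultimately show ?thesis by simp
qed

text \<open>Jensen's inequality for the probability density \<open>moll\<close> and Tonelli's theorem.\<close>

lemma conv_contraction:
 assumes G: "sqi G" "compact K" "supp_in K G"
 shows "sqi (conv (mollseq n) G)" "(LI x. (conv (mollseq n) G x)^2) <= (LI x. (G x)^2)"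
proof -
 let ?m = "mollseq n"
 note mc = moll_continuous[OF mollseq_pos, of n, folded mollseq_def]
 note ms = moll_supp[OF mollseq_pos, of n, folded mollseq_def]
 note mn = moll_nonneg[OF mollseq_pos, of n, folded mollseq_def]
 note mi = moll_shift_integral[OF mollseq_pos, of n, folded mollseq_def]
 have mm[measurable]: "?m \<in> bor" by (rule borel_measurable_continuous_onI[OF mc])
 have Gm[measurable]: "G \<in> bor" using G by (simp add: sqi_def)
 have Gi: "lint G" by (rule sqi_integrable[OF G])
 have G2: "lint (%y. (G y)^2)" using G by (simp add: sqi_def)
 note i1 = conv_integrable[OF mc compact_cball ms Gi]
 note i2 = conv_integrable[OF mc compact_cball ms G2]
 have cm: "conv ?m G \<in> bor"
  by (rule borel_measurable_continuous_onI[OF conv_continuous[OF mc compact_cball ms Gi]])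
 \<comment> \<open>The variance of G with respect to the probability density ?m (x - y) is
   nonnegative.\<close>
 have J: "(conv ?m G x)^2 <= (LI y. ?m (x - y) * (G y)^2)" for x
 proof -
  let ?c = "conv ?m G x"
  have "0 <= (LI y. ?m (x - y) * (G y - ?c)^2)"
   by (rule integral_nonneg_AE) (simp add: mn)
  also have "(%y. ?m (x - y) * (G y - ?c)^2) =
    (%y. ?m (x - y) * (G y)^2 - (2 * ?c) * (?m (x - y) * G y) + ?c^2 * ?m (x - y))"
   by (auto simp: fun_eq_iff power2_eq_square algebra_simps)
  also have "(LI y. ?m (x - y) * (G y)^2 - (2 * ?c) * (?m (x - y) * G y) + ?c^2 * ?m (x - y)) =
    (LI y. ?m (x - y) * (G y)^2) - 2 * ?c * ?c + ?c^2"
   using i1[of x] i2[of x] mi[of x] by (simp add: conv_def)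
  finally show ?thesis by (simp add: power2_eq_square)
 qed
 have "(\<integral>\<^sup>+x. ennreal ((conv ?m G x)^2) \<partial>lborel) <= (\<integral>\<^sup>+x. \<integral>\<^sup>+y. ennreal (?m (x - y) * (G y)^2) \<partial>lborel \<partial>lborel)"
 proof (rule nn_integral_mono)
  fix x :: "real^2"
  have "(\<integral>\<^sup>+y. ennreal (?m (x - y) * (G y)^2) \<partial>lborel) = ennreal (LI y. ?m (x - y) * (G y)^2)"
   by (rule nn_integral_eq_integral[OF i2]) (simp add: mn)
  thus "ennreal ((conv ?m G x)^2) <= (\<integral>\<^sup>+y. ennreal (?m (x - y) * (G y)^2) \<partial>lborel)"
   using J[of x] by (simp add: ennreal_leI)
 qed
 also have "... = (\<integral>\<^sup>+y. \<integral>\<^sup>+x. ennreal (?m (x - y) * (G y)^2) \<partial>lborel \<partial>lborel)"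
  by (rule lborel_pair.Fubini'[symmetric]) (measurable)
 also have "... = (\<integral>\<^sup>+y. ennreal ((G y)^2) \<partial>lborel)"
 proof (rule nn_integral_cong)
  fix y :: "real^2"
  have *: "(\<integral>\<^sup>+x. ennreal (?m (x - y)) \<partial>lborel) = 1"
  proof -
   have "?m (x - y) = ?m (y - x)" for x
    using moll_even[OF mollseq_pos, of n "y - x"] by (simp add: mollseq_def)
   hence "(\<integral>\<^sup>+x. ennreal (?m (x - y)) \<partial>lborel) = (\<integral>\<^sup>+x. ennreal (?m (y - x)) \<partial>lborel)" by simp
   also have "... = ennreal (LI x. ?m (y - x))" by (rule nn_integral_eq_integral[OF mi(2)]) (simp add: mn)
   finally show ?thesis using mi(1) by simp
  qed
  have "(\<integral>\<^sup>+x. ennreal (?m (x - y) * (G y)^2) \<partial>lborel) = (\<integral>\<^sup>+x. ennreal (?m (x - y)) * ennreal ((G y)^2) \<partial>lborel)"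
   by (simp add: ennreal_mult mn)
  also have "... = (\<integral>\<^sup>+x. ennreal (?m (x - y)) \<partial>lborel) * ennreal ((G y)^2)"
   by (rule nn_integral_multc) measurable
  finally show "(\<integral>\<^sup>+x. ennreal (?m (x - y) * (G y)^2) \<partial>lborel) = ennreal ((G y)^2)" by (simp add: *)
 qed
 also have "... = ennreal (LI y. (G y)^2)" by (rule nn_integral_eq_integral[OF G2]) simp
 finally have le: "(\<integral>\<^sup>+x. ennreal ((conv ?m G x)^2) \<partial>lborel) <= ennreal (LI y. (G y)^2)" .
 have ci: "lint (%x. (conv ?m G x)^2)"
  by (rule integrableI_bounded) (use cm le in "auto simp: le_less_trans[OF le]")
 thus "sqi (conv ?m G)" using cm by (simp add: sqi_def)
 have "ennreal (LI x. (conv ?m G x)^2) <= ennreal (LI y. (G y)^2)"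
  using le nn_integral_eq_integral[OF ci] by simp
 thus "(LI x. (conv ?m G x)^2) <= (LI x. (G x)^2)"
  by (subst (asm) ennreal_le_iff) (auto intro!: integral_nonneg_AE)
qed

text \<open>Truncation at height k makes F bounded, with an error that tends to 0 by dominated
  convergence; the bounded function is then approximated by \<open>bounded_approx\<close>. Two
  errors below r / 4 suffice since (a + b)^2 <= 2 a^2 + 2 b^2.\<close>

lemma sqi_dense:
 assumes F: "sqi F" "compact K" "supp_in K F" and r: "r > 0"
 obtains c K' where "cont c" "compact K'" "supp_in K' c" "(LI x. (F x - c x)^2) < r"
proof -
 have Fm[measurable]: "F \<in> bor" and F2: "lint (%x. (F x)^2)"
  using F by (auto simp: sqi_def)
 define T where "T = (%k::nat. %x. max (- real k) (min (real k) (F x)))"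
 have Tm[measurable]: "T k \<in> bor" for k unfolding T_def by measurable
 have Tb: "\<bar>T k x\<bar> <= real k" for k x by (auto simp: T_def)
 have TF: "\<bar>T k x\<bar> <= \<bar>F x\<bar>" "\<bar>F x - T k x\<bar> <= \<bar>F x\<bar>" for k x by (auto simp: T_def)
 have Ts: "supp_in K (T k)" for k using F(3) by (auto simp: supp_in_def T_def)
 have "(%k. LI x. (F x - T k x)^2) \<leadsto> integral\<^sup>L lborel (%x::real^2. 0)"
 proof (rule integral_dominated_convergence[OF _ _ F2])
  show "AE x in lborel. norm ((F x - T k x)^2) <= (F x)^2" for k
   using TF(2) by (auto simp: abs_le_square_iff)
  show "AE x in lborel. (%k. (F x - T k x)^2) \<leadsto> 0"
  proof (rule AE_I2, rule tendsto_eventually)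
   fix x
   obtain N :: nat where N: "\<bar>F x\<bar> <= real N" using real_arch_simple by blast
   show "\<forall>\<^sub>F k in sequentially. (F x - T k x)^2 = 0"
    unfolding eventually_sequentially by (rule exI[of _ N]) (use N in "auto simp: T_def")
  qed
 qed auto
 hence "(%k. LI x. (F x - T k x)^2) \<leadsto> 0" by simp
 then obtain k where k: "(LI x. (F x - T k x)^2) < r / 4"
  using order_tendstoD(2)[of _ 0 sequentially "r/4"] r eventually_happens'[OF sequentially_bot] by fastforce
 obtain K' g
  where g: "compact K'" "K' \<subseteq> UNIV" "!!n. cont (g n)" "!!n. supp_in K' (g n)"
   "!!n x. \<bar>g n x\<bar> <= real k" "AE x in lborel. (%n. g n x) \<leadsto> T k x"
   by (rule bounded_approx[OF Tm[of k] Tb Ts[of k] F(2) subset_UNIV open_UNIV]) (blast intro: that)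
 note g = g(1,3-6)
 have gm[measurable]: "g n \<in> bor" for n by (rule borel_measurable_continuous_onI[OF g(2)])
 let ?L = "K \<union> K'"
 have L: "compact ?L" using F(2) g(1) by (rule compact_Un)
 have "(%n. LI x. (T k x - g n x)^2) \<leadsto> integral\<^sup>L lborel (%x::real^2. 0)"
 proof (rule integral_dominated_convergence)
  show "lint (%x. (2 * real k)^2 * indicator ?L x :: real)"
   using integrable_indicator_compact[OF L] by simp
  show "AE x in lborel. norm ((T k x - g n x)^2) <= (2 * real k)^2 * indicator ?L x" for n
  proof (rule AE_I2)
   fix x
   have "\<bar>T k x - g n x\<bar> <= 2 * real k" using Tb[of k x] g(4)[of n x] by linarith
   hence "(T k x - g n x)^2 <= (2 * real k)^2" by (metis abs_le_square_iff abs_of_nonneg abs_ge_zero order_trans)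
   moreover have "T k x - g n x = 0" if "x \<notin> ?L" using that Ts g(3) by (auto simp: supp_in_def)
   ultimately show "norm ((T k x - g n x)^2) <= (2 * real k)^2 * indicator ?L x" by (cases "x \<in> ?L") auto
  qed
  show "AE x in lborel. (%n. (T k x - g n x)^2) \<leadsto> 0"
   using g(5)
  proof eventually_elim
   case (elim x)
   have "(%n. (T k x - g n x)^2) \<leadsto> (T k x - T k x)^2" by (intro tendsto_intros elim)
   thus ?case by simp
  qed
 qed auto
 hence "(%n. LI x. (T k x - g n x)^2) \<leadsto> 0" by simp
 then obtain n where n: "(LI x. (T k x - g n x)^2) < r / 4"
  using order_tendstoD(2)[of _ 0 sequentially "r/4"] r eventually_happens'[OF sequentially_bot] by fastforce
 have sT: "sqi (T k)" by (rule sqi_bound[OF Tm F(1), where c=1]) (use TF in auto)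
 have sg: "sqi (g n)" by (rule sqi_continuous[OF g(2,1,3)])
 have i: "lint (%x. (F x - T k x)^2)" "lint (%x. (T k x - g n x)^2)"
  "lint (%x. (F x - g n x)^2)"
  using sqi_diff[OF F(1) sT] sqi_diff[OF sT sg] sqi_diff[OF F(1) sg] by (auto simp: sqi_def)
 have "(LI x. (F x - g n x)^2) <= (LI x. 2 * (F x - T k x)^2 + 2 * (T k x - g n x)^2)"
 proof (rule integral_mono[OF i(3)])
  show "(F x - g n x)^2 <= 2 * (F x - T k x)^2 + 2 * (T k x - g n x)^2" for x
   using zero_le_power2[of "(F x - T k x) - (T k x - g n x)"] by (simp add: power2_eq_square algebra_simps)
 qed (use i in simp)
 also have "... = 2 * (LI x. (F x - T k x)^2) + 2 * (LI x. (T k x - g n x)^2)" using i by simp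
 also have "... < r" using k n by linarith
 finally show ?thesis using that[OF g(2,1,3)] by blast
qed

lemma conv_mollseq_add:
 assumes "lint f" "lint g"
 shows "conv (mollseq n) (%y. f y - g y) x = conv (mollseq n) f x - conv (mollseq n) g x"
 using conv_integrable[OF moll_continuous[OF mollseq_pos, of n, folded mollseq_def] compact_cball
   moll_supp[OF mollseq_pos, of n, folded mollseq_def]] assms
 unfolding conv_def right_diff_distrib by (intro Bochner_Integration.integral_diff) auto

text \<open>F is replaced by a continuous c: the error F - c is not enlarged by mollification, and c
  converges uniformly within a fixed compact set. Three squares, each at most r / 12, enter with the
  factor 3, so the sum stays below r.\<close>

lemma conv_L2:
 assumes F: "sqi F" "compact K" "supp_in K F"
 shows "(%n. LI x. (conv (mollseq n) F x - F x)^2) \<leadsto> 0"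
 unfolding LIMSEQ_iff
proof (intro allI impI)
 fix r :: real assume r: "r > 0"
 have "r / 12 > 0" using r by simp
 obtain c K' where c: "cont c" "compact K'" "supp_in K' c"
  "(LI x. (F x - c x)^2) < r / 12"
   by (rule sqi_dense[OF F \<open>r / 12 > 0\<close>]) (blast intro: that)
 obtain d L where L: "d > 0" "compact L" "K' \<subseteq> L" "L \<subseteq> UNIV" "!!x y. x \<in> K' ==> dist x y <= d ==> y \<in> L"
  using compact_nbhd[OF c(2) open_UNIV subset_UNIV] by metis
 obtain N1 where N1: "\<forall>n\<ge>N1. 2 * inverse (real (Suc n)) <= d" using mollseq_eventually[OF L(1)] by blast
 define mL where "mL = (\<integral>x. indicator L x \<partial>lborel :: real)"
 have mL: "mL >= 0" unfolding mL_def by (rule integral_nonneg_AE) simp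
 \<comment> \<open>The uniform error on the set L, of area mL, whose squared integral is at most r /
   12; the added 1 covers the case mL = 0.\<close>
 define s where "s = sqrt (r / (12 * (mL + 1)))"
 have s: "s > 0" "s^2 * mL <= r / 12"
 proof -
  show "s > 0" using r mL by (simp add: s_def)
  have "s^2 = r / (12 * (mL + 1))" using r mL by (simp add: s_def)
  hence "s^2 * mL = r / 12 * (mL / (mL + 1))" using mL by (simp add: field_simps)
  also have "... <= r / 12 * 1" using r mL by (intro mult_left_mono) auto
  finally show "s^2 * mL <= r / 12" by simp
 qed
 obtain N2 where N2: "\<forall>n\<ge>N2. ALL x. \<bar>conv (mollseq n) c x - c x\<bar> <= s" using mollseq_uniform[OF c(1-3) s(1)] by blast
 have sc: "sqi c" by (rule sqi_continuous[OF c(1-3)])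
 have sFc: "sqi (%x. F x - c x)" by (rule sqi_diff[OF F(1) sc])
 have suppFc: "supp_in (K \<union> K') (%x. F x - c x)" using F(3) c(3) by (auto simp: supp_in_def)
 have KK: "compact (K \<union> K')" using F(2) c(2) by (rule compact_Un)
 have fi: "lint F" "lint c" using sqi_integrable[OF F] sqi_integrable[OF sc c(2,3)] by auto
 show "EX no. \<forall>n\<ge>no. norm ((LI x. (conv (mollseq n) F x - F x)^2) - 0) < r"
 proof (intro exI allI impI)
  fix n assume n: "max N1 N2 <= n"
  let ?m = "conv (mollseq n)"
  note cc = conv_contraction[OF sFc KK suppFc, of n]
  have scc: "sqi (?m c)" by (rule conv_contraction(1)[OF sc c(2,3)])
  have sF: "sqi (?m F)" by (rule conv_contraction(1)[OF F])
  have i: "lint (%x. (?m (%x. F x - c x) x)^2)" "lint (%x. (?m c x - c x)^2)"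
   "lint (%x. (F x - c x)^2)" "lint (%x. (?m F x - F x)^2)"
   using cc(1) sqi_diff[OF scc sc] sFc sqi_diff[OF sF F(1)] by (auto simp: sqi_def)
  have "(LI x. (?m F x - F x)^2) <=
    (LI x. 3 * (?m (%x. F x - c x) x)^2 + 3 * (?m c x - c x)^2 + 3 * (F x - c x)^2)"
  proof (rule integral_mono[OF i(4)])
   fix x
   have e: "?m F x - F x = ?m (%x. F x - c x) x + (?m c x - c x) - (F x - c x)"
    using conv_mollseq_add[OF fi] by simp
   have "(a + b - c)^2 <= 3 * a^2 + 3 * b^2 + 3 * c^2" for a b c :: real
    using zero_le_power2[of "a - b"] zero_le_power2[of "a + c"] zero_le_power2[of "b + c"]
    by (simp add: power2_eq_square algebra_simps)
   thus "(?m F x - F x)^2 <= 3 * (?m (%x. F x - c x) x)^2 + 3 * (?m c x - c x)^2 + 3 * (F x - c x)^2"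
    unfolding e .
  qed (use i in simp)
  also have "... = 3 * (LI x. (?m (%x. F x - c x) x)^2) + 3 * (LI x. (?m c x - c x)^2)
    + 3 * (LI x. (F x - c x)^2)" using i by simp
  also have "(LI x. (?m c x - c x)^2) <= (LI x. s\<^sup>2 * indicator L x)"
  proof (rule integral_mono[OF i(2)])
   have sup: "supp_in L (?m c)"
    by (rule test_function_conv(2)[OF c(1-3) N1[rule_format] L(5,2,4)]) (use n in simp_all)
   fix x
   have "(?m c x - c x)^2 <= s^2"
    using N2[rule_format, of n x] n s(1) by (metis abs_le_square_iff abs_of_pos max.bounded_iff)
   moreover have "?m c x - c x = 0" if "x \<notin> L" using that sup c(3) L(3) by (auto simp: supp_in_def)
   ultimately show "(?m c x - c x)^2 <= s^2 * indicator L x" by (cases "x \<in> L") auto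
  qed (use integrable_indicator_compact[OF L(2)] in simp)
  also have "(LI x. s\<^sup>2 * indicator L x) = s^2 * mL" by (simp add: mL_def)
  finally have "(LI x. (?m F x - F x)^2) < r" using cc(2) c(4) s(2) r by linarith
  moreover have "0 <= (LI x. (?m F x - F x)^2)" by (rule integral_nonneg_AE) simp
  ultimately show "norm ((LI x. (?m F x - F x)^2) - 0) < r" by simp
 qed
qed

section \<open>Integration by parts for products of weakly differentiable functions\<close>

definition wd2 :: "(real^2) set => plane => plane => plane => bool" where
 "wd2 D f f1 f2 \<longleftrightarrow> wd D f f1 f2 & loc2 D f & loc2 D f1 & loc2 D f2"

lemma sqi_indicator_loc2:
 assumes "loc2 D f" "compact K" "K \<subseteq> D"
 shows "sqi (%y. indicator K y * f y)"
proof -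
 have "(%y. (indicator K y * f y)^2) = (%y. indicator K y * (f y)^2)"
  by (auto simp: indicator_def fun_eq_iff)
 moreover have "(%y. indicator K y * f y) \<in> bor"
  using assms borel_compact[OF assms(2)] by (intro borel_measurable_times borel_measurable_indicator) (auto simp: loc2_def)
 ultimately show ?thesis using assms by (auto simp: sqi_def loc2_def)
qed

text \<open>The first clause excludes that the integrals are 0 merely because the integrands are not
  integrable.\<close>

definition l2_tendsto :: "(real^2) set => (nat => real^2 => real) => plane => bool" where
 "l2_tendsto K g f \<longleftrightarrow> (ALL n. sqi (%y. indicator K y * (g n y - f y))) &
  (%n. LI y. indicator K y * (g n y - f y)^2) \<leadsto> 0"

text \<open>Extension of h by zero from K' followed by mollification. The derivatives converge on K
  because there they are the mollifications of the weak derivatives. The common \<open>d12\<close>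
  is what later makes the second derivatives cancel.\<close>

lemma wd2_approx:
 assumes h: "wd2 D h h1 h2" and "open D" and K: "compact K" "K \<subseteq> D"
 shows "EX g d1 d2 d11 d12 d22. (\<forall>n::nat. C1 (g n) (d1 n) (d2 n) & C1 (d1 n) (d11 n) (d12 n) &
   C1 (d2 n) (d12 n) (d22 n)) & l2_tendsto K g h & l2_tendsto K d1 h1 & l2_tendsto K d2 h2"
proof -
 obtain d K' where L: "d > 0" "compact K'" "K \<subseteq> K'" "K' \<subseteq> D" "!!x y. x \<in> K ==> dist x y <= d ==> y \<in> K'"
  using compact_nbhd[OF K(1) assms(2) K(2)] by metis
 obtain N where N: "\<forall>n\<ge>N. 2 * inverse (real (Suc n)) <= d" using mollseq_eventually[OF L(1)] by blast
 have w: "wd D h h1 h2" and l: "loc2 D h" "loc2 D h1" "loc2 D h2" using h by (auto simp: wd2_def)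
 let ?r = "%f y. indicator K' y * f y :: real"
 have sq: "sqi (?r f)" if "loc2 D f" for f by (rule sqi_indicator_loc2[OF that L(2,4)])
 have sup: "supp_in K' (?r f)" for f by (auto simp: supp_in_def)
 have int: "lint (?r f)" if "loc2 D f" for f by (rule sqi_integrable[OF sq[OF that] L(2) sup])
 have Km: "K \<in> sets borel" by (rule borel_compact[OF K(1)])
 let ?M = "%n. mollseq (n + N)"
 have "EX m1 m2 m11 m12 m22. ALL n. C1 (mollseq n) (m1 n) (m2 n) & C1 (m1 n) (m11 n) (m12 n) & C1 (m2 n) (m12 n) (m22 n)"
  using moll_C1[OF mollseq_pos, folded mollseq_def] by metis
 then obtain m1 m2 m11 m12 m22 where m: "!!n. C1 (mollseq n) (m1 n) (m2 n)"
  "!!n. C1 (m1 n) (m11 n) (m12 n)" "!!n. C1 (m2 n) (m12 n) (m22 n)" by blast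
 note ms = moll_supp[OF mollseq_pos, folded mollseq_def]
 note ms1 = C1_supp_deriv(1)[OF m(1) compact_cball ms]
 note ms2 = C1_supp_deriv(2)[OF m(1) compact_cball ms]
 define g where "g n = conv (?M n) (?r h)" for n
 define d1 where "d1 n = conv (m1 (n + N)) (?r h)" for n
 define d2 where "d2 n = conv (m2 (n + N)) (?r h)" for n
 have C: "C1 (g n) (d1 n) (d2 n)" "C1 (d1 n) (conv (m11 (n + N)) (?r h)) (conv (m12 (n + N)) (?r h))"
  "C1 (d2 n) (conv (m12 (n + N)) (?r h)) (conv (m22 (n + N)) (?r h))" for n
  unfolding g_def d1_def d2_def
  by (rule conv_C1[OF m(1) compact_cball ms int[OF l(1)]] conv_C1[OF m(2) compact_cball ms1 int[OF l(1)]]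
    conv_C1[OF m(3) compact_cball ms2 int[OF l(1)]])+
 have lt: "l2_tendsto K (%n. conv (?M n) (?r f)) f" if f: "loc2 D f" for f
 proof -
  have fm: "f \<in> bor" using f by (simp add: loc2_def)
  have s: "sqi (%y. conv (?M n) (?r f) y - ?r f y)" for n
   by (rule sqi_diff[OF conv_contraction(1)[OF sq[OF f] L(2) sup] sq[OF f]])
  have cm: "conv (?M n) (?r f) \<in> bor" for n
   using conv_contraction(1)[OF sq[OF f] L(2) sup] by (simp add: sqi_def)
  have e: "indicator K y * (conv (?M n) (?r f) y - f y) = indicator K y * (conv (?M n) (?r f) y - ?r f y)" for n y
   using L(3) by (auto simp: indicator_def)
  have e2: "indicator K y * (conv (?M n) (?r f) y - f y)^2 = indicator K y * (conv (?M n) (?r f) y - ?r f y)^2" for n y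
   using L(3) by (auto simp: indicator_def)
  have s': "sqi (%y. indicator K y * (conv (?M n) (?r f) y - f y))" for n
   by (rule sqi_bound[OF _ s[of n], where c=1]) (use cm fm Km L(3) in "auto simp: e indicator_def")
  have "(%n. LI y. indicator K y * (conv (?M n) (?r f) y - f y)^2) \<leadsto> 0"
  proof (rule tendsto_sandwich[OF _ _ tendsto_const])
   show "(%n. LI y. (conv (?M n) (?r f) y - ?r f y)^2) \<leadsto> 0"
    by (rule LIMSEQ_ignore_initial_segment[OF conv_L2[OF sq[OF f] L(2) sup]])
   have i: "lint (%y. (indicator K y * (conv (?M n) (?r f) y - f y))^2)" for n using s'[of n] by (simp add: sqi_def)
   have i': "lint (%y. indicator K y * (conv (?M n) (?r f) y - f y)^2)" for n
   proof -
    have "(%y. (indicator K y * (conv (?M n) (?r f) y - f y))^2) = (%y. indicator K y * (conv (?M n) (?r f) y - f y)^2)"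
     by (auto simp: indicator_def fun_eq_iff)
    thus ?thesis using i[of n] by simp
   qed
   show "\<forall>\<^sub>F n in sequentially. (LI y. indicator K y * (conv (?M n) (?r f) y - f y)^2)
     <= (LI y. (conv (?M n) (?r f) y - ?r f y)^2)"
    by (intro always_eventually allI integral_mono[OF i'])
     (use s L(3) in "auto simp: sqi_def e2 indicator_def")
   show "\<forall>\<^sub>F n in sequentially. 0 <= (LI y. indicator K y * (conv (?M n) (?r f) y - f y)^2)"
    by (intro always_eventually allI integral_nonneg_AE) simp
  qed
  with s' show ?thesis by (simp add: l2_tendsto_def)
 qed
 \<comment> \<open>For x in K the shifted mollifier is, as a function of y, a C1 test function
   supported in K'. Its derivative in y has the opposite sign, which cancels the sign in the
   definition of the weak derivative.\<close>
 have eq: "d1 n x = conv (?M n) (?r h1) x" "d2 n x = conv (?M n) (?r h2) x" if x: "x \<in> K" for n x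
 proof -
  have "C1 (%y. ?M n (x - y)) (%y. - m1 (n + N) (x - y)) (%y. - m2 (n + N) (x - y))"
   unfolding C1_def
  proof (intro conjI allI)
   fix y
   have "((%y. ?M n (x - y)) has_derivative
     (%v. (- v)$1 * m1 (n + N) (x - y) + (- v)$2 * m2 (n + N) (x - y))) (at y)"
    by (rule has_derivative_compose[where f="%y. x - y" and g="?M n"])
     (use m(1)[of "n + N"] in "auto intro!: derivative_eq_intros simp: C1_def")
   thus "((%y. ?M n (x - y)) has_derivative (%v. v$1 * - m1 (n + N) (x - y) + v$2 * - m2 (n + N) (x - y))) (at y)"
    by simp
   have "cont (m1 (n + N))" "cont (m2 (n + N))" using m(1)[of "n + N"] by (auto simp: C1_def)
   thus "cont (%y. - m1 (n + N) (x - y))" "cont (%y. - m2 (n + N) (x - y))"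
    by (auto intro!: continuous_intros intro: continuous_on_compose2)
  qed
  moreover have "supp_in K' (%y. ?M n (x - y))"
   unfolding supp_in_def
  proof (intro allI impI)
   fix y assume "y \<notin> K'"
   hence "dist x y > d" using L(5)[OF x] by force
   hence "norm (x - y) > 2 * inverse (real (Suc (n + N)))"
    using N[rule_format, of "n + N"] by (simp add: dist_norm)
   thus "?M n (x - y) = 0" using ms[of "n + N"] by (simp add: supp_in_def)
  qed
  ultimately have *: "(LI y. - m1 (n + N) (x - y) * h y) = - (LI y. ?M n (x - y) * h1 y)"
   "(LI y. - m2 (n + N) (x - y) * h y) = - (LI y. ?M n (x - y) * h2 y)"
   and sp: "supp_in K' (%y. ?M n (x - y))" "supp_in K' (%y. - m1 (n + N) (x - y))" "supp_in K' (%y. - m2 (n + N) (x - y))"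
   using wd_C1[OF w assms(2) _ L(2) _ L(4)] C1_supp_deriv[OF _ L(2)] by blast+
  have "conv k (?r f) x = (LI y. k (x - y) * f y)" if "supp_in K' (%y. k (x - y))" for k f
   unfolding conv_def using that by (intro Bochner_Integration.integral_cong) (auto simp: supp_in_def indicator_def)
  thus "d1 n x = conv (?M n) (?r h1) x" "d2 n x = conv (?M n) (?r h2) x"
   using * sp by (auto simp: d1_def d2_def supp_in_def)
 qed
 have cong: "l2_tendsto K a f" if "l2_tendsto K b f" "!!n x. x \<in> K ==> a n x = b n x" for a b f
 proof -
  have "(%y. indicator K y * (a n y - f y)) = (%y. indicator K y * (b n y - f y))"
   "(%y. indicator K y * (a n y - f y)^2) = (%y. indicator K y * (b n y - f y)^2)" for n
   using that(2) by (auto simp: indicator_def fun_eq_iff)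
  thus ?thesis using that(1) by (simp add: l2_tendsto_def)
 qed
 have "l2_tendsto K g h" unfolding g_def by (rule lt[OF l(1)])
 moreover have "l2_tendsto K d1 h1" by (rule cong[OF lt[OF l(2)] eq(1)])
 moreover have "l2_tendsto K d2 h2" by (rule cong[OF lt[OF l(3)] eq(2)])
 ultimately show ?thesis
  by (intro exI[of _ g] exI[of _ d1] exI[of _ d2] exI[of _ "%n. conv (m11 (n + N)) (?r h)"]
    exI[of _ "%n. conv (m12 (n + N)) (?r h)"] exI[of _ "%n. conv (m22 (n + N)) (?r h)"] conjI allI C)
qed

lemma l2_tendsto_lim:
 assumes g: "l2_tendsto K g f" and X: "sqi X" "supp_in K X"
 shows "(%n. LI y. X y * (g n y - f y)) \<leadsto> 0" (is ?P1)
  and "lint (%y. X y * (g n y - f y))"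
proof -
 define d where "d n y = indicator K y * (g n y - f y)" for n y
 have d: "sqi (d n)" for n using g unfolding l2_tendsto_def d_def by blast
 have d2: "(d n y)^2 = indicator K y * (g n y - f y)^2" for n y by (auto simp: d_def indicator_def)
 have Xd: "X y * (g n y - f y) = X y * d n y" for n y using X(2) by (auto simp: supp_in_def d_def indicator_def)
 show "lint (%y. X y * (g n y - f y))" unfolding Xd by (rule sqi_mult[OF X(1) d])
 have lim: "(%n. LI y. (d n y)^2) \<leadsto> 0" using g unfolding l2_tendsto_def d2 by blast
 have X2: "lint (%y. (X y)^2)" using X by (simp add: sqi_def)
 have di: "lint (%y. (d n y)^2)" for n using d by (simp add: sqi_def)
 define S where "S = (LI y. (X y)^2)"
 have S: "S >= 0" unfolding S_def by (rule integral_nonneg_AE) simp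
 show ?P1
  unfolding Xd LIMSEQ_iff
 proof (intro allI impI)
  fix r :: real assume r: "r > 0"
  \<comment> \<open>The weight in 2 |a b| <= t a^2 + b^2 / t: it makes t * S less than r, while the
    squared distance is eventually below r * t.\<close>
  define t where "t = r / (S + 1)"
  have t: "t > 0" "t * S < r"
   using r S by (auto simp: t_def field_simps add_pos_nonneg)
  have "r * t > 0" using r t by simp
  then obtain N where N: "!!n. n >= N ==> (LI y. (d n y)^2) < r * t"
   using order_tendstoD(2)[OF lim, of "r * t"] by (auto simp: eventually_sequentially)
  show "EX no. \<forall>n\<ge>no. norm ((LI y. X y * d n y) - 0) < r"
  proof (intro exI allI impI)
   fix n assume n: "N <= n"
   have "norm (LI y. X y * d n y) <= (LI y. (t * (X y)^2 + (d n y)^2 / t) / 2)"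
   proof (rule norm_integral_le[OF sqi_mult[OF X(1) d]])
    fix y
    have "0 <= (t * \<bar>X y\<bar> - \<bar>d n y\<bar>)^2 / t" using t by simp
    also have "... = t * (X y)^2 + (d n y)^2 / t - 2 * (\<bar>X y\<bar> * \<bar>d n y\<bar>)"
     using t by (simp add: power2_diff field_simps power2_eq_square)
    finally show "norm (X y * d n y) <= (t * (X y)^2 + (d n y)^2 / t) / 2" by (simp add: abs_mult)
   qed (use X2 di in simp)
   also have "... = (t * S + (LI y. (d n y)^2) / t) / 2" using X2 di[of n] by (simp add: S_def)
   also have "... < r"
   proof -
    have "(LI y. (d n y)^2) / t < r" using N[OF n] t by (simp add: field_simps)
    with t(2) show ?thesis by simp
   qed
   finally show "norm ((LI y. X y * d n y) - 0) < r" by simp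
  qed
 qed
qed

lemma l2_tendsto_lim':
 assumes g: "l2_tendsto K g f" and X: "sqi X" "supp_in K X" and f: "lint (%y. X y * f y)"
 shows "(%n. LI y. X y * g n y) \<leadsto> (LI y. X y * f y)" (is ?P1)
  and "lint (%y. X y * g n y)"
proof -
 note L = l2_tendsto_lim[OF g X]
 have i: "lint (%y. X y * g n y)" for n
  using Bochner_Integration.integrable_add[OF L(2)[of n] f] by (simp add: algebra_simps)
 thus "lint (%y. X y * g n y)" .
 have "(LI y. X y * g n y) = (LI y. X y * (g n y - f y)) + (LI y. X y * f y)" for n
  using i[of n] f by (simp add: right_diff_distrib)
 thus ?P1
  using tendsto_add[OF L(1) tendsto_const[of "LI y. X y * f y"]] by simp
qed

lemma sqi_mult_loc2:
 assumes f: "loc2 D f" and c: "c \<in> bor" "supp_in K c" "!!y. \<bar>c y\<bar> <= B" and K: "compact K" "K \<subseteq> D"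
 shows "sqi (%y. c y * f y)"
proof (rule sqi_bound[OF _ sqi_indicator_loc2[OF f K], where c=B])
 show "(%y. c y * f y) \<in> bor" using f c by (auto simp: loc2_def)
 show "\<bar>c y * f y\<bar> <= B * \<bar>indicator K y * f y\<bar>" for y
  using c(2,3) by (cases "y \<in> K") (auto simp: supp_in_def abs_mult mult_right_mono)
qed

lemma supp_in_mult: "supp_in K a ==> supp_in K (%y. a y * b y)"
 by (simp add: supp_in_def)

lemma sqi_loc2_integrable:
 assumes "sqi X" "supp_in K X" "loc2 D f" "compact K" "K \<subseteq> D"
 shows "lint (%y. X y * f y)"
proof -
 have "lint (%y. X y * (indicator K y * f y))"
  by (rule sqi_mult[OF assms(1) sqi_indicator_loc2[OF assms(3-5)]])
 moreover have "(%y. X y * (indicator K y * f y)) = (%y. X y * f y)"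
  using assms(2) by (auto simp: supp_in_def indicator_def fun_eq_iff)
 ultimately show ?thesis by simp
qed

text \<open>Only \<open>h\<close> is mollified: its mixed second derivatives cancel.\<close>

lemma stokes_C1:
 assumes h: "wd2 D h h1 h2" and g: "wd2 D g g1 g2" and "open D"
  and z: "C1 z z1 z2" "compact K" "K \<subseteq> D" "supp_in K z" and f: "C1 f f1 f2"
 shows "(LI y. (z2 y * f y * g y + z y * f2 y * g y + z y * f y * g2 y) * h1 y) =
  (LI y. (z1 y * f y * g y + z y * f1 y * g y + z y * f y * g1 y) * h2 y)"
proof -
 have "EX hn d1 d2 d11 d12 d22. (\<forall>n::nat. C1 (hn n) (d1 n) (d2 n) & C1 (d1 n) (d11 n) (d12 n) &
   C1 (d2 n) (d12 n) (d22 n)) & l2_tendsto K hn h & l2_tendsto K d1 h1 & l2_tendsto K d2 h2"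
  by (rule wd2_approx[OF h assms(3) z(2,3)])
 then obtain d1 d2 d11 d12 d22 :: "nat => real^2 => real"
  where d: "!!n. C1 (d1 n) (d11 n) (d12 n)" "!!n. C1 (d2 n) (d12 n) (d22 n)"
   and l: "l2_tendsto K d1 h1" "l2_tendsto K d2 h2" by blast
 note zs = C1_supp_deriv[OF z(1,2,4)]
 define F where "F y = z y * f y" for y
 define F1 where "F1 y = z1 y * f y + z y * f1 y" for y
 define F2 where "F2 y = z2 y * f y + z y * f2 y" for y
 have F: "C1 F F1 F2" unfolding F_def F1_def F2_def by (rule C1_mult[OF z(1) f])
 have sF: "supp_in K F" "supp_in K F1" "supp_in K F2"
  using z(4) zs by (auto simp: supp_in_def F_def F1_def F2_def)
 have cF: "cont F" "cont F1" "cont F2"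
  using F C1_continuous[OF F] by (auto simp: C1_def)
 have gl: "loc2 D g" "loc2 D g1" "loc2 D g2" and gw: "wd D g g1 g2" using g by (auto simp: wd2_def)
 have sq: "sqi (%y. c y * k y)" if t: "cont c" "supp_in K c" "loc2 D k" for c k
 proof -
  obtain B where "!!y. \<bar>c y\<bar> <= B" using bounded_compact_supp[OF t(1) z(2) t(2)] by metis
  thus ?thesis
   by (intro sqi_mult_loc2[OF t(3) borel_measurable_continuous_onI[OF t(1)] t(2) _ z(2,3)])
 qed
 \<comment> \<open>X1 and X2 are the weak partial derivatives of the product z f g.\<close>
 define X1 where "X1 y = F1 y * g y + F y * g1 y" for y
 define X2 where "X2 y = F2 y * g y + F y * g2 y" for y
 have X: "sqi X1" "sqi X2" unfolding X1_def X2_def by (intro sqi_add sq cF sF gl)+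
 have sX: "supp_in K X1" "supp_in K X2" using sF by (auto simp: supp_in_def X1_def X2_def)
 have hl: "loc2 D h1" "loc2 D h2" using h by (auto simp: wd2_def)
 have lim: "(%n. LI y. X2 y * d1 n y) \<leadsto> (LI y. X2 y * h1 y)"
  "(%n. LI y. X1 y * d2 n y) \<leadsto> (LI y. X1 y * h2 y)"
  by (rule l2_tendsto_lim'[OF l(1) X(2) sX(2) sqi_loc2_integrable[OF X(2) sX(2) hl(1) z(2,3)]]
    l2_tendsto_lim'[OF l(2) X(1) sX(1) sqi_loc2_integrable[OF X(1) sX(1) hl(2) z(2,3)]])+
 \<comment> \<open>Both sides equal minus the integral of F * d12 * g, where \<open>d12\<close> is
   the mixed second derivative of the mollified h.\<close>
 have eq: "(LI y. X2 y * d1 n y) = (LI y. X1 y * d2 n y)" for n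
 proof -
  have c12: "cont (d12 n)" using d(1)[of n] by (simp add: C1_def)
  have dc: "cont (d1 n)" "cont (d2 n)"
   using C1_continuous[OF d(1)] C1_continuous[OF d(2)] by auto
  have W1: "(LI y. (F2 y * d1 n y + F y * d12 n y) * g y) = - (LI y. (F y * d1 n y) * g2 y)"
   by (rule wd_C1(2)[OF gw assms(3) C1_mult[OF F d(1)] z(2) supp_in_mult[OF sF(1)] z(3)])
  have W2: "(LI y. (F1 y * d2 n y + F y * d12 n y) * g y) = - (LI y. (F y * d2 n y) * g1 y)"
   by (rule wd_C1(1)[OF gw assms(3) C1_mult[OF F d(2)] z(2) supp_in_mult[OF sF(1)] z(3)])
  have i: "lint (%y. (c y * e y) * k y)"
   if t: "cont c" "supp_in K c" "cont e" "loc2 D k" for c e k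
  proof -
   have ce: "cont (%y. c y * e y)" using t by (intro continuous_intros)
   obtain B where "!!y. \<bar>c y * e y\<bar> <= B" using bounded_compact_supp[OF ce z(2) supp_in_mult[OF t(2)]] by metis
   thus ?thesis
    by (rule loc1_mult_supp[OF loc2_imp_loc1[OF t(4)] borel_measurable_continuous_onI[OF ce] _ supp_in_mult[OF t(2)] z(2,3)])
  qed
  have "(LI y. X2 y * d1 n y) = (LI y. (F2 y * d1 n y) * g y + (F y * d1 n y) * g2 y)"
   by (rule Bochner_Integration.integral_cong) (auto simp: X2_def algebra_simps)
  also have "... = (LI y. (F2 y * d1 n y) * g y) + (LI y. (F y * d1 n y) * g2 y)"
   by (rule Bochner_Integration.integral_add) (intro i cF sF dc gl)+
  also have "(LI y. (F2 y * d1 n y) * g y) =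
    (LI y. (F2 y * d1 n y + F y * d12 n y) * g y) - (LI y. (F y * d12 n y) * g y)"
   unfolding distrib_right using i[OF cF(3) sF(3) dc(1) gl(1)] i[OF cF(1) sF(1) c12 gl(1)] by simp
  finally have 1: "(LI y. X2 y * d1 n y) = - (LI y. (F y * d12 n y) * g y)" using W1 by simp
  have "(LI y. X1 y * d2 n y) = (LI y. (F1 y * d2 n y) * g y + (F y * d2 n y) * g1 y)"
   by (rule Bochner_Integration.integral_cong) (auto simp: X1_def algebra_simps)
  also have "... = (LI y. (F1 y * d2 n y) * g y) + (LI y. (F y * d2 n y) * g1 y)"
   by (rule Bochner_Integration.integral_add) (intro i cF sF dc gl)+
  also have "(LI y. (F1 y * d2 n y) * g y) =
    (LI y. (F1 y * d2 n y + F y * d12 n y) * g y) - (LI y. (F y * d12 n y) * g y)"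
   unfolding distrib_right using i[OF cF(2) sF(2) dc(2) gl(1)] i[OF cF(1) sF(1) c12 gl(1)] by simp
  finally have "(LI y. X1 y * d2 n y) = - (LI y. (F y * d12 n y) * g y)" using W2 by simp
  with 1 show ?thesis by simp
 qed
 have "(LI y. X2 y * h1 y) = (LI y. X1 y * h2 y)"
  using LIMSEQ_unique[OF lim(1)] lim(2) eq by simp
 thus ?thesis by (simp add: X1_def X2_def F_def F1_def F2_def algebra_simps)
qed

text \<open>The product rule for g h, tested with z: if h is replaced by a C1 approximation, z times
  it is an admissible test function for g, and the limit is taken in mean square.\<close>

lemma wd2_product:
 assumes h: "wd2 D h h1 h2" and g: "wd2 D g g1 g2" and "open D"
  and z: "C1 z z1 z2" "compact K" "K \<subseteq> D" "supp_in K z"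
 shows "(LI y. z1 y * g y * h y + z y * g y * h1 y + z y * g1 y * h y) = 0" (is ?P1)
  and "(LI y. z2 y * g y * h y + z y * g y * h2 y + z y * g2 y * h y) = 0" (is ?P2)
proof -
 have "EX hn d1 d2 d11 d12 d22. (\<forall>n::nat. C1 (hn n) (d1 n) (d2 n) & C1 (d1 n) (d11 n) (d12 n) &
   C1 (d2 n) (d12 n) (d22 n)) & l2_tendsto K hn h & l2_tendsto K d1 h1 & l2_tendsto K d2 h2"
  by (rule wd2_approx[OF h assms(3) z(2,3)])
 then obtain hn d1 d2 :: "nat => real^2 => real" where d: "!!n. C1 (hn n) (d1 n) (d2 n)"
  and l: "l2_tendsto K hn h" "l2_tendsto K d1 h1" "l2_tendsto K d2 h2" by blast
 note zs = C1_supp_deriv[OF z(1,2,4)]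
 have c: "cont z" "cont z1" "cont z2"
  using z(1) C1_continuous[OF z(1)] by (auto simp: C1_def)
 have gl: "loc2 D g" "loc2 D g1" "loc2 D g2" and gw: "wd D g g1 g2" using g by (auto simp: wd2_def)
 have hl: "loc2 D h" "loc2 D h1" "loc2 D h2" using h by (auto simp: wd2_def)
 have sq: "sqi (%y. c y * k y)" if t: "cont c" "supp_in K c" "loc2 D k" for c k
 proof -
  obtain B where "!!y. \<bar>c y\<bar> <= B" using bounded_compact_supp[OF t(1) z(2) t(2)] by metis
  thus ?thesis
   by (intro sqi_mult_loc2[OF t(3) borel_measurable_continuous_onI[OF t(1)] t(2) _ z(2,3)])
 qed
 have main: "(LI y. zi y * g y * h y + z y * g y * hi y + z y * gi y * h y) = 0"
  if zi: "cont zi" "supp_in K zi" and gi: "loc2 D gi" and hi: "loc2 D hi" and di: "l2_tendsto K di hi"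
   and dc: "!!n. cont (di n)"
   and W: "!!n. (LI y. (zi y * hn n y + z y * di n y) * g y) = - (LI y. (z y * hn n y) * gi y)"
  for zi gi hi di
 proof -
  have a: "sqi (%y. zi y * g y)" "sqi (%y. z y * g y)" "sqi (%y. z y * gi y)"
   by (rule sq[OF zi gl(1)] sq[OF c(1) z(4) gl(1)] sq[OF c(1) z(4) gi])+
  note s = supp_in_mult[OF zi(2), of g] supp_in_mult[OF z(4), of g] supp_in_mult[OF z(4), of gi]
  note i1 = sqi_loc2_integrable[OF a(1) s(1) hl(1) z(2,3)]
  note i2 = sqi_loc2_integrable[OF a(2) s(2) hi z(2,3)]
  note i3 = sqi_loc2_integrable[OF a(3) s(3) hl(1) z(2,3)]
  note L1 = l2_tendsto_lim'[OF l(1) a(1) s(1) i1]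
  note L2 = l2_tendsto_lim'[OF di a(2) s(2) i2]
  note L3 = l2_tendsto_lim'[OF l(1) a(3) s(3) i3]
  have "(LI y. zi y * g y * hn n y) + (LI y. z y * g y * di n y) + (LI y. z y * gi y * hn n y) = 0" for n
  proof -
   have "(LI y. zi y * g y * hn n y) + (LI y. z y * g y * di n y) = (LI y. (zi y * hn n y + z y * di n y) * g y)"
    by (subst Bochner_Integration.integral_add[OF L1(2) L2(2), symmetric]) (simp add: algebra_simps)
   also have "... = - (LI y. z y * gi y * hn n y)" unfolding W by (simp add: mult_ac)
   finally show ?thesis by simp
  qed
  hence "(LI y. zi y * g y * h y) + (LI y. z y * g y * hi y) + (LI y. z y * gi y * h y) = 0"
   using LIMSEQ_unique[OF tendsto_add[OF tendsto_add[OF L1(1) L2(1)] L3(1)]] by simp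
  thus ?thesis using i1 i2 i3 by simp
 qed
 note W = wd_C1[OF gw assms(3) C1_mult[OF z(1) d] z(2) supp_in_mult[OF z(4)] z(3)]
 have dc: "cont (d1 n)" "cont (d2 n)" for n using d[of n] by (auto simp: C1_def)
 show ?P1
  by (rule main[OF c(2) zs(1) gl(2) hl(2) l(2) dc(1) W(1)])
 show ?P2
  by (rule main[OF c(3) zs(2) gl(3) hl(3) l(3) dc(2) W(2)])
qed

section \<open>Truncation of vector-valued functions\<close>

lemma C1_const: "C1 (%y. c) (%y. 0) (%y. 0)"
 by (simp add: C1_def)

lemma C1_add:
 assumes "C1 f f1 f2" "C1 g g1 g2"
 shows "C1 (%x. f x + g x) (%x. f1 x + g1 x) (%x. f2 x + g2 x)"
 using assms unfolding C1_def
 by (auto intro!: continuous_intros derivative_eq_intros simp: algebra_simps)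

lemma C1_sum:
 assumes "finite J" "!!j. j \<in> J ==> C1 (f j) (f1 j) (f2 j)"
 shows "C1 (%x. \<Sum>j\<in>J. f j x) (%x. \<Sum>j\<in>J. f1 j x) (%x. \<Sum>j\<in>J. f2 j x)"
 using assms by (induction rule: finite_induct) (auto intro!: C1_const C1_add)

lemma C1_inverse:
 assumes f: "C1 f f1 f2" and pos: "!!x. f x > 0"
 shows "C1 (%x. inverse (f x)) (%x. - f1 x * (inverse (f x))^2) (%x. - f2 x * (inverse (f x))^2)"
 unfolding C1_def
proof (intro conjI allI)
 fix x
 have ne: "f x ~= 0" for x using pos[of x] by simp
 have fd: "(f has_derivative (%v. v$1 * f1 x + v$2 * f2 x)) (at x)" using f by (simp add: C1_def)
 show "((%x. inverse (f x)) has_derivative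
   (%v. v$1 * (- f1 x * (inverse (f x))^2) + v$2 * (- f2 x * (inverse (f x))^2))) (at x)"
  by (rule has_derivative_eq_rhs[OF Deriv.has_derivative_inverse[OF ne fd]])
   (simp add: fun_eq_iff algebra_simps power2_eq_square)
 have fc: "cont f" "cont f1" "cont f2"
  using f C1_continuous[OF f] by (auto simp: C1_def)
 show "cont (%x. - f1 x * (inverse (f x))^2)" "cont (%x. - f2 x * (inverse (f x))^2)"
  using ne by (auto intro!: continuous_intros fc)
qed

text \<open>The radial factor 1 / (1 + |v|^2 / k). Clipping the components separately would destroy
  linear relations among them; one common scalar factor preserves these, in particular \<phi> =
  \<open>\<phi>\<^sub>u\<close>.\<close>

definition kap :: "real => ('n::finite => real) => real" where
 "kap k v = inverse (1 + inverse k * (\<Sum>j\<in>UNIV. v j * v j))"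

text \<open>The Jacobian of the truncation \<open>v \<mapsto> kap k v \<cdot> v\<close>\<close>

definition kapM :: "real => ('n::finite => real) => 'n => 'n => real" where
 "kapM k v i j = (if i = j then kap k v else 0) - 2 * inverse k * (kap k v)^2 * v i * v j"

lemma kap_den:
 assumes "k > 0" shows "1 + inverse k * (\<Sum>j\<in>UNIV. v j * v j) > (0::real)"
proof -
 have "(\<Sum>j\<in>UNIV. v j * v j) >= 0" by (intro sum_nonneg) simp
 thus ?thesis using assms by (simp add: add_pos_nonneg)
qed

text \<open>Everything rests on kap k v * |v|^2 <= k and |v i * v j| <= |v|^2; in the last bound 3 =
  1 + 2 splits the two terms of \<open>kapM\<close>. The bounds 1 and 3 do not depend on k, which is
  what dominates the limit as k tends to infinity.\<close>

lemma kap_bounds: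
 assumes "k > 0"
 shows "0 < kap k v" "kap k v <= 1" "\<bar>kap k v * v i\<bar> <= 1 + k" (is ?P1) "\<bar>kapM k v i j\<bar> <= 3" (is ?P2)
proof -
 let ?s = "\<Sum>j\<in>UNIV. v j * v j"
 have s: "?s >= 0" by (intro sum_nonneg) simp
 have p: "1 + inverse k * ?s >= 1" using s assms by simp
 show k: "0 < kap k v" "kap k v <= 1" using p by (simp_all add: kap_def inverse_le_1_iff)
 have vi: "v j * v j <= ?s" for j by (rule member_le_sum) auto
 have ks: "kap k v * (inverse k * ?s) <= 1"
 proof -
  have "inverse (1 + X) * X <= 1" if "X >= 0" for X :: real using that by (simp add: field_simps)
  thus ?thesis unfolding kap_def using s assms by simp
 qed
 have kss: "kap k v * ?s <= k" using ks assms by (simp add: field_simps)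
 have "\<bar>v i\<bar> <= 1 + v i * v i"
  using zero_le_power2[of "\<bar>v i\<bar> - 1"] zero_le_square[of "v i"] by (simp add: power2_eq_square algebra_simps)
 hence "\<bar>v i\<bar> <= 1 + ?s" using vi[of i] by linarith
 hence "kap k v * \<bar>v i\<bar> <= kap k v * (1 + ?s)" using k by (intro mult_left_mono) auto
 also have "... <= 1 + k" using k kss by (simp add: algebra_simps)
 finally show ?P1 using k by (simp add: abs_mult)
 have "\<bar>v i * v j\<bar> <= ?s"
 proof -
  have "2 * \<bar>v i * v j\<bar> <= v i * v i + v j * v j"
   using zero_le_power2[of "\<bar>v i\<bar> - \<bar>v j\<bar>"] by (simp add: power2_eq_square algebra_simps abs_mult)
  thus ?thesis using vi[of i] vi[of j] by linarith
 qed
 hence "\<bar>2 * inverse k * (kap k v)^2 * v i * v j\<bar> <= 2 * inverse k * (kap k v)^2 * ?s"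
  using assms k by (simp add: abs_mult mult.assoc mult_left_mono)
 also have "... = 2 * kap k v * (kap k v * (inverse k * ?s))" by (simp add: power2_eq_square)
 also have "... <= 2 * 1 * 1" using ks k s assms by (intro mult_mono) auto
 finally have "\<bar>2 * inverse k * (kap k v)^2 * v i * v j\<bar> <= 2" by simp
 moreover have "\<bar>if i = j then kap k v else 0\<bar> <= 1" using k by simp
 ultimately show ?P2
  unfolding kapM_def using abs_triangle_ineq4[of "if i = j then kap k v else 0" "2 * inverse k * (kap k v)^2 * v i * v j"]
  by linarith
qed

lemma kap_tendsto:
 assumes "k > 0" "!!j. (%n. f n j) \<leadsto> v j"
 shows "(%n. kap k (f n)) \<leadsto> kap k v" (is ?P1) "(%n. kapM k (f n) i j) \<leadsto> kapM k v i j" (is ?P2)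
proof -
 have p: "1 + inverse k * (\<Sum>j\<in>UNIV. v j * v j) > 0"
  by (rule kap_den[OF assms(1)])
 thus *: ?P1
  unfolding kap_def by (intro tendsto_intros assms) auto
 show ?P2
  unfolding kapM_def by (cases "i = j") (auto intro!: tendsto_intros * assms)
qed

lemma kap_tendsto_1:
 shows "(%m. kap (real (Suc m)) v) \<leadsto> 1" (is ?P1) "(%m. kapM (real (Suc m)) v i j) \<leadsto> (if i = j then 1 else 0)" (is ?P2)
proof -
 have i: "(%m. inverse (real (Suc m))) \<leadsto> 0" by (rule LIMSEQ_inverse_real_of_nat)
 have "(%m. kap (real (Suc m)) v) \<leadsto> inverse (1 + 0 * (\<Sum>j\<in>UNIV. v j * v j))"
  unfolding kap_def by (intro tendsto_intros i) auto
 thus *: ?P1 by simp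
 have a: "(%m. 2 * inverse (real (Suc m)) * (kap (real (Suc m)) v)^2 * v i * v j) \<leadsto> 2 * 0 * 1^2 * v i * v j"
  by (intro tendsto_intros i *)
 show ?P2
  using tendsto_diff[OF * a] tendsto_diff[OF tendsto_const[of 0] a] unfolding kapM_def by (cases "i = j") simp_all
qed

lemma kap_C1:
 fixes P :: "'n::finite => real^2 => real"
 assumes k: "k > 0" and P: "!!j. C1 (P j) (P1 j) (P2 j)"
 shows "C1 (%y. kap k (%j. P j y) * P i y) (%y. \<Sum>j\<in>UNIV. kapM k (%j. P j y) i j * P1 j y)
  (%y. \<Sum>j\<in>UNIV. kapM k (%j. P j y) i j * P2 j y)"
proof -
 let ?K = "%y. kap k (%j. P j y)"
 have p: "1 + inverse k * (\<Sum>j\<in>UNIV. P j y * P j y) > 0" for y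
  by (rule kap_den[OF k])
 have "C1 ?K (%y. - (0 + (0 * (\<Sum>j\<in>UNIV. P j y * P j y) + inverse k * (\<Sum>j\<in>UNIV. P1 j y * P j y + P j y * P1 j y))) * (?K y)^2)
   (%y. - (0 + (0 * (\<Sum>j\<in>UNIV. P j y * P j y) + inverse k * (\<Sum>j\<in>UNIV. P2 j y * P j y + P j y * P2 j y))) * (?K y)^2)"
  unfolding kap_def
  by (rule C1_inverse[OF C1_add[OF C1_const C1_mult[OF C1_const C1_sum[OF finite C1_mult[OF P P]]]] p])
 from C1_mult[OF this P[of i]]
 have fin: "C1 (%y. ?K y * P i y)
  (%y. - (0 + (0 * (\<Sum>j\<in>UNIV. P j y * P j y) + inverse k * (\<Sum>j\<in>UNIV. P1 j y * P j y + P j y * P1 j y))) * (?K y)^2 * P i y + ?K y * P1 i y)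
  (%y. - (0 + (0 * (\<Sum>j\<in>UNIV. P j y * P j y) + inverse k * (\<Sum>j\<in>UNIV. P2 j y * P j y + P j y * P2 j y))) * (?K y)^2 * P i y + ?K y * P2 i y)" .
 have id: "- (0 + (0 * s + inverse k * (\<Sum>j\<in>UNIV. d j * v j + v j * d j))) * (kap k v)^2 * v i + kap k v * d i
   = (\<Sum>j\<in>UNIV. kapM k v i j * d j)" for s and v d :: "'n => real"
 proof -
  have "(\<Sum>j\<in>UNIV. kapM k v i j * d j) = (\<Sum>j\<in>UNIV. (if i = j then kap k v * d i else 0))
    - (\<Sum>j\<in>UNIV. 2 * inverse k * (kap k v)^2 * v i * v j * d j)"
   unfolding sum_subtractf[symmetric] by (rule sum.cong) (auto simp: kapM_def algebra_simps)
  also have "(\<Sum>j\<in>UNIV. 2 * inverse k * (kap k v)^2 * v i * v j * d j) = 2 * inverse k * (kap k v)^2 * v i * (\<Sum>j\<in>UNIV. v j * d j)"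
   by (simp add: sum_distrib_left mult.assoc)
  also have "(\<Sum>j\<in>UNIV. (if i = j then kap k v * d i else 0)) = kap k v * d i" by simp
  finally have 1: "(\<Sum>j\<in>UNIV. kapM k v i j * d j) = kap k v * d i - 2 * inverse k * (kap k v)^2 * v i * (\<Sum>j\<in>UNIV. v j * d j)" .
  have "(\<Sum>j\<in>UNIV. d j * v j + v j * d j) = (\<Sum>j\<in>UNIV. 2 * (v j * d j))" by (rule sum.cong) simp_all
  also have "... = 2 * (\<Sum>j\<in>UNIV. v j * d j)" by (rule sum_distrib_left[symmetric])
  finally show ?thesis unfolding 1 by (simp add: algebra_simps)
 qed
 have e: "- (0 + (0 * (\<Sum>j\<in>UNIV. P j y * P j y) + inverse k * (\<Sum>j\<in>UNIV. P1 j y * P j y + P j y * P1 j y))) * (?K y)^2 * P i y + ?K y * P1 i y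
   = (\<Sum>j\<in>UNIV. kapM k (%j. P j y) i j * P1 j y)"
  "- (0 + (0 * (\<Sum>j\<in>UNIV. P j y * P j y) + inverse k * (\<Sum>j\<in>UNIV. P2 j y * P j y + P j y * P2 j y))) * (?K y)^2 * P i y + ?K y * P2 i y
   = (\<Sum>j\<in>UNIV. kapM k (%j. P j y) i j * P2 j y)"
  for y
  by (rule id[where v="%j. P j y" and d="%j. P1 j y"] id[where v="%j. P j y" and d="%j. P2 j y"])+
 show ?thesis using fin by (simp only: e)
qed

lemma l2_tendsto_subseq:
 "l2_tendsto K g f ==> strict_mono r ==> l2_tendsto K (%n. g (r n)) f"
 unfolding l2_tendsto_def using LIMSEQ_subseq_LIMSEQ[of _ 0 r] by (auto simp: o_def)

text \<open>One subsequence serves all components because mean convergence is applied to the sum of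
  the squared differences.\<close>

lemma l2_tendsto_AE:
 fixes g :: "'n::finite => nat => real^2 => real"
 assumes g: "!!j. l2_tendsto K (g j) (f j)"
 shows "EX r. strict_mono r & (AE y\<in>K in lborel. (ALL j. (%n. g j (r n) y) \<leadsto> f j y))"
proof -
 define u where "u n y = (\<Sum>j\<in>UNIV. (indicator K y * (g j n y - f j y))^2)" for n y
 have e: "(indicator K y * (g j n y - f j y))^2 = indicator K y * (g j n y - f j y)^2" for j n y
  by (auto simp: indicator_def)
 have i: "lint (%y. (indicator K y * (g j n y - f j y))^2)" for j n
  using g[of j] by (auto simp: l2_tendsto_def sqi_def)
 have ui: "lint (u n)" for n unfolding u_def by (intro Bochner_Integration.integrable_sum i)
 have un: "u n y >= 0" for n y unfolding u_def by (intro sum_nonneg) simp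
 have "(%n. LI y. norm (u n y)) = (%n. \<Sum>j\<in>UNIV. LI y. indicator K y * (g j n y - f j y)^2)"
  using un by (simp add: u_def Bochner_Integration.integral_sum[OF i] e[symmetric])
 moreover have "(%n. \<Sum>j\<in>UNIV. LI y. indicator K y * (g j n y - f j y)^2) \<leadsto> (\<Sum>j\<in>(UNIV::'n set). 0)"
  by (rule tendsto_sum) (use g in "auto simp: l2_tendsto_def")
 ultimately have "(%n. LI y. norm (u n y)) \<leadsto> 0" by simp
 from tendsto_L1_AE_subseq[OF ui this] obtain r where r: "strict_mono r" "AE y in lborel. (%n. u (r n) y) \<leadsto> 0" by blast
 have "AE y\<in>K in lborel. (ALL j. (%n. g j (r n) y) \<leadsto> f j y)"
  using r(2)
 proof eventually_elim
  case (elim y)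
  show ?case
  proof (intro impI allI)
   fix j assume y: "y \<in> K"
   have "(%n. (g j (r n) y - f j y)^2) \<leadsto> 0"
   proof (rule tendsto_sandwich[OF _ _ tendsto_const elim])
    have "(g j (r n) y - f j y)^2 <= u (r n) y" for n
     unfolding u_def using y member_le_sum[of j UNIV "%j. (indicator K y * (g j (r n) y - f j y))^2"] by auto
    thus "\<forall>\<^sub>F n in sequentially. (g j (r n) y - f j y)^2 <= u (r n) y" by auto
   qed auto
   hence "(%n. sqrt ((g j (r n) y - f j y)^2)) \<leadsto> sqrt 0" by (rule tendsto_real_sqrt)
   hence "(%n. g j (r n) y - f j y) \<leadsto> 0" by (simp add: tendsto_rabs_zero_iff)
   thus "(%n. g j (r n) y) \<leadsto> f j y" by (simp add: LIM_zero_iff)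
  qed
 qed
 with r(1) show ?thesis by blast
qed

lemma dominated_mult:
 fixes Z :: plane
 assumes Z: "lint Z" "supp_in K Z"
  and c: "!!n. c n \<in> bor" "d \<in> bor" "!!n y. \<bar>c n y\<bar> <= B"
  and lim: "AE y\<in>K in lborel. (%n. c n y) \<leadsto> d y"
 shows "(%n. LI y. Z y * c n y) \<leadsto> (LI y. Z y * d y)"
proof (rule integral_dominated_convergence[where w="%y. B * \<bar>Z y\<bar>"])
 show "AE y in lborel. (%n. Z y * c n y) \<leadsto> Z y * d y"
  using lim
 proof eventually_elim
  case (elim y)
  show ?case
  proof (cases "y \<in> K")
   case True thus ?thesis using elim by (intro tendsto_intros) auto
  next
   case False thus ?thesis using Z(2) by (simp add: supp_in_def)
  qed
 qed
 show "AE y in lborel. norm (Z y * c n y) <= B * \<bar>Z y\<bar>" for n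
  using c(3) by (auto simp: abs_mult mult.commute[of B] mult_left_mono)
qed (use Z c in "auto dest: borel_measurable_integrable")

text \<open>Y c_n g_n splits into Y c_n (g_n - f), which is small in mean because the c_n are
  uniformly bounded, and Y f c_n, to which dominated convergence applies.\<close>

lemma l2_mult_lim:
 assumes Y: "sqi Y" "supp_in K Y" and g: "l2_tendsto K g f" and f: "lint (%y. Y y * f y)"
  and gm: "!!n. g n \<in> bor"
  and c: "!!n. c n \<in> bor" "d \<in> bor" "!!n y. \<bar>c n y\<bar> <= B"
  and lim: "AE y\<in>K in lborel. (%n. c n y) \<leadsto> d y"
 shows "(%n. LI y. Y y * (c n y * g n y)) \<leadsto> (LI y. Y y * (d y * f y))" (is ?P1)
  and "lint (%y. Y y * (c n y * g n y))" (is ?P2)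
proof -
 have Ym: "Y \<in> bor" using Y by (simp add: sqi_def)
 have aY: "sqi (%y. \<bar>Y y\<bar>)" "supp_in K (%y. \<bar>Y y\<bar>)" using Y by (auto simp: sqi_def supp_in_def)
 have l: "l2_tendsto K (%n y. \<bar>g n y - f y\<bar>) (%y. 0)"
 proof -
  have "sqi (%y. indicator K y * (\<bar>g n y - f y\<bar> - 0))" for n
  proof -
   have "sqi (%y. \<bar>indicator K y * (g n y - f y)\<bar>)" using g by (auto simp: l2_tendsto_def sqi_def intro!: borel_measurable_abs)
   thus ?thesis by (simp add: abs_mult)
  qed
  thus ?thesis using g by (simp add: l2_tendsto_def)
 qed
 have i0: "lint (%y. \<bar>Y y\<bar> * 0)" by simp
 note L = l2_tendsto_lim'[OF l aY i0]
 note Ld = l2_tendsto_lim[OF g Y]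
 have i1: "lint (%y. \<bar>Y y\<bar> * \<bar>g n y - f y\<bar>)" for n using L(2)[of n] by simp
 have B: "B >= 0" using c(3)[of 0 0] by linarith
 have i2: "lint (%y. c n y * (Y y * (g n y - f y)))" for n
  by (rule integrable_bounded_mult[OF c(1,3) Ld(2)])
 have i3: "lint (%y. c n y * (Y y * f y))" for n
  by (rule integrable_bounded_mult[OF c(1,3) f])
 have e: "(%y. Y y * (c n y * g n y)) = (%y. c n y * (Y y * (g n y - f y)) + c n y * (Y y * f y))" for n
  by (simp add: fun_eq_iff algebra_simps)
 show ?P2
  unfolding e by (rule Bochner_Integration.integrable_add[OF i2 i3])
 have A: "(%n. LI y. c n y * (Y y * (g n y - f y))) \<leadsto> 0"
 proof (rule tendsto_norm_zero_cancel, rule tendsto_sandwich[OF _ _ tendsto_const])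
  show "(%n. B * (LI y. \<bar>Y y\<bar> * \<bar>g n y - f y\<bar>)) \<leadsto> 0"
  proof -
   have "(%n. LI y. \<bar>Y y\<bar> * \<bar>g n y - f y\<bar>) \<leadsto> 0" using L(1) by simp
   thus ?thesis by (rule tendsto_mult_right_zero)
  qed
  have "norm (LI y. c n y * (Y y * (g n y - f y))) <= (LI y. B * (\<bar>Y y\<bar> * \<bar>g n y - f y\<bar>))" for n
   by (rule norm_integral_le[OF i2]) (use i1 c(3) in "auto simp: abs_mult intro!: mult_right_mono")
  thus "\<forall>\<^sub>F n in sequentially. norm (LI y. c n y * (Y y * (g n y - f y))) <= B * (LI y. \<bar>Y y\<bar> * \<bar>g n y - f y\<bar>)"
   by simp
 qed simp
 have Yf: "supp_in K (%y. Y y * f y)" using Y(2) by (rule supp_in_mult)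
 have "(%n. (LI y. c n y * (Y y * (g n y - f y))) + (LI y. Y y * f y * c n y)) \<leadsto> 0 + (LI y. Y y * f y * d y)"
  by (rule tendsto_add[OF A dominated_mult[OF f Yf c lim]])
 moreover have "(LI y. Y y * (c n y * g n y)) = (LI y. c n y * (Y y * (g n y - f y))) + (LI y. Y y * f y * c n y)" for n
  unfolding e using i2 i3 by (simp add: mult_ac)
 ultimately show ?P1
  by (simp add: mult_ac)
qed

lemma kap_measurable:
 fixes \<phi> :: "'n::finite => real^2 => real"
 assumes [measurable]: "!!j. \<phi> j \<in> bor"
 shows "(%y. kap k (%j. \<phi> j y)) \<in> bor" (is ?P1) "(%y. kapM k (%j. \<phi> j y) i j) \<in> bor" (is ?P2)
proof -
 show m[measurable]: ?P1 unfolding kap_def by measurable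
 show ?P2 unfolding kapM_def by (cases "i = j") simp_all
qed

text \<open>\<open>stokes_C1\<close> demands a C1 factor, so it is applied to the truncation of a
  mollified \<phi>, and the mollification is removed for fixed k. The derivatives converge only in
  mean square and are multiplied by the Jacobian, which converges almost everywhere along a
  subsequence and is bounded.\<close>

lemma stokes_trunc:
 fixes \<phi> \<phi>1 \<phi>2 :: "'n::finite => real^2 => real" and i :: 'n
 assumes \<phi>: "!!j. wd2 G (\<phi> j) (\<phi>1 j) (\<phi>2 j)" and h: "wd2 G h h1 h2" and g: "wd2 G g g1 g2" and "open G"
  and gB: "!!y. y \<in> K ==> \<bar>g y\<bar> <= B"
  and z: "C1 z z1 z2" "compact K" "K \<subseteq> G" "supp_in K z" and k: "k > 0"
 defines "\<kappa> \<equiv> %y. kap k (%j. \<phi> j y)" and "M \<equiv> %j y. kapM k (%j. \<phi> j y) i j"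
 shows "(LI y. z2 y * g y * h1 y * (\<kappa> y * \<phi> i y)) + (\<Sum>j\<in>UNIV. LI y. z y * g y * h1 y * (M j y * \<phi>2 j y))
   + (LI y. z y * g2 y * h1 y * (\<kappa> y * \<phi> i y)) =
  (LI y. z1 y * g y * h2 y * (\<kappa> y * \<phi> i y)) + (\<Sum>j\<in>UNIV. LI y. z y * g y * h2 y * (M j y * \<phi>1 j y))
   + (LI y. z y * g1 y * h2 y * (\<kappa> y * \<phi> i y))"
proof -
 have "ALL j. EX gn d1 d2. (\<forall>n::nat. C1 (gn n) (d1 n) (d2 n)) & l2_tendsto K gn (\<phi> j) & l2_tendsto K d1 (\<phi>1 j) & l2_tendsto K d2 (\<phi>2 j)"
  using wd2_approx[OF \<phi> assms(4) z(2,3)] by blast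
 then obtain P P1 P2 where P: "!!j n. C1 (P j n) (P1 j n) (P2 j n)" "!!j. l2_tendsto K (P j) (\<phi> j)"
  "!!j. l2_tendsto K (P1 j) (\<phi>1 j)" "!!j. l2_tendsto K (P2 j) (\<phi>2 j)" by metis
 obtain r where r: "strict_mono r" "AE y\<in>K in lborel. (ALL j. (%n. P j (r n) y) \<leadsto> \<phi> j y)"
  using l2_tendsto_AE[of K P \<phi>] P(2) by blast
 note zs = C1_supp_deriv[OF z(1,2,4)]
 have zc: "cont z" "cont z1" "cont z2"
  using z(1) C1_continuous[OF z(1)] by (auto simp: C1_def)
 have lg: "loc2 G g" "loc2 G g1" "loc2 G g2" using g by (auto simp: wd2_def)
 have lh: "loc2 G h1" "loc2 G h2" using h by (auto simp: wd2_def)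
 have l\<phi>: "loc2 G (\<phi> j)" "loc2 G (\<phi>1 j)" "loc2 G (\<phi>2 j)" for j using \<phi>[of j] by (auto simp: wd2_def)
 have \<phi>m: "\<phi> j \<in> bor" for j using l\<phi>(1)[of j] by (simp add: loc2_def)
 have Pm: "P j n \<in> bor" "P1 j n \<in> bor" "P2 j n \<in> bor" for j n
  using C1_continuous[OF P(1)[of j n], of UNIV] P(1)[of j n] by (auto simp: C1_def intro: borel_measurable_continuous_onI)
 have sqc: "sqi (%y. c y * l y)" if t: "cont c" "supp_in K c" "loc2 G l" for c l
 proof -
  obtain C where "!!y. \<bar>c y\<bar> <= C" using bounded_compact_supp[OF t(1) z(2) t(2)] by metis
  thus ?thesis
   by (intro sqi_mult_loc2[OF t(3) borel_measurable_continuous_onI[OF t(1)] t(2) _ z(2,3)])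
 qed
 have int: "lint (%y. c y * l y * m y)" if t: "cont c" "supp_in K c" "loc2 G l" "loc2 G m" for c l m
  by (rule sqi_loc2_integrable[OF sqc[OF t(1-3)] supp_in_mult[OF t(2)] t(4) z(2,3)])
 have sqY: "sqi (%y. z y * g y * l y)" if "loc2 G l" for l
 proof -
  obtain C where C: "C >= 0" "!!y. \<bar>z y\<bar> <= C" using bounded_compact_supp[OF zc(1) z(2,4)] by metis
  have "\<bar>z y * g y\<bar> <= C * \<bar>B\<bar>" for y
  proof (cases "y \<in> K")
   case True
   hence "\<bar>g y\<bar> <= \<bar>B\<bar>" using gB[OF True] by linarith
   thus ?thesis unfolding abs_mult using C by (intro mult_mono) auto
  next
   case False
   thus ?thesis using z(4) C by (auto simp: supp_in_def)
  qed
  moreover have "(%y. z y * g y) \<in> bor"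
   using lg(1) borel_measurable_continuous_onI[OF zc(1)] by (auto simp: loc2_def)
  ultimately show ?thesis by (intro sqi_mult_loc2[OF that _ supp_in_mult[OF z(4)] _ z(2,3)])
 qed
 define F where "F n y = kap k (%j. P j (r n) y) * P i (r n) y" for n y
 define Mn where "Mn n j y = kapM k (%j. P j (r n) y) i j" for n j y
 have F: "C1 (F n) (%y. \<Sum>j\<in>UNIV. Mn n j y * P1 j (r n) y) (%y. \<Sum>j\<in>UNIV. Mn n j y * P2 j (r n) y)" for n
  unfolding F_def Mn_def by (rule kap_C1[OF k P(1)])
 have Fm: "F n \<in> bor" for n by (rule borel_measurable_continuous_onI[OF C1_continuous[OF F]])
 have FB: "\<bar>F n y\<bar> <= 1 + k" for n y unfolding F_def using kap_bounds(3)[OF k, of "%j. P j (r n) y"] by simp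
 have MB: "\<bar>Mn n j y\<bar> <= 3" for n j y unfolding Mn_def by (rule kap_bounds(4)[OF k])
 have Mnm: "Mn n j \<in> bor" for n j unfolding Mn_def by (rule kap_measurable(2)[OF Pm(1)])
 have \<kappa>m: "(%y. \<kappa> y * \<phi> i y) \<in> bor" unfolding \<kappa>_def by (intro borel_measurable_times kap_measurable(1) \<phi>m)
 have Mm: "M j \<in> bor" for j unfolding M_def by (rule kap_measurable(2)[OF \<phi>m])
 have limF: "AE y\<in>K in lborel. (%n. F n y) \<leadsto> \<kappa> y * \<phi> i y"
  using r(2)
 proof eventually_elim
  case (elim y)
  thus ?case unfolding F_def \<kappa>_def
   by (auto intro!: tendsto_mult kap_tendsto(1)[OF k, where f="%n j. P j (r n) y"])
 qed
 have limM: "AE y\<in>K in lborel. (%n. Mn n j y) \<leadsto> M j y" for j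
  using r(2)
 proof eventually_elim
  case (elim y)
  thus ?case unfolding Mn_def M_def
   by (auto intro!: kap_tendsto(2)[OF k, where f="%n j. P j (r n) y"])
 qed
 have main: "(%n. LI y. (zz y * F n y * g y + z y * (\<Sum>j\<in>UNIV. Mn n j y * Q j (r n) y) * g y + z y * F n y * gg y) * l y)
   \<leadsto> (LI y. zz y * g y * l y * (\<kappa> y * \<phi> i y)) + (\<Sum>j\<in>UNIV. LI y. z y * g y * l y * (M j y * q j y))
   + (LI y. z y * gg y * l y * (\<kappa> y * \<phi> i y))"
  if zz: "cont zz" "supp_in K zz" and gg: "loc2 G gg" and l: "loc2 G l"
   and Q: "!!j. l2_tendsto K (Q j) (q j)" "!!j n. Q j n \<in> bor" "!!j. loc2 G (q j)" for zz gg l Q q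
 proof -
  note i1 = int[OF zz lg(1) l] and i3 = int[OF zc(1) z(4) gg l]
  have s1: "supp_in K (%y. zz y * g y * l y)" "supp_in K (%y. z y * gg y * l y)" "supp_in K (%y. z y * g y * l y)"
   using zz(2) z(4) by (auto simp: supp_in_def)
  have Fi: "lint (%y. Z y * F n y)" if "lint Z" for Z n
   using integrable_bounded_mult[OF Fm FB that, of n] by (simp add: mult.commute)
  note L1 = dominated_mult[OF i1 s1(1) Fm \<kappa>m FB limF]
  note L3 = dominated_mult[OF i3 s1(2) Fm \<kappa>m FB limF]
  note L2 = l2_mult_lim[OF sqY[OF l] s1(3) l2_tendsto_subseq[OF Q(1) r(1)] sqi_loc2_integrable[OF sqY[OF l] s1(3) Q(3) z(2,3)] Q(2) Mnm Mm MB limM]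
  have "(LI y. (zz y * F n y * g y + z y * (\<Sum>j\<in>UNIV. Mn n j y * Q j (r n) y) * g y + z y * F n y * gg y) * l y)
   = (LI y. zz y * g y * l y * F n y) + (\<Sum>j\<in>UNIV. LI y. z y * g y * l y * (Mn n j y * Q j (r n) y))
   + (LI y. z y * gg y * l y * F n y)" for n
  proof -
   have "(%y. (zz y * F n y * g y + z y * (\<Sum>j\<in>UNIV. Mn n j y * Q j (r n) y) * g y + z y * F n y * gg y) * l y) =
    (%y. zz y * g y * l y * F n y + (\<Sum>j\<in>UNIV. z y * g y * l y * (Mn n j y * Q j (r n) y)) + z y * gg y * l y * F n y)"
    by (simp add: fun_eq_iff algebra_simps sum_distrib_left sum_distrib_right)
   thus ?thesis
    by (simp add: Fi[OF i1] Fi[OF i3] L2(2))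
  qed
  moreover have "(%n. (LI y. zz y * g y * l y * F n y) + (\<Sum>j\<in>UNIV. LI y. z y * g y * l y * (Mn n j y * Q j (r n) y))
   + (LI y. z y * gg y * l y * F n y)) \<leadsto> (LI y. zz y * g y * l y * (\<kappa> y * \<phi> i y))
   + (\<Sum>j\<in>UNIV. LI y. z y * g y * l y * (M j y * q j y)) + (LI y. z y * gg y * l y * (\<kappa> y * \<phi> i y))"
   by (intro tendsto_add tendsto_sum L1 L2(1) L3)
  ultimately show ?thesis by simp
 qed
 note A = main[OF zc(3) zs(2) lg(3) lh(1) P(4) Pm(3) l\<phi>(3)]
 note B = main[OF zc(2) zs(1) lg(2) lh(2) P(3) Pm(2) l\<phi>(2)]
 show ?thesis
  by (rule LIMSEQ_unique[OF A]) (use B stokes_C1[OF h g assms(4) z F] in simp)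
qed

section \<open>Stokes' theorem in a chart\<close>

definition sgn3 :: "3 => real" where "sgn3 a = (if a = 3 then - 1 else 1)"

lemma lor_sum: "lor X Y = (\<Sum>a\<in>UNIV. sgn3 a * X$a * Y$a)"
 by (simp add: lor_def sum_3 sgn3_def)

text \<open>Indexing by pairs of row and column lets the nine entries of a matrix be truncated
  together as one vector.\<close>

lemma lor_mult_sum: "lor (A *v X) Y = (\<Sum>p\<in>UNIV. sgn3 (fst p) * A $ fst p $ snd p * X $ snd p * Y $ fst p)"
proof -
 have "lor (A *v X) Y = (\<Sum>a\<in>UNIV. \<Sum>b\<in>UNIV. sgn3 a * A$a$b * X$b * Y$a)"
  by (simp add: lor_sum matrix_vector_mult_def sum_distrib_left sum_distrib_right mult_ac)
 thus ?thesis by (simp add: sum.cartesian_product case_prod_unfold)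
qed

text \<open>Stokes' theorem for the one-form \<open>(\<psi> U, dU)\<^sup>\<sharp>\<close>.  The function \<open>\<psi>\<close> is only square integrable, so it is truncated; the
 truncated terms without derivatives of \<open>\<psi>\<close> vanish because \<open>\<psi>(dU, dU) = 0\<close>.\<close>

lemma local_stokes:
 fixes U U1 U2 :: "real^2 => real^3" and \<psi> \<psi>1 \<psi>2 :: "real^2 => real^3^3"
 assumes U: "!!a. wd2 G (%y. U y $ a) (%y. U1 y $ a) (%y. U2 y $ a)"
  and \<psi>: "!!a b. wd2 G (%y. \<psi> y $ a $ b) (%y. \<psi>1 y $ a $ b) (%y. \<psi>2 y $ a $ b)"
  and "open G" and UB: "!!y a. y \<in> K ==> \<bar>U y $ a\<bar> <= B"
  and z: "C1 z z1 z2" "compact K" "K \<subseteq> G" "supp_in K z"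
  and sym: "AE y\<in>K in lborel. lor (\<psi> y *v U2 y) (U1 y) = lor (\<psi> y *v U1 y) (U2 y)"
 shows "(LI y. z y * (lor (\<psi>1 y *v U y) (U2 y) - lor (\<psi>2 y *v U y) (U1 y))) =
   (LI y. z2 y * lor (\<psi> y *v U y) (U1 y) - z1 y * lor (\<psi> y *v U y) (U2 y))" (is ?E)
  and "lint (%y. z y * (lor (\<psi>1 y *v U y) (U2 y) - lor (\<psi>2 y *v U y) (U1 y)))" (is ?I1)
  and "lint (%y. z2 y * lor (\<psi> y *v U y) (U1 y) - z1 y * lor (\<psi> y *v U y) (U2 y))" (is ?I2)
proof -
 define \<phi> \<phi>1 \<phi>2 where "\<phi> p y = \<psi> y $ fst p $ snd p" and "\<phi>1 p y = \<psi>1 y $ fst p $ snd p" and "\<phi>2 p y = \<psi>2 y $ fst p $ snd p"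
  for p :: "3 \<times> 3" and y
 have w\<phi>: "wd2 G (\<phi> p) (\<phi>1 p) (\<phi>2 p)" for p unfolding \<phi>_def \<phi>1_def \<phi>2_def by (rule \<psi>)
 have l\<phi>: "loc2 G (\<phi> p)" "loc2 G (\<phi>1 p)" "loc2 G (\<phi>2 p)" for p using w\<phi>[of p] by (auto simp: wd2_def)
 have lU: "loc2 G (%y. U y $ a)" "loc2 G (%y. U1 y $ a)" "loc2 G (%y. U2 y $ a)" for a using U[of a] by (auto simp: wd2_def)
 note zs = C1_supp_deriv[OF z(1,2,4)]
 have zc: "cont z" "cont z1" "cont z2"
  using z(1) C1_continuous[OF z(1)] by (auto simp: C1_def)
 have sqY: "sqi (%y. c y * U y $ a * l y)" if t: "cont c" "supp_in K c" "loc2 G l" for c l a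
 proof -
  obtain C where C: "C >= 0" "!!y. \<bar>c y\<bar> <= C" using bounded_compact_supp[OF t(1) z(2) t(2)] by metis
  have "\<bar>c y * U y $ a\<bar> <= C * \<bar>B\<bar>" for y
  proof (cases "y \<in> K")
   case True
   hence "\<bar>U y $ a\<bar> <= \<bar>B\<bar>" using UB[OF True, of a] by linarith
   thus ?thesis unfolding abs_mult using C by (intro mult_mono) auto
  next
   case False
   thus ?thesis using t(2) C by (auto simp: supp_in_def)
  qed
  moreover have "(%y. c y * U y $ a) \<in> bor"
  proof (intro borel_measurable_times borel_measurable_continuous_onI[OF t(1)])
   show "(%y. U y $ a) \<in> bor" using lU(1)[of a] by (simp add: loc2_def)
  qed
  ultimately show ?thesis by (intro sqi_mult_loc2[OF t(3) _ supp_in_mult[OF t(2)] _ z(2,3)])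
 qed
 have int: "lint (%y. c y * U y $ a * l y * m y)"
  if t: "cont c" "supp_in K c" "loc2 G l" "loc2 G m" for c l a m
  by (rule sqi_loc2_integrable[OF sqY[OF t(1-3)] _ t(4) z(2,3)]) (use t(2) in "auto simp: supp_in_def")
 define k where "k m = real (Suc m)" for m
 have k: "k m > 0" for m by (simp add: k_def)
 define \<kappa> where "\<kappa> m y = kap (k m) (%p. \<phi> p y)" for m y
 define M where "M m p j y = kapM (k m) (%p. \<phi> p y) p j" for m p j y
 have \<phi>m: "\<phi> p \<in> bor" for p using l\<phi>(1)[of p] by (simp add: loc2_def)
 have \<kappa>m: "\<kappa> m \<in> bor" for m unfolding \<kappa>_def by (rule kap_measurable(1)[OF \<phi>m])
 have Mm: "M m p j \<in> bor" for m p j unfolding M_def by (rule kap_measurable(2)[OF \<phi>m])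
 have \<kappa>B: "\<bar>\<kappa> m y\<bar> <= 1" for m y using kap_bounds(1,2)[OF k[of m], of "%p. \<phi> p y"] by (simp add: \<kappa>_def)
 have MB: "\<bar>M m p j y\<bar> <= 3" for m p j y unfolding M_def by (rule kap_bounds(4)[OF k])
 have \<kappa>lim: "AE y\<in>K in lborel. (%m. \<kappa> m y) \<leadsto> 1"
  unfolding \<kappa>_def k_def using kap_tendsto_1(1) by (intro AE_I2 impI)
 have Mlim: "AE y\<in>K in lborel. (%m. M m p j y) \<leadsto> (if p = j then 1 else 0)" for p j
  unfolding M_def k_def using kap_tendsto_1(2) by (intro AE_I2 impI)
 \<comment> \<open>For the matrix entry p and truncation index m: \<open>A\<close> holds a
   derivative of the cutoff, \<open>D\<close> a derivative of \<psi>, and \<open>R\<close> two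
   derivatives of U, which is integrable only because \<psi> is truncated.\<close>
 define A where "A c l m p = (LI y. c y * U y $ snd p * l y $ fst p * (\<kappa> m y * \<phi> p y))"
  for c and l :: "real^2 => real^3" and m p
 define D where "D l q m p = (\<Sum>j\<in>UNIV. LI y. z y * U y $ snd p * l y $ fst p * (M m p j y * q j y))"
  for l :: "real^2 => real^3" and q :: "3 \<times> 3 => real^2 => real" and m p
 define R where "R l l' m p = (LI y. z y * l y $ snd p * l' y $ fst p * (\<kappa> m y * \<phi> p y))"
  for l l' :: "real^2 => real^3" and m p
 have tr: "A z2 U1 m p + D U1 \<phi>2 m p + R U2 U1 m p = A z1 U2 m p + D U2 \<phi>1 m p + R U1 U2 m p" for m p
  unfolding A_def D_def R_def \<kappa>_def M_def
  by (rule stokes_trunc[where B=B, OF w\<phi> U[of "fst p"] U[of "snd p"] assms(3) UB z k])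
 have kb: "\<bar>\<kappa> m y * \<phi> p y\<bar> <= 1 + k m" for m y p
  unfolding \<kappa>_def using kap_bounds(3)[OF k[of m], of "%p. \<phi> p y"] .
 have k\<phi>m: "(%y. \<kappa> m y * \<phi> p y) \<in> bor" for m p by (intro borel_measurable_times \<kappa>m \<phi>m)
 \<comment> \<open>The truncation factor is common to all entries, so the summed integrand is z *
   \<kappa> times the difference that \<open>sym\<close> declares to be 0.\<close>
 have "(\<Sum>p\<in>UNIV. sgn3 (fst p) * (R U2 U1 m p - R U1 U2 m p)) = 0" for m
 proof -
  have i: "lint (%y. z y * l y $ snd p * l' y $ fst p * (\<kappa> m y * \<phi> p y))"
   if "!!a. loc2 G (%y. l y $ a)" "!!a. loc2 G (%y. l' y $ a)" for l l' :: "real^2 => real^3" and p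
  proof -
   obtain C where C: "!!y. \<bar>z y\<bar> <= C" using bounded_compact_supp[OF zc(1) z(2,4)] by metis
   have "sqi (%y. z y * l y $ snd p)"
    by (rule sqi_mult_loc2[OF that(1) borel_measurable_continuous_onI[OF zc(1)] z(4) C z(2,3)])
   hence "lint (%y. z y * l y $ snd p * l' y $ fst p)"
    by (rule sqi_loc2_integrable[OF _ supp_in_mult[OF z(4)] that(2) z(2,3)])
   hence "lint (%y. (\<kappa> m y * \<phi> p y) * (z y * l y $ snd p * l' y $ fst p))"
    by (rule integrable_bounded_mult[OF k\<phi>m kb])
   thus ?thesis by (simp add: mult_ac)
  qed
  let ?S = "%y. \<Sum>p\<in>UNIV. sgn3 (fst p) *
   (z y * U2 y $ snd p * U1 y $ fst p * (\<kappa> m y * \<phi> p y) - z y * U1 y $ snd p * U2 y $ fst p * (\<kappa> m y * \<phi> p y))"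
  have "(\<Sum>p\<in>UNIV. sgn3 (fst p) * (R U2 U1 m p - R U1 U2 m p)) = (LI y. ?S y)"
   unfolding R_def
   by (subst Bochner_Integration.integral_sum) (auto intro!: i lU Bochner_Integration.integrable_diff sum.cong simp: Bochner_Integration.integral_diff[OF i i] lU)
  also have "... = integral\<^sup>L lborel (%y::real^2. 0)"
  proof (rule integral_cong_AE)
   have zm: "z \<in> bor" by (rule borel_measurable_continuous_onI[OF zc(1)])
   have Um: "(%y. U1 y $ a) \<in> bor" "(%y. U2 y $ a) \<in> bor" for a
    using lU(2,3)[of a] by (auto simp: loc2_def)
   show "?S \<in> borel_measurable lborel"
    unfolding measurable_lborel2 by (intro borel_measurable_sum borel_measurable_times borel_measurable_diff borel_measurable_const zm Um \<kappa>m \<phi>m)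
   show "AE y in lborel. ?S y = 0"
    using sym
   proof eventually_elim
    case (elim y)
    have "?S y = z y * \<kappa> m y * (lor (\<psi> y *v U2 y) (U1 y) - lor (\<psi> y *v U1 y) (U2 y))"
     unfolding lor_mult_sum sum_subtractf[symmetric] sum_distrib_left
     by (rule sum.cong) (simp_all add: \<phi>_def algebra_simps)
    thus ?case using elim z(4) by (cases "y \<in> K") (auto simp: supp_in_def)
   qed
  qed simp
  finally show ?thesis by simp
 qed
 moreover have "R U2 U1 m p - R U1 U2 m p = A z1 U2 m p + D U2 \<phi>1 m p - A z2 U1 m p - D U1 \<phi>2 m p" for m p
  using tr[of m p] by linarith
 ultimately have E0: "(\<Sum>p\<in>UNIV. sgn3 (fst p) * (A z1 U2 m p + D U2 \<phi>1 m p - A z2 U1 m p - D U1 \<phi>2 m p)) = 0" for m by simp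
 define A' where "A' c l p = (LI y. c y * U y $ snd p * l y $ fst p * \<phi> p y)" for c and l :: "real^2 => real^3" and p
 define D' where "D' l q p = (LI y. z y * U y $ snd p * l y $ fst p * q p y)"
  for l :: "real^2 => real^3" and q :: "3 \<times> 3 => real^2 => real" and p
 have limA: "(%m. A c l m p) \<leadsto> A' c l p"
  if t: "cont c" "supp_in K c" "!!a. loc2 G (%y. l y $ a)" for c and l :: "real^2 => real^3" and p
 proof -
  have s: "supp_in K (%y. c y * U y $ snd p * l y $ fst p * \<phi> p y)" using t(2) by (auto simp: supp_in_def)
  from dominated_mult[OF int[OF t(1,2) t(3) l\<phi>(1)] s \<kappa>m borel_measurable_const \<kappa>B \<kappa>lim]
  show ?thesis unfolding A_def A'_def by (simp add: mult_ac)
 qed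
 have limD: "(%m. D l q m p) \<leadsto> D' l q p"
  if t: "!!a. loc2 G (%y. l y $ a)" "!!j. loc2 G (q j)" for l :: "real^2 => real^3" and q p
 proof -
  have s: "supp_in K (%y. z y * U y $ snd p * l y $ fst p * q j y)" for j using z(4) by (auto simp: supp_in_def)
  have "(%m. D l q m p) \<leadsto> (\<Sum>j\<in>UNIV. LI y. z y * U y $ snd p * l y $ fst p * q j y * (if p = j then 1 else 0))"
   unfolding D_def
  proof (rule tendsto_sum)
   fix j
   have i: "lint (%y. z y * U y $ snd p * l y $ fst p * q j y)" by (rule int[OF zc(1) z(4) t(1) t(2)])
   have "(%m. LI y. z y * U y $ snd p * l y $ fst p * q j y * M m p j y) \<leadsto>
    (LI y. z y * U y $ snd p * l y $ fst p * q j y * (if p = j then 1 else 0))"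
    by (rule dominated_mult[OF i s Mm borel_measurable_const MB Mlim])
   thus "(%m. LI y. z y * U y $ snd p * l y $ fst p * (M m p j y * q j y)) \<leadsto>
    (LI y. z y * U y $ snd p * l y $ fst p * q j y * (if p = j then 1 else 0))"
    by (simp only: mult_ac)
  qed
  also have "(\<Sum>j\<in>UNIV. LI y. z y * U y $ snd p * l y $ fst p * q j y * (if p = j then 1 else 0)) =
    (\<Sum>j\<in>UNIV. if p = j then D' l q p else 0)"
   by (rule sum.cong) (auto simp: D'_def)
  also have "... = D' l q p" by simp
  finally show ?thesis .
 qed
 have "(%m. \<Sum>p\<in>UNIV. sgn3 (fst p) * (A z1 U2 m p + D U2 \<phi>1 m p - A z2 U1 m p - D U1 \<phi>2 m p)) \<leadsto>
   (\<Sum>p\<in>UNIV. sgn3 (fst p) * (A' z1 U2 p + D' U2 \<phi>1 p - A' z2 U1 p - D' U1 \<phi>2 p))"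
  by (intro tendsto_sum tendsto_mult tendsto_const tendsto_add tendsto_diff limA limD zc zs lU l\<phi>)
 hence E: "(\<Sum>p\<in>UNIV. sgn3 (fst p) * (A' z1 U2 p + D' U2 \<phi>1 p - A' z2 U1 p - D' U1 \<phi>2 p)) = 0"
  unfolding E0 by (simp add: LIMSEQ_const_iff)
 have e1: "z y * (lor (\<psi>1 y *v U y) (U2 y) - lor (\<psi>2 y *v U y) (U1 y)) =
   (\<Sum>p\<in>UNIV. sgn3 (fst p) * (z y * U y $ snd p * U2 y $ fst p * \<phi>1 p y - z y * U y $ snd p * U1 y $ fst p * \<phi>2 p y))" for y
  unfolding lor_mult_sum sum_subtractf[symmetric] sum_distrib_left
  by (rule sum.cong) (simp_all add: \<phi>1_def \<phi>2_def algebra_simps)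
 have e2: "z2 y * lor (\<psi> y *v U y) (U1 y) - z1 y * lor (\<psi> y *v U y) (U2 y) =
   (\<Sum>p\<in>UNIV. sgn3 (fst p) * (z2 y * U y $ snd p * U1 y $ fst p * \<phi> p y - z1 y * U y $ snd p * U2 y $ fst p * \<phi> p y))" for y
  unfolding lor_mult_sum sum_subtractf[symmetric] sum_distrib_left
  by (rule sum.cong) (simp_all add: \<phi>_def algebra_simps)
 note i1 = int[OF zc(1) z(4) lU(3) l\<phi>(2)] int[OF zc(1) z(4) lU(2) l\<phi>(3)]
  int[OF zc(3) zs(2) lU(2) l\<phi>(1)] int[OF zc(2) zs(1) lU(3) l\<phi>(1)]
 show ?I1 unfolding e1 by (intro Bochner_Integration.integrable_sum integrable_mult_right Bochner_Integration.integrable_diff i1)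
 show ?I2 unfolding e2 by (intro Bochner_Integration.integrable_sum integrable_mult_right Bochner_Integration.integrable_diff i1)
 have "(LI y. z y * (lor (\<psi>1 y *v U y) (U2 y) - lor (\<psi>2 y *v U y) (U1 y))) =
   (\<Sum>p\<in>UNIV. sgn3 (fst p) * (D' U2 \<phi>1 p - D' U1 \<phi>2 p))"
  unfolding e1 D'_def by (subst Bochner_Integration.integral_sum) (simp_all add: i1)
 moreover have "(LI y. z2 y * lor (\<psi> y *v U y) (U1 y) - z1 y * lor (\<psi> y *v U y) (U2 y)) =
   (\<Sum>p\<in>UNIV. sgn3 (fst p) * (A' z2 U1 p - A' z1 U2 p))"
  unfolding e2 A'_def by (subst Bochner_Integration.integral_sum) (simp_all add: i1)
 moreover have "(\<Sum>p\<in>UNIV. sgn3 (fst p) * (D' U2 \<phi>1 p - D' U1 \<phi>2 p)) - (\<Sum>p\<in>UNIV. sgn3 (fst p) * (A' z2 U1 p - A' z1 U2 p)) = 0"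
  unfolding E[symmetric] sum_subtractf[symmetric] by (rule sum.cong) (simp_all add: algebra_simps)
 ultimately show ?E by simp
qed

section \<open>Singular values of maps from the plane to a two-dimensional space\<close>

lemma matrix_inv_mult:
 fixes A :: "real^'n^'n"
 assumes "invertible A"
 shows "matrix_inv A ** A = mat 1" "A ** matrix_inv A = mat 1"
 using someI_ex[OF assms[unfolded invertible_def]] by (simp_all add: matrix_inv_def)

lemma matrix_inv_unique:
 fixes A :: "real^'n^'n"
 assumes "A ** B = mat 1" shows "matrix_inv A = B"
proof -
 have "B ** A = mat 1" using assms by (simp add: matrix_left_right_inverse)
 hence "invertible A" using assms by (auto simp: invertible_def)
 hence "matrix_inv A ** (A ** B) = B" by (simp add: matrix_mul_assoc matrix_inv_mult)
 with assms show ?thesis by simp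
qed

text \<open>The form h is symmetric and bilinear on the whole ambient space but positive definite
  only on W, where this is encoded by the orthonormal basis E. It is used for the Lorentz form on
  tangent planes and for the trace form on \<open>p_space\<close>.\<close>

locale ip_pair =
 fixes g :: "real^2 => real^2 => real" and G :: "real^2^2"
  and W :: "'v::real_vector set" and h :: "'v => 'v => real" and E :: "nat => 'v"
 assumes g_def: "g v w = v \<bullet> (G *v w)" and G_sym: "transpose G = G"
  and G_pos: "v ~= 0 ==> v \<bullet> (G *v v) > 0"
  and h_add: "h (x + y) z = h x z + h y z" and h_scale: "h (c *\<^sub>R x) z = c * h x z"
  and h_sym: "h x y = h y x"
  and E: "orthonormal_basis_on W h 2 E"
begin

declare One_nat_def [simp del]

lemma g_add: "g (x + y) z = g x z + g y z" and g_scale: "g (c *\<^sub>R x) z = c * g x z"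
 and g_add2: "g z (x + y) = g z x + g z y" and g_scale2: "g z (c *\<^sub>R x) = c * g z x"
 by (simp_all add: g_def inner_left_distrib inner_right_distrib matrix_vector_right_distrib
   matrix_vector_mult_scaleR)

lemma g_sym: "g x y = g y x"
proof -
 have "x \<bullet> (G *v y) = (transpose G *v x) \<bullet> y" by (simp add: dot_lmul_matrix[symmetric] transpose_matrix_vector)
 thus ?thesis by (simp add: g_def G_sym inner_commute)
qed

lemma g_pos: "v ~= 0 ==> g v v > 0" by (simp add: g_def G_pos)

lemma g_zero[simp]: "g 0 x = 0" "g x 0 = 0" by (simp_all add: g_def)
lemma g_minus[simp]: "g (- x) y = - g x y" "g x (- y) = - g x y"
 using g_scale[of "-1"] g_scale2[of _ "-1"] by auto
lemma g_diff: "g (x - y) z = g x z - g y z" "g z (x - y) = g z x - g z y"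
 using g_add[of x "-y" z] g_add2[of z x "-y"] by auto

lemma h_add2: "h z (x + y) = h z x + h z y" and h_scale2: "h z (c *\<^sub>R x) = c * h z x"
 using h_add h_scale h_sym by metis+
lemma h_zero[simp]: "h 0 x = 0" "h x 0 = 0" using h_scale[of 0 0 x] h_scale2[of x 0 0] by auto
lemma h_minus[simp]: "h (- x) y = - h x y" "h x (- y) = - h x y"
 using h_scale[of "-1"] h_scale2[of _ "-1"] by auto
lemma h_diff: "h (x - y) z = h x z - h y z" "h z (x - y) = h z x - h z y"
 using h_add[of x "-y" z] h_add2[of z x "-y"] by auto

lemmas bil = g_add g_scale g_add2 g_scale2 g_diff h_add h_scale h_add2 h_scale2 h_diff

lemma EE: "h (E 0) (E 0) = 1" "h (E 1) (E 1) = 1" "h (E 0) (E 1) = 0" "h (E 1) (E 0) = 0"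
  "E 0 \<in> W" "E 1 \<in> W" "span {E 0, E 1} = W" "subspace W"
proof -
 have *: "{..<2::nat} = {0, 1}" by auto
 have "\<forall>i<2. \<forall>j<2. h (E i) (E j) = (if i = j then 1 else 0)" "\<forall>i<2. E i \<in> W" "span (E ` {..<2}) = W"
  using E by (auto simp: orthonormal_basis_on_def orthonormal_on_def)
 thus "h (E 0) (E 0) = 1" "h (E 1) (E 1) = 1" "h (E 0) (E 1) = 0" "h (E 1) (E 0) = 0"
  "E 0 \<in> W" "E 1 \<in> W" "span {E 0, E 1} = W" "subspace W" by (auto simp: *)
qed

lemma W_expand:
 assumes "w \<in> W"
 shows "w = h (E 0) w *\<^sub>R E 0 + h (E 1) w *\<^sub>R E 1"
proof -
 obtain a where "w - a *\<^sub>R E 0 \<in> span {E 1}" using assms EE(7) span_breakdown_eq[of w "E 0" "{E 1}"] by auto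
 then obtain b where "w - a *\<^sub>R E 0 - b *\<^sub>R E 1 \<in> span {}" using span_breakdown_eq[of _ "E 1" "{}"] by auto
 hence "w = a *\<^sub>R E 0 + b *\<^sub>R E 1" by (simp add: algebra_simps)
 thus ?thesis by (simp add: bil EE)
qed

lemma W_comb: "a *\<^sub>R E 0 + b *\<^sub>R E 1 \<in> W"
 using EE(5,6,8) by (intro subspace_add subspace_scale)

lemma h_parseval:
 assumes "w \<in> W" shows "h w x = h (E 0) w * h (E 0) x + h (E 1) w * h (E 1) x"
 using arg_cong[OF W_expand[OF assms], of "%w. h w x"] by (simp add: bil)

lemma h_pos: "w \<in> W ==> h w w >= 0" using h_parseval[of w w] by simp

lemma h_pos_eq: "w \<in> W ==> h w w = 0 ==> w = 0"
proof -
 assume w: "w \<in> W" "h w w = 0"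
 hence "h (E 0) w = 0 & h (E 1) w = 0" using h_parseval[of w w] sum_squares_eq_zero_iff[of "h (E 0) w"] by simp
 thus "w = 0" using W_expand[OF w(1)] by simp
qed

definition ob :: "real^2 => real^2 => bool" where
 "ob b c \<longleftrightarrow> g b b = 1 & g c c = 1 & g b c = 0"

lemma ob_expand:
 assumes "ob b c"
 shows "v = g b v *\<^sub>R b + g c v *\<^sub>R c"
proof -
 have cb: "g c b = 0" using assms g_sym by (simp add: ob_def)
 have ind: "independent {b, c}" and ne: "b ~= c"
 proof -
  show "b ~= c" using assms by (auto simp: ob_def)
  show "independent {b, c}"
  proof (rule independent_if_scalars_zero)
   fix f x assume s: "(\<Sum>x\<in>{b, c}. f x *\<^sub>R x) = 0" and x: "x \<in> {b, c}"
   have "f b *\<^sub>R b + f c *\<^sub>R c = 0" using s \<open>b ~= c\<close> by simp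
   hence "g (f b *\<^sub>R b + f c *\<^sub>R c) b = 0" "g (f b *\<^sub>R b + f c *\<^sub>R c) c = 0" by auto
   thus "f x = 0" using x assms cb by (auto simp: bil ob_def)
  qed simp
 qed
 have "span {b, c} = UNIV"
  using card_eq_dim[of "{b,c}" "UNIV :: (real^2) set"] ind ne by (auto simp: dim_UNIV)
 hence "v \<in> span {b, c}" by simp
 then obtain x where "v - x *\<^sub>R b \<in> span {c}" using span_breakdown_eq[of v b "{c}"] by auto
 then obtain y where "v - x *\<^sub>R b - y *\<^sub>R c \<in> span {}" using span_breakdown_eq[of _ c "{}"] by auto
 hence "v = x *\<^sub>R b + y *\<^sub>R c" by (simp add: algebra_simps)
 thus ?thesis using assms cb by (simp add: bil ob_def)
qed

lemma ob_parseval: "ob b c ==> g v w = g b v * g b w + g c v * g c w"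
 using arg_cong[OF ob_expand[of b c v], of "%v. g v w"] by (simp add: bil)

lemma ob_exists: "EX b c. ob b c"
proof -
 let ?e = "axis 1 1 :: real^2" let ?f = "axis 2 1 :: real^2"
 define b where "b = (1 / sqrt (g ?e ?e)) *\<^sub>R ?e"
 have ne: "?e ~= 0" by (simp add: axis_eq_0_iff)
 have gb: "g b b = 1" using g_pos[OF ne] by (simp add: b_def bil)
 define f where "f = ?f - g b ?f *\<^sub>R b"
 have fz: "f ~= 0"
 proof
  assume "f = 0"
  hence "?f $ 2 = (g b ?f *\<^sub>R b) $ 2" by (simp add: f_def)
  thus False by (simp add: b_def axis_def)
 qed
 have bf: "g b f = 0" by (simp add: f_def bil gb)
 have "ob b ((1 / sqrt (g f f)) *\<^sub>R f)" using g_pos[OF fz] gb bf by (simp add: ob_def bil)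
 thus ?thesis by blast
qed

lemma ob_rotate:
 assumes "ob b c" "x^2 + y^2 = 1"
 shows "ob (x *\<^sub>R b + y *\<^sub>R c) (x *\<^sub>R c - y *\<^sub>R b)"
proof -
 have "g c b = 0" using assms g_sym by (simp add: ob_def)
 thus ?thesis using assms by (auto simp: ob_def bil power2_eq_square algebra_simps)
qed

text \<open>Exactly two terms, zero singular values included, so that B, C is always an orthonormal
  basis of W and b, c one of the plane.\<close>

definition svd2 :: "(real^2 => 'v) => real => real => 'v => 'v => real^2 => real^2 => bool" where
 "svd2 A s t B C b c \<longleftrightarrow> s >= 0 & t >= 0 & ob b c & B \<in> W & C \<in> W & h B B = 1 & h C C = 1 & h B C = 0 &
  A = (%v. (s * g b v) *\<^sub>R B + (t * g c v) *\<^sub>R C)"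

text \<open>Rotate a \<open>g\<close>-orthonormal basis through a right angle: the inner product of the images changes
 sign, so it vanishes somewhere.\<close>

lemma svd2_exists:
 assumes A: "linear A" "!!v. A v \<in> W"
 shows "EX s t B C b c. svd2 A s t B C b c"
proof -
 obtain b0 c0 where bc0: "ob b0 c0" using ob_exists by blast
 define b where "b \<theta> = cos \<theta> *\<^sub>R b0 + sin \<theta> *\<^sub>R c0" for \<theta>
 define c where "c \<theta> = cos \<theta> *\<^sub>R c0 - sin \<theta> *\<^sub>R b0" for \<theta>
 have obr: "ob (b \<theta>) (c \<theta>)" for \<theta> unfolding b_def c_def by (rule ob_rotate[OF bc0]) simp
 note Al = linear_add[OF A(1)] linear_diff[OF A(1)] linear_scale[OF A(1)]
 define F where "F \<theta> = h (A (b \<theta>)) (A (c \<theta>))" for \<theta>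
 have "F 0 = h (A b0) (A c0)" "F (pi/2) = - h (A b0) (A c0)"
  by (simp_all add: F_def b_def c_def h_sym linear_neg[OF A(1)])
 moreover have "continuous_on {0..pi/2} F"
  unfolding F_def b_def c_def Al bil by (intro continuous_intros)
 ultimately have F: "F 0 = h (A b0) (A c0)" "F (pi/2) = - h (A b0) (A c0)" "continuous_on {0..pi/2} F" by blast+
 have "(0::real) <= pi/2" by simp
 have "\<exists>\<theta>. F \<theta> = 0"
 proof (cases "h (A b0) (A c0) <= 0")
  case True
  hence "F 0 <= 0" "0 <= F (pi/2)" using F(1,2) by simp_all
  from IVT'[OF this \<open>0 <= pi/2\<close> F(3)] show ?thesis by blast
 next
  case False
  hence "F (pi/2) <= 0" "0 <= F 0" using F(1,2) by simp_all
  from IVT2'[OF this \<open>0 <= pi/2\<close> F(3)] show ?thesis by blast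
 qed
 then obtain b1 c1 where b1: "ob b1 c1" "h (A b1) (A c1) = 0" using obr unfolding F_def by blast
 \<comment> \<open>With the larger image first, the only degenerate case is A = 0: if A b = 0 then A
   c = 0 as well.\<close>
 have "EX b c. ob b c & h (A b) (A c) = 0 & h (A b) (A b) >= h (A c) (A c)"
 proof (cases "h (A b1) (A b1) >= h (A c1) (A c1)")
  case False
  hence "ob c1 b1 & h (A c1) (A b1) = 0 & h (A c1) (A c1) >= h (A b1) (A b1)"
   using b1 g_sym[of c1 b1] h_sym[of "A c1" "A b1"] by (simp add: ob_def)
  thus ?thesis by blast
 qed (use b1 in blast)
 then obtain b c where bc: "ob b c" "h (A b) (A c) = 0" "h (A b) (A b) >= h (A c) (A c)" by blast
 show ?thesis
 proof (cases "h (A b) (A b) = 0")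
  case True
  hence "A b = 0" "A c = 0" using bc(3) h_pos_eq[OF A(2)] h_pos[OF A(2), of c] by auto
  hence "A v = 0" for v
   using arg_cong[OF ob_expand[OF bc(1), of v], of A] by (simp add: Al)
  hence "svd2 A 0 0 (E 0) (E 1) b c" using bc(1) EE by (auto simp: svd2_def)
  thus ?thesis by blast
 next
  case False
  define s where "s = sqrt (h (A b) (A b))"
  have s: "s > 0" "s * s = h (A b) (A b)" using False h_pos[OF A(2)[of b]] by (auto simp: s_def)
  define B where "B = (1 / s) *\<^sub>R A b"
  have BW: "B \<in> W" unfolding B_def using A(2) EE(8) by (intro subspace_scale)
  have BB: "h B B = 1" using s False by (simp add: B_def bil field_simps)
  \<comment> \<open>B rotated through a right angle within W. The direction of A c cannot serve,
    since A c may vanish.\<close>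
  define C where "C = (- h (E 1) B) *\<^sub>R E 0 + h (E 0) B *\<^sub>R E 1"
  have CW: "C \<in> W" unfolding C_def by (rule W_comb)
  have Bs: "h (E 0) B * h (E 0) B + h (E 1) B * h (E 1) B = 1" using h_parseval[OF BW, of B] BB by simp
  have CC: "h C C = 1" using Bs by (simp add: C_def bil EE algebra_simps)
  have BC: "h B C = 0" by (simp add: C_def bil h_sym[of B])
  have ABC: "h (A c) B = 0" using bc(2) by (simp add: B_def bil h_sym)
  define t where "t = h (A c) C"
  have Ac: "A c = t *\<^sub>R C"
  proof -
   let ?x = "A c - t *\<^sub>R C"
   have xW: "?x \<in> W" using A(2) CW EE(8) by (intro subspace_diff subspace_scale)
   have x: "h ?x B = 0" "h ?x C = 0" using ABC CC BC by (simp_all add: bil t_def h_sym[of C B])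
   let ?p = "h (E 0) ?x" let ?q = "h (E 1) ?x" let ?a = "h (E 0) B" let ?b = "h (E 1) B"
   have cC: "h (E 0) C = - ?b" "h (E 1) C = ?a" by (simp_all add: C_def bil EE)
   have "?p * ?a + ?q * ?b = 0" using h_parseval[OF xW, of B] x(1) by simp
   moreover have "?p * (- ?b) + ?q * ?a = 0" using h_parseval[OF xW, of C] x(2) unfolding cC by simp
   ultimately have "?p * (?a * ?a + ?b * ?b) = 0" "?q * (?a * ?a + ?b * ?b) = 0" by algebra+
   hence "?p = 0" "?q = 0" using Bs by auto
   hence "?x = 0" using W_expand[OF xW] by simp
   thus ?thesis by simp
  qed
  have Ab: "A b = s *\<^sub>R B" using s by (simp add: B_def)
  \<comment> \<open>The coefficient t may be negative; its sign is moved into c.\<close>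
  define \<sigma> :: real where "\<sigma> = (if t >= 0 then 1 else - 1)"
  have \<sigma>: "\<sigma> * \<sigma> = 1" "\<sigma> * t = \<bar>t\<bar>" by (auto simp: \<sigma>_def)
  have "A v = (s * g b v) *\<^sub>R B + (\<bar>t\<bar> * g (\<sigma> *\<^sub>R c) v) *\<^sub>R C" for v
  proof -
   have "A v = g b v *\<^sub>R A b + g c v *\<^sub>R A c"
    using arg_cong[OF ob_expand[OF bc(1), of v], of A] by (simp add: Al)
   moreover have "\<bar>t\<bar> * g (\<sigma> *\<^sub>R c) v = t * g c v" by (auto simp: \<sigma>_def bil)
   ultimately show ?thesis unfolding Ab Ac by (simp add: mult.commute)
  qed
  moreover have "ob b (\<sigma> *\<^sub>R c)" using bc(1) \<sigma> by (auto simp: ob_def bil \<sigma>_def)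
  ultimately have "svd2 A s \<bar>t\<bar> B C b (\<sigma> *\<^sub>R c)" using s BW CW BB CC BC by (auto simp: svd2_def)
  thus ?thesis by blast
 qed
qed

definition Kmat :: "(real^2 => 'v) => real^2^2" where
 "Kmat A = (\<chi> i j. h (A (axis i 1)) (A (axis j 1)))"

text \<open>The matrix of the operator A^T A in the given coordinates. Its trace and determinant are
  the symmetric functions of the squared singular values and depend rationally on the data, which
  later gives measurability.\<close>

definition Nmat :: "(real^2 => 'v) => real^2^2" where
 "Nmat A = matrix_inv G ** Kmat A"

lemma G_inv: "invertible G"
proof -
 have "inj ((*v) G)"
 proof (rule injI)
  fix x y assume "G *v x = G *v y"
  hence "G *v (x - y) = 0" by (simp add: matrix_vector_mult_diff_distrib)
  hence "(x - y) \<bullet> (G *v (x - y)) = 0" by simp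
  thus "x = y" using G_pos[of "x - y"] by (cases "x - y = 0") auto
 qed
 thus ?thesis by (simp add: invertible_left_inverse matrix_left_invertible_injective)
qed

lemma vec2_expand: "(v::real^2) = v$1 *\<^sub>R axis 1 1 + v$2 *\<^sub>R axis 2 1"
 by (simp add: vec_eq_iff forall_2 axis_def)

lemma Kmat_inner:
 assumes "linear A" shows "v \<bullet> (Kmat A *v w) = h (A v) (A w)"
proof -
 have "A v = v$1 *\<^sub>R A ax1 + v$2 *\<^sub>R A ax2" for v
  using arg_cong[OF vec2_expand[of v], of A] by (simp add: linear_add[OF assms] linear_scale[OF assms])
 from this[of v] this[of w] show ?thesis
  by (simp add: Kmat_def bil inner_vec_def sum_2 matrix_vector_mult_def algebra_simps)
qed

lemma Nmat_g:
 assumes "linear A" shows "g v (Nmat A *v w) = h (A v) (A w)"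
proof -
 have "G ** Nmat A = Kmat A"
  unfolding Nmat_def matrix_mul_assoc matrix_inv_mult(2)[OF G_inv] by simp
 hence "g v (Nmat A *v w) = v \<bullet> (Kmat A *v w)"
  by (simp add: g_def matrix_vector_mul_assoc)
 thus ?thesis using Kmat_inner[OF assms] by simp
qed

lemma g_eqI:
 assumes "!!v. g v x = g v y" shows "x = y"
proof (rule ccontr)
 assume "x ~= y"
 hence "g (x - y) (x - y) > 0" by (intro g_pos) simp
 thus False using assms[of "x - y"] by (simp add: bil)
qed

end

lemma sum_lessThan_2: "(\<Sum>j<2. f j) = f 0 + f (1::nat)" for f :: "nat => 'a::comm_monoid_add"
proof -
 have "{..<2::nat} = {0, 1}" by auto
 thus ?thesis by simp
qed

lemma all_less_2: "(\<forall>j<2::nat. P j) \<longleftrightarrow> P 0 & P 1"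
 by (auto simp: less_2_cases_iff)

definition eig1 :: "real => real => real" where "eig1 T D = (T + sqrt (T^2 - 4 * D)) / 2"
definition eig2 :: "real => real => real" where "eig2 T D = (T - sqrt (T^2 - 4 * D)) / 2"

text \<open>Coefficients of the polynomial of degree one interpolating \<open>\<lambda>x. x powr e\<close> at the roots.\<close>

definition interp1 :: "real => real => real => real" where
 "interp1 e T D = (if eig1 T D = eig2 T D then 0
  else (eig1 T D powr e - eig2 T D powr e) / (eig1 T D - eig2 T D))"
definition interp0 :: "real => real => real => real" where
 "interp0 e T D = eig1 T D powr e - interp1 e T D * eig1 T D"

lemma interp_eq: "x = eig1 T D \<or> x = eig2 T D ==> interp0 e T D + interp1 e T D * x = x powr e"
 by (auto simp: interp0_def interp1_def field_simps)

lemma eig_root: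
 assumes "x^2 - T * x + D = 0"
 shows "x = eig1 T D \<or> x = eig2 T D"
proof -
 have "T^2 - 4 * D = (2 * x - T)^2" using assms by (simp add: power2_eq_square algebra_simps)
 hence "sqrt (T^2 - 4 * D) = \<bar>2 * x - T\<bar>" by simp
 thus ?thesis by (auto simp: eig1_def eig2_def abs_if split: if_splits)
qed

lemma eig_sum_prod:
 assumes "T = x + y" "D = x * y"
 shows "eig1 T D = max x y" "eig2 T D = min x y"
proof -
 have "T^2 - 4 * D = (x - y)^2" using assms by (simp add: power2_eq_square algebra_simps)
 hence "sqrt (T^2 - 4 * D) = \<bar>x - y\<bar>" by simp
 thus "eig1 T D = max x y" "eig2 T D = min x y"
  by (auto simp: eig1_def eig2_def assms(1) abs_if max_def min_def)
qed

lemma char_poly_2: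
 fixes N :: "real^2^2"
 assumes "N *v b = x *\<^sub>R b" "b ~= 0"
 shows "x^2 - trace N * x + det N = 0"
proof -
 have 1: "N$1$1 * b$1 + N$1$2 * b$2 = x * b$1" "N$2$1 * b$1 + N$2$2 * b$2 = x * b$2"
  using assms(1) by (simp_all add: vec_eq_iff forall_2 matrix_vector_mult_def sum_2)
 let ?p = "x^2 - (N$1$1 + N$2$2) * x + (N$1$1 * N$2$2 - N$1$2 * N$2$1)"
 have "?p * b$1 = 0" "?p * b$2 = 0" using 1 by algebra+
 moreover have "b$1 ~= 0 \<or> b$2 ~= 0" using assms(2) by (auto simp: vec_eq_iff forall_2)
 ultimately show ?thesis by (auto simp: trace_def sum_2 det_2)
qed

context ip_pair begin

lemma svd2_ops:
 assumes "svd2 A s t B C b c"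
 shows "A b = s *\<^sub>R B" "A c = t *\<^sub>R C" "linear A" "A v \<in> W"
proof -
 have a: "A = (%v. (s * g b v) *\<^sub>R B + (t * g c v) *\<^sub>R C)" "ob b c" "B \<in> W" "C \<in> W"
  using assms by (auto simp: svd2_def)
 have cb: "g c b = 0" using a(2) g_sym by (simp add: ob_def)
 show "A b = s *\<^sub>R B" "A c = t *\<^sub>R C" using a(2) cb by (simp_all add: a(1) ob_def)
 show "linear A" unfolding a(1) by (rule linearI) (simp_all add: bil algebra_simps)
 show "A v \<in> W" unfolding a(1) using a(3,4) EE(8) by (intro subspace_add subspace_scale)
qed

text \<open>Every orthonormal pair in W is a basis, by comparing coordinates with respect to
  E.\<close>

lemma onb_imp_span:
 assumes "B \<in> W" "C \<in> W" "h B B = 1" "h C C = 1" "h B C = 0"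
 shows "span {B, C} = W" "x \<in> W ==> x = h B x *\<^sub>R B + h C x *\<^sub>R C"
proof -
 have ex: "x = h B x *\<^sub>R B + h C x *\<^sub>R C" if x: "x \<in> W" for x
 proof -
  let ?y = "x - h B x *\<^sub>R B - h C x *\<^sub>R C"
  have yW: "?y \<in> W" using assms x EE(8) by (intro subspace_diff subspace_scale)
  have CB: "h C B = 0" using assms h_sym by simp
  have y: "h B ?y = 0" "h C ?y = 0" using assms CB by (simp_all add: bil)
  let ?p = "h (E 0) ?y" let ?q = "h (E 1) ?y"
  let ?a = "h (E 0) B" let ?b = "h (E 1) B" let ?c = "h (E 0) C" let ?d = "h (E 1) C"
  have 1: "?a * ?p + ?b * ?q = 0" "?c * ?p + ?d * ?q = 0" "?a * ?a + ?b * ?b = 1" "?c * ?c + ?d * ?d = 1" "?a * ?c + ?b * ?d = 0"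
   using y assms h_parseval[OF assms(1), of ?y] h_parseval[OF assms(2), of ?y] h_parseval[OF assms(1), of B]
    h_parseval[OF assms(2), of C] h_parseval[OF assms(1), of C] by simp_all
  \<comment> \<open>Lagrange's identity for the coordinate vectors of B and C.\<close>
  have "(?a * ?d - ?b * ?c)^2 = 1" using 1(3-5) by algebra
  hence ne: "?a * ?d - ?b * ?c ~= 0" by auto
  have "(?a * ?d - ?b * ?c) * ?p = 0" "(?a * ?d - ?b * ?c) * ?q = 0" using 1(1,2) by algebra+
  hence "?p = 0" "?q = 0" using ne by auto
  hence "?y = 0" using W_expand[OF yW] by simp
  thus ?thesis by (simp add: algebra_simps)
 qed
 thus "x \<in> W ==> x = h B x *\<^sub>R B + h C x *\<^sub>R C" .
 show "span {B, C} = W"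
 proof
  show "span {B, C} \<subseteq> W" by (rule span_minimal) (use assms EE(8) in auto)
  show "W \<subseteq> span {B, C}"
  proof
   fix x assume "x \<in> W"
   have "h B x *\<^sub>R B + h C x *\<^sub>R C \<in> span {B, C}" by (intro span_add span_scale span_base) auto
   thus "x \<in> span {B, C}" using ex[OF \<open>x \<in> W\<close>] by simp
  qed
 qed
qed

text \<open>Any singular value decomposition, of whatever length, gives the same value of \<open>Q(A)\<^bsup>r-1\<^esup> A\<close>.\<close>

lemma svd_power:
 assumes "singular_value_decomp g W h A n s B b"
 shows "(\<Sum>j<n. (s j powr r * g (b j) v) *\<^sub>R B j) =
  interp0 ((r - 1) / 2) (trace (Nmat A)) (det (Nmat A)) *\<^sub>R A v +
  interp1 ((r - 1) / 2) (trace (Nmat A)) (det (Nmat A)) *\<^sub>R A (Nmat A *v v)"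
proof -
 let ?N = "Nmat A" let ?e = "(r - 1) / 2"
 let ?c0 = "interp0 ?e (trace ?N) (det ?N)" let ?c1 = "interp1 ?e (trace ?N) (det ?N)"
 have a: "A = (%v. \<Sum>j<n. (s j * g (b j) v) *\<^sub>R B j)"
  and on: "!!i j. i < n ==> j < n ==> g (b i) (b j) = (if i = j then 1 else 0)"
  and oB: "!!i j. i < n ==> j < n ==> h (B i) (B j) = (if i = j then 1 else 0)"
  and s: "!!j. j < n ==> 0 <= s j"
  using assms by (auto simp: singular_value_decomp_def orthonormal_on_def)
 have lin: "linear A" unfolding a
  by (rule linearI) (simp_all add: bil algebra_simps sum.distrib scaleR_sum_right)
 have hs: "h x (\<Sum>j\<in>J. f j) = (\<Sum>j\<in>J. h x (f j))" if "finite J" for x f and J :: "nat set"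
  using that by induction (simp_all add: bil)
 have Ab: "A (b j) = s j *\<^sub>R B j" if j: "j < n" for j
 proof -
  have "A (b j) = (\<Sum>i<n. if i = j then s j *\<^sub>R B j else 0)"
   unfolding a by (rule sum.cong) (use on j in auto)
  thus ?thesis using j by simp
 qed
 have Nb: "?N *v b j = (s j)^2 *\<^sub>R b j" if j: "j < n" for j
 proof (rule g_eqI)
  fix v
  have "g v (?N *v b j) = h (A v) (A (b j))" by (rule Nmat_g[OF lin])
  also have "... = s j * h (B j) (A v)" by (simp add: Ab[OF j] bil h_sym)
  also have "h (B j) (A v) = (\<Sum>i<n. if i = j then s j * g (b j) v else 0)"
   unfolding a hs[OF finite_lessThan] by (rule sum.cong) (use oB j in "auto simp: bil")
  also have "... = s j * g (b j) v" using j by simp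
  finally show "g v (?N *v b j) = g v ((s j)^2 *\<^sub>R b j)" by (simp add: bil g_sym power2_eq_square)
 qed
 have AN: "A (?N *v v) = (\<Sum>j<n. ((s j)^2 * (s j * g (b j) v)) *\<^sub>R B j)"
 proof -
  have "g (b j) (?N *v v) = (s j)^2 * g (b j) v" if "j < n" for j
  proof -
   have "g (b j) (?N *v v) = h (A (b j)) (A v)" by (rule Nmat_g[OF lin])
   also have "... = g v (?N *v b j)" using Nmat_g[OF lin, of v "b j"] h_sym by simp
   also have "... = (s j)^2 * g (b j) v" by (simp add: Nb[OF that] bil g_sym)
   finally show ?thesis .
  qed
  thus ?thesis by (subst a, intro sum.cong) (simp_all add: mult_ac)
 qed
 \<comment> \<open>The square of s j is an eigenvalue of \<open>Nmat A\<close>, so the interpolation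
   is exact there; the exponent (r - 1) / 2 on squares is r - 1 on s j. For s j = 0 both sides are
   0, because 0 powr r = 0.\<close>
 have "s j powr r = s j * (?c0 + ?c1 * (s j)^2)" if j: "j < n" for j
 proof (cases "s j = 0")
  case False
  have "b j ~= 0" using on[OF j j] by auto
  hence "((s j)^2)^2 - trace ?N * (s j)^2 + det ?N = 0" by (rule char_poly_2[OF Nb[OF j]])
  hence "?c0 + ?c1 * (s j)^2 = ((s j)^2) powr ?e" by (intro interp_eq eig_root)
  also have "... = s j powr (r - 1)"
   using s[OF j] False by (simp add: powr_powr diff_divide_distrib flip: powr_numeral)
  finally show ?thesis using s[OF j] False by (simp add: powr_diff)
 qed simp
 hence "(\<Sum>j<n. (s j powr r * g (b j) v) *\<^sub>R B j) =
   (\<Sum>j<n. ?c0 *\<^sub>R ((s j * g (b j) v) *\<^sub>R B j) + ?c1 *\<^sub>R (((s j)^2 * (s j * g (b j) v)) *\<^sub>R B j))"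
  by (intro sum.cong) (simp_all add: algebra_simps)
 also have "... = ?c0 *\<^sub>R A v + ?c1 *\<^sub>R A (?N *v v)"
  unfolding AN sum.distrib scaleR_sum_right[symmetric] by (simp add: a)
 finally show ?thesis .
qed

lemma svd2_imp_svd:
 assumes "svd2 A s t B C b c"
 shows "singular_value_decomp g W h A 2 (%j. if j = 0 then s else t) (%j. if j = 0 then B else C) (%j. if j = 0 then b else c)"
proof -
 have "g c b = 0 & h C B = 0" using assms g_sym h_sym by (simp add: svd2_def ob_def)
 thus ?thesis using assms
  unfolding singular_value_decomp_def orthonormal_on_def all_less_2
  by (auto simp: svd2_def ob_def sum_lessThan_2)
qed

text \<open>Uniqueness behind the definite description: \<open>svd_power\<close> expresses the value
  through A and invariants of \<open>Nmat A\<close> alone.\<close>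

lemma Q_powr_map_eqI:
 assumes "singular_value_decomp g W h A n s B b"
 shows "Q_powr_map g W h r A = (%v. \<Sum>j<n. (s j powr r * g (b j) v) *\<^sub>R B j)"
 unfolding Q_powr_map_def
proof (rule the_equality)
 show "\<exists>n' s' B' b'. singular_value_decomp g W h A n' s' B' b' &
   (%v. \<Sum>j<n. (s j powr r * g (b j) v) *\<^sub>R B j) = (%v. \<Sum>j<n'. (s' j powr r * g (b' j) v) *\<^sub>R B' j)"
  using assms by blast
 fix D assume "EX n s B b. singular_value_decomp g W h A n s B b & D = (%v. \<Sum>j<n. (s j powr r * g (b j) v) *\<^sub>R B j)"
 thus "D = (%v. \<Sum>j<n. (s j powr r * g (b j) v) *\<^sub>R B j)"
  using svd_power assms by (metis (no_types, lifting))
qed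

lemma Q_powr_map_svd2:
 assumes "svd2 A s t B C b c"
 shows "Q_powr_map g W h r A = (%v. (s powr r * g b v) *\<^sub>R B + (t powr r * g c v) *\<^sub>R C)"
 using Q_powr_map_eqI[OF svd2_imp_svd[OF assms], of r] by (simp add: sum_lessThan_2)

lemma Q_powr_map_interp:
 assumes "linear A" "!!v. A v \<in> W"
 shows "Q_powr_map g W h r A = (%v. interp0 ((r - 1) / 2) (trace (Nmat A)) (det (Nmat A)) *\<^sub>R A v +
  interp1 ((r - 1) / 2) (trace (Nmat A)) (det (Nmat A)) *\<^sub>R A (Nmat A *v v))"
proof -
 obtain s t B C b c where sv: "svd2 A s t B C b c" using svd2_exists[OF assms] by blast
 show ?thesis unfolding Q_powr_map_eqI[OF svd2_imp_svd[OF sv]] using svd_power[OF svd2_imp_svd[OF sv]] by (rule ext)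
qed

lemma onb_expand:
 assumes e: "orthonormal_basis_on W h n e" and w: "w \<in> W"
 shows "w = (\<Sum>j<n. h (e j) w *\<^sub>R e j)"
proof -
 have ee: "h (e i) (e j) = (if i = j then 1 else 0)" if "i < n" "j < n" for i j
  using e that by (auto simp: orthonormal_basis_on_def orthonormal_on_def)
 have "w \<in> span (e ` {..<n})" using e w by (simp add: orthonormal_basis_on_def)
 thus ?thesis
 proof (induction rule: span_induct_alt)
  case base thus ?case by simp
 next
  case (step c x y)
  then obtain i where i: "i < n" "x = e i" by auto
  have "(\<Sum>j<n. h (e j) x *\<^sub>R e j) = (\<Sum>j<n. if j = i then e i else 0)"
   by (rule sum.cong) (use i ee in auto)
  hence x: "(\<Sum>j<n. h (e j) x *\<^sub>R e j) = x" using i by simp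
  have "(\<Sum>j<n. h (e j) (c *\<^sub>R x + y) *\<^sub>R e j) = c *\<^sub>R (\<Sum>j<n. h (e j) x *\<^sub>R e j) + (\<Sum>j<n. h (e j) y *\<^sub>R e j)"
   by (simp add: bil algebra_simps sum.distrib scaleR_sum_right)
  thus ?case unfolding x using step.IH by simp
 qed
qed

text \<open>In any other spectral decomposition, an eigenvector not orthogonal to B has the
  eigenvalue x of B, and likewise for C, so both decompositions apply the same powers.\<close>

lemma op_powr_eqI:
 assumes B: "B \<in> W" "C \<in> W" "h B B = 1" "h C C = 1" "h B C = 0" and x: "x >= 0" "y >= 0"
  and P: "!!w. w \<in> W ==> P w = (x * h B w) *\<^sub>R B + (y * h C w) *\<^sub>R C"
 shows "op_powr W h P r = (%w. (x powr r * h B w) *\<^sub>R B + (y powr r * h C w) *\<^sub>R C)"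
 unfolding op_powr_def
proof (rule the_equality)
 have CB: "h C B = 0" using B h_sym by simp
 let ?e = "%j::nat. if j = 0 then B else C" let ?l = "%j::nat. if j = 0 then x else y"
 have im: "?e ` {..<2} = {B, C}" by (auto simp: image_iff Bex_def less_2_cases_iff)
 have "orthonormal_basis_on W h 2 ?e"
  using B CB onb_imp_span(1)[OF B] unfolding orthonormal_basis_on_def orthonormal_on_def im all_less_2 by auto
 thus "EX n e l. orthonormal_basis_on W h n e & (\<forall>j<n. 0 <= l j) &
   (\<forall>w\<in>W. P w = (\<Sum>j<n. (l j * h (e j) w) *\<^sub>R e j)) &
   (%w. (x powr r * h B w) *\<^sub>R B + (y powr r * h C w) *\<^sub>R C) = (%w. \<Sum>j<n. (l j powr r * h (e j) w) *\<^sub>R e j)"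
  by (intro exI[of _ 2] exI[of _ ?e] exI[of _ ?l]) (use x P in "auto simp: sum_lessThan_2 fun_eq_iff")
 fix R assume "EX n e l. orthonormal_basis_on W h n e & (\<forall>j<n. 0 <= l j) &
   (\<forall>w\<in>W. P w = (\<Sum>j<n. (l j * h (e j) w) *\<^sub>R e j)) & R = (%w. \<Sum>j<n. (l j powr r * h (e j) w) *\<^sub>R e j)"
 then obtain n e l where e: "orthonormal_basis_on W h n e" "\<forall>j<n. 0 <= l j"
  "\<forall>w\<in>W. P w = (\<Sum>j<n. (l j * h (e j) w) *\<^sub>R e j)" "R = (%w. \<Sum>j<n. (l j powr r * h (e j) w) *\<^sub>R e j)" by blast
 have eW: "e j \<in> W" if "j < n" for j using e(1) that by (auto simp: orthonormal_basis_on_def orthonormal_on_def)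
 have ee: "h (e i) (e j) = (if i = j then 1 else 0)" if "i < n" "j < n" for i j
  using e(1) that by (auto simp: orthonormal_basis_on_def orthonormal_on_def)
 have hs: "h x (\<Sum>j\<in>J. f j) = (\<Sum>j\<in>J. h x (f j))" if "finite J" for x f and J :: "nat set"
  using that by induction (simp_all add: bil)
 have hs': "h (\<Sum>j\<in>J. f j) x = (\<Sum>j\<in>J. h (f j) x)" if "finite J" for x f and J :: "nat set"
  using hs[OF that] h_sym by simp
 note exp = onb_expand[OF e(1)]
 have Pe: "P (e j) = l j *\<^sub>R e j" if j: "j < n" for j
 proof -
  have "P (e j) = (\<Sum>i<n. (l i * h (e i) (e j)) *\<^sub>R e i)" using e(3) eW[OF j] by blast
  also have "... = (\<Sum>i<n. if i = j then l j *\<^sub>R e j else 0)"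
   by (rule sum.cong) (use ee j in auto)
  finally show ?thesis using j by simp
 qed
 have key: "l j powr r * h (e j) D = z powr r * h (e j) D" if j: "j < n" and D: "(D, z) \<in> {(B, x), (C, y)}" for j D z
 proof -
  have "P D = z *\<^sub>R D" "D \<in> W" using D B CB P by auto
  have "l j * h (e j) D = h (P (e j)) D" using Pe[OF j] by (simp add: bil)
  also have "... = z * h (e j) D" using D B CB P[OF eW[OF j]] by (auto simp: bil h_sym)
  finally have "l j = z \<or> h (e j) D = 0" by auto
  thus ?thesis by auto
 qed
 have RD: "(\<Sum>j<n. (l j powr r * h (e j) D) *\<^sub>R e j) = z powr r *\<^sub>R D" if D: "(D, z) \<in> {(B, x), (C, y)}" for D z
 proof -
  have "(\<Sum>j<n. (l j powr r * h (e j) D) *\<^sub>R e j) = (\<Sum>j<n. z powr r *\<^sub>R (h (e j) D *\<^sub>R e j))"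
   by (rule sum.cong) (use key[OF _ D] in simp_all)
  also have "... = z powr r *\<^sub>R D"
   unfolding scaleR_sum_right[symmetric] using exp[of D] B D by auto
  finally show ?thesis .
 qed
 show "R = (%w. (x powr r * h B w) *\<^sub>R B + (y powr r * h C w) *\<^sub>R C)"
 proof
  fix w
  \<comment> \<open>The equality is between functions on the whole ambient space, but h against
    elements of W sees only the component of w in W.\<close>
  define w' where "w' = h B w *\<^sub>R B + h C w *\<^sub>R C"
  have red: "h d w = h d w'" if "d \<in> W" for d
   using arg_cong[OF onb_imp_span(2)[OF B that], of "%d. h d w"]
   by (simp add: w'_def bil h_sym[of d])
  have "R w = (\<Sum>j<n. (l j powr r * h (e j) w') *\<^sub>R e j)"
   unfolding e(4) by (rule sum.cong) (use red eW in simp_all)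
  also have "... = h B w *\<^sub>R (\<Sum>j<n. (l j powr r * h (e j) B) *\<^sub>R e j) + h C w *\<^sub>R (\<Sum>j<n. (l j powr r * h (e j) C) *\<^sub>R e j)"
   by (simp add: w'_def bil algebra_simps sum.distrib scaleR_sum_right)
  also have "... = (x powr r * h B w) *\<^sub>R B + (y powr r * h C w) *\<^sub>R C"
   by (simp add: RD[of B x] RD[of C y] mult.commute)
  finally show "R w = (x powr r * h B w) *\<^sub>R B + (y powr r * h C w) *\<^sub>R C" .
 qed
qed

text \<open>Parseval: for any orthonormal basis e of W the squares of h B (e j) sum to 1, so the
  trace does not depend on the basis.\<close>

lemma op_trace_eqI:
 assumes B: "B \<in> W" "C \<in> W" "h B B = 1" "h C C = 1" "h B C = 0"
 shows "op_trace W h (%w. (x * h B w) *\<^sub>R B + (y * h C w) *\<^sub>R C) = x + y"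
 unfolding op_trace_def
proof (rule the_equality)
 let ?P = "%w. (x * h B w) *\<^sub>R B + (y * h C w) *\<^sub>R C"
 have CB: "h C B = 0" using B h_sym by simp
 let ?e = "%j::nat. if j = 0 then B else C"
 have im: "?e ` {..<2} = {B, C}" by (auto simp: image_iff Bex_def less_2_cases_iff)
 have ob: "orthonormal_basis_on W h 2 ?e"
  using B CB onb_imp_span(1)[OF B] unfolding orthonormal_basis_on_def orthonormal_on_def im all_less_2 by auto
 show "EX n e. orthonormal_basis_on W h n e & x + y = (\<Sum>j<n. h (?P (e j)) (e j))"
  by (intro exI[of _ 2] exI[of _ ?e] conjI ob) (use B CB in "simp add: sum_lessThan_2 bil")
 fix t assume "EX n e. orthonormal_basis_on W h n e & t = (\<Sum>j<n. h (?P (e j)) (e j))"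
 then obtain n e where e: "orthonormal_basis_on W h n e" "t = (\<Sum>j<n. h (?P (e j)) (e j))" by blast
 have hs: "h x (\<Sum>j\<in>J. f j) = (\<Sum>j\<in>J. h x (f j))" if "finite J" for x f and J :: "nat set"
  using that by induction (simp_all add: bil)
 have ee: "h (e i) (e j) = (if i = j then 1 else 0)" if "i < n" "j < n" for i j
  using e(1) that by (auto simp: orthonormal_basis_on_def orthonormal_on_def)
 have par: "(\<Sum>j<n. h D (e j) * h D (e j)) = h D D" if D: "D \<in> W" for D
 proof -
  have "D = (\<Sum>j<n. h (e j) D *\<^sub>R e j)" by (rule onb_expand[OF e(1) D])
  hence "h D D = h D (\<Sum>j<n. h (e j) D *\<^sub>R e j)" by simp
  thus ?thesis by (simp add: hs bil h_sym)
 qed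
 have "t = x * (\<Sum>j<n. h B (e j) * h B (e j)) + y * (\<Sum>j<n. h C (e j) * h C (e j))"
  unfolding e(2) by (simp add: bil sum.distrib sum_distrib_left mult.assoc)
 thus "t = x + y" using par B by simp
qed

lemma TrQ_powr_svd2:
 assumes sv: "svd2 A s t B C b c"
 shows "TrQ_powr g W h r A = s powr r + t powr r"
proof -
 have B: "B \<in> W" "C \<in> W" "h B B = 1" "h C C = 1" "h B C = 0" and st: "s >= 0" "t >= 0" and ob: "ob b c"
  and A: "A = (%v. (s * g b v) *\<^sub>R B + (t * g c v) *\<^sub>R C)" using sv by (auto simp: svd2_def)
 have CB: "h C B = 0" using B h_sym by simp
 have adj: "adjoint_wrt g h A w = (s * h B w) *\<^sub>R b + (t * h C w) *\<^sub>R c" for w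
  unfolding adjoint_wrt_def
 proof (rule the_equality)
  show "\<forall>v'. g ((s * h B w) *\<^sub>R b + (t * h C w) *\<^sub>R c) v' = h w (A v')"
   by (simp add: A bil h_sym algebra_simps)
  fix v assume "\<forall>v'. g v v' = h w (A v')"
  thus "v = (s * h B w) *\<^sub>R b + (t * h C w) *\<^sub>R c"
   by (intro g_eqI) (simp add: A bil h_sym g_sym[of _ v] g_sym[of _ b] g_sym[of _ c] algebra_simps)
 qed
 have "op_powr W h (A \<circ> adjoint_wrt g h A) (1/2) =
   (%w. ((s * s) powr (1/2) * h B w) *\<^sub>R B + ((t * t) powr (1/2) * h C w) *\<^sub>R C)"
  by (rule op_powr_eqI[OF B])
   (use st svd2_ops[OF sv] in "simp_all add: adj linear_add linear_scale mult_ac")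
 also have "... = (%w. (s * h B w) *\<^sub>R B + (t * h C w) *\<^sub>R C)" using st by (simp add: powr_half_sqrt)
 finally have Q: "Qop g W h A = (%w. (s * h B w) *\<^sub>R B + (t * h C w) *\<^sub>R C)" by (simp add: Qop_def)
 have "op_powr W h (Qop g W h A) r = (%w. (s powr r * h B w) *\<^sub>R B + (t powr r * h C w) *\<^sub>R C)"
  unfolding Q by (rule op_powr_eqI[OF B st]) simp
 thus ?thesis unfolding TrQ_powr_def using op_trace_eqI[OF B] by simp
qed

end

section \<open>Trace inequalities\<close>

context ip_pair begin

text \<open>The inner product Tr (A^T B) of linear maps, in the coordinate form of
  \<open>form_ip\<close>.\<close>

definition ipm :: "(real^2 => 'v) => (real^2 => 'v) => real" where
 "ipm A B = (\<Sum>i\<in>UNIV. \<Sum>j\<in>UNIV. matrix_inv G $ i $ j * h (A (axis i 1)) (B (axis j 1)))"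

lemma matrix_inv_ob:
 assumes "ob b c" shows "matrix_inv G $ i $ j = b$i * b$j + c$i * c$j"
proof -
 have "G ** (\<chi> i j. b$i * b$j + c$i * c$j) = mat 1"
 proof -
  have "(\<chi> i j. b$i * b$j + c$i * c$j) *v (G *v v) = v" for v
  proof -
   have "(\<chi> i j. b$i * b$j + c$i * c$j) *v (G *v v) = g b v *\<^sub>R b + g c v *\<^sub>R c"
    by (simp add: vec_eq_iff matrix_vector_mult_def g_def inner_vec_def sum_distrib_left sum_distrib_right
      sum.distrib algebra_simps sum_2)
   thus ?thesis using ob_expand[OF assms, of v] by simp
  qed
  hence "(\<chi> i j. b$i * b$j + c$i * c$j) ** G = mat 1"
   by (simp add: matrix_eq matrix_vector_mul_assoc[symmetric])
  thus ?thesis by (simp add: matrix_left_right_inverse)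
 qed
 from matrix_inv_unique[OF this] show ?thesis by simp
qed

lemma ipm_ob:
 assumes ob: "ob b c" and A: "linear A" "linear B"
 shows "ipm A B = h (A b) (B b) + h (A c) (B c)"
proof -
 have ex: "F v = v$1 *\<^sub>R F ax1 + v$2 *\<^sub>R F ax2" if "linear F" for F :: "real^2 => 'v" and v
  using arg_cong[OF vec2_expand[of v], of F] by (simp add: linear_add[OF that] linear_scale[OF that])
 show ?thesis
  unfolding ipm_def matrix_inv_ob[OF ob] sum_2 ex[OF A(1), of b] ex[OF A(1), of c] ex[OF A(2), of b] ex[OF A(2), of c]
  by (simp add: bil algebra_simps)
qed

lemma svd2_Nmat:
 assumes sv: "svd2 A s t B C b c"
 shows "Nmat A *v b = s^2 *\<^sub>R b" (is ?P1) "Nmat A *v c = t^2 *\<^sub>R c" (is ?P2)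
proof -
 note o = svd2_ops[OF sv]
 have BC: "h B B = 1" "h C C = 1" "h B C = 0" "h C B = 0" and A: "A = (%v. (s * g b v) *\<^sub>R B + (t * g c v) *\<^sub>R C)"
  using sv h_sym by (auto simp: svd2_def)
 have 1: "h (A v) B = s * g b v" "h (A v) C = t * g c v" for v by (simp_all add: A bil BC)
 show ?P1
  by (rule g_eqI) (simp add: Nmat_g[OF o(3)] o(1) bil 1 g_sym[of b] power2_eq_square)
 show ?P2
  by (rule g_eqI) (simp add: Nmat_g[OF o(3)] o(2) bil 1 g_sym[of c] power2_eq_square)
qed

text \<open>\<open>Nmat A\<close> is diagonal in the basis b, c. The identities are multiplied by
  the determinant of this basis, which is nonzero, instead of inverting the change of basis.\<close>

lemma svd2_trace_det:
 assumes sv: "svd2 A s t B C b c"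
 shows "trace (Nmat A) = s^2 + t^2" "det (Nmat A) = s^2 * t^2"
proof -
 have ob: "ob b c" using sv by (simp add: svd2_def)
 let ?N = "Nmat A" let ?d = "b$1 * c$2 - b$2 * c$1"
 have n: "?N$1$1 * b$1 + ?N$1$2 * b$2 = s^2 * b$1" "?N$2$1 * b$1 + ?N$2$2 * b$2 = s^2 * b$2"
  "?N$1$1 * c$1 + ?N$1$2 * c$2 = t^2 * c$1" "?N$2$1 * c$1 + ?N$2$2 * c$2 = t^2 * c$2"
  using svd2_Nmat[OF sv] by (simp_all add: vec_eq_iff forall_2 matrix_vector_mult_def sum_2)
 have ne: "?d ~= 0"
 proof
  assume d: "?d = 0"
  have "b$2 *\<^sub>R c - c$2 *\<^sub>R b = 0" "b$1 *\<^sub>R c - c$1 *\<^sub>R b = 0" using d by (auto simp: vec_eq_iff forall_2 algebra_simps)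
  from arg_cong[OF this(1), of "g b"] arg_cong[OF this(2), of "g b"] have "c$2 = 0" "c$1 = 0"
   using ob by (simp_all add: bil ob_def)
  hence "c = 0" by (simp add: vec_eq_iff forall_2)
  thus False using ob by (simp add: ob_def)
 qed
 have "(?N$1$1 + ?N$2$2 - (s^2 + t^2)) * ?d = 0" "(?N$1$1 * ?N$2$2 - ?N$1$2 * ?N$2$1 - s^2 * t^2) * ?d = 0"
  using n by algebra+
 thus "trace ?N = s^2 + t^2" "det ?N = s^2 * t^2" using ne by (simp_all add: trace_def sum_2 det_2)
qed

text \<open>No choice of singular vectors occurs on the right-hand side, which makes it suitable for
  showing measurability.\<close>

lemma TrQ_powr_eig:
 assumes A: "linear A" "!!v. A v \<in> W"
 shows "TrQ_powr g W h r A = eig1 (trace (Nmat A)) (det (Nmat A)) powr (r/2) + eig2 (trace (Nmat A)) (det (Nmat A)) powr (r/2)"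
proof -
 obtain s t B C b c where sv: "svd2 A s t B C b c" using svd2_exists[OF A] by blast
 have st: "s >= 0" "t >= 0" using sv by (auto simp: svd2_def)
 have e: "(x^2) powr (r/2) = x powr r" if "x >= 0" for x :: real
  using that by (cases "x = 0") (simp_all add: powr_powr flip: powr_numeral)
 note E = eig_sum_prod[OF svd2_trace_det[OF sv]]
 have "eig1 (trace (Nmat A)) (det (Nmat A)) powr (r/2) + eig2 (trace (Nmat A)) (det (Nmat A)) powr (r/2)
   = (s^2) powr (r/2) + (t^2) powr (r/2)" unfolding E by (auto simp: max_def min_def)
 thus ?thesis using TrQ_powr_svd2[OF sv] e st by simp
qed

lemma trace_Nmat_ipm: assumes A: "linear A" shows "trace (Nmat A) = ipm A A"
 by (simp add: trace_def Nmat_def matrix_matrix_mult_def Kmat_def ipm_def sum_2 h_sym)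

lemma TrQ_powr_bounds:
 assumes A: "linear A" "!!v. A v \<in> W" and r: "r > 0"
 shows "0 <= ipm A A" "0 <= TrQ_powr g W h r A" "TrQ_powr g W h r A <= 2 * ipm A A powr (r/2)" (is ?P1)
proof -
 obtain s t B C b c where sv: "svd2 A s t B C b c" using svd2_exists[OF A] by blast
 have st: "s >= 0" "t >= 0" using sv by (auto simp: svd2_def)
 have T: "ipm A A = s^2 + t^2" using svd2_trace_det[OF sv] trace_Nmat_ipm[OF A(1)] by simp
 thus "0 <= ipm A A" by simp
 show "0 <= TrQ_powr g W h r A" unfolding TrQ_powr_svd2[OF sv] by simp
 have e: "(x^2) powr (r/2) = x powr r" if "x >= 0" for x :: real
  using that by (cases "x = 0") (simp_all add: powr_powr flip: powr_numeral)
 have "(s^2) powr (r/2) <= ipm A A powr (r/2)" "(t^2) powr (r/2) <= ipm A A powr (r/2)"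
  using r by (auto simp: T intro!: powr_mono2)
 thus ?P1
  unfolding TrQ_powr_svd2[OF sv] using e st by simp
qed

text \<open>Young's inequality for s t and the inequality of means for the overlaps x, y of the
  singular vectors.\<close>

lemma svd_bilinear_bound:
 fixes x y :: real
 assumes "s >= 0" "t >= 0" "1 < p" "1 / p + 1 / q = 1"
 shows "s * t * (x * y) <= (s powr p / p + t powr q / q) * ((x^2 + y^2) / 2)"
proof -
 have q: "q > 1"
 proof -
  have "1 / p > 0" "1 / p < 1" using assms(3) by simp_all
  hence i: "1 / q > 0" "1 / q < 1" using assms(4) by linarith+
  hence "q > 0" by (simp add: zero_less_divide_1_iff)
  with i(2) show ?thesis by (simp add: divide_less_eq)
 qed
 have Y: "s * t <= s powr p / p + t powr q / q"
  using Youngs_inequality[of p q s t] assms q by simp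
 have "s * t * (x * y) <= s * t * ((x^2 + y^2) / 2)"
  using zero_le_power2[of "x - y"] assms by (intro mult_left_mono) (auto simp: power2_eq_square algebra_simps)
 also have "... <= (s powr p / p + t powr q / q) * ((x^2 + y^2) / 2)"
  by (rule mult_right_mono[OF Y]) simp
 finally show ?thesis .
qed

text \<open>Trace form of Young's inequality, \<open>(A;B) \<le> Tr Q(A)\<^sup>p / p + Tr Q(B)\<^sup>q / q\<close>: the weights
 \<open>((b\<^sub>j, c\<^sub>k)\<^sup>2 + (B\<^sub>j, C\<^sub>k)\<^sup>2) / 2\<close> are doubly stochastic.\<close>

lemma trace_Young:
 assumes A: "linear A" "!!v. A v \<in> W" and B: "linear B" "!!v. B v \<in> W"
  and pq: "1 < p" "1 / p + 1 / q = 1"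
 shows "ipm A B <= TrQ_powr g W h p A / p + TrQ_powr g W h q B / q"
proof -
 obtain s0 s1 B0 B1 b0 b1 where S: "svd2 A s0 s1 B0 B1 b0 b1" using svd2_exists[OF A] by blast
 obtain t0 t1 C0 C1 c0 c1 where T: "svd2 B t0 t1 C0 C1 c0 c1" using svd2_exists[OF B] by blast
 have s: "s0 >= 0" "s1 >= 0" "t0 >= 0" "t1 >= 0" and ob: "ob b0 b1" "ob c0 c1"
  and on: "B0 \<in> W" "B1 \<in> W" "h B0 B0 = 1" "h B1 B1 = 1" "h B0 B1 = 0"
   "C0 \<in> W" "C1 \<in> W" "h C0 C0 = 1" "h C1 C1 = 1" "h C0 C1 = 0"
  and Bf: "B = (%v. (t0 * g c0 v) *\<^sub>R C0 + (t1 * g c1 v) *\<^sub>R C1)"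
  using S T by (auto simp: svd2_def)
 note Ao = svd2_ops[OF S]
 have ip: "ipm A B = s0 * t0 * (g c0 b0 * h B0 C0) + s0 * t1 * (g c1 b0 * h B0 C1)
   + s1 * t0 * (g c0 b1 * h B1 C0) + s1 * t1 * (g c1 b1 * h B1 C1)"
  unfolding ipm_ob[OF ob(1) A(1) B(1)] Ao(1,2) by (simp add: Bf bil algebra_simps)
 have hp: "(h x C0)^2 + (h x C1)^2 = h x x" if "x \<in> W" for x
  using arg_cong[OF onb_imp_span(2)[OF on(6-10) that], of "h x"] by (simp add: bil h_sym power2_eq_square)
 have hp': "(h B0 x)^2 + (h B1 x)^2 = h x x" if "x \<in> W" for x
  using arg_cong[OF onb_imp_span(2)[OF on(1-5) that], of "h x"] by (simp add: bil h_sym[of x B0] h_sym[of x B1] power2_eq_square)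
 have gp: "(g c0 x)^2 + (g c1 x)^2 = g x x" "(g x b0)^2 + (g x b1)^2 = g x x" for x
  using ob_parseval[OF ob(2), of x x] ob_parseval[OF ob(1), of x x] by (simp_all add: g_sym power2_eq_square)
 have one: "g b0 b0 = 1" "g b1 b1 = 1" "g c0 c0 = 1" "g c1 c1 = 1" using ob by (auto simp: ob_def)
 let ?S0 = "s0 powr p / p" let ?S1 = "s1 powr p / p" let ?T0 = "t0 powr q / q" let ?T1 = "t1 powr q / q"
 define w00 w01 w10 w11 where "w00 = ((g c0 b0)^2 + (h B0 C0)^2) / 2" and "w01 = ((g c1 b0)^2 + (h B0 C1)^2) / 2"
  and "w10 = ((g c0 b1)^2 + (h B1 C0)^2) / 2" and "w11 = ((g c1 b1)^2 + (h B1 C1)^2) / 2"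
 have w: "w00 + w01 = 1" "w10 + w11 = 1" "w00 + w10 = 1" "w01 + w11 = 1"
 proof -
  note f = hp[OF on(1), unfolded on] hp[OF on(2), unfolded on] hp'[OF on(6), unfolded on] hp'[OF on(7), unfolded on]
   gp(1)[of b0, unfolded one] gp(1)[of b1, unfolded one] gp(2)[of c0, unfolded one] gp(2)[of c1, unfolded one]
  have H: "(c + a) / 2 + (d + b) / 2 = 1" if "a + b = 1" "c + d = 1" for a b c d :: real
  proof -
   have "(c + a) / 2 + (d + b) / 2 = ((a + b) + (c + d)) / 2" by (simp add: add_divide_distrib)
   thus ?thesis unfolding that by simp
  qed
  note d = w00_def w01_def w10_def w11_def
  show "w00 + w01 = 1" unfolding d by (rule H[OF f(1,5)])
  show "w10 + w11 = 1" unfolding d by (rule H[OF f(2,6)])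
  show "w00 + w10 = 1" unfolding d by (rule H[OF f(3,7)])
  show "w01 + w11 = 1" unfolding d by (rule H[OF f(4,8)])
 qed
 have "ipm A B <= (?S0 + ?T0) * w00 + (?S0 + ?T1) * w01 + (?S1 + ?T0) * w10 + (?S1 + ?T1) * w11"
  unfolding ip w00_def w01_def w10_def w11_def
  using svd_bilinear_bound[OF s(1,3) pq, of "g c0 b0" "h B0 C0"] svd_bilinear_bound[OF s(1,4) pq, of "g c1 b0" "h B0 C1"]
   svd_bilinear_bound[OF s(2,3) pq, of "g c0 b1" "h B1 C0"] svd_bilinear_bound[OF s(2,4) pq, of "g c1 b1" "h B1 C1"]
  by linarith
 also have "... = ?S0 * (w00 + w01) + ?S1 * (w10 + w11) + ?T0 * (w00 + w10) + ?T1 * (w01 + w11)"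
  by (simp only: distrib_left distrib_right add_ac)
 also have "... = TrQ_powr g W h p A / p + TrQ_powr g W h q B / q"
  unfolding w TrQ_powr_svd2[OF S] TrQ_powr_svd2[OF T] by (simp add: add_divide_distrib)
 finally show ?thesis .
qed

lemma ipm_add: "linear B ==> linear C ==> ipm A (%v. B v + C v) = ipm A B + ipm A C"
 by (simp add: ipm_def bil sum.distrib algebra_simps)

text \<open>Convexity of \<open>A \<mapsto> Tr Q(A)\<^sup>q\<close>, whose differential at \<open>V\<close> is \<open>q (Q(V)\<^bsup>q-2\<^esup>V; \<cdot>)\<close>.\<close>

lemma TrQ_convex:
 assumes V: "linear V" "!!v. V v \<in> W" and B: "linear B" "!!v. B v \<in> W"
  and pq: "1 < p" "1 < q" "1 / p + 1 / q = 1"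
 shows "TrQ_powr g W h q (%v. V v + B v) >= TrQ_powr g W h q V + q * ipm (Q_powr_map g W h (q - 1) V) B"
proof -
 obtain s t B' C b c where S: "svd2 V s t B' C b c" using svd2_exists[OF V] by blast
 let ?S = "Q_powr_map g W h (q - 1) V"
 have st: "s >= 0" "t >= 0" and ob: "ob b c" and hh: "h B' B' = 1" "h C C = 1" using S by (auto simp: svd2_def)
 have S': "svd2 ?S (s powr (q - 1)) (t powr (q - 1)) B' C b c"
  using S unfolding Q_powr_map_svd2[OF S] by (auto simp: svd2_def)
 note o = svd2_ops[OF S] and o' = svd2_ops[OF S']
 have pq': "(q - 1) * p = q" using pq by (simp add: field_simps)
 have e: "s powr (q - 1) * s = s powr q" "t powr (q - 1) * t = t powr q"
  using st by (cases "s = 0"; cases "t = 0"; simp add: powr_diff)+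
 have "ipm ?S V = s powr q + t powr q"
  unfolding ipm_ob[OF ob o'(3) V(1)] o(1,2) o'(1,2) using hh e by (simp add: bil mult.commute[of _ "_ powr _"])
 moreover have "TrQ_powr g W h p ?S = s powr q + t powr q" unfolding TrQ_powr_svd2[OF S'] by (simp add: powr_powr pq')
 \<comment> \<open>Young's inequality for the pair ?S and V + B is an equality at B = 0, where both
   traces equal s powr q + t powr q; this is why it yields the tangent inequality at V.\<close>
 moreover have "ipm ?S (%v. V v + B v) <= TrQ_powr g W h p ?S / p + TrQ_powr g W h q (%v. V v + B v) / q"
  by (rule trace_Young[OF o'(3,4) _ _ pq(1,3)])
   (use V B EE(8) in "auto intro: linear_compose_add subspace_add")
 ultimately have "s powr q + t powr q + ipm ?S B <= (s powr q + t powr q) / p + TrQ_powr g W h q (%v. V v + B v) / q"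
  by (simp add: ipm_add[OF V(1) B(1)])
 hence "q * (s powr q + t powr q + ipm ?S B) <= q * ((s powr q + t powr q) / p + TrQ_powr g W h q (%v. V v + B v) / q)"
  using pq by (intro mult_left_mono) auto
 moreover have "q * ((s powr q + t powr q) / p) = (q - 1) * (s powr q + t powr q)"
 proof -
  have "q / p = q - 1" using pq by (simp add: field_simps)
  thus ?thesis by (simp add: mult.commute divide_simps) (metis times_divide_eq_left mult.commute)
 qed
 ultimately have "s powr q + t powr q + q * ipm ?S B <= TrQ_powr g W h q (%v. V v + B v)"
  using pq by (simp add: algebra_simps)
 thus ?thesis unfolding TrQ_powr_svd2[OF S] .
qed

end

section \<open>Lifting through covering maps and transitivity of the deck group\<close>

text \<open>Two partial lifts over closed sets glue when the second piece lies over an evenly covered set and the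
 overlap is connected.\<close>

lemma lift_extend:
 fixes \<pi> :: "'c::topological_space => 'm::topological_space" and f :: "'a::topological_space => 'm"
 assumes cl: "closed A" "closed B" and f: "continuous_on (A \<union> B) f"
  and h: "continuous_on A h" "\<forall>x\<in>A. \<pi> (h x) = f x"
  and AB: "connected (A \<inter> B)" "A \<inter> B ~= {}"
  and T: "f ` B \<subseteq> T" "\<Union>v = \<pi> -` T" "\<forall>u\<in>v. open u" "pairwise disjnt v"
   "\<forall>u\<in>v. EX q. homeomorphism u T \<pi> q"
 shows "EX k. continuous_on (A \<union> B) k & (\<forall>x\<in>A \<union> B. \<pi> (k x) = f x) & (\<forall>x\<in>A. k x = h x)"
proof -
 obtain x0 where x0: "x0 \<in> A" "x0 \<in> B" using AB(2) by blast
 have hT: "h ` (A \<inter> B) \<subseteq> \<Union>v" unfolding T(2) using h(2) T(1) by auto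
 obtain u where u: "u \<in> v" "h x0 \<in> u" using hT x0 by blast
 obtain q where q: "homeomorphism u T \<pi> q" using bspec[OF T(5) u(1)] by blast
 have conn: "connected (h ` (A \<inter> B))"
  by (rule connected_continuous_image[OF continuous_on_subset[OF h(1)] AB(1)]) simp
 \<comment> \<open>A connected image cannot meet two disjoint sheets.\<close>
 have sub: "h ` (A \<inter> B) \<subseteq> u"
 proof (rule ccontr)
  assume n: "\<not> h ` (A \<inter> B) \<subseteq> u"
  let ?w = "\<Union>(v - {u})"
  have "open u" "open ?w" using T(3) u(1) by auto
  moreover have "u \<inter> ?w = {}" using T(4) u(1) by (auto simp: pairwise_def disjnt_def)
  moreover have "h ` (A \<inter> B) \<subseteq> u \<union> ?w" using hT by blast
  moreover have "u \<inter> h ` (A \<inter> B) ~= {}" using u(2) x0 by blast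
  moreover have "?w \<inter> h ` (A \<inter> B) ~= {}" using n hT by blast
  ultimately show False using conn unfolding connected_def by (metis inf_bot_left inf_commute)
 qed
 have eq: "h x = q (f x)" if "x \<in> A" "x \<in> B" for x
  using sub that bspec[OF h(2) that(1)] homeomorphism_apply1[OF q, of "h x"] by auto
 let ?k = "%x. if x \<in> A then h x else q (f x)"
 have "continuous_on B (%x. q (f x))"
  by (rule continuous_on_compose2[OF homeomorphism_cont2[OF q] continuous_on_subset[OF f] T(1)]) simp
 hence "continuous_on (A \<union> B) ?k"
  by (intro continuous_on_cases_local) (use cl h(1) eq in "auto intro: closed_subset")
 moreover have "\<pi> (?k x) = f x" if "x \<in> A \<union> B" for x
  using that h(2) T(1) homeomorphism_apply2[OF q] by auto
 ultimately show ?thesis by (intro exI[of _ ?k]) auto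
qed

definition evenly :: "('c::topological_space => 'm::topological_space) => 'm set => bool" where
 "evenly \<pi> T \<longleftrightarrow> open T & (EX v. \<Union>v = \<pi> -` T & (\<forall>u\<in>v. open u) & pairwise disjnt v &
  (\<forall>u\<in>v. EX q. homeomorphism u T \<pi> q))"

lemma covering_evenly:
 assumes "covering_space UNIV \<pi> UNIV"
 shows "EX T. x \<in> T & evenly \<pi> T" "cont \<pi>" "surj \<pi>"
 using assms unfolding covering_space_def evenly_def by (auto simp: subtopology_UNIV)

lemma lift_extend_evenly:
 fixes \<pi> :: "'c::topological_space => 'm::topological_space" and f :: "'a::topological_space => 'm"
 assumes "closed A" "closed B" "continuous_on (A \<union> B) f"
  and "continuous_on A h" "\<forall>x\<in>A. \<pi> (h x) = f x"
  and "connected (A \<inter> B)" "A \<inter> B ~= {}" "f ` B \<subseteq> T" "evenly \<pi> T"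
 shows "EX k. continuous_on (A \<union> B) k & (\<forall>x\<in>A \<union> B. \<pi> (k x) = f x) & (\<forall>x\<in>A. k x = h x)"
proof -
 obtain v where "\<Union>v = \<pi> -` T" "\<forall>u\<in>v. open u" "pairwise disjnt v" "\<forall>u\<in>v. EX q. homeomorphism u T \<pi> q"
  using assms(9) unfolding evenly_def by (elim conjE exE) (rule that, assumption+)
 from lift_extend[OF assms(1-8) this] show ?thesis .
qed

text \<open>The sets where the lifts agree and where they differ are both open in S: near a point
  the two lifts lie in one sheet, where \<pi> is injective, or in two disjoint sheets.\<close>

lemma lift_unique:
 fixes \<pi> :: "'c::topological_space => 'm::topological_space" and f :: "'a::topological_space => 'm"
 assumes cov: "covering_space UNIV \<pi> UNIV" and S: "connected S"
  and h: "continuous_on S h" "continuous_on S k" "!!x. x \<in> S ==> \<pi> (h x) = \<pi> (k x)"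
  and a: "a \<in> S" "h a = k a" and x: "x \<in> S"
 shows "h x = k x"
proof -
 let ?E = "{x \<in> S. h x = k x}" let ?D = "{x \<in> S. h x ~= k x}"
 have loc: "EX O1. openin (top_of_set S) O1 & y \<in> O1 & (h y = k y --> O1 \<subseteq> ?E) & (h y ~= k y --> O1 \<subseteq> ?D)" if y: "y \<in> S" for y
 proof -
  obtain T where T0: "\<pi> (h y) \<in> T" "evenly \<pi> T" using covering_evenly(1)[OF cov, of "\<pi> (h y)"] by blast
  obtain v where v: "\<Union>v = \<pi> -` T" "\<forall>u\<in>v. open u" "pairwise disjnt v" "\<forall>u\<in>v. EX q. homeomorphism u T \<pi> q"
   using T0(2) unfolding evenly_def by (elim conjE exE) (rule that, assumption+)
  note T = T0(1) v
  have "\<pi> (k y) \<in> T" using T(1) h(3)[OF y] by simp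
  hence "h y \<in> \<Union>v" "k y \<in> \<Union>v" using T(1,2) by auto
  then obtain u w where uw: "u \<in> v" "h y \<in> u" "w \<in> v" "k y \<in> w" by (elim UnionE)
  let ?O = "(S \<inter> h -` u) \<inter> (S \<inter> k -` w)"
  have op: "openin (top_of_set S) ?O"
   using uw T(3) by (intro openin_Int continuous_openin_preimage_gen h) auto
  show ?thesis
  proof (intro exI[of _ ?O] conjI impI op)
   show "y \<in> ?O" using y uw by simp
   assume "h y = k y"
   hence "u = w" using T(4) uw by (auto simp: pairwise_def disjnt_def)
   moreover obtain q where "homeomorphism u T \<pi> q" using T(5) uw by blast
   ultimately have "h z = k z" if "z \<in> ?O" for z
    using that h(3)[of z] homeomorphism_apply1[of u T \<pi> q] by (metis IntD1 IntD2 vimageE)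
   thus "?O \<subseteq> ?E" by blast
  next
   assume ne: "h y ~= k y"
   have "u ~= w"
   proof
    assume "u = w"
    moreover obtain q where "homeomorphism u T \<pi> q" using T(5) uw by blast
    ultimately show False using ne uw h(3)[OF y] homeomorphism_apply1[of u T \<pi> q] by metis
   qed
   hence "u \<inter> w = {}" using T(4) uw by (auto simp: pairwise_def disjnt_def)
   thus "?O \<subseteq> ?D" by auto
  qed
 qed
 have "openin (top_of_set S) ?E" "openin (top_of_set S) ?D"
  using loc by (subst openin_subopen, fastforce)+
 moreover have "S \<subseteq> ?E \<union> ?D" "?E \<inter> ?D = {}" by auto
 ultimately have "?E = {} \<or> ?D = {}" using S unfolding connected_openin by blast
 thus ?thesis using a x by blast
qed

lemma closed_square:
 "closed ({a..b::real} \<times> {c..d::real})" by (intro closed_Times closed_atLeastAtMost)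

text \<open>Lebesgue number: a fine square grid is subordinate to the evenly covered sets.\<close>

lemma square_grid:
 fixes f :: "real \<times> real => 'm::topological_space"
 assumes cov: "covering_space UNIV \<pi> UNIV" and f: "continuous_on ({0..1} \<times> {0..1}) f"
 obtains N :: nat where "N > 0" "!!i j. i < N ==> j < N ==>
  EX T. evenly \<pi> T & f ` ({real i / N..real (Suc i) / N} \<times> {real j / N..real (Suc j) / N}) \<subseteq> T"
proof -
 let ?S = "{0..1::real} \<times> {0..1::real}"
 define C where "C = {G. open G & (EX T. evenly \<pi> T & f ` (?S \<inter> G) \<subseteq> T)}"
 have "?S \<subseteq> \<Union>C"
 proof
  fix z assume z: "z \<in> ?S"
  obtain T where T: "f z \<in> T" "evenly \<pi> T" using covering_evenly(1)[OF cov] by blast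
  have "openin (top_of_set ?S) (?S \<inter> f -` T)"
   using T(2) by (intro continuous_openin_preimage_gen f) (auto simp: evenly_def)
  then obtain G where G: "open G" "?S \<inter> f -` T = ?S \<inter> G" by (auto simp: openin_open)
  hence "G \<in> C" unfolding C_def using T(2) by blast
  moreover have "z \<in> G" using G(2) z T(1) by blast
  ultimately show "z \<in> \<Union>C" by blast
 qed
 moreover have "compact ?S" by (intro compact_Times compact_Icc)
 moreover have "!!G. G \<in> C ==> open G" by (simp add: C_def)
 ultimately obtain e where e: "e > 0" "!!x. x \<in> ?S ==> \<exists>G\<in>C. ball x e \<subseteq> G"
  using Heine_Borel_lemma[of ?S C] by metis
 \<comment> \<open>The diameter of a grid square is at most 1 / N + 1 / N, the sum of its side
   lengths.\<close>
 obtain N :: nat where N: "2 / e < real N" using reals_Archimedean2 by blast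
 have N0: "N > 0" using N e(1) by (metis divide_pos_pos gr0I not_less_iff_gr_or_eq of_nat_0 order_less_trans zero_less_numeral)
 show ?thesis
 proof (rule that[OF N0])
  fix i j assume ij: "i < N" "j < N"
  let ?Q = "{real i / N..real (Suc i) / N} \<times> {real j / N..real (Suc j) / N}"
  let ?c = "(real i / N, real j / N)"
  have QS: "?Q \<subseteq> ?S"
  proof -
   have "real (Suc k) / N <= 1" "0 <= real k / N" if "k < N" for k using that N0 by (auto simp: divide_simps)
   from this[OF ij(1)] this[OF ij(2)] show ?thesis by (intro Sigma_mono) auto
  qed
  have "?c \<in> ?Q" using N0 by (auto simp: divide_simps)
  hence "?c \<in> ?S" using QS by blast
  then obtain G where G: "G \<in> C" "ball ?c e \<subseteq> G" using e(2) by blast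
  have "?Q \<subseteq> ball ?c e"
  proof
   fix z assume "z \<in> ?Q"
   then obtain x y where z: "z = (x, y)" "real i / N <= x" "x <= real (Suc i) / N" "real j / N <= y" "y <= real (Suc j) / N" by auto
   have "real (Suc k) / N = real k / N + 1 / N" for k by (simp add: add_divide_distrib)
   hence "\<bar>x - real i / N\<bar> <= 1 / N" "\<bar>y - real j / N\<bar> <= 1 / N" using z by auto
   moreover have "dist ?c z <= \<bar>x - real i / N\<bar> + \<bar>y - real j / N\<bar>"
    unfolding z(1) dist_Pair_Pair using sqrt_sum_squares_le_sum_abs[of "dist (real i / N) x" "dist (real j / N) y"]
    by (simp add: dist_real_def abs_minus_commute)
   moreover have "1 / N + 1 / N < e" using N N0 e(1) by (simp add: field_simps)
   ultimately show "z \<in> ball ?c e" by simp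
  qed
  hence "?Q \<subseteq> ?S \<inter> G" using QS G(2) by blast
  thus "EX T. evenly \<pi> T & f ` ?Q \<subseteq> T" using G(1) unfolding C_def by blast
 qed
qed

text \<open>R a is the region already lifted when the current row is filled up to abscissa a. The
  next square meets it in its bottom and left edges, which together are connected.\<close>

lemma L_shape:
 fixes a b c d :: real
 assumes "0 <= a" "a <= b" "b <= 1" "0 <= c" "c <= d"
 defines "R \<equiv> %a. ({0..1} \<times> {0..c}) \<union> ({0..a} \<times> {0..d})" and "B \<equiv> {a..b} \<times> {c..d}"
 shows "connected (R a \<inter> B)" "R a \<inter> B ~= {}" "R a \<union> B = R b"
proof -
 have "R a \<inter> B = ({a..b} \<times> {c..c}) \<union> ({a..a} \<times> {c..d})" unfolding R_def B_def using assms(1-5) by auto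
 moreover have "connected ..."
 proof (rule connected_Un)
  have "(a, c) \<in> ({a..b} \<times> {c..c}) \<inter> ({a..a} \<times> {c..d})" using assms(1-5) by simp
  thus "({a..b} \<times> {c..c}) \<inter> ({a..a} \<times> {c..d}) ~= {}" by blast
 qed (intro connected_Times connected_Icc)+
 ultimately show "connected (R a \<inter> B)" by simp
 have "(a, c) \<in> R a \<inter> B" unfolding R_def B_def using assms(1-5) by auto
 thus "R a \<inter> B ~= {}" by blast
 show "R a \<union> B = R b" unfolding R_def B_def using assms(1-5) by auto
qed

text \<open>The squares are added one at a time, row by row, so that each overlap is connected and
  \<open>lift_extend_evenly\<close> applies.\<close>

lemma square_lift:
 fixes f :: "real \<times> real => 'm::topological_space" and \<pi> :: "'c::topological_space => 'm"
 assumes cov: "covering_space UNIV \<pi> UNIV" and f: "continuous_on ({0..1} \<times> {0..1}) f" and y0: "\<pi> y0 = f (0, 0)"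
 shows "EX h. continuous_on ({0..1} \<times> {0..1}) h & (\<forall>z\<in>{0..1} \<times> {0..1}. \<pi> (h z) = f z) & h (0, 0) = y0"
proof -
 obtain N :: nat where N: "N > 0" "!!i j. i < N ==> j < N ==>
  EX T. evenly \<pi> T & f ` ({real i / N..real (Suc i) / N} \<times> {real j / N..real (Suc j) / N}) \<subseteq> T"
  using square_grid[OF cov f] by blast
 let ?s = "%i. real i / real N"
 have sm: "?s i <= ?s j" if "i <= j" for i j using that by (simp add: divide_right_mono)
 have s0: "?s 0 = 0" and sN: "?s N = 1" using N(1) by auto
 define R where "R i j = ({0..1} \<times> {0..?s j}) \<union> ({0..?s i} \<times> {0..?s (Suc j)})" for i j
 define L where "L A \<longleftrightarrow> (EX h. continuous_on A h & (\<forall>z\<in>A. \<pi> (h z) = f z) & h (0, 0) = y0)" for A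
 have step: "L (A \<union> B)"
  if A: "L A" "closed A" "(0,0) \<in> A" "A \<subseteq> {0..1} \<times> {0..1}" and AB: "connected (A \<inter> B)" "A \<inter> B ~= {}"
   and B: "B = {?s i..?s (Suc i)} \<times> {?s j..?s (Suc j)}" "i < N" "j < N" for A B i j
 proof -
  obtain h where h: "continuous_on A h" "\<forall>z\<in>A. \<pi> (h z) = f z" "h (0,0) = y0" using A(1) unfolding L_def by blast
  obtain T where T: "evenly \<pi> T" "f ` B \<subseteq> T" using N(2)[OF B(2,3)] unfolding B(1) by blast
  have "?s (Suc i) <= 1" "?s (Suc j) <= 1" "0 <= ?s i" "0 <= ?s j"
   using sm[of "Suc i" N] sm[of "Suc j" N] B(2,3) sN by simp_all
  hence "B \<subseteq> {0..1} \<times> {0..1}" unfolding B(1) by (intro Sigma_mono) auto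
  hence cAB: "continuous_on (A \<union> B) f" using A(4) by (intro continuous_on_subset[OF f]) auto
  have clB: "closed B" unfolding B(1) by (rule closed_square)
  from lift_extend_evenly[OF A(2) clB cAB h(1,2) AB T(2,1)]
  obtain k where k: "continuous_on (A \<union> B) k" "\<forall>x\<in>A \<union> B. \<pi> (k x) = f x" "\<forall>x\<in>A. k x = h x"
   by (elim conjE exE) (rule that, assumption+)
  have "k (0,0) = y0" using k(3) h(3) A(3) by simp
  with k show ?thesis unfolding L_def by (intro exI[of _ k] conjI)
 qed
 \<comment> \<open>The bottom edge is lifted before the first row. Each square is attached at a
   single point of it, and the resulting lift is restricted to the edge.\<close>
 have row0: "L ({0..?s i} \<times> {0..0})" if "i <= N" for i
  using that
 proof (induction i)
  case 0
  have "{0..?s 0} \<times> {0..0::real} = {(0,0)}" by auto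
  thus ?case unfolding L_def using y0 by (intro exI[of _ "%_. y0"]) auto
 next
  case (Suc i)
  let ?A = "{0..?s i} \<times> {0..0::real}" let ?B = "{?s i..?s (Suc i)} \<times> {?s 0..?s (Suc 0)}"
  have LA: "L ?A" using Suc by simp
  have b: "0 <= ?s i" "?s i <= 1" "?s i <= ?s (Suc i)" using sm[of i N] sm[of i "Suc i"] sN Suc.prems by simp_all
  have c: "?A \<inter> ?B = {(?s i, 0)}" using b N(1) by (auto simp del: of_nat_Suc)
  have sub: "{0..?s (Suc i)} \<times> {0..0} \<subseteq> ?A \<union> ?B" using N(1) by (auto simp del: of_nat_Suc)
  have "L (?A \<union> ?B)"
  proof (rule step[OF LA closed_square _ _ _ _ refl])
   show "(0, 0) \<in> ?A" using b by simp
   show "?A \<subseteq> {0..1} \<times> {0..1}" using b by (intro Sigma_mono) auto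
   show "connected (?A \<inter> ?B)" "?A \<inter> ?B ~= {}" unfolding c by auto
   show "i < N" "0 < N" using Suc.prems N(1) by auto
  qed
  then obtain h where h: "continuous_on (?A \<union> ?B) h & (\<forall>z\<in>?A \<union> ?B. \<pi> (h z) = f z) & h (0,0) = y0" unfolding L_def ..
  have "continuous_on ({0..?s (Suc i)} \<times> {0..0}) h" using h sub continuous_on_subset by blast
  with h sub show ?case unfolding L_def by (intro exI[of _ h]) blast
 qed
 have rows: "L ({0..1} \<times> {0..?s j})" if "j <= N" for j
  using that
 proof (induction j)
  case 0 show ?case using row0[of N] sN s0 by simp
 next
  case (Suc j)
  have "L (R i j)" if "i <= N" for i
   using that
  proof (induction i)
   \<comment> \<open>A row begins with the left edge of its first square, which meets the finished
     part in one point.\<close>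
   case 0
   have "L ({0..1} \<times> {0..?s j})" using Suc by simp
   then obtain h where h: "continuous_on ({0..1} \<times> {0..?s j}) h" "\<forall>z\<in>{0..1} \<times> {0..?s j}. \<pi> (h z) = f z" "h (0,0) = y0"
    unfolding L_def by blast
   let ?A = "{0..1::real} \<times> {0..?s j}" let ?B = "{0..0::real} \<times> {?s j..?s (Suc j)}"
   obtain T where T: "evenly \<pi> T" "f ` ({?s 0..?s (Suc 0)} \<times> {?s j..?s (Suc j)}) \<subseteq> T"
    using N(2)[of 0 j] Suc.prems N(1) by auto
   have "?B \<subseteq> {?s 0..?s (Suc 0)} \<times> {?s j..?s (Suc j)}" by auto
   hence fB: "f ` ?B \<subseteq> T" using T(2) by blast
   have "?A \<inter> ?B = {(0, ?s j)}" using sm[of 0 j] sm[of j "Suc j"] s0 by auto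
   hence AB: "connected (?A \<inter> ?B)" "?A \<inter> ?B ~= {}" by auto
   have cAB: "continuous_on (?A \<union> ?B) f"
   proof (rule continuous_on_subset[OF f])
    have "?s j <= 1" "?s (Suc j) <= 1" "0 <= ?s j"
     using sm[of "j" N] sm[of "Suc j" N] Suc.prems sN by simp_all
    hence s1: "{0..?s j} \<subseteq> {0..1}" "{?s j..?s (Suc j)} \<subseteq> {0..1}"
     unfolding atLeastatMost_subset_iff by blast+
    show "?A \<union> ?B \<subseteq> {0..1} \<times> {0..1}" by (intro Un_least Sigma_mono s1) simp_all
   qed
   from lift_extend_evenly[OF closed_square closed_square cAB h(1,2) AB fB T(1)]
   obtain k where k: "continuous_on (?A \<union> ?B) k" "\<forall>x\<in>?A \<union> ?B. \<pi> (k x) = f x" "\<forall>x\<in>?A. k x = h x"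
    by (elim conjE exE) (rule that, assumption+)
   have nn: "0 <= b" if "?s j <= b" for b by (rule order_trans[OF _ that]) simp
   have "R 0 j = ?A \<union> ?B" unfolding R_def s0 using nn linear[of _ "?s j"]
    by (auto simp del: of_nat_Suc)
   moreover have "k (0,0) = y0" using k(3) h(3) sm[of 0 j] s0 by simp
   ultimately show ?case unfolding L_def using k by (intro exI[of _ k]) auto
  next
   case (Suc i)
   let ?B = "{?s i..?s (Suc i)} \<times> {?s j..?s (Suc j)}"
   have i1: "0 <= ?s i" "?s i <= ?s (Suc i)" "?s (Suc i) <= 1" "0 <= ?s j" "?s j <= ?s (Suc j)" "?s (Suc j) <= 1"
    using sm[of 0 i] sm[of i "Suc i"] sm[of "Suc i" N] sm[of 0 j] sm[of j "Suc j"] sm[of "Suc j" N] sN s0 Suc.prems \<open>Suc j <= N\<close> by auto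
   note Ls = L_shape[OF i1(1-5), folded R_def]
   have "L (R i j \<union> ?B)"
   proof (rule step[OF _ _ _ _ Ls(1,2) refl])
    show "L (R i j)" using Suc by simp
    show "closed (R i j)" unfolding R_def by (intro closed_Un closed_square)
    show "(0, 0) \<in> R i j" unfolding R_def using i1 by simp
    have "{0..?s j} \<subseteq> {0..1}" "{0..?s i} \<subseteq> {0..1}" "{0..?s (Suc j)} \<subseteq> {0..1}"
     unfolding atLeastatMost_subset_iff using i1 order_trans by blast+
    thus "R i j \<subseteq> {0..1} \<times> {0..1}" unfolding R_def by (intro Un_least Sigma_mono) simp_all
    show "i < N" "j < N" using Suc.prems \<open>Suc j <= N\<close> by auto
   qed
   thus ?case unfolding Ls(3) .
  qed
  from this[of N] have "L (R N j)" by simp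
  moreover have "R N j = {0..1} \<times> {0..?s (Suc j)}" unfolding R_def sN using sm[of j "Suc j"] by auto
  ultimately show ?case by simp
 qed
 from rows[of N] show ?thesis unfolding L_def sN by simp
qed

text \<open>A path is a map of the square that does not depend on the second variable.\<close>

lemma path_lift:
 fixes \<pi> :: "'c::topological_space => 'm::topological_space"
 assumes cov: "covering_space UNIV \<pi> UNIV" and g: "path g" and y0: "\<pi> y0 = pathstart g"
 shows "EX h. path h & (\<forall>t\<in>{0..1}. \<pi> (h t) = g t) & pathstart h = y0"
proof -
 have c: "continuous_on ({0..1::real} \<times> {0..1::real}) (%z::real\<times>real. g (fst z))"
  using g unfolding path_def by (rule continuous_on_compose2) (auto intro!: continuous_intros)
 have s: "\<pi> y0 = (%z::real\<times>real. g (fst z)) (0,0)" using y0 by (simp add: pathstart_def)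
 from square_lift[OF cov c s] obtain h
  where h0: "continuous_on ({0..1::real} \<times> {0..1::real}) h & (\<forall>z\<in>{0..1::real} \<times> {0..1::real}. \<pi> (h z) = g (fst z)) & h (0,0) = y0" ..
 note h = conjunct1[OF h0] conjunct1[OF conjunct2[OF h0]] conjunct2[OF conjunct2[OF h0]]
 have "continuous_on {0..1} (%t. h (t, 0))"
  by (rule continuous_on_compose2[OF h(1)]) (auto intro!: continuous_intros)
 thus ?thesis using h by (intro exI[of _ "%t. h (t, 0)"]) (auto simp: path_def pathstart_def)
qed

text \<open>Apply the lifting of squares to a free null-homotopy of the loop.\<close>

lemma loop_lift_closed:
 fixes \<pi> :: "'c::topological_space => 'm::topological_space"
 assumes cov: "covering_space UNIV \<pi> UNIV" and sc: "simply_connected (UNIV :: 'c set)"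
  and g: "path g" "pathfinish g = pathstart g"
  and h: "path h" "!!t. t \<in> {0..1} ==> \<pi> (h t) = \<pi> (g t)"
 shows "pathfinish h = pathstart h"
proof -
 have "homotopic_loops UNIV g (%t. pathstart g)"
  using sc g unfolding simply_connected_def by (auto simp: path_def pathfinish_def pathstart_def)
 hence "EX H. continuous_on ({0..1::real} \<times> {0..1::real}) H & (ALL x. H (0, x) = g x) & (ALL x. H (1, x) = pathstart g) &
   (\<forall>t\<in>{0..1::real}. H (t, 1) = H (t, 0))"
  unfolding homotopic_loops_def homotopic_with_def pathstart_def pathfinish_def o_def by auto
 then obtain H where H0: "continuous_on ({0..1::real} \<times> {0..1::real}) H" "ALL x. H (0, x) = g x" "ALL x. H (1, x) = pathstart g"
  "\<forall>t\<in>{0..1::real}. H (t, 1) = H (t, 0)" by (elim conjE exE) (rule that, assumption+)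
 note H = H0(1) spec[OF H0(2)] spec[OF H0(3)] bspec[OF H0(4)]
 have c\<pi>: "cont \<pi>" by (rule covering_evenly(2)[OF cov])
 let ?f = "%z. \<pi> (H z)"
 have cf: "continuous_on ({0..1::real} \<times> {0..1::real}) ?f" by (rule continuous_on_compose2[OF c\<pi> H(1)]) simp
 have st: "\<pi> (pathstart h) = ?f (0, 0)" using h(2)[of 0] H(2) by (simp add: pathstart_def)
 from square_lift[OF cov cf st] obtain K
  where K0: "continuous_on ({0..1::real} \<times> {0..1::real}) K & (\<forall>z\<in>{0..1::real} \<times> {0..1::real}. \<pi> (K z) = ?f z) & K (0,0) = pathstart h" ..
 note K = conjunct1[OF K0] bspec[OF conjunct1[OF conjunct2[OF K0]]] conjunct2[OF conjunct2[OF K0]]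
 have c: "continuous_on {0..1} (%t. K (a t, b t))" if "continuous_on {0..1} a" "continuous_on {0..1} b"
  "a ` {0..1} \<subseteq> {0..1}" "b ` {0..1} \<subseteq> {0..1}" for a b :: "real => real"
  by (rule continuous_on_compose2[OF K(1)]) (use that in "auto intro!: continuous_intros")
 have c0: "continuous_on {0..1} (%t. K (0, t))" and c1: "continuous_on {0..1} (%t. K (1, t))"
  and d0: "continuous_on {0..1} (%t. K (t, 0))" and d1: "continuous_on {0..1} (%t. K (t, 1))"
  by (rule c[of "%_. 0" "%t. t"] c[of "%_. 1" "%t. t"] c[of "%t. t" "%_. 0"] c[of "%t. t" "%_. 1"]; auto)+
 have Kh: "K (0, t) = h t" if "t \<in> {0..1}" for t
  by (rule lift_unique[OF cov connected_Icc[of 0 1], where h="%t. K (0, t)" and a=0])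
   (use c0 h H(2) K that in "auto simp: path_def pathstart_def")
 \<comment> \<open>On the side where the homotopy is constant the lift is constant. Hence the lifts
   of the two other sides, which lie over the same path, agree at parameter 1 and therefore at
   0.\<close>
 have K1: "K (1, t) = K (1, 0)" if "t \<in> {0..1}" for t
  by (rule lift_unique[OF cov connected_Icc[of 0 1], where h="%t. K (1, t)" and k="%_. K (1, 0)" and a=0])
   (use c1 H(3) K that in auto)
 have "K (s, 1) = K (s, 0)" if "s \<in> {0..1}" for s
 proof (rule lift_unique[OF cov connected_Icc[of 0 1], where h="%s. K (s, 1)" and k="%s. K (s, 0)" and a=1])
  show "\<pi> (K (x, 1)) = \<pi> (K (x, 0))" if "x \<in> {0..1}" for x
   using H(4)[OF that] K(2) that by (simp add: pathstart_def pathfinish_def)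
 qed (use d0 d1 K1[of 1] that in auto)
 from this[of 0] show ?thesis using Kh[of 0] Kh[of 1] by (simp add: pathstart_def pathfinish_def)
qed

text \<open>Local path connectedness of the base, from which continuity of the maps built in
  \<open>deck_lift\<close> follows.\<close>

definition manifoldlike :: "'m::topological_space itself => bool" where
 "manifoldlike _ \<longleftrightarrow> (\<forall>(m::'m) T. open T & m \<in> T --> (EX V. open V & m \<in> V & V \<subseteq> T & path_connected V))"

text \<open>Simple connectedness makes all loops freely homotopic, including two constant loops; the
  track of the base point is a path between them.\<close>

lemma simply_connected_imp_path_connected_UNIV:
 assumes "simply_connected (UNIV :: 'c::topological_space set)"
 shows "path_connected (UNIV :: 'c set)"
 unfolding path_connected_def
proof (intro ballI)
 fix a b :: 'c
 have "homotopic_loops UNIV (%_. a) (%_. b)"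
  using assms unfolding simply_connected_def by (auto simp: path_def pathstart_def pathfinish_def)
 hence "EX H. continuous_on ({0..1::real} \<times> {0..1::real}) H & (ALL x. H (0, x) = a) & (ALL x. H (1, x) = b)"
  unfolding homotopic_loops_def homotopic_with_def by auto
 then obtain H where H: "continuous_on ({0..1::real} \<times> {0..1::real}) H & (ALL x. H (0, x) = a) & (ALL x. H (1, x) = b)" ..
 have "continuous_on {0..1} (%t. H (t, 0))"
  by (rule continuous_on_compose2[OF conjunct1[OF H]]) (auto intro!: continuous_intros)
 thus "EX g. path g & path_image g \<subseteq> UNIV & pathstart g = a & pathfinish g = b"
  using H by (intro exI[of _ "%t. H (t, 0)"]) (auto simp: path_def pathstart_def pathfinish_def)
qed

lemma endpoint_unique:
 fixes \<pi> :: "'c::topological_space => 'm::topological_space"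
 assumes cov: "covering_space UNIV \<pi> UNIV" and sc: "simply_connected (UNIV :: 'c set)"
  and g: "path g" "path g'" "pathstart g = pathstart g'" "pathfinish g = pathfinish g'"
  and h: "path h" "!!t. t \<in> {0..1} ==> \<pi> (h t) = \<pi> (g t)"
  and h': "path h'" "!!t. t \<in> {0..1} ==> \<pi> (h' t) = \<pi> (g' t)" and st: "pathstart h = pathstart h'"
 shows "pathfinish h = pathfinish h'"
proof -
 let ?l = "reversepath g +++ g'" let ?k = "reversepath h +++ h'"
 have "pathfinish ?k = pathstart ?k"
 proof (rule loop_lift_closed[OF cov sc])
  show "path ?l" "pathfinish ?l = pathstart ?l" using g by auto
  show "path ?k" using h h' st by auto
  show "\<pi> (?k t) = \<pi> (?l t)" if "t \<in> {0..1}" for t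
   using that h(2)[of "1 - 2 * t"] h'(2)[of "2 * t - 1"] by (auto simp: joinpaths_def reversepath_def)
 qed
 thus ?thesis by simp
qed

text \<open>The deck transformation transports a path from \<open>x0\<close> to \<open>x\<close> to the path over it that starts at \<open>y0\<close>.\<close>

lemma deck_lift:
 fixes \<pi> :: "'c::topological_space => 'm::topological_space"
 assumes cov: "covering_space UNIV \<pi> UNIV" and sc: "simply_connected (UNIV :: 'c set)" and mf: "manifoldlike TYPE('m)"
  and xy: "\<pi> x0 = \<pi> y0"
 shows "EX r. cont r & \<pi> \<circ> r = \<pi> & r x0 = y0"
proof -
 have c\<pi>: "cont \<pi>" by (rule covering_evenly(2)[OF cov])
 have pc: "path_connected (UNIV :: 'c set)" using sc by (rule simply_connected_imp_path_connected_UNIV)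
 define P where "P g h x \<longleftrightarrow> path g & pathstart g = x0 & pathfinish g = x & path h & pathstart h = y0 &
  (\<forall>t\<in>{0..1}. \<pi> (h t) = \<pi> (g t))" for g h x
 have lift: "EX h. P g h (pathfinish g)" if "path g" "pathstart g = x0" for g
 proof -
  have "path (%t. \<pi> (g t))" using that(1) unfolding path_def by (rule continuous_on_compose2[OF c\<pi>]) simp
  moreover have "\<pi> y0 = pathstart (%t. \<pi> (g t))" using that(2) xy by (simp add: pathstart_def)
  ultimately obtain h where "path h & (\<forall>t\<in>{0..1}. \<pi> (h t) = \<pi> (g t)) & pathstart h = y0"
   using path_lift[OF cov] by blast
  thus ?thesis using that unfolding P_def by blast
 qed
 have ex: "EX g h. P g h x" for x
 proof -
  obtain g where "path g" "pathstart g = x0" "pathfinish g = x"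
   using pc unfolding path_connected_def by blast
  thus ?thesis using lift by blast
 qed
 have uniq: "pathfinish h = pathfinish h'" if "P g h x" "P g' h' x" for g h g' h' x
  by (rule endpoint_unique[OF cov sc, of g g' h h']) (use that in "auto simp: P_def")
 define r where "r x = (SOME y. EX g h. P g h x & y = pathfinish h)" for x
 have r: "r x = pathfinish h" if "P g h x" for g h x
 proof -
  have "\<exists>g' h'. P g' h' x & r x = pathfinish h'" unfolding r_def by (rule someI_ex) (use that in blast)
  thus ?thesis using uniq that by metis
 qed
 have \<pi>r: "\<pi> (r x) = \<pi> x" for x
 proof -
  obtain g h where "P g h x" using ex by blast
  thus ?thesis using r[of g h x] by (auto simp: P_def pathfinish_def)
 qed
 have "r x0 = y0"
 proof -
  have "P (%_. x0) (%_. y0) x0" using xy by (auto simp: P_def path_def pathstart_def pathfinish_def)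
  thus ?thesis using r by (fastforce simp: pathfinish_def)
 qed
 moreover have "cont r"
 proof -
  have "EX O1. open O1 & x \<in> O1 & continuous_on O1 r" for x
  proof -
  obtain T where T0: "\<pi> x \<in> T" "evenly \<pi> T" using covering_evenly(1)[OF cov, of "\<pi> x"] by blast
  then obtain v where v: "\<Union>v = \<pi> -` T" "\<forall>u\<in>v. open u" "pairwise disjnt v" "\<forall>u\<in>v. EX q. homeomorphism u T \<pi> q"
   unfolding evenly_def by (elim conjE exE) (rule that, assumption+)
  have T: "open T" using T0(2) by (simp add: evenly_def)
  have "x \<in> \<Union>v" "r x \<in> \<Union>v" using v(1) T0(1) \<pi>r by auto
  then obtain u w where uw: "u \<in> v" "x \<in> u" "w \<in> v" "r x \<in> w" by (elim UnionE)
  obtain qu where qu: "homeomorphism u T \<pi> qu" using bspec[OF v(4) uw(1)] by blast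
  obtain qw where qw: "homeomorphism w T \<pi> qw" using bspec[OF v(4) uw(3)] by blast
  obtain V where V: "open V" "\<pi> x \<in> V" "V \<subseteq> T" "path_connected V" using mf T T0(1) unfolding manifoldlike_def by blast
  obtain g h where gh: "P g h x" using ex by blast
  let ?O = "u \<inter> \<pi> -` V"
  have opO: "open ?O" using v(2) uw(1) V(1) c\<pi> by (simp add: continuous_open_vimage open_Int continuous_on_open_vimage)
  \<comment> \<open>Continue the path to x by the lift of p into the sheet u, and its partner by the
    lift of p into the sheet w. So near x the map r is \<open>qw\<close> after \<pi>.\<close>
  have loc: "r x' = qw (\<pi> x')" if x': "x' \<in> ?O" for x'
  proof -
   obtain p where p: "path p" "path_image p \<subseteq> V" "pathstart p = \<pi> x" "pathfinish p = \<pi> x'"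
    using V(2,4) x' unfolding path_connected_def by blast
   have pT: "p t \<in> T" if "t \<in> {0..1}" for t
   proof -
    have "p t \<in> path_image p" using that unfolding path_image_def by (rule imageI)
    thus ?thesis using p(2) V(3) by blast
   qed
   let ?a = "%t. qu (p t)" let ?b = "%t. qw (p t)"
   have a: "path ?a" "path ?b"
    using p(1) pT unfolding path_def
    by (auto intro: continuous_on_compose2[OF homeomorphism_cont2[OF qu]] continuous_on_compose2[OF homeomorphism_cont2[OF qw]])
   have a0: "pathstart ?a = x" "pathfinish ?a = x'" "pathstart ?b = r x" "pathfinish ?b = qw (\<pi> x')"
    using p(3,4) x' homeomorphism_apply1[OF qu] homeomorphism_apply1[OF qw uw(4)] uw(2) \<pi>r[of x]
    by (auto simp: pathstart_def pathfinish_def)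
   have "P (g +++ ?a) (h +++ ?b) x'"
    using gh a a0 r[OF gh] homeomorphism_apply2[OF qu pT] homeomorphism_apply2[OF qw pT]
    by (auto simp: P_def joinpaths_def pathstart_join pathfinish_join intro!: path_join_imp simp del: joinpaths_def)
     (auto simp: joinpaths_def)
   from r[OF this] show ?thesis using a0 by simp
  qed
  have "continuous_on ?O (%x. qw (\<pi> x))"
   by (rule continuous_on_compose2[OF homeomorphism_cont2[OF qw] continuous_on_subset[OF c\<pi>]]) (use V(3) in auto)
  hence "continuous_on ?O r" using loc by (simp cong: continuous_on_cong_simp)
  thus ?thesis using opO uw(2) V(2) by (intro exI[of _ ?O]) auto
  qed
  then obtain Q where Q: "!!x. open (Q x)" "!!x. x \<in> Q x" "!!x. continuous_on (Q x) r" by metis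
  hence "continuous_on (\<Union>x\<in>UNIV. Q x) r" by (intro continuous_on_open_UN) auto
  moreover have "(\<Union>x\<in>UNIV. Q x) = UNIV" using Q(2) by auto
  ultimately show ?thesis by simp
 qed
 ultimately show ?thesis using \<pi>r by (intro exI[of _ r]) (auto simp: fun_eq_iff)
qed

text \<open>The maps over \<pi> taking x to y and y to x compose to lifts of \<pi> that fix a point,
  hence to the identity.\<close>

lemma deck_transitive:
 fixes \<pi> :: "'c::topological_space => 'm::topological_space"
 assumes uc: "universal_covering \<pi>" and mf: "manifoldlike TYPE('m)" and xy: "\<pi> x = \<pi> y"
 shows "\<exists>r\<in>deck \<pi>. r x = y"
proof -
 have cov: "covering_space UNIV \<pi> UNIV" and sc: "simply_connected (UNIV :: 'c set)"
  using uc by (auto simp: universal_covering_def)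
 obtain r where r: "cont r" "\<pi> \<circ> r = \<pi>" "r x = y" using deck_lift[OF cov sc mf xy] by blast
 obtain d where d: "cont d" "\<pi> \<circ> d = \<pi>" "d y = x" using deck_lift[OF cov sc mf xy[symmetric]] by blast
 have conn: "connected (UNIV :: 'c set)" using sc by (intro path_connected_imp_connected simply_connected_imp_path_connected_UNIV)
 have id: "a (b z) = z" if "cont a" "cont b" "\<pi> \<circ> a = \<pi>" "\<pi> \<circ> b = \<pi>" "a (b p) = p" for a b :: "'c => 'c" and p z
 proof (rule lift_unique[OF cov conn, where h="%z. a (b z)" and k="%z. z" and a=p])
  show "cont (%z. a (b z))" by (rule continuous_on_compose2[OF that(1,2)]) simp
  show "\<pi> (a (b x)) = \<pi> x" for x using that(3,4) by (metis o_apply)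
 qed (use that(5) in auto)
 have "homeomorphism UNIV UNIV r d"
  using id[OF r(1) d(1) r(2) d(2), of y] id[OF d(1) r(1) d(2) r(2), of x] r d
  unfolding homeomorphism_def by (metis UNIV_I surjI surj_def)
 thus ?thesis using r unfolding deck_def by blast
qed

section \<open>The hyperboloid and its tangent planes\<close>

lemma lor_bil:
 "lor (x + y) z = lor x z + lor y z" "lor (c *\<^sub>R x) z = c * lor x z"
 "lor z (x + y) = lor z x + lor z y" "lor z (c *\<^sub>R x) = c * lor z x"
 "lor (x - y) z = lor x z - lor y z" "lor z (x - y) = lor z x - lor z y" "lor 0 z = 0" "lor z 0 = 0"
 by (simp_all add: lor_def algebra_simps)

lemma lor_sym: "lor x y = lor y x" by (simp add: lor_def mult.commute)

lemma lor_inner: "lor x y = x \<bullet> sharp y" "lor x y = sharp x \<bullet> y"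
 by (simp_all add: lor_def sharp_def inner_vec_def sum_3)

lemma mcross_mult: "mcross X Y *v Z = lor X Z *\<^sub>R Y - lor Y Z *\<^sub>R X"
 by (simp add: vec_eq_iff matrix_vector_mult_def mcross_def lor_def sharp_def sum_3 forall_3 algebra_simps)

lemma trace_form_mcross: "trace_form (mcross X Y) A = lor X (A *v Y) - lor Y (A *v X)"
proof -
 have "lor X (A *v Y) = (\<Sum>i\<in>UNIV. \<Sum>j\<in>UNIV. Y$i * sharp X $ j * A$j$i)" for X Y
  unfolding lor_inner(2) inner_vec_def matrix_vector_mult_def inner_real_def vec_lambda_beta sum_distrib_left
  by (subst sum.swap) (simp add: mult_ac)
 thus ?thesis
  by (simp add: trace_form_def trace_def matrix_matrix_mult_def mcross_def sum_subtractf left_diff_distrib)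
qed

lemma trace_form_sym: "trace_form A B = trace_form B A"
 unfolding trace_form_def by (rule trace_mul_sym)

lemma trace_form_add: "trace_form (A + B) C = trace_form A C + trace_form B C"
 by (simp add: trace_form_def trace_def matrix_matrix_mult_def sum.distrib distrib_right)

lemma trace_form_scale: "trace_form (c *\<^sub>R A) C = c * trace_form A C"
 by (simp add: trace_form_def trace_def matrix_matrix_mult_def sum_distrib_left mult.assoc)

lemma mcross_add: "mcross (x + y) z = mcross x z + mcross y z"
 and mcross_scale: "mcross (c *\<^sub>R x) z = c *\<^sub>R mcross x z"
 by (simp_all add: vec_eq_iff mcross_def sharp_def forall_3 algebra_simps)

lemma linear_mcross: "linear (%x. mcross x z)"
 by (rule linearI) (simp_all add: mcross_add mcross_scale)

lemma hyperboloid_lor: "X \<in> hyperboloid ==> lor X X = -1" by (simp add: hyperboloid_def)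

text \<open>For vectors orthogonal to u the form is doubled; every factor sqrt 2 below originates
  here.\<close>

lemma mcross_ip:
 assumes "lor u u = -1"
 shows "trace_form (mcross v u) (mcross w u) = 2 * (lor v w + lor v u * lor w u)"
 using assms by (simp add: trace_form_mcross mcross_mult lor_bil lor_sym algebra_simps)

lemma tangent_projD: "lor u u = -1 ==> tangent_proj u v \<in> tangent_H u"
 by (simp add: tangent_H_def tangent_proj_def lor_bil)

lemma mcross_tangent_proj: "mcross (tangent_proj u v) u = mcross v u"
 by (simp add: vec_eq_iff tangent_proj_def mcross_def sharp_def forall_3 algebra_simps)

lemma mcross_in_p_space: "lor u u = -1 ==> mcross v u \<in> p_space u"
 unfolding p_space_def by (intro CollectI exI[of _ "tangent_proj u v"]) (simp add: tangent_projD mcross_tangent_proj)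

text \<open>The second vector is the normalised tangential projection of the second coordinate
  vector; the first is orthogonal to it and to X. Both have squared length 1 + (X$2)^2 before
  normalisation.\<close>

definition tE :: "real^3 => nat => real^3" where
 "tE X j = inverse (sqrt (1 + (X$2)^2)) *\<^sub>R
  (if j = 0 then vector [X$3, 0, X$1] else vector [X$1 * X$2, 1 + (X$2)^2, X$2 * X$3])"

lemma tE_props:
 assumes X: "X \<in> hyperboloid"
 shows "lor (tE X 0) (tE X 0) = 1" "lor (tE X 1) (tE X 1) = 1" "lor (tE X 0) (tE X 1) = 0"
  "lor (tE X 0) X = 0" "lor (tE X 1) X = 0"
proof -
 let ?q = "1 + (X$2)^2" let ?r = "inverse (sqrt ?q)"
 have q: "?q > 0" by (simp add: add_pos_nonneg)
 have r: "?r * ?r * ?q = 1" using q by (simp add: field_simps)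
 have h: "X$3 * X$3 = 1 + X$1 * X$1 + X$2 * X$2" using hyperboloid_lor[OF X] by (simp add: lor_def)
 have a: "lor (vector [X$3, 0, X$1]) (vector [X$3, 0, X$1]) = ?q"
  "lor (vector [X$1 * X$2, ?q, X$2 * X$3]) (vector [X$1 * X$2, ?q, X$2 * X$3]) = ?q"
  "lor (vector [X$3, 0, X$1]) (vector [X$1 * X$2, ?q, X$2 * X$3]) = 0"
  "lor (vector [X$3, 0, X$1]) X = 0" "lor (vector [X$1 * X$2, ?q, X$2 * X$3]) X = 0"
 proof -
  show "lor (vector [X$3, 0, X$1]) (vector [X$3, 0, X$1]) = ?q" using h by (simp add: lor_def power2_eq_square)
  show "lor (vector [X$1 * X$2, ?q, X$2 * X$3]) (vector [X$1 * X$2, ?q, X$2 * X$3]) = ?q"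
   unfolding lor_def by (simp add: power2_eq_square) (use h in algebra)
  show "lor (vector [X$1 * X$2, ?q, X$2 * X$3]) X = 0"
   unfolding lor_def by (simp add: power2_eq_square) (use h in algebra)
 qed (simp_all add: lor_def)
 show "lor (tE X 0) (tE X 0) = 1" "lor (tE X 1) (tE X 1) = 1" "lor (tE X 0) (tE X 1) = 0"
  "lor (tE X 0) X = 0" "lor (tE X 1) X = 0"
  using r by (simp_all add: tE_def lor_bil a mult.assoc[symmetric])
qed

lemma subspace_tangent_H: "subspace (tangent_H X)"
 by (simp add: subspace_def tangent_H_def lor_bil)

lemma tangent_span:
 assumes X: "X \<in> hyperboloid"
 shows "span {tE X 0, tE X 1} = tangent_H X"
proof
 note t = tE_props[OF X]
 show "span {tE X 0, tE X 1} \<subseteq> tangent_H X"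
  by (rule span_minimal) (use t subspace_tangent_H in "auto simp: tangent_H_def")
 have t10: "lor (tE X 1) (tE X 0) = 0" using t lor_sym by simp
 have ne: "tE X 0 ~= tE X 1" using t by auto
 have ind: "independent {tE X 0, tE X 1}"
 proof (rule independent_if_scalars_zero)
  fix f x assume s: "(\<Sum>x\<in>{tE X 0, tE X 1}. f x *\<^sub>R x) = 0" and x: "x \<in> {tE X 0, tE X 1}"
  have "f (tE X 0) *\<^sub>R tE X 0 + f (tE X 1) *\<^sub>R tE X 1 = 0" using s ne by simp
  hence "lor (f (tE X 0) *\<^sub>R tE X 0 + f (tE X 1) *\<^sub>R tE X 1) (tE X 0) = 0"
   "lor (f (tE X 0) *\<^sub>R tE X 0 + f (tE X 1) *\<^sub>R tE X 1) (tE X 1) = 0" by (simp_all add: lor_bil)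
  thus "f x = 0" using x t t10 by (auto simp: lor_bil)
 qed simp
 have "sharp X ~= 0"
 proof
  assume "sharp X = 0"
  hence "lor X X = 0" by (simp add: lor_inner)
  thus False using hyperboloid_lor[OF X] by simp
 qed
 moreover have "tangent_H X = {v. sharp X \<bullet> v = 0}" by (auto simp: tangent_H_def lor_inner inner_commute)
 ultimately have "dim (tangent_H X) = 2" using dim_hyperplane[of "sharp X"] by simp
 thus "tangent_H X \<subseteq> span {tE X 0, tE X 1}"
  using card_eq_dim[of "{tE X 0, tE X 1}" "tangent_H X"] ind ne t by (auto simp: tangent_H_def)
qed

lemma tangent_onb:
 assumes X: "X \<in> hyperboloid"
 shows "orthonormal_basis_on (tangent_H X) lor 2 (tE X)"
proof -
 have *: "{..<2::nat} = {0, 1}" by auto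
 show ?thesis using tE_props[OF X] tangent_span[OF X] lor_sym[of "tE X 1" "tE X 0"]
  unfolding orthonormal_basis_on_def orthonormal_on_def
  by (auto simp: * tangent_H_def less_2_cases_iff)
qed

definition pE :: "real^3 => nat => real^3^3" where
 "pE X j = mcross (inverse (sqrt 2) *\<^sub>R tE X j) X"

lemma p_onb:
 assumes X: "X \<in> hyperboloid"
 shows "orthonormal_basis_on (p_space X) trace_form 2 (pE X)"
proof -
 have *: "{..<2::nat} = {0, 1}" by auto
 note t = tE_props[OF X] and u = hyperboloid_lor[OF X]
 have t10: "lor (tE X 1) (tE X 0) = 0" using t lor_sym by simp
 have s: "2 * (inverse (sqrt 2) * inverse (sqrt 2)) = (1::real)"
  by (simp add: field_simps)
 have o: "trace_form (pE X 0) (pE X 0) = 1" "trace_form (pE X 1) (pE X 1) = 1" "trace_form (pE X 0) (pE X 1) = 0"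
  "trace_form (pE X 1) (pE X 0) = 0"
  using t t10 by (simp_all add: pE_def mcross_ip[OF u] lor_bil s)
 have "span {pE X 0, pE X 1} = p_space X"
 proof -
  have "p_space X = (%x. mcross x X) ` span {tE X 0, tE X 1}"
   unfolding tangent_span[OF X] p_space_def by auto
  also have "... = span ((%x. mcross x X) ` {tE X 0, tE X 1})"
   by (rule linear_span_image[OF linear_mcross, symmetric])
  also have "... = span {pE X 0, pE X 1}"
  proof -
   have p: "pE X j = inverse (sqrt 2) *\<^sub>R mcross (tE X j) X" and m: "mcross (tE X j) X = sqrt 2 *\<^sub>R pE X j" for j
    by (simp_all add: pE_def mcross_scale)
   show ?thesis
   proof (rule span_eq[THEN iffD2], intro conjI)
    have "mcross (tE X 0) X \<in> span {pE X 0, pE X 1}" "mcross (tE X 1) X \<in> span {pE X 0, pE X 1}"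
     unfolding m by (intro span_scale span_base, simp)+
    thus "(%x. mcross x X) ` {tE X 0, tE X 1} \<subseteq> span {pE X 0, pE X 1}" by blast
    have "pE X 0 \<in> span ((%x. mcross x X) ` {tE X 0, tE X 1})" "pE X 1 \<in> span ((%x. mcross x X) ` {tE X 0, tE X 1})"
     unfolding p by (intro span_scale span_base, simp)+
    thus "{pE X 0, pE X 1} \<subseteq> span ((%x. mcross x X) ` {tE X 0, tE X 1})" by blast
   qed
  qed
  finally show ?thesis by simp
 qed
 thus ?thesis using o u
  unfolding orthonormal_basis_on_def orthonormal_on_def
  by (auto simp: * less_2_cases_iff pE_def mcross_in_p_space)
qed

text \<open>By \<open>mcross_mult\<close> an element of \<open>p_space u\<close> sends every vector
  orthogonal to u to a multiple of u. This removes the terms with two derivatives of the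
  lift.\<close>

lemma p_section_mult:
 assumes "lor u u = -1" "A = p_proj u A" "lor u x = 0" "lor u y = 0"
 shows "lor (A *v x) y = 0"
proof -
 have "A *v x = mcross (A *v u) u *v x" using assms(2) by (simp add: p_proj_def)
 thus ?thesis using assms by (simp add: mcross_mult lor_bil)
qed

section \<open>Equivariance, and uniqueness of the lift up to \<Gamma>\<close>

lemma SO21_lor: "L \<in> SO21_plus ==> lor (L *v X) (L *v Y) = lor X Y"
 by (simp add: SO21_plus_def)

lemma SO21_inv:
 assumes "L \<in> SO21_plus" shows "invertible L" "matrix_inv L ** L = mat 1" "L ** matrix_inv L = mat 1"
proof -
 show i: "invertible L" using assms by (simp add: invertible_det_nz SO21_plus_def)
 show "matrix_inv L ** L = mat 1" "L ** matrix_inv L = mat 1"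
  using someI_ex[OF i[unfolded invertible_def]] by (simp_all add: matrix_inv_def)
qed

lemma mcross_equivariant:
 assumes L: "L \<in> SO21_plus"
 shows "mcross (L *v X) (L *v Y) = L ** mcross X Y ** matrix_inv L"
proof -
 have "mcross (L *v X) (L *v Y) ** L = L ** mcross X Y"
  by (simp add: matrix_eq matrix_vector_mul_assoc[symmetric] mcross_mult SO21_lor[OF L]
    matrix_vector_mult_diff_distrib matrix_vector_mult_scaleR)
 hence "mcross (L *v X) (L *v Y) ** L ** matrix_inv L = L ** mcross X Y ** matrix_inv L" by simp
 thus ?thesis by (simp add: matrix_mul_assoc[symmetric] SO21_inv[OF L])
qed

lemma trace_form_conj:
 assumes L: "L \<in> SO21_plus"
 shows "trace_form (L ** A ** matrix_inv L) (L ** B ** matrix_inv L) = trace_form A B"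
proof -
 have "L ** A ** matrix_inv L ** (L ** B ** matrix_inv L) = L ** A ** (matrix_inv L ** L) ** B ** matrix_inv L"
  by (simp add: matrix_mul_assoc)
 also have "... = L ** (A ** B) ** matrix_inv L" by (simp add: SO21_inv[OF L] matrix_mul_assoc)
 finally have "trace_form (L ** A ** matrix_inv L) (L ** B ** matrix_inv L) = trace (matrix_inv L ** (L ** (A ** B)))"
  unfolding trace_form_def by (simp only: trace_mul_sym[of "L ** (A ** B)" "matrix_inv L"])
 also have "... = trace_form A B" by (simp add: matrix_mul_assoc SO21_inv[OF L] trace_form_def)
 finally show ?thesis .
qed

lemma p_proj_equivariant:
 assumes L: "L \<in> SO21_plus"
 shows "p_proj (L *v X) (L ** A ** matrix_inv L) = L ** p_proj X A ** matrix_inv L"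
proof -
 have "(L ** A ** matrix_inv L) *v (L *v X) = L *v (A *v X)"
  by (simp add: matrix_vector_mul_assoc matrix_mul_assoc[symmetric] SO21_inv[OF L])
 thus ?thesis by (simp add: p_proj_def mcross_equivariant[OF L])
qed

lemma group_facts:
 assumes G: "closed_surface_group \<Gamma>"
 shows "\<Gamma> \<subseteq> SO21_plus" "mat 1 \<in> \<Gamma>" "L \<in> \<Gamma> ==> L' \<in> \<Gamma> ==> L ** L' \<in> \<Gamma>" "L \<in> \<Gamma> ==> matrix_inv L \<in> \<Gamma>"
  "L \<in> \<Gamma> ==> X \<in> hyperboloid ==> L *v X = X ==> L = mat 1"
  "compact K ==> K \<subseteq> hyperboloid ==> finite {L\<in>\<Gamma>. (*v) L ` K \<inter> K ~= {}}"
proof -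
 from G[unfolded closed_surface_group_def]
 show "\<Gamma> \<subseteq> SO21_plus" "mat 1 \<in> \<Gamma>" "L \<in> \<Gamma> ==> L' \<in> \<Gamma> ==> L ** L' \<in> \<Gamma>" "L \<in> \<Gamma> ==> matrix_inv L \<in> \<Gamma>"
  "L \<in> \<Gamma> ==> X \<in> hyperboloid ==> L *v X = X ==> L = mat 1" by (elim conjE, metis)+
 from G[unfolded closed_surface_group_def]
 show "compact K ==> K \<subseteq> hyperboloid ==> finite {L\<in>\<Gamma>. (*v) L ` K \<inter> K ~= {}}"
  by (elim conjE) (drule spec, erule mp, rule conjI)
qed

text \<open>Deck transformations act without fixed points on lifts, so two lifts of \<open>u\<close> differ by one element of \<open>\<Gamma>\<close>:
 the set where they differ by a given element is open, by proper discontinuity.\<close>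

lemma lifts_differ_by_constant:
 fixes U U' :: "'c::topological_space => real^3"
 assumes G: "closed_surface_group \<Gamma>" and conn: "connected (UNIV :: 'c set)"
  and U: "cont U" "range U \<subseteq> hyperboloid" and U': "cont U'" "range U' \<subseteq> hyperboloid"
  and orb: "!!x. orbit \<Gamma> (U x) = orbit \<Gamma> (U' x)"
 shows "\<exists>L\<in>\<Gamma>. ALL x. U x = L *v U' x"
proof -
 note GS = group_facts(1)[OF G] and G1 = group_facts(2)[OF G] and Gm = group_facts(3)[OF G]
  and Gi = group_facts(4)[OF G] and free = group_facts(5)[OF G] and pd = group_facts(6)[OF G]
 have UH: "U x \<in> hyperboloid" "U' x \<in> hyperboloid" for x using U(2) U'(2) by auto
 have ex: "\<exists>L\<in>\<Gamma>. U x = L *v U' x" for x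
 proof -
  have "U x \<in> orbit \<Gamma> (U x)" using G1 unfolding orbit_def by (force simp: image_iff)
  hence "U x \<in> orbit \<Gamma> (U' x)" by (simp only: orb)
  thus ?thesis unfolding orbit_def by auto
 qed
 have clH: "closed hyperboloid"
 proof -
  have e: "hyperboloid = {X. lor X X = -1} \<inter> {X. 1 <= X$3}" by (auto simp: hyperboloid_def)
  have 1: "closed {X :: real^3. X$1 * X$1 + X$2 * X$2 - X$3 * X$3 = -1}"
   by (rule closed_Collect_eq) (intro continuous_intros)+
  have 2: "closed {X :: real^3. 1 <= X$3}"
   by (rule closed_Collect_le) (intro continuous_intros)+
  show ?thesis unfolding e lor_def by (rule closed_Int[OF 1 2])
 qed
 define A where "A L = {x. U x = L *v U' x}" for L
 have cm: "cont (%X. L *v X)" for L :: "real^3^3" by (intro linear_continuous_on matrix_vector_mul_bounded_linear)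
 have opA: "open (A L)" if L: "L \<in> \<Gamma>" for L
 proof -
  have "EX O1. open O1 & x \<in> O1 & O1 \<subseteq> A L" if x: "x \<in> A L" for x
  proof -
   let ?X = "U x"
   define K where "K = cball ?X 1 \<inter> hyperboloid"
   have K: "compact K" "K \<subseteq> hyperboloid" unfolding K_def using clH by (auto intro: compact_Int_closed)
   \<comment> \<open>By proper discontinuity only finitely many elements other than the identity
     move K so that it meets itself. None of them fixes U x, so all are avoided near x.\<close>
   define F where "F = {L\<in>\<Gamma>. (*v) L ` K \<inter> K ~= {}} - {mat 1}"
   have F: "finite F" unfolding F_def using pd[OF K] by simp
   have V: "cont (%z. L *v U' z)" by (rule continuous_on_compose2[OF cm U'(1)]) simp
   have xL: "L *v U' x = ?X" using x by (simp add: A_def)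
   define O1 where "O1 = U -` ball ?X 1 \<inter> (%z. L *v U' z) -` ball ?X 1 \<inter> (\<Inter>T\<in>F. {z. U z ~= T *v (L *v U' z)})"
   have "open O1"
    unfolding O1_def
   proof (intro open_Int open_INT F ballI)
    show "open (U -` ball ?X 1)" "open ((%z. L *v U' z) -` ball ?X 1)"
     by (intro open_vimage U(1) V open_ball)+
    fix T :: "real^3^3"
    have "cont (%z. T *v (L *v U' z))" by (rule continuous_on_compose2[OF cm V]) simp
    thus "open {z. U z ~= T *v (L *v U' z)}" by (intro open_Collect_neq U(1))
   qed
   moreover have "x \<in> O1"
   proof -
    have "?X ~= T *v ?X" if "T \<in> F" for T
     using free[of T ?X] UH(1) that unfolding F_def by force
    thus ?thesis unfolding O1_def by (simp add: xL)
   qed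
   moreover have "O1 \<subseteq> A L"
   proof
    fix z assume z: "z \<in> O1"
    obtain L' where L': "L' \<in> \<Gamma>" "U z = L' *v U' z" using ex by blast
    let ?T = "L' ** matrix_inv L"
    have TG: "?T \<in> \<Gamma>" using Gm Gi L L'(1) by blast
    have LV: "L *v U' z \<in> hyperboloid"
    proof -
     obtain L2 where "L2 \<in> \<Gamma>" "U z = L2 *v U' z" using ex by blast
     have "lor (L *v U' z) (L *v U' z) = -1" using SO21_lor L GS hyperboloid_lor[OF UH(2)] by (simp add: subsetD)
     \<comment> \<open>The third coordinate has absolute value at least 1 and lies within 1 of a
       number that is at least 1, so it is positive: the point is on the upper sheet.\<close>
     moreover have "(L *v U' z)$3 >= 1"
     proof -
      let ?y = "L *v U' z"
      have "(?y$3)^2 = 1 + (?y$1)^2 + (?y$2)^2" using calculation by (simp add: lor_def power2_eq_square)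
      hence "(?y$3)^2 >= 1" using zero_le_power2[of "?y$1"] zero_le_power2[of "?y$2"] by linarith
      hence "\<bar>?y$3\<bar> >= 1" using abs_le_square_iff[of 1 "?y$3"] by simp
      moreover have "\<bar>?y$3 - ?X$3\<bar> < 1"
       using z component_le_norm_cart[of "?y - ?X" 3] unfolding O1_def by (simp add: dist_norm norm_minus_commute)
      moreover have "?X$3 >= 1" using UH(1)[of x] by (simp add: hyperboloid_def)
      ultimately show ?thesis by linarith
     qed
     ultimately show ?thesis by (simp add: hyperboloid_def)
    qed
    have eq: "?T *v (L *v U' z) = U z"
     using SO21_inv(2)[of L] L GS L'(2) by (simp add: matrix_vector_mul_assoc matrix_mul_assoc[symmetric] subsetD)
    have "U z \<in> K" "L *v U' z \<in> K" using z UH(1) LV unfolding K_def O1_def by auto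
    hence "?T \<in> {L\<in>\<Gamma>. (*v) L ` K \<inter> K ~= {}}" using TG eq by (auto intro!: image_eqI)
    moreover have "?T \<notin> F" using z eq unfolding O1_def by auto
    ultimately have "?T = mat 1" unfolding F_def by blast
    hence "U z = L *v U' z" using eq by simp
    thus "z \<in> A L" by (simp add: A_def)
   qed
   ultimately show ?thesis by blast
  qed
  thus ?thesis by (subst open_subopen) blast
 qed
 obtain x0 :: 'c where True by blast
 obtain L where L: "L \<in> \<Gamma>" "U x0 = L *v U' x0" using ex by blast
 have disj: "A L \<inter> A L' = {}" if "L' \<in> \<Gamma>" "L' ~= L" for L'
 proof (rule ccontr)
  assume "A L \<inter> A L' ~= {}"
  then obtain z where "U z = L *v U' z" "U z = L' *v U' z" unfolding A_def by blast
  hence z: "L *v U' z = L' *v U' z" by simp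
  have "(matrix_inv L ** L') *v U' z = matrix_inv L *v (L *v U' z)" unfolding z by (simp add: matrix_vector_mul_assoc)
  also have "... = U' z" using SO21_inv(2)[of L] L GS by (simp add: matrix_vector_mul_assoc subsetD)
  finally have "matrix_inv L ** L' = mat 1" using free[of "matrix_inv L ** L'" "U' z"] Gm Gi L(1) that(1) UH(2) by blast
  hence "L ** (matrix_inv L ** L') = L" by simp
  hence "L' = L" using SO21_inv(3)[of L] L GS by (simp add: matrix_mul_assoc subsetD)
  thus False using that by simp
 qed
 let ?B = "\<Union>L'\<in>\<Gamma> - {L}. A L'"
 have "open (A L)" "open ?B" using opA L(1) by auto
 moreover have "A L \<inter> ?B = {}" using disj by blast
 moreover have "UNIV \<subseteq> A L \<union> ?B" using ex unfolding A_def by blast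
 moreover have "x0 \<in> A L" using L by (simp add: A_def)
 ultimately have "?B = {}" using conn unfolding connected_def by (metis Int_UNIV_right disjoint_iff empty_iff)
 hence "x \<in> A L" for x using \<open>UNIV \<subseteq> A L \<union> ?B\<close> by blast
 thus ?thesis using L(1) unfolding A_def by blast
qed

section \<open>Charts, metric and area measure of M\<close>

definition cinv :: "'m chart => real^2 => 'm" where
 "cinv c = inv_into (fst c) (snd c)"

locale surf =
 fixes M :: "'m::{t2_space,second_countable_topology} rsurface" and \<pi> :: "'c::topological_space => 'm"
 assumes M: "closed_oriented_riemannian_surface M" and uc: "universal_covering \<pi>"
begin

abbreviation "pdom \<equiv> patch_dom \<pi>"
abbreviation "pinv \<equiv> patch_inv \<pi>"
abbreviation "area_c \<equiv> completion (area M)"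
abbreviation "desc \<equiv> descend M \<pi>"
abbreviation wedge :: "('v => 'v => real) => ('m, 'c, 'v) form1 => ('m, 'c, 'v) form1 => 'm chart => 'c => real"
 where "wedge \<equiv> wedge_density M \<pi>"
abbreviation oform :: "(('c => 'c) => 'v::real_vector => 'v) => ('m, 'c, 'v) form1 => bool" where "oform \<equiv> one_form M \<pi>"

lemma atlas: "oriented_smooth_atlas (charts M)" and metric: "riemannian_metric M" and area_M: "riemannian_area M"
 and compact_M: "compact (UNIV :: 'm set)"
 using M by (auto simp: closed_oriented_riemannian_surface_def)

lemma cov: "covering_space UNIV \<pi> UNIV"
 using uc by (simp add: universal_covering_def)

lemma chart_props:
 assumes "c \<in> charts M"
 shows chart_open: "open (fst c)" and chart_image_open: "open (snd c ` fst c)"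
  and chart_homeo: "homeomorphism (fst c) (snd c ` fst c) (snd c) (cinv c)" (is ?P1)
proof -
 obtain Uc f where c: "c = (Uc, f)" by (cases c)
 have "\<forall>(Uc, f)\<in>charts M. open Uc & open (f ` Uc) & (\<exists>f'. homeomorphism Uc (f ` Uc) f f')"
  using atlas unfolding oriented_smooth_atlas_def by (elim conjE)
 from bspec[OF this assms] have a: "open Uc" "open (f ` Uc)" "\<exists>f'. homeomorphism Uc (f ` Uc) f f'" by (simp_all add: c)
 thus "open (fst c)" "open (snd c ` fst c)" by (simp_all add: c)
 obtain f' where h: "homeomorphism Uc (f ` Uc) f f'" using a(3) by blast
 have inj: "inj_on f Uc" using homeomorphism_apply1[OF h] by (rule inj_on_inverseI)
 show ?P1
 proof -
  have "cinv c y = f' y" if "y \<in> f ` Uc" for y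
   using that homeomorphism_apply1[OF h] inj by (auto simp: c cinv_def)
  hence "homeomorphism Uc (f ` Uc) f (cinv c)"
   using h unfolding homeomorphism_def by (simp cong: continuous_on_cong image_cong)
  thus ?thesis by (simp add: c)
 qed
qed

lemma cinv_simps:
 assumes "c \<in> charts M"
 shows "m \<in> fst c ==> cinv c (snd c m) = m" "y \<in> snd c ` fst c ==> snd c (cinv c y) = y"
  "y \<in> snd c ` fst c ==> cinv c y \<in> fst c"
 using homeomorphism_apply1[OF chart_homeo[OF assms]] homeomorphism_apply2[OF chart_homeo[OF assms]]
  homeomorphism_image2[OF chart_homeo[OF assms]] by auto

lemma chart_cover: "\<exists>c\<in>charts M. m \<in> fst c"
proof -
 have "(\<Union>c\<in>charts M. fst c) = UNIV" using atlas unfolding oriented_smooth_atlas_def by (elim conjE)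
 thus ?thesis by blast
qed

lemma chart_image_open':
 assumes c: "c \<in> charts M" and W: "open W" "W \<subseteq> fst c" shows "open (snd c ` W)"
proof -
 have "openin (top_of_set (fst c)) W" using W by (simp add: openin_open_eq chart_open[OF c])
 hence "openin (top_of_set (snd c ` fst c)) (snd c ` W)"
  using homeomorphism_imp_open_map[OF chart_homeo[OF c]] by blast
 thus ?thesis by (simp add: openin_open_eq chart_image_open[OF c])
qed

lemma chart_preimage_open:
 assumes c: "c \<in> charts M" and V: "open V" "V \<subseteq> snd c ` fst c" shows "open (cinv c ` V)"
proof -
 have "openin (top_of_set (snd c ` fst c)) V" using V by (simp add: openin_open_eq chart_image_open[OF c])
 hence "openin (top_of_set (fst c)) (cinv c ` V)"
  using homeomorphism_imp_open_map[OF homeomorphism_symD[OF chart_homeo[OF c]]] by blast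
 thus ?thesis by (simp add: openin_open_eq chart_open[OF c])
qed

lemma manifoldlike_M: "manifoldlike TYPE('m)"
 unfolding manifoldlike_def
proof (intro allI impI)
 fix m :: 'm and T assume T: "open T & m \<in> T"
 obtain c where c: "c \<in> charts M" "m \<in> fst c" using chart_cover by blast
 have "open (snd c ` (fst c \<inter> T))" using T chart_open[OF c(1)] by (intro chart_image_open'[OF c(1)]) auto
 moreover have "snd c m \<in> snd c ` (fst c \<inter> T)" using c T by blast
 ultimately obtain e where e: "e > 0" "ball (snd c m) e \<subseteq> snd c ` (fst c \<inter> T)" using open_contains_ball by blast
 let ?V = "cinv c ` ball (snd c m) e"
 have sub: "ball (snd c m) e \<subseteq> snd c ` fst c" using e(2) by blast
 have "continuous_on (ball (snd c m) e) (cinv c)"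
  by (rule continuous_on_subset[OF homeomorphism_cont2[OF chart_homeo[OF c(1)]] sub])
 hence "path_connected ?V" by (intro path_connected_continuous_image convex_imp_path_connected convex_ball)
 moreover have "open ?V" by (rule chart_preimage_open[OF c(1) open_ball sub])
 moreover have "m \<in> ?V" using e(1) cinv_simps(1)[OF c(1,2)] by (force intro: image_eqI[where x="snd c m"])
 moreover have "?V \<subseteq> T"
 proof
  fix x assume "x \<in> ?V"
  then obtain y where y: "y \<in> ball (snd c m) e" "x = cinv c y" by blast
  then obtain z where "z \<in> fst c \<inter> T" "y = snd c z" using e(2) by blast
  thus "x \<in> T" using y(2) cinv_simps(1)[OF c(1), of z] by simp
 qed
 ultimately show "EX V. open V & m \<in> V & V \<subseteq> T & path_connected V" by blast
qed

lemma fibre_deck: "\<pi> x = \<pi> y ==> \<exists>r\<in>deck \<pi>. r x = y"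
 by (rule deck_transitive[OF uc manifoldlike_M])

lemma pi_open: "open W ==> open (\<pi> ` W)"
proof -
 assume W: "open W"
 have "EX T. open T & \<pi> x \<in> T & T \<subseteq> \<pi> ` W" if x: "x \<in> W" for x
 proof -
  obtain T where T: "\<pi> x \<in> T" "evenly \<pi> T" using covering_evenly(1)[OF cov] by blast
  then obtain v where v: "\<Union>v = \<pi> -` T" "\<forall>u\<in>v. open u" "pairwise disjnt v" "\<forall>u\<in>v. EX q. homeomorphism u T \<pi> q"
   unfolding evenly_def by (elim conjE exE) (rule that, assumption+)
  have oT: "open T" using T(2) by (simp add: evenly_def)
  have "x \<in> \<Union>v" unfolding v(1) using T(1) by simp
  then obtain u where u: "u \<in> v" "x \<in> u" by blast
  then obtain q where q: "homeomorphism u T \<pi> q" using v(4) by blast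
  have "open u" using v(2) u(1) by blast
  hence "openin (top_of_set u) (u \<inter> W)" using W by (simp add: openin_open_Int)
  hence "openin (top_of_set T) (\<pi> ` (u \<inter> W))" by (rule homeomorphism_imp_open_map[OF q])
  hence "open (\<pi> ` (u \<inter> W))" using oT by (simp add: openin_open_eq)
  thus ?thesis using u(2) x by blast
 qed
 thus "open (\<pi> ` W)" by (subst open_subopen) blast
qed

lemma patch_props:
 assumes p: "patch M \<pi> c W"
 shows "c \<in> charts M" "open W" "inj_on \<pi> W" "\<pi> ` W \<subseteq> fst c" "open (pdom c W)" "pdom c W \<subseteq> snd c ` fst c" (is ?P1)
  "y \<in> pdom c W ==> pinv c W y \<in> W"
  "y \<in> pdom c W ==> snd c (\<pi> (pinv c W y)) = y"
  "y \<in> pdom c W ==> \<pi> (pinv c W y) = cinv c y"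
  "continuous_on (pdom c W) (pinv c W)" (is ?P2)
  "m \<in> fst c ==> snd c m \<in> pdom c W ==> m \<in> \<pi> ` W"
proof -
 show c: "c \<in> charts M" and W: "open W" and i: "inj_on \<pi> W" and s: "\<pi> ` W \<subseteq> fst c" using p by (auto simp: patch_def)
 have d: "pdom c W = snd c ` \<pi> ` W" by (auto simp: patch_dom_def)
 show o: "open (pdom c W)" unfolding d by (rule chart_image_open'[OF c pi_open[OF W] s])
 show ?P1 unfolding d using s by blast
 have inj: "inj_on (snd c \<circ> \<pi>) W"
  by (rule comp_inj_on[OF i]) (use cinv_simps(1)[OF c] s in \<open>auto intro: inj_on_inverseI[of _ "cinv c"]\<close>)
 show 1: "pinv c W y \<in> W" if "y \<in> pdom c W" for y
  using that unfolding patch_inv_def patch_dom_def by (rule inv_into_into)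
 show 2: "snd c (\<pi> (pinv c W y)) = y" if "y \<in> pdom c W" for y
  using f_inv_into_f[OF that[unfolded patch_dom_def]] by (simp add: patch_inv_def)
 show "\<pi> (pinv c W y) = cinv c y" if "y \<in> pdom c W" for y
  using 2[OF that] 1[OF that] s cinv_simps(1)[OF c, of "\<pi> (pinv c W y)"] by auto
 show "m \<in> \<pi> ` W" if t: "m \<in> fst c" "snd c m \<in> pdom c W"
 proof -
  obtain x where x: "x \<in> W" "snd c m = snd c (\<pi> x)" using t(2) unfolding patch_dom_def by auto
  have "m = \<pi> x" using cinv_simps(1)[OF c t(1)] cinv_simps(1)[OF c, of "\<pi> x"] x s by auto
  thus ?thesis using x by blast
 qed
 show ?P2
  unfolding continuous_on_open_vimage[OF o]
 proof (intro allI impI)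
  fix B :: "'c set" assume B: "open B"
  have "pinv c W -` B \<inter> pdom c W = snd c ` \<pi> ` (B \<inter> W)"
  proof
   show "pinv c W -` B \<inter> pdom c W \<subseteq> snd c ` \<pi> ` (B \<inter> W)" using 1 2 by force
   show "snd c ` \<pi> ` (B \<inter> W) \<subseteq> pinv c W -` B \<inter> pdom c W"
   proof
    fix y assume "y \<in> snd c ` \<pi> ` (B \<inter> W)"
    then obtain x where x: "x \<in> B" "x \<in> W" "y = (snd c \<circ> \<pi>) x" by auto
    have "pinv c W y = x" unfolding patch_inv_def x(3) by (rule inv_into_f_f[OF inj x(2)])
    thus "y \<in> pinv c W -` B \<inter> pdom c W" using x by (auto simp: patch_dom_def)
   qed
  qed
  moreover have "open (snd c ` \<pi> ` (B \<inter> W))"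
   by (rule chart_image_open'[OF c pi_open]) (use B W s in auto)
  ultimately show "open (pinv c W -` B \<inter> pdom c W)" by simp
 qed
qed

lemma patch_exists: "EX c W. patch M \<pi> c W & m \<in> \<pi> ` W"
proof -
 obtain c where c: "c \<in> charts M" "m \<in> fst c" using chart_cover by blast
 obtain T where T: "m \<in> T" "evenly \<pi> T" using covering_evenly(1)[OF cov] by blast
 then obtain v where v: "\<Union>v = \<pi> -` T" "\<forall>u\<in>v. open u" "pairwise disjnt v" "\<forall>u\<in>v. EX q. homeomorphism u T \<pi> q"
  unfolding evenly_def by (elim conjE exE) (rule that, assumption+)
 obtain x where x: "\<pi> x = m" using covering_evenly(3)[OF cov] by (metis surjD)
 have "x \<in> \<Union>v" unfolding v(1) using T(1) x by simp
 then obtain u where u: "u \<in> v" "x \<in> u" by blast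
 then obtain q where q: "homeomorphism u T \<pi> q" using v(4) by blast
 have "inj_on \<pi> u" using homeomorphism_apply1[OF q] by (rule inj_on_inverseI)
 moreover have "open (\<pi> -` fst c)"
  using continuous_on_open_vimage[OF open_UNIV, of \<pi>] covering_evenly(2)[OF cov] chart_open[OF c(1)] by auto
 ultimately have "patch M \<pi> c (u \<inter> \<pi> -` fst c)"
  using v(2) u c unfolding patch_def by (auto intro: inj_on_subset)
 thus ?thesis using x u c by blast
qed

lemma gram_props:
 assumes c: "c \<in> charts M" and m: "m \<in> fst c"
 shows "transpose (gram M c m) = gram M c m" (is ?P1) "v ~= 0 ==> v \<bullet> (gram M c m *v v) > 0" "det (gram M c m) > 0"
  "matrix_inv (gram M c m) = (\<chi> i j. (if i = j then gram M c m $ (if i = 1 then 2 else 1) $ (if i = 1 then 2 else 1)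
   else - gram M c m $ i $ j) / det (gram M c m))"
proof -
 have *: "transpose (gram M c m) = gram M c m & (ALL v. v ~= 0 --> v \<bullet> (gram M c m *v v) > 0)"
  using metric c m unfolding riemannian_metric_def by blast
 show 1: ?P1 using * by blast
 have 2: "v \<bullet> (gram M c m *v v) > 0" if "v ~= 0" for v using * that by blast
 thus "v ~= 0 ==> v \<bullet> (gram M c m *v v) > 0" .
 let ?G = "gram M c m"
 have s: "?G$2$1 = ?G$1$2" using arg_cong[OF 1, of "%A. A$1$2"] by (simp add: transpose_def)
 have a: "?G$1$1 > 0" using 2[of "axis 1 1"] by (simp add: inner_vec_def sum_2 matrix_vector_mult_def axis_def vec_eq_iff forall_2)
 \<comment> \<open>Positivity of the quadratic form at this vector reads G11 * det G > 0.\<close>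
 let ?v = "vector [- ?G$1$2, ?G$1$1] :: real^2"
 have "?v ~= 0" using a by (auto simp: vec_eq_iff forall_2)
 from 2[OF this] have "?G$1$1 * (?G$1$1 * ?G$2$2 - ?G$1$2 * ?G$1$2) > 0"
  by (simp add: inner_vec_def sum_2 matrix_vector_mult_def s algebra_simps)
 thus d: "det ?G > 0" using a by (simp add: det_2 s zero_less_mult_iff)
 let ?B = "(\<chi> i j. (if i = j then ?G $ (if i = 1 then 2 else 1) $ (if i = 1 then 2 else 1) else - ?G $ i $ j) / det ?G)"
 have "?G ** ?B = mat 1"
 proof -
  have D: "?G$1$1 * ?G$2$2 - ?G$1$2 * ?G$1$2 = det ?G" by (simp add: det_2 s)
  have "(?G$1$1 * ?G$2$2 - ?G$1$2 * ?G$1$2) / det ?G = 1" unfolding D using d by simp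
  thus ?thesis
   by (simp add: vec_eq_iff forall_2 matrix_matrix_mult_def sum_2 mat_def s diff_divide_distrib mult_ac)
 qed
 thus "matrix_inv ?G = ?B" by (rule matrix_inv_unique)
qed

lemma jac_props:
 assumes c: "c \<in> charts M" "c' \<in> charts M" and m: "m \<in> fst c" "m \<in> fst c'"
 shows "det (trans_jac c c' m) > 0" "gram M c m = transpose (trans_jac c c' m) ** gram M c' m ** trans_jac c c' m" (is ?P1)
  "sqrt (det (gram M c m)) = det (trans_jac c c' m) * sqrt (det (gram M c' m))" (is ?P2)
proof -
 show d: "det (trans_jac c c' m) > 0" using atlas c m unfolding oriented_smooth_atlas_def by blast
 show g: ?P1
  using metric c m unfolding riemannian_metric_def by blast
 have "det (gram M c m) = (det (trans_jac c c' m))^2 * det (gram M c' m)"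
  by (subst g) (simp add: det_mul power2_eq_square mult_ac)
 thus ?P2
  using d by (simp add: real_sqrt_mult)
qed

lemma gram_continuous:
 assumes c: "c \<in> charts M"
 shows "continuous_on (snd c ` fst c) (%y. gram M c (cinv c y))"
proof -
 have "smooth_on (snd c ` fst c) (%y. gram M c (cinv c y))"
  using metric c unfolding riemannian_metric_def cinv_def by blast
 thus ?thesis unfolding smooth_on_def by (metis ck_on.simps(1))
qed

end

text \<open>Functions obtained by \<open>descend\<close> are controlled only almost everywhere; for
  the completed measure, agreement with a measurable function outside a null set suffices.\<close>

lemma completion_measurable_AE:
 fixes F F' :: "'a => real"
 assumes F': "F' \<in> borel_measurable N" and ae: "AE x in N. F x = F' x"
 shows "F \<in> borel_measurable (completion N)"
proof (rule measurableI)
 fix A :: "real set" assume A: "A \<in> sets borel"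
 let ?S = "space (completion N)"
 have "Measurable.pred (completion N) (%x. F x ~= F' x)" "Measurable.pred (completion N) (%x. F x ~= F' x & F x \<in> A)"
  by (rule sets_completion_AE, use ae in eventually_elim, simp)+
 hence 1: "{x\<in>?S. F x ~= F' x} \<in> sets (completion N)" "{x\<in>?S. F x ~= F' x & F x \<in> A} \<in> sets (completion N)"
  by (auto simp: pred_def)
 have 2: "F' -` A \<inter> ?S \<in> sets (completion N)"
  using measurable_sets[OF measurable_completion[OF F'] A] .
 have "F -` A \<inter> ?S = (F' -` A \<inter> ?S - {x\<in>?S. F x ~= F' x}) \<union> {x\<in>?S. F x ~= F' x & F x \<in> A}" by auto
 thus "F -` A \<inter> ?S \<in> sets (completion N)" using 1 2 by auto
qed simp

lemma completion_integral_AE: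
 fixes F F' :: "'a => real"
 assumes F': "integrable N F'" and ae: "AE x in N. F x = F' x"
 shows "integrable (completion N) F" "integral\<^sup>L (completion N) F = integral\<^sup>L N F'" (is ?P1)
proof -
 have m: "F' \<in> borel_measurable N" using F' by auto
 have Fm: "F \<in> borel_measurable (completion N)" by (rule completion_measurable_AE[OF m ae])
 have ae': "AE x in completion N. F x = F' x" by (rule AE_completion[OF ae])
 have i: "integrable (completion N) F'" using F' by (simp add: integrable_completion[OF m])
 thus "integrable (completion N) F"
  by (rule integrable_cong_AE_imp[OF _ Fm]) (use ae' in eventually_elim, simp)
 have "integral\<^sup>L (completion N) F = integral\<^sup>L (completion N) F'"
  by (rule integral_cong_AE[OF Fm _ ae']) (use i in auto)
 also have "... = integral\<^sup>L N F'" by (rule integral_completion[OF m])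
 finally show ?P1 .
qed

context surf begin

definition sd :: "'m chart => real^2 => real" where
 "sd c y = sqrt (det (gram M c (cinv c y)))"

lemma sd_pos: "c \<in> charts M ==> y \<in> snd c ` fst c ==> sd c y > 0"
 unfolding sd_def using gram_props(3)[of c "cinv c y"] cinv_simps(3)[of c y] by simp

lemma sd_continuous:
 assumes c: "c \<in> charts M" shows "continuous_on (snd c ` fst c) (sd c)"
proof -
 have g: "continuous_on (snd c ` fst c) (%y. gram M c (cinv c y) $ i $ j)" for i j
  by (intro continuous_intros gram_continuous[OF c])
 show ?thesis unfolding sd_def det_2 by (intro continuous_intros g)
qed

lemma sets_area: "sets (area M) = sets borel"
 using area_M by (simp add: riemannian_area_def)

lemma space_area: "space (area M) = UNIV"
 using sets_eq_imp_space_eq[OF sets_area] by simp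

lemma area_emeasure:
 assumes c: "c \<in> charts M" and S: "S \<in> sets borel" "S \<subseteq> fst c"
 shows "emeasure (area M) S = (\<integral>\<^sup>+ y. ennreal (sd c y) * indicator (snd c ` S) y \<partial>lborel)"
proof -
 obtain Uc Q where c': "c = (Uc, Q)" by (cases c)
 have "\<forall>(U, Q)\<in>charts M. \<forall>S \<in> sets borel. S \<subseteq> U -->
    emeasure (area M) S =
     (\<integral>\<^sup>+ y. ennreal (sqrt (det (gram M (U, Q) (inv_into U Q y)))) * indicator (Q ` S) y \<partial>lborel)"
  using area_M unfolding riemannian_area_def by (elim conjE)
 from bspec[OF this c] show ?thesis using S by (simp add: c' sd_def cinv_def)
qed

lemma chart_borel: "c \<in> charts M ==> fst c \<in> sets borel" "c \<in> charts M ==> snd c ` fst c \<in> sets borel"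
 using chart_open chart_image_open by auto

lemma chart_measurable:
 assumes c: "c \<in> charts M"
 shows "snd c \<in> restrict_space (area M) (fst c) \<rightarrow>\<^sub>M borel"
proof -
 have "snd c \<in> borel_measurable (restrict_space borel (fst c))"
  by (rule borel_measurable_continuous_on_restrict[OF homeomorphism_cont1[OF chart_homeo[OF c]]])
 moreover have "sets (restrict_space (area M) (fst c)) = sets (restrict_space borel (fst c))"
  by (rule sets_restrict_space_cong[OF sets_area])
 ultimately show ?thesis using measurable_cong_sets by blast
qed

lemma chart_preimage_borel:
 assumes c: "c \<in> charts M" and A: "A \<in> sets borel"
 shows "snd c -` A \<inter> fst c \<in> sets borel" (is ?P1) "snd c ` (snd c -` A \<inter> fst c) = A \<inter> snd c ` fst c"
proof -
 have "snd c -` A \<inter> space (restrict_space (area M) (fst c)) \<in> sets (restrict_space (area M) (fst c))"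
  by (rule measurable_sets[OF chart_measurable[OF c] A])
 hence "snd c -` A \<inter> fst c \<in> sets (restrict_space (area M) (fst c))" by (simp add: space_restrict_space space_area)
 thus ?P1
  using chart_borel(1)[OF c] by (subst (asm) sets_restrict_space_iff) (auto simp: sets_area space_area)
qed auto

lemma chart_distr:
 assumes c: "c \<in> charts M"
 shows "distr (restrict_space (area M) (fst c)) borel (snd c) = density lborel (%y. ennreal (indicator (snd c ` fst c) y * sd c y))"
proof (rule measure_eqI)
 fix A assume "A \<in> sets (distr (restrict_space (area M) (fst c)) borel (snd c))"
 hence A: "A \<in> sets borel" by simp
 note p = chart_preimage_borel[OF c A]
 have m: "(%y. indicator (snd c ` fst c) y * sd c y) \<in> bor"
  using borel_measurable_continuous_on_indicator[OF chart_borel(2)[OF c] sd_continuous[OF c]] by simp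
 have "emeasure (distr (restrict_space (area M) (fst c)) borel (snd c)) A = emeasure (restrict_space (area M) (fst c)) (snd c -` A \<inter> fst c)"
  using emeasure_distr[OF chart_measurable[OF c] A] by (simp add: space_restrict_space space_area)
 also have "... = emeasure (area M) (snd c -` A \<inter> fst c)"
  by (rule emeasure_restrict_space) (use chart_borel(1)[OF c] in "auto simp: sets_area space_area")
 also have "... = (\<integral>\<^sup>+ y. ennreal (sd c y) * indicator (A \<inter> snd c ` fst c) y \<partial>lborel)"
  unfolding area_emeasure[OF c p(1) Int_lower2] p(2) ..
 also have "... = (\<integral>\<^sup>+ y. ennreal (indicator (snd c ` fst c) y * sd c y) * indicator A y \<partial>lborel)"
  by (rule nn_integral_cong) (auto simp: indicator_def)
 also have "... = emeasure (density lborel (%y. ennreal (indicator (snd c ` fst c) y * sd c y))) A"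
  using m A by (subst emeasure_density) auto
 finally show "emeasure (distr (restrict_space (area M) (fst c)) borel (snd c)) A =
  emeasure (density lborel (%y. ennreal (indicator (snd c ` fst c) y * sd c y))) A" .
qed simp

lemma chart_integral_borel:
 fixes k :: plane
 assumes c: "c \<in> charts M" and k: "k \<in> bor"
  and i: "lint (%y. indicator (snd c ` fst c) y * sd c y * k y)"
 shows "integrable (area M) (%m. indicator (fst c) m * k (snd c m))" (is ?P1)
  "(\<integral>m. indicator (fst c) m * k (snd c m) \<partial>area M) = (LI y. indicator (snd c ` fst c) y * sd c y * k y)"
proof -
 let ?w = "%y. indicator (snd c ` fst c) y * sd c y"
 have m: "?w \<in> bor"
  using borel_measurable_continuous_on_indicator[OF chart_borel(2)[OF c] sd_continuous[OF c]] by simp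
 have nn: "AE y in lborel. 0 <= ?w y" using sd_pos[OF c] by (auto simp: indicator_def less_imp_le)
 have km: "k \<in> borel_measurable lborel" and wm: "?w \<in> borel_measurable lborel" using k m by simp_all
 have fc: "fst c \<inter> space (area M) \<in> sets (area M)" using chart_borel(1)[OF c] by (simp add: sets_area space_area)
 have "integrable (density lborel (%y. ennreal (?w y))) k" using i by (subst integrable_density[OF km wm nn]) simp
 hence "integrable (distr (restrict_space (area M) (fst c)) borel (snd c)) k" by (simp only: chart_distr[OF c])
 hence "integrable (restrict_space (area M) (fst c)) (%m. k (snd c m))"
  by (subst (asm) integrable_distr_eq[OF chart_measurable[OF c] k])
 thus ?P1
  by (subst (asm) integrable_restrict_space[OF fc]) simp
 have "(\<integral>m. indicator (fst c) m * k (snd c m) \<partial>area M) = (\<integral>m. k (snd c m) \<partial>restrict_space (area M) (fst c))"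
  by (subst integral_restrict_space[OF fc]) simp
 also have "... = integral\<^sup>L (distr (restrict_space (area M) (fst c)) borel (snd c)) k"
  by (rule integral_distr[OF chart_measurable[OF c] k, symmetric])
 also have "... = (LI y. ?w y * k y)"
  unfolding chart_distr[OF c] by (subst integral_density[OF km wm nn]) simp
 finally show "(\<integral>m. indicator (fst c) m * k (snd c m) \<partial>area M) = (LI y. ?w y * k y)" .
qed

lemma chart_AE:
 assumes c: "c \<in> charts M" and P: "AE y in lborel. y \<in> snd c ` fst c --> P (cinv c y)"
 shows "AE m in area M. m \<in> fst c --> P m"
proof -
 obtain N where N: "{y \<in> space lborel. \<not> (y \<in> snd c ` fst c --> P (cinv c y))} \<subseteq> N" "emeasure lborel N = 0" "N \<in> sets lborel"
  using AE_E[OF P] by blast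
 have Nb: "N \<in> sets borel" using N(3) by simp
 let ?S = "snd c -` N \<inter> fst c"
 note p = chart_preimage_borel[OF c Nb]
 have "emeasure (area M) ?S = (\<integral>\<^sup>+ y. ennreal (sd c y) * indicator (N \<inter> snd c ` fst c) y \<partial>lborel)"
  unfolding area_emeasure[OF c p(1) Int_lower2] p(2) ..
 also have "... = nn_integral lborel (%y::real^2. 0)"
 proof (rule nn_integral_cong_AE)
  have "N \<in> null_sets lborel" using N(2,3) by auto
  hence "AE y in lborel. y \<notin> N" by (rule AE_not_in)
  thus "AE y in lborel. ennreal (sd c y) * indicator (N \<inter> snd c ` fst c) y = 0" by eventually_elim simp
 qed
 finally have null: "?S \<in> null_sets (area M)" using p(1) by (simp add: null_sets_def sets_area)
 have "{m \<in> space (area M). \<not> (m \<in> fst c --> P m)} \<subseteq> ?S"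
 proof
  fix m assume "m \<in> {m \<in> space (area M). \<not> (m \<in> fst c --> P m)}"
  hence "m \<in> fst c" "\<not> P (cinv c (snd c m))" using cinv_simps(1)[OF c] by auto
  thus "m \<in> ?S" using N(1) by auto
 qed
 thus ?thesis by (rule AE_I'[OF null])
qed

text \<open>f includes the area density and need agree with F only almost everywhere, so no
  measurability of F is presupposed.\<close>

lemma chart_integral:
 assumes c: "c \<in> charts M" and F: "!!m. m \<notin> fst c ==> F m = 0"
  and f: "f \<in> bor" "AE y in lborel. y \<in> snd c ` fst c --> F (cinv c y) * sd c y = f y"
  and i: "lint (%y. indicator (snd c ` fst c) y * f y)"
 shows "integrable area_c F" "integral\<^sup>L area_c F = (LI y. indicator (snd c ` fst c) y * f y)" (is ?P1)
proof -
 \<comment> \<open>Dividing out the density gives a Borel representative of F in coordinates;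
   outside the chart the quotient is 0 by the convention for division.\<close>
 define k where "k y = f y / (indicator (snd c ` fst c) y * sd c y)" for y
 have m: "(%y. indicator (snd c ` fst c) y * sd c y) \<in> bor"
  using borel_measurable_continuous_on_indicator[OF chart_borel(2)[OF c] sd_continuous[OF c]] by simp
 have k: "k \<in> bor" unfolding k_def[abs_def] by (rule borel_measurable_divide[OF f(1) m])
 have e: "(%y. indicator (snd c ` fst c) y * sd c y * k y) = (%y. indicator (snd c ` fst c) y * f y)"
 proof
  fix y show "indicator (snd c ` fst c) y * sd c y * k y = indicator (snd c ` fst c) y * f y"
   using sd_pos[OF c, of y] by (cases "y \<in> snd c ` fst c") (auto simp: k_def)
 qed
 have i': "lint (%y. indicator (snd c ` fst c) y * sd c y * k y)" unfolding e by (rule i)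
 note B = chart_integral_borel[OF c k i']
 have "AE y in lborel. y \<in> snd c ` fst c --> F (cinv c y) = k (snd c (cinv c y))"
  using f(2)
 proof eventually_elim
  case (elim y)
  thus ?case using sd_pos[OF c, of y] cinv_simps(2)[OF c, of y] by (auto simp: k_def field_simps)
 qed
 from chart_AE[OF c this[folded]] have "AE m in area M. m \<in> fst c --> F m = k (snd c m)" .
 hence ae: "AE m in area M. F m = indicator (fst c) m * k (snd c m)"
  by eventually_elim (use F in "auto simp: indicator_def")
 show "integrable area_c F" by (rule completion_integral_AE(1)[OF B(1) ae])
 show ?P1
  using completion_integral_AE(2)[OF B(1) ae] B(2) e by simp
qed

end

section \<open>Components of weakly differentiable maps\<close>

lemma linear_vec2:
 assumes "linear (F :: real^2 => 'v::real_vector)"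
 shows "F v = v$1 *\<^sub>R F ax1 + v$2 *\<^sub>R F ax2"
proof -
 have "v = v$1 *\<^sub>R axis 1 1 + v$2 *\<^sub>R axis 2 1" by (simp add: vec_eq_iff forall_2 axis_def)
 thus ?thesis using linear_add[OF assms] linear_scale[OF assms] by metis
qed

lemma test_function_C1:
 assumes "test_function D e"
 obtains K where "C1 e (%y. pd 1 e y) (%y. pd 2 e y)"
  "compact K" "K \<subseteq> D" "supp_in K e"
proof -
 have "ck_on (Suc 0) UNIV e" using assms unfolding test_function_def smooth_on_def by blast
 hence d: "e differentiable_on UNIV" and c: "!!v. cont (%y. frechet_derivative e (at y) v)" by simp_all
 have "(e has_derivative (%v. v$1 * pd 1 e y + v$2 * pd 2 e y)) (at y)" for y
 proof -
  have h: "(e has_derivative frechet_derivative e (at y)) (at y)"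
   using d by (simp add: differentiable_on_def frechet_derivative_works)
  have "frechet_derivative e (at y) = (%v. v$1 * pd 1 e y + v$2 * pd 2 e y)"
  proof
   fix v show "frechet_derivative e (at y) v = v$1 * pd 1 e y + v$2 * pd 2 e y"
    using linear_vec2[OF has_derivative_linear[OF h], of v] by (simp only: real_scaleR_def)
  qed
  from has_derivative_eq_rhs[OF h this] show ?thesis .
 qed
 hence C: "C1 e (%y. pd 1 e y) (%y. pd 2 e y)"
  using c by (simp add: C1_def)
 obtain K where "compact K" "K \<subseteq> D" "ALL y. y \<notin> K --> e y = 0" using assms unfolding test_function_def by blast
 thus thesis using that C by (simp add: supp_in_def)
qed

lemma power_le_powr:
 fixes x :: real
 assumes "x >= 0" "real k <= p"
 shows "x ^ k <= x powr p + 1"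
proof (cases "x >= 1")
 case True
 hence "x ^ k = x powr real k" by (simp add: powr_realpow)
 also have "... <= x powr p" using powr_mono[OF assms(2) True] .
 finally show ?thesis by simp
next
 case False
 hence "x ^ k <= 1" using assms by (simp add: power_le_one)
 thus ?thesis using powr_ge_zero[of x p] by linarith
qed

text \<open>Extension by zero makes a component Borel on the whole plane; on compact sets x^k <= x
  powr p + 1 lowers the exponent.\<close>

lemma loc_Lp_comp:
 fixes f :: "real^2 => 'v::euclidean_space"
 assumes f: "loc_Lp D p f"
 shows "p >= 1 ==> loc1 D (%y. indicator D y * (f y \<bullet> b))" "p >= 2 ==> loc2 D (%y. indicator D y * (f y \<bullet> b))"
proof -
 let ?g = "%y. indicat_real D y * (f y \<bullet> b)"
 have "(%y. indicat_real D y *\<^sub>R f y) \<in> bor" using f by (simp add: loc_Lp_def set_borel_measurable_def)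
 hence "(%y. (indicat_real D y *\<^sub>R f y) \<bullet> b) \<in> bor" by measurable
 hence m: "?g \<in> bor" by simp
 have I: "lint (%y. indicator K y * ?g y ^ k)" if K: "compact K" "K \<subseteq> D" and k: "real k <= p" for K k
 proof (rule Bochner_Integration.integrable_bound)
  show "lint (%y. norm b ^ k * (indicator K y * norm (f y) powr p + indicator K y))"
   using f K integrable_indicator_compact[OF K(1)] unfolding loc_Lp_def set_integrable_def
   by (intro integrable_mult_right Bochner_Integration.integrable_add) auto
  have "K \<in> sets borel" using K by (simp add: borel_compact)
  thus "(%y. indicator K y * ?g y ^ k) \<in> borel_measurable lborel" using m by measurable
  show "AE y in lborel. norm (indicator K y * ?g y ^ k) <= norm (norm b ^ k * (indicator K y * norm (f y) powr p + indicator K y))"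
  proof (rule AE_I2)
   fix y
   have "\<bar>f y \<bullet> b\<bar> ^ k <= (norm b * norm (f y)) ^ k"
    using Cauchy_Schwarz_ineq2[of "f y" b] by (intro power_mono) (simp_all add: mult.commute)
   also have "... <= norm b ^ k * (norm (f y) powr p + 1)"
    unfolding power_mult_distrib by (intro mult_left_mono power_le_powr k) simp_all
   finally show "norm (indicator K y * ?g y ^ k) <= norm (norm b ^ k * (indicator K y * norm (f y) powr p + indicator K y))"
    using K(2) by (auto simp: indicator_def power_abs)
  qed
 qed
 show "loc1 D ?g" if "p >= 1" using m I[of _ 1] that by (simp add: loc1_def)
 show "loc2 D ?g" if "p >= 2" using m I[of _ 2] that by (simp add: loc2_def)
qed

lemma loc_Lp_mult_integrable:
 fixes f :: "real^2 => 'v::euclidean_space"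
 assumes f: "loc_Lp D 1 f" and h: "cont h" "compact K" "K \<subseteq> D" "supp_in K h"
 shows "lint (%y. h y *\<^sub>R (indicat_real D y *\<^sub>R f y))"
proof -
 obtain B where B: "B >= 0" "!!y. \<bar>h y\<bar> <= B" using bounded_compact_supp[OF h(1,2,4)] by metis
 have fm: "(%y. indicat_real D y *\<^sub>R f y) \<in> bor" using f by (simp add: loc_Lp_def set_borel_measurable_def)
 have hm: "h \<in> bor" by (rule borel_measurable_continuous_onI[OF h(1)])
 have "lint (%y. B * (indicator K y * norm (f y)))"
  using f h(2,3) by (intro integrable_mult_right) (auto simp: loc_Lp_def set_integrable_def)
 thus ?thesis
 proof (rule Bochner_Integration.integrable_bound)
  show "(%y. h y *\<^sub>R (indicat_real D y *\<^sub>R f y)) \<in> borel_measurable lborel" using fm hm by measurable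
  show "AE y in lborel. norm (h y *\<^sub>R (indicat_real D y *\<^sub>R f y)) <= norm (B * (indicator K y * norm (f y)))"
  proof (rule AE_I2)
   fix y show "norm (h y *\<^sub>R (indicat_real D y *\<^sub>R f y)) <= norm (B * (indicator K y * norm (f y)))"
   proof (cases "y \<in> K")
    case True thus ?thesis using B h(3) by (auto simp: abs_mult intro!: mult_mono)
   next
    case False thus ?thesis using h(4) B by (simp add: supp_in_def)
   qed
  qed
 qed
qed

lemma loc_Lp_mult_inner:
 fixes f :: "real^2 => 'v::euclidean_space"
 assumes f: "loc_Lp D 1 f" and h: "cont h" "compact K" "K \<subseteq> D" "supp_in K h"
 shows "(LINT y:D|lborel. h y *\<^sub>R f y) \<bullet> b = (LI y. h y * (indicator D y * (f y \<bullet> b)))"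
 using integral_inner_left[OF loc_Lp_mult_integrable[OF assms], of b]
 by (simp add: set_lebesgue_integral_def mult_ac)

lemma weak_partial_comp:
 fixes f :: "real^2 => 'v::euclidean_space"
 assumes w: "weak_partial D i f f'" and e: "test_function D e"
 shows "(LI y. pd i e y * (indicator D y * (f y \<bullet> b)))
  = - (LI y. e y * (indicator D y * (f' y \<bullet> b)))"
proof -
 obtain K where K: "C1 e (%y. pd 1 e y) (%y. pd 2 e y)"
  "compact K" "K \<subseteq> D" "supp_in K e" by (rule test_function_C1[OF e])
 have l: "loc_Lp D 1 f" "loc_Lp D 1 f'" using w by (auto simp: weak_partial_def)
 have i: "i = 1 \<or> i = 2" by (rule exhaust_2)
 have "cont (%y. pd i e y)" "supp_in K (%y. pd i e y)"
  using i K(1) C1_supp_deriv[OF K(1,2,4)] by (auto simp: C1_def)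
 note 1 = loc_Lp_mult_inner[OF l(1) this(1) K(2,3) this(2), of b]
 note 2 = loc_Lp_mult_inner[OF l(2) C1_continuous[OF K(1)] K(2-4), of b]
 have "(LINT y:D|lborel. pd i e y *\<^sub>R f y) = - (LINT y:D|lborel. e y *\<^sub>R f' y)"
  using w e by (simp add: weak_partial_def)
 from arg_cong[OF this, of "%x. x \<bullet> b"] show ?thesis unfolding inner_minus_left 1 2 .
qed

lemma weak_partial_unique:
 fixes f f' f'' :: "real^2 => 'v::euclidean_space"
 assumes w: "weak_partial D i f f'" "weak_partial D i f f''" and O: "open D"
 shows "AE y\<in>D in lborel. f' y = f'' y"
proof -
 have "AE y\<in>D in lborel. indicator D y * (f' y \<bullet> b) - indicator D y * (f'' y \<bullet> b) = 0" for b
 proof (rule fundamental_lemma[OF _ O])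
  have l: "loc1 D (%y. indicator D y * (f' y \<bullet> b))" "loc1 D (%y. indicator D y * (f'' y \<bullet> b))"
   using w by (auto simp: weak_partial_def intro!: loc_Lp_comp(1))
  thus "loc1 D (%y. indicator D y * (f' y \<bullet> b) - indicator D y * (f'' y \<bullet> b))"
   unfolding loc1_def by (auto simp: right_diff_distrib)
  fix e assume e: "test_function D e"
  obtain K where K: "C1 e (%y. pd 1 e y) (%y. pd 2 e y)"
   "compact K" "K \<subseteq> D" "supp_in K e" by (rule test_function_C1[OF e])
  note c = C1_continuous[OF K(1), of UNIV]
  obtain B where B: "B >= 0" "!!y. \<bar>e y\<bar> <= B" using bounded_compact_supp[OF c K(2,4)] by metis
  have hm: "e \<in> bor" by (rule borel_measurable_continuous_onI[OF c])
  note i = loc1_mult_supp[OF l(1) hm B(2) K(4,2,3)] loc1_mult_supp[OF l(2) hm B(2) K(4,2,3)]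
  have "(LI y. e y * (indicator D y * (f' y \<bullet> b))) = (LI y. e y * (indicator D y * (f'' y \<bullet> b)))"
   using weak_partial_comp[OF w(1) e, of b] weak_partial_comp[OF w(2) e, of b] by simp
  thus "(LI y. e y * (indicator D y * (f' y \<bullet> b) - indicator D y * (f'' y \<bullet> b))) = 0"
   unfolding right_diff_distrib Bochner_Integration.integral_diff[OF i] by simp
 qed
 hence "AE y in lborel. \<forall>b\<in>Basis. y \<in> D --> indicator D y * (f' y \<bullet> b) - indicator D y * (f'' y \<bullet> b) = 0"
  by (intro AE_finite_allI finite_Basis)
 thus ?thesis by eventually_elim (auto intro: euclidean_eqI)
qed

text \<open>Agreement almost everywhere transfers the bounds but not Borel measurability, which is
  therefore a separate hypothesis.\<close>

lemma loc_Lp_cong_AE: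
 fixes f g :: "real^2 => 'v::euclidean_space"
 assumes f: "loc_Lp D p f" and g: "set_borel_measurable borel D g" and ae: "AE y\<in>D in lborel. f y = g y"
 shows "loc_Lp D p g"
 unfolding loc_Lp_def
proof (intro conjI allI impI g)
 fix K assume K: "compact K & K \<subseteq> D"
 have Kb: "K \<in> sets borel" using K by (simp add: borel_compact)
 have m: "(%y. indicat_real D y *\<^sub>R g y) \<in> bor" using g by (simp add: set_borel_measurable_def)
 have "(%y. indicat_real K y *\<^sub>R norm (indicat_real D y *\<^sub>R g y) powr p) \<in> bor" using m Kb by measurable
 moreover have "(%y. indicat_real K y *\<^sub>R norm (indicat_real D y *\<^sub>R g y) powr p) = (%y. indicat_real K y *\<^sub>R norm (g y) powr p)"
  using K by (auto simp: indicator_def fun_eq_iff)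
 ultimately have gm: "(%y. indicat_real K y *\<^sub>R norm (g y) powr p) \<in> borel_measurable lborel" by simp
 have "lint (%y. indicat_real K y *\<^sub>R norm (f y) powr p)" using f K by (auto simp: loc_Lp_def set_integrable_def)
 thus "set_integrable lborel K (%y. norm (g y) powr p)"
  unfolding set_integrable_def
  by (rule integrable_cong_AE_imp[OF _ gm]) (use ae in eventually_elim, use K in "auto simp: indicator_def")
qed

lemma weak_partial_wd2:
 fixes f :: "real^2 => 'v::euclidean_space"
 assumes w: "weak_partial D 1 f f1" "weak_partial D 2 f f2" and p: "p >= 2"
  and l: "loc_Lp D p f" "loc_Lp D p f1" "loc_Lp D p f2"
 shows "wd2 D (%y. indicator D y * (f y \<bullet> b)) (%y. indicator D y * (f1 y \<bullet> b)) (%y. indicator D y * (f2 y \<bullet> b))"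
 unfolding wd2_def wd_def
 using loc_Lp_comp[OF l(1), of b] loc_Lp_comp[OF l(2), of b] loc_Lp_comp[OF l(3), of b] p
  weak_partial_comp[OF w(1), of _ b] weak_partial_comp[OF w(2), of _ b] by simp

section \<open>C1 functions and a partition of unity on M\<close>

definition C1on :: "(real^2) set => plane => plane => plane => bool" where
 "C1on S f f1 f2 \<longleftrightarrow> (\<forall>y\<in>S. (f has_derivative (%v. v$1 * f1 y + v$2 * f2 y)) (at y)) &
  continuous_on S f1 & continuous_on S f2"

lemma C1on_continuous: "C1on S f f1 f2 ==> continuous_on S f"
 unfolding C1on_def by (meson continuous_at_imp_continuous_on has_derivative_continuous)

lemma C1on_mult:
 assumes "C1on S f f1 f2" "C1on S g g1 g2"
 shows "C1on S (%x. f x * g x) (%x. f1 x * g x + f x * g1 x) (%x. f2 x * g x + f x * g2 x)"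
 unfolding C1on_def
proof (intro conjI ballI)
 fix y assume "y \<in> S"
 hence "(f has_derivative (%v. v$1 * f1 y + v$2 * f2 y)) (at y)" "(g has_derivative (%v. v$1 * g1 y + v$2 * g2 y)) (at y)"
  using assms by (auto simp: C1on_def)
 from has_derivative_mult[OF this]
 show "((%x. f x * g x) has_derivative (%v. v$1 * (f1 y * g y + f y * g1 y) + v$2 * (f2 y * g y + f y * g2 y))) (at y)"
  by (rule has_derivative_eq_rhs) (simp add: fun_eq_iff algebra_simps)
qed (use assms C1on_continuous[OF assms(1)] C1on_continuous[OF assms(2)] in "auto simp: C1on_def intro!: continuous_intros")

lemma C1on_add:
 assumes "C1on S f f1 f2" "C1on S g g1 g2"
 shows "C1on S (%x. f x + g x) (%x. f1 x + g1 x) (%x. f2 x + g2 x)"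
 unfolding C1on_def
proof (intro conjI ballI)
 fix y assume "y \<in> S"
 hence "(f has_derivative (%v. v$1 * f1 y + v$2 * f2 y)) (at y)" "(g has_derivative (%v. v$1 * g1 y + v$2 * g2 y)) (at y)"
  using assms by (auto simp: C1on_def)
 from has_derivative_add[OF this]
 show "((%x. f x + g x) has_derivative (%v. v$1 * (f1 y + g1 y) + v$2 * (f2 y + g2 y))) (at y)"
  by (rule has_derivative_eq_rhs) (simp add: fun_eq_iff algebra_simps)
qed (use assms in "auto simp: C1on_def intro!: continuous_intros")

lemma C1on_const: "C1on S (%x. c) (%x. 0) (%x. 0)"
 by (simp add: C1on_def)

lemma C1on_inverse:
 assumes f: "C1on S f f1 f2" and ne: "!!y. y \<in> S ==> f y ~= 0"
 shows "C1on S (%x. inverse (f x)) (%x. - (inverse (f x) * f1 x * inverse (f x))) (%x. - (inverse (f x) * f2 x * inverse (f x)))"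
 unfolding C1on_def
proof (intro conjI ballI)
 fix y assume y: "y \<in> S"
 hence "(f has_derivative (%v. v$1 * f1 y + v$2 * f2 y)) (at y)" using f by (auto simp: C1on_def)
 from Deriv.has_derivative_inverse[OF ne[OF y] this]
 show "((%x. inverse (f x)) has_derivative (%v. v$1 * - (inverse (f y) * f1 y * inverse (f y)) + v$2 * - (inverse (f y) * f2 y * inverse (f y)))) (at y)"
  by (rule has_derivative_eq_rhs) (simp add: fun_eq_iff algebra_simps)
qed (use f ne C1on_continuous[OF f] in "auto simp: C1on_def intro!: continuous_intros")

context surf begin

definition C1M :: "('m => real) => bool" where
 "C1M k \<longleftrightarrow> (\<forall>c\<in>charts M. EX f1 f2. C1on (snd c ` fst c) (%y. k (cinv c y)) f1 f2)"

lemma C1M_D: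
 assumes "C1M k" "c \<in> charts M"
 obtains f1 f2 where "C1on (snd c ` fst c) (%y. k (cinv c y)) f1 f2"
 using bspec[OF assms(1)[unfolded C1M_def] assms(2)] by (elim exE) (rule that)

lemma C1M_I:
 assumes "!!c. c \<in> charts M ==> EX f1 f2. C1on (snd c ` fst c) (%y. k (cinv c y)) f1 f2"
 shows "C1M k"
 unfolding C1M_def by (intro ballI assms)

lemma C1M_mult:
 assumes "C1M k" "C1M \<xi>" shows "C1M (%m. k m * \<xi> m)"
proof (rule C1M_I)
 fix c assume c: "c \<in> charts M"
 obtain f1 f2 where f: "C1on (snd c ` fst c) (%y. k (cinv c y)) f1 f2" by (rule C1M_D[OF assms(1) c])
 obtain g1 g2 where g: "C1on (snd c ` fst c) (%y. \<xi> (cinv c y)) g1 g2" by (rule C1M_D[OF assms(2) c])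
 show "EX f1 f2. C1on (snd c ` fst c) (%y. k (cinv c y) * \<xi> (cinv c y)) f1 f2"
  by (intro exI) (rule C1on_mult[OF f g])
qed

lemma C1M_add:
 assumes "C1M k" "C1M \<xi>" shows "C1M (%m. k m + \<xi> m)"
proof (rule C1M_I)
 fix c assume c: "c \<in> charts M"
 obtain f1 f2 where f: "C1on (snd c ` fst c) (%y. k (cinv c y)) f1 f2" by (rule C1M_D[OF assms(1) c])
 obtain g1 g2 where g: "C1on (snd c ` fst c) (%y. \<xi> (cinv c y)) g1 g2" by (rule C1M_D[OF assms(2) c])
 show "EX f1 f2. C1on (snd c ` fst c) (%y. k (cinv c y) + \<xi> (cinv c y)) f1 f2"
  by (intro exI) (rule C1on_add[OF f g])
qed

lemma C1M_sum: "finite I ==> (!!i. i \<in> I ==> C1M (k i)) ==> C1M (%m. \<Sum>i\<in>I. k i m)"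
proof (induction rule: finite_induct)
 case empty show ?case by (rule C1M_I) (simp, intro exI, rule C1on_const)
next
 case (insert x F)
 hence "C1M (k x)" "C1M (%m. \<Sum>i\<in>F. k i m)" by auto
 hence "C1M (%m. k x m + (\<Sum>i\<in>F. k i m))" by (rule C1M_add)
 thus ?case using insert by simp
qed

lemma C1M_inverse:
 assumes "C1M k" "!!m. k m ~= 0" shows "C1M (%m. inverse (k m))"
proof (rule C1M_I)
 fix c assume c: "c \<in> charts M"
 obtain f1 f2 where f: "C1on (snd c ` fst c) (%y. k (cinv c y)) f1 f2" by (rule C1M_D[OF assms(1) c])
 show "EX f1 f2. C1on (snd c ` fst c) (%y. inverse (k (cinv c y))) f1 f2"
  by (intro exI) (rule C1on_inverse[OF f assms(2)])
qed

lemma transition_props: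
 assumes c: "c \<in> charts M" "c' \<in> charts M"
 defines "T \<equiv> transition c c'" and "A \<equiv> snd c ` (fst c \<inter> fst c')"
 shows "open A" "y \<in> A ==> (T has_derivative frechet_derivative T (at y)) (at y)"
  "continuous_on A (%y. frechet_derivative T (at y) v)" (is ?P1) "y \<in> A ==> T y = snd c' (cinv c y)" "continuous_on A T"
proof -
 show o: "open A" unfolding A_def by (rule chart_image_open'[OF c(1)]) (intro open_Int chart_open c, simp)
 have "smooth_on A T" using atlas c unfolding oriented_smooth_atlas_def T_def A_def by blast
 hence 1: "ck_on (Suc 0) A T" unfolding smooth_on_def by blast
 hence d: "T differentiable_on A" by simp
 show "(T has_derivative frechet_derivative T (at y)) (at y)" if y: "y \<in> A"
 proof -
  have "T differentiable (at y within A)" using d y by (simp add: differentiable_on_def)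
  hence "T differentiable at y" using at_within_open[OF y o] by simp
  thus ?thesis by (rule frechet_derivative_works[THEN iffD1])
 qed
 show ?P1 using 1 by simp
 show "T y = snd c' (cinv c y)" if "y \<in> A" using that by (simp add: T_def transition_def cinv_def)
 show "continuous_on A T" by (rule differentiable_imp_continuous_on[OF d])
qed

text \<open>In another chart the domain is covered by two open sets: on A the transition map is
  available, on B the function is 0. B is open because the compact support is closed in the
  Hausdorff space M.\<close>

lemma C1_extend:
 assumes c: "c \<in> charts M" and z: "C1 z z1 z2" "supp_in K z" "compact K" "K \<subseteq> snd c ` fst c"
 shows "C1M (%m. if m \<in> fst c then z (snd c m) else 0)"
 unfolding C1M_def
proof
 fix c' assume c': "c' \<in> charts M"
 let ?k = "%m. if m \<in> fst c then z (snd c m) else 0"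
 define S where "S = cinv c ` K"
 have S: "compact S" unfolding S_def
  by (rule compact_continuous_image[OF continuous_on_subset[OF homeomorphism_cont2[OF chart_homeo[OF c]] z(4)] z(3)])
 have zS: "?k m = 0" if "m \<notin> S" for m
 proof -
  have "snd c m \<notin> K" if m: "m \<in> fst c"
  proof
   assume "snd c m \<in> K"
   hence "cinv c (snd c m) \<in> S" unfolding S_def by blast
   thus False using \<open>m \<notin> S\<close> cinv_simps(1)[OF c m] by simp
  qed
  thus ?thesis using z(2) by (auto simp: supp_in_def)
 qed
 note t = transition_props[OF c' c]
 let ?T = "transition c' c"
 define A where "A = snd c' ` (fst c' \<inter> fst c)"
 define B where "B = snd c' ` (fst c' - S)"
 note t = t[folded A_def]
 have oB: "open B" unfolding B_def
  by (rule chart_image_open'[OF c']) (use chart_open[OF c'] compact_imp_closed[OF S] in auto)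
 have AB: "snd c' ` fst c' = A \<union> B"
 proof -
  have "S \<subseteq> fst c" unfolding S_def using z(4) cinv_simps(3)[OF c] by blast
  thus ?thesis unfolding A_def B_def by blast
 qed
 have eA: "?k (cinv c' y) = z (?T y)" if yA: "y \<in> A" for y
 proof -
  obtain m where m: "m \<in> fst c'" "m \<in> fst c" "y = snd c' m" using yA unfolding A_def by blast
  thus ?thesis using t(4)[OF yA] cinv_simps(1)[OF c' m(1)] by simp
 qed
 have eB: "?k (cinv c' y) = 0" if yB: "y \<in> B" for y
 proof -
  obtain m where m: "m \<in> fst c'" "m \<notin> S" "y = snd c' m" using yB unfolding B_def by blast
  show ?thesis using zS[OF m(2)] by (simp only: m(3) cinv_simps(1)[OF c' m(1)])
 qed
 define D where "D y v = frechet_derivative ?T (at y) v" for y v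
 define f where "f e y = (if y \<in> A then (D y e)$1 * z1 (?T y) + (D y e)$2 * z2 (?T y) else 0)" for e y
 have Tc: "?T y \<notin> K" if yy: "y \<in> A" "y \<in> B" for y
 proof
  assume K: "?T y \<in> K"
  obtain m where m: "m \<in> fst c'" "m \<in> fst c" "y = snd c' m" using yy(1) unfolding A_def by blast
  have "?T y = snd c m" using t(4)[OF yy(1)] m cinv_simps(1)[OF c' m(1)] by simp
  hence "m \<in> S" using K cinv_simps(1)[OF c m(2)] unfolding S_def by (metis imageI)
  moreover obtain m' where m': "m' \<in> fst c'" "m' \<notin> S" "y = snd c' m'" using yy(2) unfolding B_def by blast
  ultimately have "m \<in> S" "m' \<notin> S" by blast+
  moreover have "cinv c' y = m" by (simp only: m(3) cinv_simps(1)[OF c' m(1)])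
  moreover have "cinv c' y = m'" by (simp only: m'(3) cinv_simps(1)[OF c' m'(1)])
  ultimately show False by simp
 qed
 note sz = C1_supp_deriv[OF z(1,3,2)]
 have fB: "f e y = 0" if "y \<in> B" for e y
  using Tc[of y] that sz by (auto simp: f_def supp_in_def)
 have zc: "cont z1" "cont z2" using z(1) by (auto simp: C1_def)
 have fA: "continuous_on A (f e)" for e
 proof -
  have "continuous_on A (%y. (D y e)$1 * z1 (?T y) + (D y e)$2 * z2 (?T y))"
   unfolding D_def by (intro continuous_intros t(3) continuous_on_compose2[OF zc(1) t(5)] continuous_on_compose2[OF zc(2) t(5)]) auto
  thus ?thesis by (rule continuous_on_eq) (simp add: f_def)
 qed
 have fc: "continuous_on (A \<union> B) (f e)" for e
 proof (rule continuous_on_open_Un[OF t(1) oB fA])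
  show "continuous_on B (f e)" by (rule continuous_on_eq[OF continuous_on_const[of B 0]]) (simp add: fB)
 qed
 have "C1on (snd c' ` fst c') (%y. ?k (cinv c' y)) (f ax1) (f ax2)"
  unfolding C1on_def AB
 proof (intro conjI ballI fc)
  fix y assume y: "y \<in> A \<union> B"
  show "((%y. ?k (cinv c' y)) has_derivative (%v. v$1 * f ax1 y + v$2 * f ax2 y)) (at y)"
  proof (cases "y \<in> A")
   case True
   have zd: "(z has_derivative (%v. v$1 * z1 (?T y) + v$2 * z2 (?T y))) (at (?T y))" using z(1) by (simp add: C1_def)
   have "((%y. z (?T y)) has_derivative (%v. (D y v)$1 * z1 (?T y) + (D y v)$2 * z2 (?T y))) (at y)"
    using has_derivative_compose[OF t(2)[OF True] zd] by (simp add: D_def)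
   moreover have "(D y v)$1 * z1 (?T y) + (D y v)$2 * z2 (?T y) = v$1 * f ax1 y + v$2 * f ax2 y" for v
   proof -
    have lin: "linear (D y)" unfolding D_def using has_derivative_linear[OF t(2)[OF True]] by (simp add: eta_contract_eq)
    have "v = v$1 *\<^sub>R axis 1 1 + v$2 *\<^sub>R axis 2 1" by (simp add: vec_eq_iff forall_2 axis_def)
    hence "D y v = v$1 *\<^sub>R D y ax1 + v$2 *\<^sub>R D y ax2"
     using linear_add[OF lin] linear_scale[OF lin] by metis
    thus ?thesis using True by (simp add: f_def algebra_simps)
   qed
   ultimately have "((%y. z (?T y)) has_derivative (%v. v$1 * f ax1 y + v$2 * f ax2 y)) (at y)" by simp
   thus ?thesis
    by (rule has_derivative_transform_within_open[OF _ t(1) True]) (simp add: eA)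
  next
   case False
   hence B: "y \<in> B" using y by blast
   have "((%y. 0) has_derivative (%v. v$1 * f ax1 y + v$2 * f ax2 y)) (at y)" by (simp add: fB[OF B])
   thus ?thesis
    by (rule has_derivative_transform_within_open[OF _ oB B]) (simp only: eB)
  qed
 qed
 thus "EX f1 f2. C1on (snd c' ` fst c') (%y. ?k (cinv c' y)) f1 f2" by blast
qed

definition loc :: "'m chart => ('m => real) => real^2 => real" where
 "loc c k y = (if y \<in> snd c ` fst c then k (cinv c y) else 0)"

definition dform :: "('m => real) => ('m, 'c, real) form1" where
 "dform k c x v = frechet_derivative (%y. k (cinv c y)) (at (snd c (\<pi> x))) v"

lemma C1M_dform:
 assumes z: "C1M k" and c: "c \<in> charts M" and x: "\<pi> x \<in> fst c"
 shows "((%y. k (cinv c y)) has_derivative dform k c x) (at (snd c (\<pi> x)))"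
proof -
 obtain f1 f2 where "C1on (snd c ` fst c) (%y. k (cinv c y)) f1 f2" using z c unfolding C1M_def by blast
 hence "((%y. k (cinv c y)) has_derivative (%v. v$1 * f1 (snd c (\<pi> x)) + v$2 * f2 (snd c (\<pi> x)))) (at (snd c (\<pi> x)))"
  using x unfolding C1on_def by blast
 hence "(%y. k (cinv c y)) differentiable at (snd c (\<pi> x))" by (rule differentiableI)
 thus ?thesis unfolding frechet_derivative_works dform_def[abs_def] .
qed

lemma trans_jac_works:
 assumes c: "c \<in> charts M" "c' \<in> charts M" and m: "m \<in> fst c" "m \<in> fst c'"
 shows "(transition c c' has_derivative (%v. trans_jac c c' m *v v)) (at (snd c m))"
proof -
 have "snd c m \<in> snd c ` (fst c \<inter> fst c')" using m by blast
 note d = transition_props(2)[OF c this]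
 have "frechet_derivative (transition c c') (at (snd c m)) = (%v. trans_jac c c' m *v v)"
  unfolding trans_jac_def
 proof
  fix v show "frechet_derivative (transition c c') (at (snd c m)) v = matrix (frechet_derivative (transition c c') (at (snd c m))) *v v"
   by (subst linear_vec2[OF has_derivative_linear[OF d]]) (simp add: vec_eq_iff matrix_vector_mult_def matrix_def sum_2 mult.commute)
 qed
 with d show ?thesis by simp
qed

lemma dform_one_form:
 assumes z: "C1M k" shows "oform (%_ r. r) (dform k)"
 unfolding one_form_def
proof (intro ballI allI impI conjI)
 fix c x assume c: "c \<in> charts M" and x: "\<pi> x \<in> fst c"
 show "linear (dform k c x)" using has_derivative_linear[OF C1M_dform[OF z c x]] .
 show "dform k c (\<gamma> x) v = dform k c x v" if "\<gamma> \<in> deck \<pi>" for \<gamma> v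
 proof -
  have "\<pi> (\<gamma> x) = \<pi> x" using that unfolding deck_def by (auto simp: fun_eq_iff)
  thus ?thesis by (simp add: dform_def)
 qed
 fix c' v assume c': "c' \<in> charts M" and x': "\<pi> x \<in> fst c'"
 let ?m = "\<pi> x" let ?y = "snd c ?m"
 have Ty: "transition c c' ?y = snd c' ?m" using cinv_simps(1)[OF c x] by (simp add: transition_def cinv_def)
 have "((%y. k (cinv c' (transition c c' y))) has_derivative (%v. dform k c' x (trans_jac c c' ?m *v v))) (at ?y)"
  by (rule has_derivative_compose[OF trans_jac_works[OF c c' x x']]) (simp add: Ty C1M_dform[OF z c' x'])
 hence "((%y. k (cinv c y)) has_derivative (%v. dform k c' x (trans_jac c c' ?m *v v))) (at ?y)"
 proof (rule has_derivative_transform_within_open[OF _ transition_props(1)[OF c c']])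
  show "?y \<in> snd c ` (fst c \<inter> fst c')" using x x' by blast
  fix y assume "y \<in> snd c ` (fst c \<inter> fst c')"
  then obtain m where m: "m \<in> fst c" "m \<in> fst c'" "y = snd c m" by blast
  thus "k (cinv c' (transition c c' y)) = k (cinv c y)"
   using cinv_simps(1)[OF c m(1)] cinv_simps(1)[OF c' m(2)] by (simp add: transition_def cinv_def)
 qed
 from has_derivative_unique[OF C1M_dform[OF z c x] this]
 show "dform k c x v = dform k c' x (trans_jac c c' ?m *v v)" by (rule fun_cong)
qed

lemma loc_C1:
 assumes z: "C1M k" and c: "c \<in> charts M" and K: "compact K" "K \<subseteq> snd c ` fst c"
  and s: "!!m. m \<in> fst c ==> k m ~= 0 ==> snd c m \<in> K"
 shows "EX z1 z2. C1 (loc c k) z1 z2 & supp_in K (loc c k) &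
  (ALL x. \<pi> x \<in> fst c --> dform k c x ax1 = z1 (snd c (\<pi> x)) & dform k c x ax2 = z2 (snd c (\<pi> x)))"
proof -
 let ?O = "snd c ` fst c"
 obtain f1 f2 where f: "C1on ?O (%y. k (cinv c y)) f1 f2" using z c unfolding C1M_def by blast
 have sup: "supp_in K (loc c k)"
  unfolding supp_in_def loc_def using s cinv_simps[OF c] by (metis (no_types, lifting))
 have oO: "open ?O" by (rule chart_image_open[OF c])
 have oK: "open (- K)" using K(1) by (simp add: compact_imp_closed open_Compl)
 have D0: "((loc c k) has_derivative (%v. 0)) (at y)" if "y \<in> - K" for y
  by (rule has_derivative_transform_within_open[OF has_derivative_const oK that]) (use sup in "auto simp: supp_in_def")
 have D1: "((loc c k) has_derivative (%v. v$1 * f1 y + v$2 * f2 y)) (at y)" if "y \<in> ?O" for y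
  by (rule has_derivative_transform_within_open[OF _ oO that, where f="%y. k (cinv c y)"])
   (use f that in "auto simp: C1on_def loc_def")
 define g where "g h y = (if y \<in> ?O then h y else 0)" for h :: plane and y
 have z0: "f1 y = 0 & f2 y = 0" if "y \<in> ?O" "y \<in> - K" for y
 proof -
  have "(%v::real^2. 0::real) = (%v. v$1 * f1 y + v$2 * f2 y)" by (rule has_derivative_unique[OF D0[OF that(2)] D1[OF that(1)]])
  from fun_cong[OF this, of "axis 1 1"] fun_cong[OF this, of "axis 2 1"] show ?thesis by (simp add: axis_def)
 qed
 have gc: "cont (g h)" if "continuous_on ?O h" "!!y. y \<in> ?O ==> y \<in> - K ==> h y = 0" for h
 proof -
  have "continuous_on (?O \<union> - K) (g h)"
  proof (rule continuous_on_open_Un[OF oO oK])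
   show "continuous_on ?O (g h)" by (rule continuous_on_eq[OF that(1)]) (simp add: g_def)
   show "continuous_on (- K) (g h)"
    by (rule continuous_on_eq[OF continuous_on_const[of _ 0]]) (use that(2) in "auto simp: g_def")
  qed
  moreover have "?O \<union> - K = UNIV" using K(2) by blast
  ultimately show ?thesis by simp
 qed
 have "C1 (loc c k) (g f1) (g f2)"
  unfolding C1_def
 proof (intro conjI allI)
  show "cont (g f1)" "cont (g f2)" using f z0 by (auto intro!: gc simp: C1on_def)
  fix y
  show "((loc c k) has_derivative (%v. v$1 * g f1 y + v$2 * g f2 y)) (at y)"
  proof (cases "y \<in> ?O")
   case True thus ?thesis using D1[OF True] by (simp add: g_def)
  next
   case False
   hence "y \<in> - K" using K(2) by blast
   thus ?thesis using D0 False by (simp add: g_def)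
  qed
 qed
 moreover have "dform k c x ax1 = g f1 (snd c (\<pi> x)) & dform k c x ax2 = g f2 (snd c (\<pi> x))" if x: "\<pi> x \<in> fst c" for x
 proof -
  have y: "snd c (\<pi> x) \<in> ?O" using x by blast
  have "dform k c x = (%v. v$1 * f1 (snd c (\<pi> x)) + v$2 * f2 (snd c (\<pi> x)))"
   by (rule has_derivative_unique[OF C1M_dform[OF z c x]]) (use f y in "auto simp: C1on_def")
  thus ?thesis using y by (simp add: g_def axis_def)
 qed
 ultimately show ?thesis using sup by blast
qed

lemma sum_dform_const:
 assumes "finite I" "!!i. i \<in> I ==> C1M (k i)" "!!m. (\<Sum>i\<in>I. k i m) = 1" and c: "c \<in> charts M" and x: "\<pi> x \<in> fst c"
 shows "(\<Sum>i\<in>I. dform (k i) c x v) = 0"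
proof -
 have "((%y. \<Sum>i\<in>I. k i (cinv c y)) has_derivative (%v. \<Sum>i\<in>I. dform (k i) c x v)) (at (snd c (\<pi> x)))"
  by (rule has_derivative_sum) (rule C1M_dform[OF assms(2) c x])
 hence "((%y. 1::real) has_derivative (%v. \<Sum>i\<in>I. dform (k i) c x v)) (at (snd c (\<pi> x)))" by (simp add: assms(3))
 from has_derivative_unique[OF this has_derivative_const] show ?thesis by (rule fun_cong)
qed

text \<open>Each function is supported in one patch, where \<pi> has a local inverse, so that
  sections of the flat bundles become vector-valued functions of the coordinates there.\<close>

definition partition :: "nat => (nat => 'm chart) => (nat => 'c set) => (nat => (real^2) set) => (nat => 'm => real) => bool" where
 "partition n c W K k \<longleftrightarrow> (\<forall>i<n. patch M \<pi> (c i) (W i) & compact (K i) & K i \<subseteq> pdom (c i) (W i) & C1M (k i) &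
  (ALL m. k i m ~= 0 --> m \<in> fst (c i) & snd (c i) m \<in> K i)) & (ALL m. (\<Sum>i<n. k i m) = 1)"

text \<open>Around every point there is a bump function, positive at that point. By compactness
  finitely many have a positive sum S, which is divided out.\<close>

lemma partition_exists: "EX n c W K k. partition n c W K k"
proof -
 have "EX c W K h. patch M \<pi> c W & compact K & K \<subseteq> pdom c W & C1M h & (\<forall>m'. h m' >= 0) &
   (\<forall>m'. h m' ~= 0 --> m' \<in> fst c & snd c m' \<in> K) & open {m'. h m' > 0} & h m > 0" for m :: 'm
 proof -
  obtain c W where p: "patch M \<pi> c W" "m \<in> \<pi> ` W" using patch_exists by blast
  note pp = patch_props[OF p(1)]
  let ?a = "snd c m"
  have m: "m \<in> fst c" using p(2) pp(4) by blast
  have "?a \<in> pdom c W" using p(2) unfolding patch_dom_def by auto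
  then obtain e where e: "e > 0" "cball ?a e \<subseteq> pdom c W" using pp(5) open_contains_cball by blast
  \<comment> \<open>Half the radius, because the tensor product of bumps of width e / 2 is supported
    in the ball of radius e.\<close>
  let ?b = "%i t. bump (e/2) (1 * t + - ?a$i)"
  let ?z = "tensor (?b 1) (?b 2)"
  have sm: "smooth1 (?b i)" for i by (rule smooth1_affine[OF smooth1_bump])
  note zC = C1_tensor[OF sm[of 1] sm[of 2]]
  have zs: "supp_in (cball ?a e) ?z"
   unfolding supp_in_def
  proof (intro allI impI)
   fix y assume y: "y \<notin> cball ?a e"
   have "supp_in (cball 0 (2 * (e/2))) (tensor (bump (e/2)) (bump (e/2)))"
    by (rule tensor_supp) (simp_all add: bump_zero)
   moreover have "y - ?a \<notin> cball 0 (2 * (e/2))" using y by (simp add: dist_norm norm_minus_commute)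
   ultimately have "tensor (bump (e/2)) (bump (e/2)) (y - ?a) = 0" unfolding supp_in_def by blast
   thus "?z y = 0" by (simp add: tensor_def)
  qed
  have zn: "?z y >= 0" for y by (simp add: tensor_def bump_nonneg)
  have za: "?z ?a > 0" using e(1) by (simp add: tensor_def bump_pos)
  let ?h = "%m. if m \<in> fst c then ?z (snd c m) else 0"
  have sub: "cball ?a e \<subseteq> snd c ` fst c" using e(2) pp(6) by blast
  have hC: "C1M ?h" by (rule C1_extend[OF pp(1) zC zs compact_cball sub])
  have "open {m'. ?h m' > 0}"
  proof -
   have "continuous_on (fst c) (%m. ?z (snd c m))"
    by (rule continuous_on_compose2[OF C1_continuous[OF zC, of UNIV] homeomorphism_cont1[OF chart_homeo[OF pp(1)]]]) simp
   hence "open ((%m. ?z (snd c m)) -` {0<..} \<inter> fst c)"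
    using chart_open[OF pp(1)] by (subst (asm) continuous_on_open_vimage) auto
   moreover have "{m'. ?h m' > 0} = (%m. ?z (snd c m)) -` {0<..} \<inter> fst c" by auto
   ultimately show ?thesis by simp
  qed
  moreover have "?h m' ~= 0 --> m' \<in> fst c & snd c m' \<in> cball ?a e" for m' using zs by (auto simp: supp_in_def)
  ultimately show ?thesis
   using p(1) e(2) hC zn za m
   by (intro exI[of _ c] exI[of _ W] exI[of _ "cball ?a e"] exI[of _ ?h] conjI) auto
 qed
 hence "ALL m. EX c W K h. patch M \<pi> c W & compact K & K \<subseteq> pdom c W & C1M h & (\<forall>m'. h m' >= 0) &
   (\<forall>m'. h m' ~= 0 --> m' \<in> fst c & snd c m' \<in> K) & open {m'. h m' > 0} & h m > 0" by blast
 then obtain c W K h where H: "!!m. patch M \<pi> (c m) (W m)" "!!m. compact (K m)" "!!m. K m \<subseteq> pdom (c m) (W m)"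
  "!!m. C1M (h m)" "!!m m'. h m m' >= 0" "!!m m'. h m m' ~= 0 ==> m' \<in> fst (c m) & snd (c m) m' \<in> K m"
  "!!m. open {m'. h m m' > 0}" "!!m. h m m > 0" by metis
 have "UNIV \<subseteq> (\<Union>m\<in>UNIV. {m'. h m m' > 0})" using H(8) by blast
 then obtain D where D: "finite D" "UNIV \<subseteq> (\<Union>m\<in>D. {m'. h m m' > 0})"
  using compactE_image[OF compact_M, of UNIV "%m. {m'. h m m' > 0}"] H(7) by metis
 obtain a :: "nat => 'm" and n where a: "D = a ` {..<n}" "inj_on a {..<n}"
  using finite_imp_nat_seg_image_inj_on[OF D(1)] by (auto simp: lessThan_def)
 define S where "S m = (\<Sum>i<n. h (a i) m)" for m
 have Sp: "S m > 0" for m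
 proof -
  obtain i where i: "i < n" "h (a i) m > 0" using D(2) a(1) by auto
  hence "h (a i) m <= S m" unfolding S_def by (intro member_le_sum) (auto intro: H(5))
  thus ?thesis using i(2) by linarith
 qed
 have "C1M S" unfolding S_def by (rule C1M_sum) (auto intro: H(4))
 hence SC: "C1M (%m. inverse (S m))" by (rule C1M_inverse) (use Sp in "simp add: less_imp_neq[symmetric]")
 have "partition n (c \<circ> a) (W \<circ> a) (K \<circ> a) (%i m. h (a i) m * inverse (S m))"
  unfolding partition_def
 proof (intro conjI allI impI)
  fix m
  have "(\<Sum>i<n. h (a i) m * inverse (S m)) = S m * inverse (S m)" by (simp add: S_def sum_distrib_right)
  thus "(\<Sum>i<n. h (a i) m * inverse (S m)) = 1" using Sp[of m] by simp
 qed (use H SC in "auto intro: C1M_mult")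
 thus ?thesis by blast
qed

end

section \<open>Pointwise algebra of V and its dual exponent\<close>

lemma bilinear_lor: "bilinear lor"
 unfolding bilinear_def by (auto intro!: linearI simp: lor_bil)

lemma bilinear_trace_form: "bilinear trace_form"
 unfolding bilinear_def
 by (auto intro!: linearI simp: trace_form_add trace_form_scale trace_form_sym[of _ "_ + _"] trace_form_sym[of _ "_ *\<^sub>R _"])
  (simp_all add: trace_form_sym)

text \<open>Rotation of the tangent plane through a right angle, so that \<open>*\<alpha> = \<alpha> \<circ> rot\<close>\<close>

definition rot :: "real^2^2 => real^2 => real^2" where
 "rot G v = inverse (sqrt (det G)) *\<^sub>R vector [(G *v v) $ 2, - (G *v v) $ 1]"

lemma linear_rot: "linear (rot G)"
 by (rule linearI) (simp_all add: rot_def vec_eq_iff forall_2 matrix_vector_right_distrib matrix_vector_mult_scaleR algebra_simps)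

context
 fixes G :: "real^2^2"
 assumes G: "transpose G = G" "det G > 0"
begin

lemma G21: "G$2$1 = G$1$2"
 using arg_cong[OF G(1), of "%A. A$1$2"] by (simp add: transpose_def)

lemma sqrt_det: "inverse (sqrt (det G)) * inverse (sqrt (det G)) * (G$1$1 * G$2$2 - G$1$2 * G$1$2) = 1"
proof -
 have "G$1$1 * G$2$2 - G$1$2 * G$1$2 = sqrt (det G) * sqrt (det G)" using G(2) by (simp add: det_2 G21)
 moreover have "sqrt (det G) ~= 0" using G(2) by simp
 ultimately show ?thesis by (simp add: field_simps)
qed

lemma rot_rot: "rot G (rot G v) = - v"
proof -
 let ?r = "inverse (sqrt (det G))"
 have c: "rot G w $ 1 = ?r * (G$1$2 * w$1 + G$2$2 * w$2)" "rot G w $ 2 = - (?r * (G$1$1 * w$1 + G$1$2 * w$2))" for w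
  by (simp_all add: rot_def matrix_vector_mult_def sum_2 G21 algebra_simps)
 note s = sqrt_det
 have "rot G (rot G v) $ 1 = - v $ 1" "rot G (rot G v) $ 2 = - v $ 2" unfolding c using s by algebra+
 thus ?thesis by (simp add: vec_eq_iff forall_2)
qed

lemma rot_ip: "rot G v \<bullet> (G *v rot G w) = v \<bullet> (G *v w)"
proof -
 let ?r = "inverse (sqrt (det G))"
 have c: "rot G w $ 1 = ?r * (G$1$2 * w$1 + G$2$2 * w$2)" "rot G w $ 2 = - (?r * (G$1$1 * w$1 + G$1$2 * w$2))" for w
  by (simp_all add: rot_def matrix_vector_mult_def sum_2 G21 algebra_simps)
 have i: "x \<bullet> (G *v y) = x$1 * (G$1$1 * y$1 + G$1$2 * y$2) + x$2 * (G$1$2 * y$1 + G$2$2 * y$2)" for x y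
  by (simp add: inner_vec_def matrix_vector_mult_def sum_2 G21)
 show ?thesis unfolding i c using sqrt_det by algebra
qed

lemma rot_anti: "rot G v \<bullet> (G *v w) = - (v \<bullet> (G *v rot G w))"
 using rot_ip[of v "rot G w"] rot_ip[of "v" w] by (simp add: rot_rot vec.neg)

end

text \<open>With R the standard quarter turn, J R J^T = det J * R; since det J > 0, this factor
  cancels against the square roots of the Gram determinants.\<close>

lemma rot_equivariant:
 assumes G: "G = transpose J ** G' ** J" and J: "det J > 0" and G': "det G' > 0"
 shows "rot G' (J *v v) = J *v rot G v"
proof -
 have "det G = det J * det J * det G'" unfolding G by (simp add: det_mul)
 hence d: "sqrt (det G) = det J * sqrt (det G')" using J by (simp add: real_sqrt_mult)
 define w where "w = G' *v (J *v v)"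
 have g: "G *v v = transpose J *v w" unfolding G w_def by (simp add: matrix_vector_mul_assoc matrix_mul_assoc)
 have "J *v vector [(G *v v)$2, - (G *v v)$1] = det J *\<^sub>R vector [w$2, - w$1]"
  unfolding g by (simp add: vec_eq_iff forall_2 matrix_vector_mult_def sum_2 det_2 transpose_def algebra_simps)
 hence "J *v rot G v = (inverse (sqrt (det G)) * det J) *\<^sub>R vector [w$2, - w$1]"
  by (simp add: rot_def matrix_vector_mult_scaleR)
 thus ?thesis using J G' by (simp add: rot_def d w_def)
qed

text \<open>Isometries of source and target carry a singular value decomposition of A to one of A'.
  In the application J is a change of coordinates and L the action of a deck transformation on the
  fibre.\<close>

lemma Q_transport:
 assumes I: "ip_pair g G W h E" and I': "ip_pair g' G' W' h' E'"
  and A: "linear A" "!!v. A v \<in> W"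
  and J: "!!v. A' (J *v v) = L (A v)" "!!v w. g' (J *v v) (J *v w) = g v w" "invertible J"
  and L: "linear L" "!!x y. h' (L x) (L y) = h x y" "!!x. x \<in> W ==> L x \<in> W'"
 shows "TrQ_powr g' W' h' r A' = TrQ_powr g W h r A" (is ?P1)
  "Q_powr_map g' W' h' r A' (J *v v) = L (Q_powr_map g W h r A v)" (is ?P2)
proof -
 interpret P: ip_pair g G W h E by (rule I)
 interpret P': ip_pair g' G' W' h' E' by (rule I')
 obtain s t B C b c where sv: "P.svd2 A s t B C b c" using P.svd2_exists[OF A] by blast
 note Ll = linear_add[OF L(1)] linear_scale[OF L(1)]
 have "A' w = (s * g' (J *v b) w) *\<^sub>R L B + (t * g' (J *v c) w) *\<^sub>R L C" for w
 proof -
  have w: "w = J *v (matrix_inv J *v w)" using matrix_inv_mult(2)[OF J(3)] by (simp add: matrix_vector_mul_assoc)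
  have "A' (J *v v) = (s * g' (J *v b) (J *v v)) *\<^sub>R L B + (t * g' (J *v c) (J *v v)) *\<^sub>R L C" for v
   unfolding J(1,2) using sv by (simp add: P.svd2_def Ll)
  from this[of "matrix_inv J *v w", folded w] show ?thesis .
 qed
 hence sv': "P'.svd2 A' s t (L B) (L C) (J *v b) (J *v c)"
  using sv unfolding P.svd2_def P'.svd2_def P.ob_def P'.ob_def by (simp add: J(2) L(2,3) fun_eq_iff)
 show ?P1
  unfolding P.TrQ_powr_svd2[OF sv] P'.TrQ_powr_svd2[OF sv'] ..
 show ?P2
  unfolding P.Q_powr_map_svd2[OF sv] P'.Q_powr_map_svd2[OF sv'] by (simp add: J(2) Ll)
qed

lemma powr_add_le:
 fixes x y r :: real
 assumes "x >= 0" "y >= 0" "r >= 0"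
 shows "(x + y) powr r <= 2 powr r * (x powr r + y powr r)"
proof -
 have "(x + y) powr r <= (2 * max x y) powr r" using assms by (intro powr_mono2) auto
 also have "... = 2 powr r * max x y powr r" using assms by (simp add: powr_mult)
 also have "... <= 2 powr r * (x powr r + y powr r)" by (auto simp: max_def)
 finally show ?thesis .
qed

text \<open>The algebra at one point: \<open>G\<close> is the Gram matrix, \<open>u\<close> the value of the lift, \<open>A\<close> its differential,
 and \<open>V\<close> the value of \<open>*S\<^bsub>p-1\<^esub>(A) \<times> u\<close>.\<close>

locale pt =
 fixes g :: "real^2 => real^2 => real" and G :: "real^2^2" and u :: "real^3" and A :: "real^2 => real^3" and p q :: real
 assumes g: "g = (%v w. v \<bullet> (G *v w))" and G: "transpose G = G" "!!v. v ~= 0 ==> v \<bullet> (G *v v) > 0" "det G > 0"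
  and u: "u \<in> hyperboloid" and A: "linear A" "!!v. lor (A v) u = 0"
  and pq: "p > 2" "1 / p + 1 / q = 1"
begin

sublocale T: ip_pair g G "tangent_H u" lor "tE u"
 by unfold_locales (auto simp: g G lor_bil tangent_onb[OF u] intro: lor_sym)

sublocale P: ip_pair g G "p_space u" trace_form "pE u"
 by unfold_locales (auto simp: g G trace_form_add trace_form_scale p_onb[OF u] intro: trace_form_sym)

definition V :: "real^2 => real^3^3" where
 "V v = mcross (Q_powr_map g (tangent_H u) lor (p - 1) A (rot G v)) u"

abbreviation "X \<equiv> %v. mcross (A v) u"
abbreviation "\<kappa> \<equiv> 2 powr ((q - 2) / 2) :: real"

lemma uu: "lor u u = -1" by (rule hyperboloid_lor[OF u])

lemma AW: "A v \<in> tangent_H u" using A(2) by (simp add: tangent_H_def)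

lemma q: "q > 1" "q < 2" "(p - 1) * (q - 1) = 1" "(p - 1) * q = p"
proof -
 have "1 / q = (p - 1) / p" using pq by (simp add: diff_divide_distrib)
 hence "1 / (1 / q) = p / (p - 1)" by simp
 hence q': "q = p / (p - 1)" by simp
 show "q > 1" "q < 2" "(p - 1) * (q - 1) = 1" "(p - 1) * q = p" unfolding q' using pq(1) by (simp_all add: field_simps)
qed

text \<open>\<open>mcross_ip\<close> doubles squared lengths, whence sqrt 2 in the singular values
  and its inverse in the singular vectors. The rotation is skew for g and passes to b and c with a
  minus sign.\<close>

lemma V_svd:
 assumes sv: "T.svd2 A s t B C b c"
 shows "P.svd2 V (sqrt 2 * s powr (p - 1)) (sqrt 2 * t powr (p - 1)) (inverse (sqrt 2) *\<^sub>R mcross B u)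
  (inverse (sqrt 2) *\<^sub>R mcross C u) (- rot G b) (- rot G c)"
proof -
 have BC: "B \<in> tangent_H u" "C \<in> tangent_H u" "lor B B = 1" "lor C C = 1" "lor B C = 0" "T.ob b c" "s >= 0" "t >= 0"
  using sv by (auto simp: T.svd2_def)
 have z: "lor B u = 0" "lor C u = 0" using BC by (auto simp: tangent_H_def)
 have r: "g b (rot G v) = g (- rot G b) v" for b v using rot_anti[OF G(1,3), of b v] by (simp add: g)
 have ri: "g (- rot G x) (- rot G y) = g x y" for x y using rot_ip[OF G(1,3), of x y] by (simp add: g vec.neg)
 have cc: "sqrt 2 * x * y * inverse (sqrt 2) = x * y" for x y :: real by simp
 have i2: "inverse (sqrt 2) * (inverse (sqrt 2) * 2) = (1::real)" by (simp add: field_simps)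
 have Vv: "V v = (sqrt 2 * s powr (p - 1) * g (- rot G b) v) *\<^sub>R (inverse (sqrt 2) *\<^sub>R mcross B u)
   + (sqrt 2 * t powr (p - 1) * g (- rot G c) v) *\<^sub>R (inverse (sqrt 2) *\<^sub>R mcross C u)" for v
  unfolding V_def T.Q_powr_map_svd2[OF sv] r by (simp only: mcross_add mcross_scale scaleR_scaleR cc)
 have BW: "inverse (sqrt 2) *\<^sub>R mcross v u \<in> p_space u" if "v \<in> tangent_H u" for v
 proof -
  have "mcross v u \<in> p_space u" using that by (auto simp: p_space_def)
  thus ?thesis by (rule subspace_scale[OF P.EE(8)])
 qed
 have ob: "P.ob (- rot G b) (- rot G c)" using BC(6) unfolding T.ob_def P.ob_def ri .
 have m: "trace_form (inverse (sqrt 2) *\<^sub>R mcross v u) (inverse (sqrt 2) *\<^sub>R mcross w u) = lor v w"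
  if "lor v u = 0" for v w
 proof -
  have "trace_form (inverse (sqrt 2) *\<^sub>R mcross v u) (inverse (sqrt 2) *\<^sub>R mcross w u) =
   inverse (sqrt 2) * (inverse (sqrt 2) * 2) * lor v w"
   unfolding trace_form_scale P.h_scale2 mcross_ip[OF uu] that by (simp only: mult_zero_left add_0_right mult_ac)
  thus ?thesis unfolding i2 by simp
 qed
 show ?thesis
  unfolding P.svd2_def
 proof (intro conjI)
  show "0 <= sqrt 2 * s powr (p - 1)" "0 <= sqrt 2 * t powr (p - 1)" by simp_all
  show "V = (%v. (sqrt 2 * s powr (p - 1) * g (- rot G b) v) *\<^sub>R (inverse (sqrt 2) *\<^sub>R mcross B u)
   + (sqrt 2 * t powr (p - 1) * g (- rot G c) v) *\<^sub>R (inverse (sqrt 2) *\<^sub>R mcross C u))" by (rule ext) (rule Vv)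
 qed (simp_all only: ob BW BC m z)
qed

lemma V_props: "linear V" "V v \<in> p_space u"
proof -
 obtain s t B C b c where sv: "T.svd2 A s t B C b c" using T.svd2_exists[OF A(1) AW] by blast
 show "linear V" "V v \<in> p_space u" using P.svd2_ops(3,4)[OF V_svd[OF sv]] by blast+
qed

text \<open>(p - 1) * (q - 1) = 1 undoes the power of the singular values; there remains sqrt 2 powr
  (q - 1) / sqrt 2 = \<kappa>.\<close>

lemma QV_eq: "Q_powr_map g (p_space u) trace_form (q - 1) V = (%v. \<kappa> *\<^sub>R mcross (A (rot G v)) u)"
proof -
 obtain s t B C b c where sv: "T.svd2 A s t B C b c" using T.svd2_exists[OF A(1) AW] by blast
 have st: "s >= 0" "t >= 0" using sv by (auto simp: T.svd2_def)
 have r: "g b (rot G v) = g (- rot G b) v" for b v using rot_anti[OF G(1,3), of b v] by (simp add: g)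
 have e: "(sqrt 2 * x powr (p - 1)) powr (q - 1) * inverse (sqrt 2) = \<kappa> * x" if x: "x >= 0" for x
 proof -
  have "(sqrt 2 * x powr (p - 1)) powr (q - 1) = sqrt 2 powr (q - 1) * x"
   using x by (simp add: powr_mult powr_powr q(3))
  moreover have "sqrt 2 powr (q - 1) * inverse (sqrt 2) = \<kappa>"
  proof -
   have s: "sqrt 2 = 2 powr (1/2)" by (simp add: powr_half_sqrt)
   have "sqrt 2 powr (q - 1) * inverse (sqrt 2) = 2 powr (1 / 2 * (q - 1)) * 2 powr (- (1/2))"
    by (simp only: s powr_powr powr_minus)
   also have "... = 2 powr (1 / 2 * (q - 1) + - (1/2))" by (rule powr_add[symmetric])
   also have "1 / 2 * (q - 1) + - (1/2) = (q - 2) / 2" by (simp add: field_simps)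
   finally show ?thesis .
  qed
  ultimately show ?thesis by (simp add: mult_ac)
 qed
 have "A v = (s * g b v) *\<^sub>R B + (t * g c v) *\<^sub>R C" for v using sv by (simp add: T.svd2_def)
 hence Ar: "A (rot G v) = (s * g (- rot G b) v) *\<^sub>R B + (t * g (- rot G c) v) *\<^sub>R C" for v by (simp only: r)
 show ?thesis
 proof
  fix v
  have e': "(sqrt 2 * x powr (p - 1)) powr (q - 1) * k * inverse (sqrt 2) = \<kappa> * (x * k)" if "x >= 0" for x k
  proof -
   have "(sqrt 2 * x powr (p - 1)) powr (q - 1) * k * inverse (sqrt 2) = ((sqrt 2 * x powr (p - 1)) powr (q - 1) * inverse (sqrt 2)) * k"
    by (simp only: mult_ac)
   thus ?thesis unfolding e[OF that] by (simp only: mult_ac)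
  qed
  show "Q_powr_map g (p_space u) trace_form (q - 1) V v = \<kappa> *\<^sub>R mcross (A (rot G v)) u"
   unfolding P.Q_powr_map_svd2[OF V_svd[OF sv]] Ar mcross_add mcross_scale scaleR_scaleR e'[OF st(1)] e'[OF st(2)]
   by (simp only: scaleR_add_right scaleR_scaleR)
 qed
qed

lemma matrix_inv_G:
 "matrix_inv G $ 1 $ 1 = G$2$2 / (G$1$1 * G$2$2 - G$1$2 * G$1$2)" "matrix_inv G $ 2 $ 2 = G$1$1 / (G$1$1 * G$2$2 - G$1$2 * G$1$2)"
 "matrix_inv G $ 1 $ 2 = - G$1$2 / (G$1$1 * G$2$2 - G$1$2 * G$1$2)" "matrix_inv G $ 2 $ 1 = - G$1$2 / (G$1$1 * G$2$2 - G$1$2 * G$1$2)"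
 "G$1$1 * G$2$2 - G$1$2 * G$1$2 = det G"
proof -
 show d: "G$1$1 * G$2$2 - G$1$2 * G$1$2 = det G" by (simp add: det_2 G21[OF G(1,3)])
 have "G ** (\<chi> i j. (if i = j then (if i = 1 then G$2$2 else G$1$1) else - G$1$2) / det G) = mat 1"
  using G(3) d by (simp add: vec_eq_iff forall_2 matrix_matrix_mult_def sum_2 mat_def G21[OF G(1,3)] diff_divide_distrib[symmetric] mult_ac)
 from matrix_inv_unique[OF this]
 show "matrix_inv G $ 1 $ 1 = G$2$2 / (G$1$1 * G$2$2 - G$1$2 * G$1$2)" "matrix_inv G $ 2 $ 2 = G$1$1 / (G$1$1 * G$2$2 - G$1$2 * G$1$2)"
  "matrix_inv G $ 1 $ 2 = - G$1$2 / (G$1$1 * G$2$2 - G$1$2 * G$1$2)" "matrix_inv G $ 2 $ 1 = - G$1$2 / (G$1$1 * G$2$2 - G$1$2 * G$1$2)"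
  unfolding d by simp_all
qed

text \<open>Converts the inner product in the convexity inequality into the wedge density to which
  Stokes' theorem applies.\<close>

lemma ipm_rot:
 assumes "linear C" "linear B"
 shows "P.ipm (%v. C (rot G v)) B =
  (trace_form (C ax1) (B ax2) - trace_form (C ax2) (B ax1)) / sqrt (det G)"
proof -
 obtain b c where bc: "P.ob b c" using P.ob_exists by blast
 let ?r = "inverse (sqrt (det G))"
 let ?B = "%i. B (axis i 1)" let ?C = "%i. C (axis i 1)"
 have c: "rot G w $ 1 = ?r * (G$1$2 * w$1 + G$2$2 * w$2)" "rot G w $ 2 = - (?r * (G$1$1 * w$1 + G$1$2 * w$2))" for w
  by (simp_all add: rot_def matrix_vector_mult_def sum_2 G21[OF G(1,3)] algebra_simps)
 have R: "C (rot G w) = (?r * (G$1$2 * w$1 + G$2$2 * w$2)) *\<^sub>R ?C 1 + (- (?r * (G$1$1 * w$1 + G$1$2 * w$2))) *\<^sub>R ?C 2" for w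
  by (subst linear_vec2[OF assms(1)]) (simp only: c)
 note d = matrix_inv_G(5) and gi = matrix_inv_G(1-4)[unfolded matrix_inv_G(5)]
 have a: "C (rot G ax1) = (?r * G$1$2) *\<^sub>R ?C 1 + (- (?r * G$1$1)) *\<^sub>R ?C 2"
  "C (rot G ax2) = (?r * G$2$2) *\<^sub>R ?C 1 + (- (?r * G$1$2)) *\<^sub>R ?C 2"
  by (simp_all add: R axis_def)
 have "P.ipm (%v. C (rot G v)) B = ?r * ((G$1$1 * G$2$2 - G$1$2 * G$1$2) / det G) * (trace_form (?C 1) (?B 2) - trace_form (?C 2) (?B 1))"
  unfolding P.ipm_def sum_2 a P.bil gi by (simp add: diff_divide_distrib add_divide_distrib algebra_simps)
 thus ?thesis unfolding d using G(3) by (simp add: divide_inverse mult.commute)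
qed

lemma linear_X: "linear X"
 by (rule linear_compose[OF A(1) linear_mcross, unfolded o_def])

lemma convex:
 assumes B: "linear B" "!!v. B v \<in> p_space u"
 shows "TrQ_powr g (p_space u) trace_form q (%v. V v + B v) >= TrQ_powr g (p_space u) trace_form q V
  + q * \<kappa> * ((trace_form (X ax1) (B ax2) - trace_form (X ax2) (B ax1)) / sqrt (det G))"
proof -
 have "P.ipm (%v. \<kappa> *\<^sub>R X (rot G v)) B = \<kappa> * P.ipm (%v. X (rot G v)) B"
  by (simp add: P.ipm_def P.bil sum_2 algebra_simps)
 thus ?thesis
  using P.TrQ_convex[OF V_props B, of p q] pq q(1) unfolding QV_eq ipm_rot[OF linear_X B(1), symmetric] by simp
qed

text \<open>The parallelogram identity separates V from B, and |V|^2 is at most 4 times the power p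
  - 1 of |A|^2. Since (p - 1) * q = p, the q-th power of |V| becomes a p-th power of |A|; the q-th
  power of |B| is at most the p-th power plus 1.\<close>

lemma bound:
 assumes B: "linear B" "!!v. B v \<in> p_space u"
 shows "TrQ_powr g (p_space u) trace_form q (%v. V v + B v) <=
  2 * 2 powr (q/2) * 8 powr (q/2) * (T.ipm A A powr (p/2) + P.ipm B B powr (p/2) + 1)"
  "0 <= TrQ_powr g (p_space u) trace_form q (%v. V v + B v)" (is ?P1) "T.ipm A A >= 0" "P.ipm B B >= 0"
proof -
 obtain s t B' C b c where sv: "T.svd2 A s t B' C b c" using T.svd2_exists[OF A(1) AW] by blast
 have st: "s >= 0" "t >= 0" using sv by (auto simp: T.svd2_def)
 have I: "T.ipm A A = s^2 + t^2" using T.svd2_trace_det(1)[OF sv] T.trace_Nmat_ipm[OF A(1)] by simp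
 have VV: "P.ipm V V = 2 * (s powr (p - 1))^2 + 2 * (t powr (p - 1))^2"
  using P.svd2_trace_det(1)[OF V_svd[OF sv]] P.trace_Nmat_ipm[OF V_props(1)] by (simp add: power_mult_distrib)
 have e: "(x powr (p - 1))^2 <= T.ipm A A powr (p - 1)" if "x >= 0" "x^2 <= T.ipm A A" for x
 proof -
  have "(x powr (p - 1))^2 = (x^2) powr (p - 1)" using that(1) by (simp add: power2_eq_square powr_mult)
  also have "... <= T.ipm A A powr (p - 1)" using that pq by (intro powr_mono2) auto
  finally show ?thesis .
 qed
 let ?I = "T.ipm A A" let ?J = "P.ipm B B"
 show I0: "?I >= 0" by (simp add: I)
 show J0: "?J >= 0" by (rule P.TrQ_powr_bounds(1)[OF B, of 1]) simp
 have VB: "linear (%v. V v + B v)" "!!v. V v + B v \<in> p_space u" "linear (%v. V v - B v)" "!!v. V v - B v \<in> p_space u"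
  using V_props B P.EE(8) by (auto intro: linear_compose_add linear_compose_sub subspace_add subspace_diff)
 have "P.ipm (%v. V v + B v) (%v. V v + B v) + P.ipm (%v. V v - B v) (%v. V v - B v) = 2 * P.ipm V V + 2 * ?J"
  by (simp add: P.ipm_def P.bil sum_2 algebra_simps)
 moreover have "P.ipm (%v. V v - B v) (%v. V v - B v) >= 0" by (rule P.TrQ_powr_bounds(1)[OF VB(3,4), of 1]) simp
 moreover have "P.ipm V V <= 4 * ?I powr (p - 1)"
  unfolding VV using e[of s] e[of t] st by (simp add: I)
 ultimately have S: "P.ipm (%v. V v + B v) (%v. V v + B v) <= 8 * ?I powr (p - 1) + 2 * ?J" by linarith
 have S0: "P.ipm (%v. V v + B v) (%v. V v + B v) >= 0" by (rule P.TrQ_powr_bounds(1)[OF VB(1,2), of 1]) simp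
 have q0: "q > 0" using q by simp
 show ?P1 by (rule P.TrQ_powr_bounds(2)[OF VB(1,2) q0])
 have "TrQ_powr g (p_space u) trace_form q (%v. V v + B v) <= 2 * P.ipm (%v. V v + B v) (%v. V v + B v) powr (q/2)"
  by (rule P.TrQ_powr_bounds(3)[OF VB(1,2) q0])
 also have "... <= 2 * (8 * ?I powr (p - 1) + 8 * ?J) powr (q/2)"
  using S S0 q0 J0 by (intro mult_left_mono powr_mono2) auto
 also have "... <= 2 * (2 powr (q/2) * ((8 * ?I powr (p - 1)) powr (q/2) + (8 * ?J) powr (q/2)))"
  using J0 q0 by (intro mult_left_mono powr_add_le) auto
 also have "(8 * ?I powr (p - 1)) powr (q/2) = 8 powr (q/2) * ?I powr (p/2)"
  using I0 q(4) by (simp add: powr_mult powr_powr)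
 also have "(8 * ?J) powr (q/2) = 8 powr (q/2) * ?J powr (q/2)" using J0 by (simp add: powr_mult)
 also have "2 * (2 powr (q/2) * (8 powr (q/2) * ?I powr (p/2) + 8 powr (q/2) * ?J powr (q/2)))
   <= 2 * 2 powr (q/2) * 8 powr (q/2) * (?I powr (p/2) + ?J powr (p/2) + 1)"
 proof -
  have "?J powr (q/2) <= ?J powr (p/2) + 1"
  proof (cases "?J >= 1")
   case True
   hence "?J powr (q/2) <= ?J powr (p/2)" using q pq by (intro powr_mono) auto
   thus ?thesis by simp
  next
   case False
   hence "?J powr (q/2) <= 1 powr (q/2)" using J0 q0 by (intro powr_mono2) auto
   hence "?J powr (q/2) <= 1" by simp
   with powr_ge_zero[of ?J "p/2"] show ?thesis by linarith
  qed
  hence "2 * 2 powr (q/2) * 8 powr (q/2) * (?I powr (p/2) + ?J powr (q/2)) <=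
   2 * 2 powr (q/2) * 8 powr (q/2) * (?I powr (p/2) + (?J powr (p/2) + 1))" by (intro mult_left_mono add_left_mono) auto
  thus ?thesis by (simp add: algebra_simps)
 qed
 finally show "TrQ_powr g (p_space u) trace_form q (%v. V v + B v) <=
  2 * 2 powr (q/2) * 8 powr (q/2) * (?I powr (p/2) + ?J powr (p/2) + 1)" .
qed

end

section \<open>Differentiating the constraint (U, U) = -1\<close>

lemma C1_integral_zero:
 assumes z: "C1 z z1 z2" "compact K" "supp_in K z"
 shows "(LI y. z1 y) = 0" "(LI y. z2 y) = 0"
proof -
 note s = C1_supp_deriv[OF z]
 have c: "cont z" "cont z1" "cont z2"
  using C1_continuous[OF z(1)] z(1) by (auto simp: C1_def)
 obtain r where r: "!!x. x \<in> K ==> norm x <= r" using z(2) compact_imp_bounded bounded_iff by metis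
 \<comment> \<open>The convolution of z with the indicator of a ball large enough for all |x| < 1 is
   constant near 0, while its partial derivatives at 0 are the two integrals in question.\<close>
 let ?F = "indicator (cball 0 (r + 1)) :: real^2 => real"
 have F: "lint ?F" by (rule integrable_indicator_compact[OF compact_cball])
 have cv: "conv k ?F x = integral\<^sup>L lborel k" if k: "supp_in K k" "norm x < 1" "cont k" for k x
 proof -
  have "k (x - y) * ?F y = k (x - y)" for y
  proof (cases "x - y \<in> K")
   case True
   hence "norm y <= r + 1" using r[OF True] k(2) norm_triangle_ineq4[of x "x - y"] by simp
   thus ?thesis by (simp add: indicator_def)
  next
   case False thus ?thesis using k(1) by (simp add: supp_in_def)
  qed
  thus ?thesis unfolding conv_def by (simp only: integral_reflect[OF borel_measurable_continuous_onI[OF k(3)], of x])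
 qed
 have "C1 (conv z ?F) (conv z1 ?F) (conv z2 ?F)" by (rule conv_C1[OF z F])
 hence D: "((conv z ?F) has_derivative (%v. v$1 * conv z1 ?F 0 + v$2 * conv z2 ?F 0)) (at 0)" by (simp add: C1_def)
 have "((%x::real^2. integral\<^sup>L lborel z) has_derivative (%v. v$1 * conv z1 ?F 0 + v$2 * conv z2 ?F 0)) (at 0)"
  by (rule has_derivative_transform_within_open[OF D open_ball[of 0 1]]) (auto simp: cv[OF z(3) _ c(1)])
 from has_derivative_unique[OF this has_derivative_const]
 have e: "(%v::real^2. v$1 * conv z1 ?F 0 + v$2 * conv z2 ?F 0) = (%v. 0)" .
 from fun_cong[OF e, of "axis 1 1"] fun_cong[OF e, of "axis 2 1"]
 show "(LI y. z1 y) = 0" "(LI y. z2 y) = 0"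
  using cv[OF s(1) _ c(2), of 0] cv[OF s(2) _ c(3), of 0] by (simp_all add: axis_def)
qed

text \<open>One partial derivative at a time: V stands for that derivative of U and g1 for that of
  g. The conclusion says that V is tangent to the hyperboloid almost everywhere.\<close>

lemma lor_deriv_zero_aux:
 fixes U V :: "real^2 => real^3"
 assumes l: "!!a. loc2 S (%y. U y $ a)" "!!a. loc2 S (%y. V y $ a)" and O: "open S"
  and H: "!!y. y \<in> S ==> lor (U y) (U y) = -1"
  and D: "!!g K a. test_function S g ==> compact K ==> K \<subseteq> S ==> supp_in K g ==>
   EX g1. cont g1 & supp_in K g1 & integral\<^sup>L lborel g1 = 0 &
    (ALL a. (LI y. g1 y * U y $ a * U y $ a + g y * U y $ a * V y $ a + g y * V y $ a * U y $ a) = 0)"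
 shows "AE y\<in>S in lborel. lor (V y) (U y) = 0"
proof (rule fundamental_lemma[OF _ O])
 have m: "(%y. U y $ a) \<in> bor" "(%y. V y $ a) \<in> bor" for a
  using l by (auto simp: loc2_def)
 show L: "loc1 S (%y. lor (V y) (U y))"
  unfolding loc1_def
 proof (intro conjI allI impI)
  show "(%y. lor (V y) (U y)) \<in> bor" unfolding lor_def using m by measurable
  fix K assume K: "compact K & K \<subseteq> S"
  have i: "lint (%y. (indicator K y * V y $ a) * (indicator K y * U y $ a))" for a
   using K by (intro sqi_mult sqi_indicator_loc2[OF l(1)] sqi_indicator_loc2[OF l(2)]) auto
  have "lint (%y. (indicator K y * V y $ 1) * (indicator K y * U y $ 1) + (indicator K y * V y $ 2) * (indicator K y * U y $ 2)
   - (indicator K y * V y $ 3) * (indicator K y * U y $ 3))"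
   by (intro Bochner_Integration.integrable_add Bochner_Integration.integrable_diff i)
  moreover have "(%y. (indicator K y * V y $ 1) * (indicator K y * U y $ 1) + (indicator K y * V y $ 2) * (indicator K y * U y $ 2)
   - (indicator K y * V y $ 3) * (indicator K y * U y $ 3)) = (%y. indicator K y * lor (V y) (U y))"
   by (auto simp: indicator_def lor_def)
  ultimately show "lint (%y. indicator K y * lor (V y) (U y))" by simp
 qed
 fix g assume g: "test_function S g"
 obtain K where K: "C1 g (%y. pd 1 g y) (%y. pd 2 g y)"
  "compact K" "K \<subseteq> S" "supp_in K g" by (rule test_function_C1[OF g])
 from D[OF g K(2-4)] obtain g1 where e: "cont g1 & supp_in K g1 & integral\<^sup>L lborel g1 = 0 &
    (ALL a. (LI y. g1 y * U y $ a * U y $ a + g y * U y $ a * V y $ a + g y * V y $ a * U y $ a) = 0)" ..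
 note c = C1_continuous[OF K(1), of UNIV]
 have "lint (%y. k y * F y $ a * G y $ a)"
  if k: "cont k" "supp_in K k" and F: "!!a. loc2 S (%y. F y $ a)" "!!a. loc2 S (%y. G y $ a)" for k a and F G :: "real^2 => real^3"
 proof -
  obtain B where B: "B >= 0" "!!y. \<bar>k y\<bar> <= B" using bounded_compact_supp[OF k(1) K(2) k(2)] by metis
  show ?thesis
   by (rule sqi_loc2_integrable[OF sqi_mult_loc2[OF F(1) borel_measurable_continuous_onI[OF k(1)] k(2) B(2) K(2,3)]
    supp_in_mult[OF k(2)] F(2) K(2,3)])
 qed
 note i = this
 define t where "t a y = g1 y * U y $ a * U y $ a + g y * U y $ a * V y $ a + g y * V y $ a * U y $ a" for a y
 have ti: "lint (t a)" for a
  unfolding t_def using e c K(4) by (intro Bochner_Integration.integrable_add i l) auto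
 have t0: "integral\<^sup>L lborel (t a) = 0" for a using e unfolding t_def by blast
 \<comment> \<open>The product rules are summed with the Lorentz signs. As (U, U) = -1, the term
   with the derivative of g reduces to - g1, whose integral is 0.\<close>
 have "t 1 y + t 2 y - t 3 y = - g1 y + 2 * (g y * lor (V y) (U y))" for y
 proof (cases "y \<in> S")
  case True
  have "t 1 y + t 2 y - t 3 y = g1 y * lor (U y) (U y) + 2 * (g y * lor (V y) (U y))"
   by (simp add: t_def lor_def algebra_simps)
  thus ?thesis by (simp add: H[OF True])
 next
  case False
  hence "y \<notin> K" using K(3) by blast
  thus ?thesis using e K(4) by (simp add: t_def supp_in_def)
 qed
 hence eq: "(%y. - g1 y + 2 * (g y * lor (V y) (U y))) = (%y. t 1 y + t 2 y - t 3 y)" by simp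
 have s: "(LI y. t 1 y + t 2 y - t 3 y) = 0"
  by (simp add: ti t0)
 obtain B where B: "B >= 0" "!!y. \<bar>g y\<bar> <= B" using bounded_compact_supp[OF c K(2,4)] by metis
 have i1: "lint (%y. g y * lor (V y) (U y))"
  by (rule loc1_mult_supp[OF L borel_measurable_continuous_onI[OF c] B(2) K(4,2,3)])
 have i2: "lint g1" using e K(2) by (intro integrable_compact_supp) auto
 have "(LI y. - g1 y + 2 * (g y * lor (V y) (U y))) = 0" unfolding eq by (rule s)
 thus "(LI y. g y * lor (V y) (U y)) = 0" using i1 i2 e by simp
qed

lemma lor_deriv_zero:
 fixes U U1 U2 :: "real^2 => real^3"
 assumes U: "!!a. wd2 S (%y. U y $ a) (%y. U1 y $ a) (%y. U2 y $ a)" and O: "open S"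
  and H: "!!y. y \<in> S ==> lor (U y) (U y) = -1"
 shows "AE y\<in>S in lborel. lor (U1 y) (U y) = 0" (is ?P1) "AE y\<in>S in lborel. lor (U2 y) (U y) = 0" (is ?P2)
proof -
 have l: "loc2 S (%y. U y $ a)" "loc2 S (%y. U1 y $ a)" "loc2 S (%y. U2 y $ a)" for a using U[of a] by (auto simp: wd2_def)
 have D: "C1 g (%y. pd 1 g y) (%y. pd 2 g y)" if g: "test_function S g" for g
  by (rule test_function_C1[OF g])
 show ?P1
 proof (rule lor_deriv_zero_aux[OF l(1,2) O H])
  fix g K assume t: "test_function S g" "compact K" "K \<subseteq> S" "supp_in K g"
  note C = D[OF t(1)]
  show "EX g1. cont g1 & supp_in K g1 & integral\<^sup>L lborel g1 = 0 &
    (ALL a. (LI y. g1 y * U y $ a * U y $ a + g y * U y $ a * U1 y $ a + g y * U1 y $ a * U y $ a) = 0)"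
   using C wd2_product(1)[OF U U O C t(2-4)] C1_supp_deriv(1)[OF C t(2,4)] C1_integral_zero(1)[OF C t(2,4)]
   unfolding C1_def by (intro exI[of _ "%y. pd 1 g y"] conjI allI) blast+
 qed
 show ?P2
 proof (rule lor_deriv_zero_aux[OF l(1,3) O H])
  fix g K assume t: "test_function S g" "compact K" "K \<subseteq> S" "supp_in K g"
  note C = D[OF t(1)]
  show "EX g1. cont g1 & supp_in K g1 & integral\<^sup>L lborel g1 = 0 &
    (ALL a. (LI y. g1 y * U y $ a * U y $ a + g y * U y $ a * U2 y $ a + g y * U2 y $ a * U y $ a) = 0)"
   using C wd2_product(2)[OF U U O C t(2-4)] C1_supp_deriv(2)[OF C t(2,4)] C1_integral_zero(2)[OF C t(2,4)]
   unfolding C1_def by (intro exI[of _ "%y. pd 2 g y"] conjI allI) blast+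
 qed
qed

section \<open>Weak differentials and functions descending to M\<close>

context surf begin

lemma weak_d_props:
 assumes "W1p_section M \<pi> act p s"
 shows "oform act (weak_d M \<pi> act s)" (is ?P1) "weak_differential M \<pi> s (weak_d M \<pi> act s)" (is ?P2)
proof -
 have "\<exists>\<alpha>. oform act \<alpha> & weak_differential M \<pi> s \<alpha>" using assms unfolding W1p_section_def by blast
 from someI_ex[OF this] show ?P1 ?P2
  unfolding weak_d_def by blast+
qed

lemma weak_d_AE:
 fixes s :: "'c => 'v::euclidean_space"
 assumes s: "W1p_section M \<pi> act p s" and \<alpha>: "weak_differential M \<pi> s \<alpha>" and P: "patch M \<pi> c W"
 shows "AE y in lborel. y \<in> pdom c W -->
  weak_d M \<pi> act s c (pinv c W y) (axis i 1) = \<alpha> c (pinv c W y) (axis i 1)"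
proof (rule weak_partial_unique[OF _ _ patch_props(5)[OF P], where i=i and f="%y. s (pinv c W y)"])
 show "weak_partial (pdom c W) i (%y. s (pinv c W y)) (%y. weak_d M \<pi> act s c (pinv c W y) (axis i 1))"
  "weak_partial (pdom c W) i (%y. s (pinv c W y)) (%y. \<alpha> c (pinv c W y) (axis i 1))"
  using weak_d_props(2)[OF s] \<alpha> P unfolding weak_differential_def by blast+
qed

text \<open>\<open>weak_d\<close> is an arbitrary choice among the weak differentials; uniqueness
  almost everywhere transfers to it the bounds of the one that \<open>W1p_section\<close>
  provides.\<close>

lemma weak_d_local:
 fixes s :: "'c => 'v::euclidean_space"
 assumes s: "W1p_section M \<pi> act p s" and P: "patch M \<pi> c W"
 shows "weak_partial (pdom c W) i (%y. s (pinv c W y)) (%y. weak_d M \<pi> act s c (pinv c W y) (axis i 1))" (is ?P1)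
  "loc_Lp (pdom c W) p (%y. s (pinv c W y))" (is ?P2)
  "loc_Lp (pdom c W) p (%y. weak_d M \<pi> act s c (pinv c W y) (axis i 1))" (is ?P3)
proof -
 show w: ?P1
  using weak_d_props(2)[OF s] P unfolding weak_differential_def by blast
 from s obtain \<alpha> where "weak_differential M \<pi> s \<alpha> & (ALL c W. patch M \<pi> c W -->
     loc_Lp (pdom c W) p (%y. s (pinv c W y)) &
     (ALL i. loc_Lp (pdom c W) p (%y. \<alpha> c (pinv c W y) (axis i 1))))" unfolding W1p_section_def by blast
 hence \<alpha>: "weak_differential M \<pi> s \<alpha>" and l: "loc_Lp (pdom c W) p (%y. s (pinv c W y))"
  "loc_Lp (pdom c W) p (%y. \<alpha> c (pinv c W y) (axis i 1))" using P by blast+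
 show ?P2 by (rule l(1))
 have "set_borel_measurable borel (pdom c W) (%y. weak_d M \<pi> act s c (pinv c W y) (axis i 1))"
  using w by (simp add: weak_partial_def loc_Lp_def)
 thus ?P3
  by (rule loc_Lp_cong_AE[OF l(2)]) (use weak_d_AE[OF s \<alpha> P, of i] in eventually_elim, simp)
qed

lemma one_form_linear: "oform act \<alpha> ==> c \<in> charts M ==> \<pi> x \<in> fst c ==> linear (\<alpha> c x)"
 unfolding one_form_def by blast

lemma deck_pi: "\<gamma> \<in> deck \<pi> ==> \<pi> (\<gamma> x) = \<pi> x"
 unfolding deck_def by (auto simp: fun_eq_iff)

lemma one_form_change:
 assumes \<alpha>: "oform act \<alpha>" and c: "c \<in> charts M" "c' \<in> charts M" "\<pi> x \<in> fst c" "\<pi> x \<in> fst c'" and \<gamma>: "\<gamma> \<in> deck \<pi>"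
 shows "\<alpha> c' (\<gamma> x) (trans_jac c c' (\<pi> x) *v v) = act \<gamma> (\<alpha> c x v)"
proof -
 have "\<alpha> c (\<gamma> x) v = \<alpha> c' (\<gamma> x) (trans_jac c c' (\<pi> (\<gamma> x)) *v v)"
  using \<alpha> c deck_pi[OF \<gamma>, of x] unfolding one_form_def by metis
 moreover have "\<alpha> c (\<gamma> x) v = act \<gamma> (\<alpha> c x v)" using \<alpha> c \<gamma> unfolding one_form_def by blast
 ultimately show ?thesis by (simp add: deck_pi[OF \<gamma>])
qed

text \<open>Under a change of chart numerator and denominator both acquire the factor det J, which
  is positive; the deck transformation is absorbed by invariance of h.\<close>

lemma wedge_invariant:
 assumes c: "c \<in> charts M" "c' \<in> charts M" "\<pi> x \<in> fst c" "\<pi> x \<in> fst c'" and \<gamma>: "\<gamma> \<in> deck \<pi>"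
  and \<alpha>: "oform act \<alpha>" "oform act' \<beta>"
  and h: "bilinear h" "!!a b. h (act \<gamma> a) (act' \<gamma> b) = h a b"
 shows "wedge h \<alpha> \<beta> c' (\<gamma> x) = wedge h \<alpha> \<beta> c x"
proof -
 let ?J = "trans_jac c c' (\<pi> x)" let ?a = "%i. \<alpha> c' (\<gamma> x) (axis i 1)" let ?b = "%i. \<beta> c' (\<gamma> x) (axis i 1)"
 have x': "\<pi> (\<gamma> x) \<in> fst c'" using c by (simp add: deck_pi[OF \<gamma>])
 have e: "h (\<alpha> c x v) (\<beta> c x w) = h (\<alpha> c' (\<gamma> x) (?J *v v)) (\<beta> c' (\<gamma> x) (?J *v w))" for v w
  unfolding one_form_change[OF \<alpha>(1) c \<gamma>] one_form_change[OF \<alpha>(2) c \<gamma>] h(2) ..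
 note la = linear_vec2[OF one_form_linear[OF \<alpha>(1) c(2) x']] and lb = linear_vec2[OF one_form_linear[OF \<alpha>(2) c(2) x']]
 have j: "(?J *v axis k 1) $ l = ?J $ l $ k" for k l by (simp add: matrix_vector_mul_component inner_axis column_def matrix_vector_mult_basis)
 have "h (\<alpha> c x ax1) (\<beta> c x ax2) - h (\<alpha> c x ax2) (\<beta> c x ax1) =
   det ?J * (h (?a 1) (?b 2) - h (?a 2) (?b 1))"
  unfolding e la[of "?J *v axis 1 1"] la[of "?J *v axis 2 1"] lb[of "?J *v axis 1 1"] lb[of "?J *v axis 2 1"] j det_2
   bilinear_ladd[OF h(1)] bilinear_radd[OF h(1)] bilinear_lmul[OF h(1)] bilinear_rmul[OF h(1)]
  by (simp add: algebra_simps)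
 thus ?thesis
  using jac_props(1,3)[OF c] unfolding wedge_density_def deck_pi[OF \<gamma>] by simp
qed

text \<open>Stated at a single point, because the integrand of J_q is shown to be invariant only at
  \<open>good\<close> points.\<close>

definition inv_at :: "('m chart => 'c => real) => 'm => bool" where
 "inv_at F m \<longleftrightarrow> (\<forall>c\<in>charts M. \<forall>c'\<in>charts M. ALL x. \<forall>\<gamma>\<in>deck \<pi>. \<pi> x = m & m \<in> fst c & m \<in> fst c' --> F c' (\<gamma> x) = F c x)"

lemma descend_choice:
 obtains c x where "c \<in> charts M" "m \<in> fst c" "\<pi> x = m" "!!F. desc F m = F c x"
proof -
 have "EX c. c \<in> charts M & m \<in> fst c" using chart_cover[of m] by blast
 from someI_ex[OF this] have c: "(SOME c. c \<in> charts M & m \<in> fst c) \<in> charts M" "m \<in> fst (SOME c. c \<in> charts M & m \<in> fst c)" by auto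
 have "EX x. \<pi> x = m" using covering_evenly(3)[OF cov] by (metis surjD)
 from someI_ex[OF this] have "\<pi> (SOME x. \<pi> x = m) = m" .
 with c show thesis by (rule that) (simp add: descend_def)
qed

text \<open>The point of the fibre chosen by \<open>descend\<close> differs from x by a deck
  transformation; this is where transitivity enters.\<close>

lemma descend_eq:
 assumes i: "inv_at F (\<pi> x)" and c: "c \<in> charts M" "\<pi> x \<in> fst c"
 shows "desc F (\<pi> x) = F c x"
proof -
 obtain c' x' where c': "c' \<in> charts M" "\<pi> x \<in> fst c'" "\<pi> x' = \<pi> x" "!!F. desc F (\<pi> x) = F c' x'"
  by (rule descend_choice[of "\<pi> x"]) blast
 obtain \<gamma> where \<gamma>: "\<gamma> \<in> deck \<pi>" "\<gamma> x = x'" using fibre_deck[of x x'] c'(3) by auto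
 have "F c' (\<gamma> x) = F c x" using i c c' \<gamma>(1) unfolding inv_at_def by blast
 thus ?thesis by (simp add: c'(4) \<gamma>(2))
qed

lemma patch_AE:
 assumes P: "patch M \<pi> c W" and ae: "AE y\<in>pdom c W in lborel. Q (\<pi> (pinv c W y))"
 shows "AE m in area M. m \<in> \<pi> ` W --> Q m"
proof -
 note pp = patch_props[OF P]
 have "AE y in lborel. y \<in> snd c ` fst c --> (cinv c y \<in> \<pi> ` W --> Q (cinv c y))"
  using ae
 proof eventually_elim
  case (elim y)
  show ?case
  proof (intro impI)
   assume y: "y \<in> snd c ` fst c" "cinv c y \<in> \<pi> ` W"
   hence d: "y \<in> pdom c W" using cinv_simps(2)[OF pp(1) y(1)] unfolding patch_dom_def by force
   thus "Q (cinv c y)" using elim pp(9)[OF d] by simp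
  qed
 qed
 from chart_AE[OF pp(1) this] show ?thesis by eventually_elim (use pp(4) in auto)
qed

lemma partition_covers:
 assumes "partition n c W K \<zeta>"
 shows "\<exists>i<n. m \<in> \<pi> ` W i"
proof -
 have s: "(\<Sum>i<n. \<zeta> i m) = 1" using assms unfolding partition_def by blast
 have "\<exists>i<n. \<zeta> i m ~= 0"
 proof (rule ccontr)
  assume "\<not> (\<exists>i<n. \<zeta> i m ~= 0)"
  hence "(\<Sum>i<n. \<zeta> i m) = 0" by (intro sum.neutral) auto
  thus False using s by simp
 qed
 then obtain i where i: "i < n" "\<zeta> i m ~= 0" by blast
 hence "patch M \<pi> (c i) (W i)" "m \<in> fst (c i)" "snd (c i) m \<in> pdom (c i) (W i)"
  using assms unfolding partition_def by blast+
 hence "m \<in> \<pi> ` W i" by (rule patch_props(11))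
 thus ?thesis using i by blast
qed

lemma AE_M:
 assumes "!!c W. patch M \<pi> c W ==> AE y\<in>pdom c W in lborel. Q (\<pi> (pinv c W y))"
 shows "AE m in area M. Q m"
proof -
 obtain n c W K \<zeta> where p: "partition n c W K \<zeta>" using partition_exists by (elim exE) (rule that)
 have "AE m in area M. \<forall>i\<in>{..<n}. m \<in> \<pi> ` W i --> Q m"
  by (intro AE_finite_allI finite_lessThan patch_AE assms) (use p in "auto simp: partition_def")
 thus ?thesis by eventually_elim (use partition_covers[OF p] in blast)
qed

lemma partition_loc:
 assumes p: "partition n c W K \<zeta>" and i: "i < n"
 shows "patch M \<pi> (c i) (W i)" "compact (K i)" "K i \<subseteq> pdom (c i) (W i)" (is ?P1) "C1M (\<zeta> i)"
  "EX z1 z2. C1 (loc (c i) (\<zeta> i)) z1 z2 & supp_in (K i) (loc (c i) (\<zeta> i)) &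
   (ALL x. \<pi> x \<in> fst (c i) --> dform (\<zeta> i) (c i) x ax1 = z1 (snd (c i) (\<pi> x)) & dform (\<zeta> i) (c i) x ax2 = z2 (snd (c i) (\<pi> x)))" (is ?P2)
  "\<zeta> i m ~= 0 ==> m \<in> fst (c i) & snd (c i) m \<in> K i"
proof -
 show a: "patch M \<pi> (c i) (W i)" "compact (K i)" ?P1 "C1M (\<zeta> i)"
  and s: "!!m. \<zeta> i m ~= 0 ==> m \<in> fst (c i) & snd (c i) m \<in> K i"
  using p i unfolding partition_def by blast+
 note pp = patch_props[OF a(1)]
 show ?P2
  by (rule loc_C1[OF a(4) pp(1) a(2)]) (use a(3) pp(6) s in auto)
qed

text \<open>Only Borel representatives f i of H times the area density in the patches are required;
  measurability of H itself is a consequence.\<close>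

lemma partition_integral:
 assumes p: "partition n c W K \<zeta>"
  and f: "!!i. i < n ==> f i \<in> bor"
   "!!i. i < n ==> AE y\<in>pdom (c i) (W i) in lborel. H (cinv (c i) y) * sd (c i) y = f i y"
   "!!i. i < n ==> lint (%y. loc (c i) (\<zeta> i) y * f i y)"
 shows "integrable area_c H"
  "integral\<^sup>L area_c H = (\<Sum>i<n. LI y. loc (c i) (\<zeta> i) y * f i y)" (is ?P1)
proof -
 have I: "integrable area_c (%m. \<zeta> i m * H m) &
  integral\<^sup>L area_c (%m. \<zeta> i m * H m) = (LI y. loc (c i) (\<zeta> i) y * f i y)" if i: "i < n" for i
 proof -
  note pl = partition_loc[OF p i] and pp = patch_props[OF partition_loc(1)[OF p i]]
  let ?O = "snd (c i) ` fst (c i)"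
  from pl(5) obtain z1 z2 where z: "C1 (loc (c i) (\<zeta> i)) z1 z2" "supp_in (K i) (loc (c i) (\<zeta> i))" by blast
  have lm: "loc (c i) (\<zeta> i) \<in> bor"
   by (rule borel_measurable_continuous_onI[OF C1_continuous[OF z(1)]])
  have e: "(%y. indicator ?O y * (loc (c i) (\<zeta> i) y * f i y)) = (%y. loc (c i) (\<zeta> i) y * f i y)"
   by (auto simp: loc_def indicator_def)
  have 1: "\<zeta> i m * H m = 0" if "m \<notin> fst (c i)" for m using pl(6)[of m] that by auto
  have 2: "(%y. loc (c i) (\<zeta> i) y * f i y) \<in> bor" using lm f(1)[OF i] by simp
  have 3: "AE y\<in>?O in lborel. \<zeta> i (cinv (c i) y) * H (cinv (c i) y) * sd (c i) y = loc (c i) (\<zeta> i) y * f i y"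
   using f(2)[OF i]
  proof eventually_elim
   case (elim y)
   show ?case
   proof
    assume y: "y \<in> ?O"
    show "\<zeta> i (cinv (c i) y) * H (cinv (c i) y) * sd (c i) y = loc (c i) (\<zeta> i) y * f i y"
    proof (cases "y \<in> pdom (c i) (W i)")
     case True thus ?thesis using elim y by (simp add: loc_def mult.assoc)
    next
     case False
     hence "loc (c i) (\<zeta> i) y = 0" using z(2) pl(3) unfolding supp_in_def by blast
     thus ?thesis using y by (simp add: loc_def)
    qed
   qed
  qed
  have 4: "lint (%y. indicator ?O y * (loc (c i) (\<zeta> i) y * f i y))" unfolding e by (rule f(3)[OF i])
  from chart_integral[OF pp(1), of "%m. \<zeta> i m * H m", OF 1 2 3 4] show ?thesis unfolding e by blast
 qed
 have "(%m. \<Sum>i<n. \<zeta> i m * H m) = H"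
 proof
  fix m
  have "(\<Sum>i<n. \<zeta> i m) = 1" using p unfolding partition_def by blast
  thus "(\<Sum>i<n. \<zeta> i m * H m) = H m" by (simp add: sum_distrib_right[symmetric])
 qed
 moreover have "integrable area_c (%m. \<Sum>i<n. \<zeta> i m * H m)"
  using I by (intro Bochner_Integration.integrable_sum) auto
 moreover have "(\<integral>m. (\<Sum>i<n. \<zeta> i m * H m) \<partial>area_c) = (\<Sum>i<n. LI y. loc (c i) (\<zeta> i) y * f i y)"
  using I by (subst Bochner_Integration.integral_sum) auto
 ultimately show "integrable area_c H"
  ?P1 by simp_all
qed

lemma dform_zero:
 assumes z: "C1M \<zeta>" and c: "c \<in> charts M" "\<pi> x \<in> fst c" and T: "open T" "\<pi> x \<in> T" "!!m. m \<in> T ==> \<zeta> m = 0"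
 shows "dform \<zeta> c x v = 0"
proof -
 have o: "open (snd c ` (T \<inter> fst c))" by (rule chart_image_open'[OF c(1)]) (use T chart_open[OF c(1)] in auto)
 have y: "snd c (\<pi> x) \<in> snd c ` (T \<inter> fst c)" using c T by blast
 have "((%y. \<zeta> (cinv c y)) has_derivative (%v. 0)) (at (snd c (\<pi> x)))"
  by (rule has_derivative_transform_within_open[OF has_derivative_const[of 0] o y]) (use T(3) cinv_simps(1)[OF c(1)] in auto)
 from has_derivative_unique[OF C1M_dform[OF z c] this] show ?thesis by (rule fun_cong)
qed

end

lemma borel_bilinear:
 fixes h :: "'a::euclidean_space => 'b::euclidean_space => 'c::euclidean_space"
 assumes h: "bilinear h" and f: "f \<in> borel_measurable N" and g: "g \<in> borel_measurable N"
 shows "(%y. h (f y) (g y)) \<in> borel_measurable N"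
proof -
 have bb: "bounded_bilinear h" using h by (simp add: bilinear_conv_bounded_bilinear)
 have "cont (%x. h (fst x) (snd x))"
  by (intro bounded_bilinear.continuous_on[OF bb] continuous_intros)
 from borel_measurable_continuous_Pair[OF f g this] show ?thesis .
qed

lemma bilinear_mcross: "bilinear mcross"
 unfolding bilinear_def
 by (auto intro!: linearI simp: mcross_add mcross_scale) (simp_all add: vec_eq_iff mcross_def sharp_def forall_3 algebra_simps)

lemma bilinear_matvec: "bilinear (%(A::real^3^3) x. A *v x)"
 unfolding bilinear_def
 by (auto intro!: linearI simp: matrix_vector_right_distrib matrix_vector_mult_scaleR)
  (simp_all add: vec_eq_iff matrix_vector_mult_def sum_3 algebra_simps)

context surf begin

definition rep :: "'m chart => 'c set => ('c => 'v::real_vector) => real^2 => 'v" where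
 "rep c W f y = indicat_real (pdom c W) y *\<^sub>R f (pinv c W y)"

lemma rep_in: "y \<in> pdom c W ==> rep c W f y = f (pinv c W y)"
 by (simp add: rep_def)

lemma rep_out: "y \<notin> pdom c W ==> rep c W f y = 0"
 by (simp add: rep_def)

lemma rep_measurable:
 "loc_Lp (pdom c W) r (%y. f (pinv c W y)) ==> rep c W f \<in> bor"
 by (simp add: loc_Lp_def set_borel_measurable_def rep_def[abs_def])

lemma wd2_rep:
 fixes s :: "'c => 'v::euclidean_space"
 assumes s: "W1p_section M \<pi> act p s" and P: "patch M \<pi> c W" and p: "p > 2"
 shows "wd2 (pdom c W) (%y. rep c W s y \<bullet> b) (%y. rep c W (%x. weak_d M \<pi> act s c x ax1) y \<bullet> b)
  (%y. rep c W (%x. weak_d M \<pi> act s c x ax2) y \<bullet> b)"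
proof -
 note l = weak_d_local[OF s P]
 have "p >= 2" using p by simp
 from weak_partial_wd2[OF l(1) l(1) this l(2) l(3) l(3), of b] show ?thesis by (simp add: rep_def)
qed

end

section \<open>The lift U, its one-forms and Stokes' theorem on M\<close>

locale hmap = surf M \<pi> for M :: "'m::{t2_space,second_countable_topology} rsurface" and \<pi> :: "'c::topological_space => 'm" +
 fixes \<rho> :: "('c => 'c) => real^3^3" and U :: "'c => real^3" and p q :: real
 assumes \<rho>: "!!\<gamma>. \<gamma> \<in> deck \<pi> ==> \<rho> \<gamma> \<in> SO21_plus" and Uc: "cont U" and UH: "U x \<in> hyperboloid"
  and UW: "W1p_section M \<pi> (std_act \<rho>) p U" and pq: "p > 2" "1 / p + 1 / q = 1"
begin

abbreviation "dP \<equiv> weak_d M \<pi> (ad_act \<rho>)"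
abbreviation "dU \<equiv> weak_d M \<pi> (std_act \<rho>) U"
abbreviation "Du \<equiv> Du_form M \<pi> \<rho> U"
abbreviation "PS \<equiv> p_sections M \<pi> \<rho> U p"

definition X :: "('m, 'c, real^3^3) form1" where "X c x v = mcross (dU c x v) (U x)"

text \<open>A scalar one-form invariant under deck transformations. Formally its exterior derivative
  is half of the density of \<open>Du \<phi>\<close> wedge X.\<close>

definition \<theta> :: "('c => real^3^3) => ('m, 'c, real) form1" where "\<theta> \<phi> c x v = lor (\<phi> x *v U x) (dU c x v)"

lemma U_deck: "\<gamma> \<in> deck \<pi> ==> U (\<gamma> x) = \<rho> \<gamma> *v U x"
 using UW unfolding W1p_section_def bundle_section_def std_act_def by blast

lemma UU: "lor (U x) (U x) = -1" by (rule hyperboloid_lor[OF UH])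

lemma PS_D:
 assumes "\<phi> \<in> PS"
 shows "W1p_section M \<pi> (ad_act \<rho>) p \<phi>" "\<phi> x = p_proj (U x) (\<phi> x)" "\<gamma> \<in> deck \<pi> ==> \<phi> (\<gamma> x) = ad_act \<rho> \<gamma> (\<phi> x)"
 using assms unfolding p_sections_def W1p_section_def bundle_section_def by blast+

lemma dU_one: "oform (std_act \<rho>) dU" by (rule weak_d_props(1)[OF UW])

lemma one_formI:
 assumes "!!c x. c \<in> charts M ==> \<pi> x \<in> fst c ==> linear (\<alpha> c x)"
  "!!c x \<gamma> v. c \<in> charts M ==> \<pi> x \<in> fst c ==> \<gamma> \<in> deck \<pi> ==> \<alpha> c (\<gamma> x) v = act \<gamma> (\<alpha> c x v)"
  "!!c c' x v. c \<in> charts M ==> \<pi> x \<in> fst c ==> c' \<in> charts M ==> \<pi> x \<in> fst c' ==>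
   \<alpha> c x v = \<alpha> c' x (trans_jac c c' (\<pi> x) *v v)"
 shows "oform act \<alpha>"
 unfolding one_form_def by (intro ballI allI impI conjI assms)

lemma one_form_D:
 assumes "oform act \<alpha>" "c \<in> charts M" "\<pi> x \<in> fst c"
 shows "linear (\<alpha> c x)" "\<gamma> \<in> deck \<pi> ==> \<alpha> c (\<gamma> x) v = act \<gamma> (\<alpha> c x v)"
  "c' \<in> charts M ==> \<pi> x \<in> fst c' ==> \<alpha> c x v = \<alpha> c' x (trans_jac c c' (\<pi> x) *v v)"
 using assms unfolding one_form_def by blast+

lemma X_one: "oform (ad_act \<rho>) X"
proof (rule one_formI)
 fix c x assume c: "c \<in> charts M" "\<pi> x \<in> fst c"
 note d = one_form_D[OF dU_one c]
 have "X c x = (%v. mcross (dU c x v) (U x))" by (simp add: X_def fun_eq_iff)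
 thus "linear (X c x)" using linear_compose[OF d(1) linear_mcross, of "U x"] by (simp add: o_def)
 show "X c (\<gamma> x) v = ad_act \<rho> \<gamma> (X c x v)" if "\<gamma> \<in> deck \<pi>" for \<gamma> v
  unfolding X_def d(2)[OF that] U_deck[OF that] std_act_def ad_act_def by (rule mcross_equivariant[OF \<rho>[OF that]])
 show "X c x v = X c' x (trans_jac c c' (\<pi> x) *v v)" if "c' \<in> charts M" "\<pi> x \<in> fst c'" for c' v
  unfolding X_def d(3)[OF that, of v] ..
qed

lemma Du_one:
 assumes \<phi>: "\<phi> \<in> PS" shows "oform (ad_act \<rho>) (Du \<phi>)"
proof (rule one_formI)
 fix c x assume c: "c \<in> charts M" "\<pi> x \<in> fst c"
 note d = one_form_D[OF weak_d_props(1)[OF PS_D(1)[OF \<phi>]] c]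
 have "linear (%A. mcross (A *v U x) (U x))"
  by (rule linearI) (simp_all add: matrix_vector_mult_add_rdistrib mcross_add scaleR_matrix_vector_assoc[symmetric] mcross_scale)
 from linear_compose[OF d(1) this] show "linear (Du \<phi> c x)" by (simp add: o_def Du_form_def[abs_def] p_proj_def)
 show "Du \<phi> c (\<gamma> x) v = ad_act \<rho> \<gamma> (Du \<phi> c x v)" if "\<gamma> \<in> deck \<pi>" for \<gamma> v
  unfolding Du_form_def d(2)[OF that] U_deck[OF that] ad_act_def by (rule p_proj_equivariant[OF \<rho>[OF that]])
 show "Du \<phi> c x v = Du \<phi> c' x (trans_jac c c' (\<pi> x) *v v)" if "c' \<in> charts M" "\<pi> x \<in> fst c'" for c' v
  unfolding Du_form_def d(3)[OF that, of v] ..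
qed

lemma \<theta>_one:
 assumes \<phi>: "\<phi> \<in> PS" shows "oform (%_ r. r) (\<theta> \<phi>)"
proof (rule one_formI)
 fix c x assume c: "c \<in> charts M" "\<pi> x \<in> fst c"
 note d = one_form_D[OF dU_one c]
 have "linear (lor (\<phi> x *v U x))" using bilinear_lor by (simp add: bilinear_def)
 from linear_compose[OF d(1) this] show "linear (\<theta> \<phi> c x)" by (simp add: o_def \<theta>_def[abs_def])
 show "\<theta> \<phi> c (\<gamma> x) v = \<theta> \<phi> c x v" if g: "\<gamma> \<in> deck \<pi>" for \<gamma> v
 proof -
  have "ad_act \<rho> \<gamma> (\<phi> x) *v (\<rho> \<gamma> *v U x) = \<rho> \<gamma> *v (\<phi> x *v U x)"
   by (simp add: ad_act_def matrix_vector_mul_assoc matrix_mul_assoc[symmetric] SO21_inv[OF \<rho>[OF g]])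
  thus ?thesis
   unfolding \<theta>_def d(2)[OF g] U_deck[OF g] std_act_def PS_D(3)[OF \<phi> g] by (simp add: SO21_lor[OF \<rho>[OF g]])
 qed
 show "\<theta> \<phi> c x v = \<theta> \<phi> c' x (trans_jac c c' (\<pi> x) *v v)" if "c' \<in> charts M" "\<pi> x \<in> fst c'" for c' v
  unfolding \<theta>_def d(3)[OF that, of v] ..
qed

lemma ad_trace: "\<gamma> \<in> deck \<pi> ==> trace_form (ad_act \<rho> \<gamma> A) (ad_act \<rho> \<gamma> B) = trace_form A B"
 unfolding ad_act_def by (rule trace_form_conj[OF \<rho>])

lemma wedge_inv:
 assumes "\<phi> \<in> PS" shows "inv_at (wedge trace_form (Du \<phi>) X) m"
 unfolding inv_at_def
proof (intro ballI allI impI)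
 fix c c' x \<gamma> assume a: "c \<in> charts M" "c' \<in> charts M" "\<gamma> \<in> deck \<pi>" "\<pi> x = m & m \<in> fst c & m \<in> fst c'"
 have x: "\<pi> x \<in> fst c" "\<pi> x \<in> fst c'" using a(4) by blast+
 show "wedge trace_form (Du \<phi>) X c' (\<gamma> x) = wedge trace_form (Du \<phi>) X c x"
  by (rule wedge_invariant[where act="ad_act \<rho>" and act'="ad_act \<rho>" and h=trace_form, OF a(1,2) x a(3) Du_one[OF assms] X_one bilinear_trace_form ad_trace[OF a(3)]])
qed

lemma wedge_inv_scalar:
 assumes "\<phi> \<in> PS" "C1M k" shows "inv_at (wedge (*) (dform k) (\<theta> \<phi>)) m"
proof -
 have b: "bilinear ((*) :: real => real => real)" by (simp add: bilinear_conv_bounded_bilinear bounded_bilinear_mult)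
 show ?thesis unfolding inv_at_def
 proof (intro ballI allI impI)
  fix c c' x \<gamma> assume a: "c \<in> charts M" "c' \<in> charts M" "\<gamma> \<in> deck \<pi>" "\<pi> x = m & m \<in> fst c & m \<in> fst c'"
  have x: "\<pi> x \<in> fst c" "\<pi> x \<in> fst c'" using a(4) by blast+
  show "wedge (*) (dform k) (\<theta> \<phi>) c' (\<gamma> x) = wedge (*) (dform k) (\<theta> \<phi>) c x"
   by (rule wedge_invariant[where act="%_ r. r" and act'="%_ r. r" and h="(*)", OF a(1,2) x a(3) dform_one_form[OF assms(2)] \<theta>_one[OF assms(1)] b]) (rule refl)
 qed
qed

text \<open>The chosen weak differential is tangent to the hyperboloid only almost everywhere; all
  pointwise algebra is confined to these points.\<close>

definition good :: "'m => bool" where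
 "good m \<longleftrightarrow> (\<forall>c\<in>charts M. ALL x. \<pi> x = m & m \<in> fst c --> (ALL v. lor (dU c x v) (U x) = 0))"

lemma jac_surj:
 assumes "c \<in> charts M" "c' \<in> charts M" "m \<in> fst c" "m \<in> fst c'"
 shows "EX v. w = trans_jac c c' m *v v" (is ?P1) "invertible (trans_jac c c' m)"
proof -
 show i: "invertible (trans_jac c c' m)" using jac_props(1)[OF assms] by (simp add: invertible_det_nz)
 hence "w = trans_jac c c' m *v (matrix_inv (trans_jac c c' m) *v w)"
  by (simp add: matrix_vector_mul_assoc matrix_inv_mult(2))
 thus ?P1 by blast
qed

text \<open>A property of the two coordinate values at one point of the fibre passes to all charts
  and to the whole fibre, since Jacobians are invertible and deck transformations act
  transitively.\<close>

lemma form_vanish: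
 assumes \<alpha>: "oform act \<alpha>" and c: "c \<in> charts M" "\<pi> x \<in> fst c" "c' \<in> charts M" "\<pi> x' = \<pi> x" "\<pi> x \<in> fst c'"
  and Q: "Q x (\<alpha> c x ax1)" "Q x (\<alpha> c x ax2)" "!!a b r s. Q x a ==> Q x b ==> Q x (r *\<^sub>R a + s *\<^sub>R b)"
   "!!\<gamma> a. \<gamma> \<in> deck \<pi> ==> Q x a ==> Q (\<gamma> x) (act \<gamma> a)"
 shows "Q x' (\<alpha> c' x' v)"
proof -
 obtain \<gamma> where \<gamma>: "\<gamma> \<in> deck \<pi>" "\<gamma> x = x'" using fibre_deck[of x x'] c(4) by auto
 obtain w where w: "v = trans_jac c c' (\<pi> x) *v w" using jac_surj(1)[OF c(1,3,2,5)] by blast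
 have "Q x (\<alpha> c x w)" unfolding linear_vec2[OF one_form_linear[OF \<alpha> c(1,2)], of w] by (rule Q(3)[OF Q(1,2)])
 from Q(4)[OF \<gamma>(1) this] show ?thesis
  unfolding w \<gamma>(2)[symmetric] one_form_change[OF \<alpha> c(1,3,2,5) \<gamma>(1)] .
qed

lemma goodI:
 assumes c: "c \<in> charts M" "\<pi> x \<in> fst c" and z: "lor (dU c x ax1) (U x) = 0" "lor (dU c x ax2) (U x) = 0"
 shows "good (\<pi> x)"
 unfolding good_def
proof (intro ballI allI impI)
 fix c' x' v assume "c' \<in> charts M" "\<pi> x' = \<pi> x & \<pi> x \<in> fst c'"
 thus "lor (dU c' x' v) (U x') = 0"
  using form_vanish[OF dU_one c, of c' x' "%x a. lor a (U x) = 0"] z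
  by (simp add: lor_bil U_deck std_act_def SO21_lor[OF \<rho>])
qed

lemma wd2_U:
 assumes P: "patch M \<pi> c W"
 shows "wd2 (pdom c W) (%y. rep c W U y $ a) (%y. rep c W (%x. dU c x ax1) y $ a)
  (%y. rep c W (%x. dU c x ax2) y $ a)"
 using wd2_rep[OF UW P pq(1), of "axis a 1"] by (simp add: inner_axis)

lemma wd2_PS:
 assumes \<phi>: "\<phi> \<in> PS" and P: "patch M \<pi> c W"
 shows "wd2 (pdom c W) (%y. rep c W \<phi> y $ a $ b) (%y. rep c W (%x. dP \<phi> c x ax1) y $ a $ b)
  (%y. rep c W (%x. dP \<phi> c x ax2) y $ a $ b)"
 using wd2_rep[OF PS_D(1)[OF \<phi>] P pq(1), of "axis a (axis b 1)"] by (simp add: inner_axis)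

lemma patch_point:
 assumes P: "patch M \<pi> c W" and y: "y \<in> pdom c W"
 shows "c \<in> charts M" "\<pi> (pinv c W y) \<in> fst c"
 using patch_props(1,4,7)[OF P] y by auto

lemma good_AE_patch:
 assumes P: "patch M \<pi> c W"
 shows "AE y\<in>pdom c W in lborel. good (\<pi> (pinv c W y))"
proof -
 have H: "lor (rep c W U y) (rep c W U y) = -1" if "y \<in> pdom c W" for y
  unfolding rep_in[OF that] by (rule UU)
 have z: "AE y\<in>pdom c W in lborel. lor (rep c W (%x. dU c x ax1) y) (rep c W U y) = 0"
  "AE y\<in>pdom c W in lborel. lor (rep c W (%x. dU c x ax2) y) (rep c W U y) = 0"
  by (rule lor_deriv_zero[OF wd2_U[OF P] patch_props(5)[OF P]], erule H)+
 from z show ?thesis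
 proof eventually_elim
  case (elim y)
  show ?case
  proof
   assume y: "y \<in> pdom c W"
   show "good (\<pi> (pinv c W y))"
    by (rule goodI[OF patch_point[OF P y]]) (use elim y in "simp_all add: rep_in")
  qed
 qed
qed

lemma good_AE: "AE m in area M. good m"
 by (rule AE_M) (rule good_AE_patch)

lemma local_stokes_rep:
 assumes \<phi>: "\<phi> \<in> PS" and P: "patch M \<pi> c W" and z: "C1 z z1 z2" "compact K" "K \<subseteq> pdom c W" "supp_in K z"
 defines "u \<equiv> rep c W U" and "u1 \<equiv> rep c W (%x. dU c x ax1)" and "u2 \<equiv> rep c W (%x. dU c x ax2)"
  and "f \<equiv> rep c W \<phi>" and "f1 \<equiv> rep c W (%x. dP \<phi> c x ax1)"
  and "f2 \<equiv> rep c W (%x. dP \<phi> c x ax2)"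
 shows "(LI y. z y * (lor (f1 y *v u y) (u2 y) - lor (f2 y *v u y) (u1 y))) =
   (LI y. z2 y * lor (f y *v u y) (u1 y) - z1 y * lor (f y *v u y) (u2 y))" (is ?P1)
  and "lint (%y. z y * (lor (f1 y *v u y) (u2 y) - lor (f2 y *v u y) (u1 y)))" (is ?P2)
  and "lint (%y. z2 y * lor (f y *v u y) (u1 y) - z1 y * lor (f y *v u y) (u2 y))" (is ?P3)
proof -
 note pp = patch_props[OF P]
 have "compact ((%y. U (pinv c W y)) ` K)"
  by (intro compact_continuous_image z(2) continuous_on_compose2[OF Uc continuous_on_subset[OF pp(10) z(3)]]) auto
 then obtain B where B: "!!y. y \<in> K ==> norm (U (pinv c W y)) <= B"
  using compact_imp_bounded bounded_iff by (metis imageI)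
 have ub: "\<bar>u y $ a\<bar> <= B" if y: "y \<in> K" for y a
 proof -
  have "u y = U (pinv c W y)" unfolding u_def by (rule rep_in) (use y z(3) in blast)
  thus ?thesis using B[OF y] component_le_norm_cart[of "u y" a] by simp
 qed
 \<comment> \<open>At good points both partial derivatives of U are tangent, so both sides are 0 by
   \<open>p_section_mult\<close>.\<close>
 have sym: "AE y\<in>K in lborel. lor (f y *v u2 y) (u1 y) = lor (f y *v u1 y) (u2 y)"
  using good_AE_patch[OF P]
 proof eventually_elim
  case (elim y)
  show ?case
  proof
   assume "y \<in> K"
   hence y: "y \<in> pdom c W" using z(3) by blast
   have g: "lor (U (pinv c W y)) (dU c (pinv c W y) v) = 0" for v
    using elim y patch_point[OF P y] lor_sym unfolding good_def by metis
   show "lor (f y *v u2 y) (u1 y) = lor (f y *v u1 y) (u2 y)"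
    unfolding f_def u1_def u2_def rep_in[OF y]
    by (simp add: p_section_mult[OF UU PS_D(2)[OF \<phi>] g g])
  qed
 qed
 note L = local_stokes[OF wd2_U[OF P] wd2_PS[OF \<phi> P] pp(5) _ z(1,2,3,4), folded u_def u1_def u2_def f_def f1_def f2_def, OF ub sym]
 show ?P1 by (rule L(1))
 show ?P2 by (rule L(2))
 show ?P3 by (rule L(3))
qed

lemma wedge_point:
 assumes g: "!!v. lor (dU c x v) (U x) = 0"
 shows "wedge trace_form (Du \<phi>) X c x = 2 * (lor (dP \<phi> c x ax1 *v U x) (dU c x ax2)
  - lor (dP \<phi> c x ax2 *v U x) (dU c x ax1)) / sqrt (det (gram M c (\<pi> x)))"
 unfolding wedge_density_def X_def Du_form_def p_proj_def mcross_ip[OF UU] g by simp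

text \<open>A partition of unity turns the local integrations by parts into \<open>\<integral> d(\<Sum>k\<^sub>i) \<and> \<theta> = 0\<close>.\<close>

lemma stokes:
 assumes \<phi>: "\<phi> \<in> PS"
 defines "H \<equiv> desc (wedge trace_form (Du \<phi>) X)"
 shows "integrable area_c H" "integral\<^sup>L area_c H = 0"
proof -
 obtain n c W K k where pt: "partition n c W K k" using partition_exists by (elim exE) (rule that)
 define u where "u i = rep (c i) (W i) U" for i
 define u1 where "u1 i = rep (c i) (W i) (%x. dU (c i) x ax1)" for i
 define u2 where "u2 i = rep (c i) (W i) (%x. dU (c i) x ax2)" for i
 define f where "f i = rep (c i) (W i) \<phi>" for i
 define f1 where "f1 i = rep (c i) (W i) (%x. dP \<phi> (c i) x ax1)" for i
 define f2 where "f2 i = rep (c i) (W i) (%x. dP \<phi> (c i) x ax2)" for i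
 define F where "F i y = 2 * (lor (f1 i y *v u i y) (u2 i y) - lor (f2 i y *v u i y) (u1 i y))" for i y
 \<comment> \<open>The density of the differential of k i wedge \<theta>.\<close>
 define Hi where "Hi i = desc (wedge (*) (dform (k i)) (\<theta> \<phi>))" for i
 have mb: "u i \<in> bor" "u1 i \<in> bor" "u2 i \<in> bor"
  "f i \<in> bor" "f1 i \<in> bor" "f2 i \<in> bor" if i: "i < n" for i
  unfolding u_def u1_def u2_def f_def f1_def f2_def
  by (rule rep_measurable, rule weak_d_local[OF UW partition_loc(1)[OF pt i]] weak_d_local[OF PS_D(1)[OF \<phi>] partition_loc(1)[OF pt i]])+
 note bl = borel_bilinear[OF bilinear_lor borel_bilinear[OF bilinear_matvec]]
 have Fm: "F i \<in> bor" if "i < n" for i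
  unfolding F_def by (intro borel_measurable_times borel_measurable_const borel_measurable_diff bl mb that)
 have sdp: "sqrt (det (gram M (c i) (\<pi> (pinv (c i) (W i) y)))) = sd (c i) y" "sd (c i) y > 0"
  if i: "i < n" and y: "y \<in> pdom (c i) (W i)" for i y
  using patch_props(9)[OF partition_loc(1)[OF pt i] y] sd_pos[OF patch_props(1)[OF partition_loc(1)[OF pt i]], of y]
   patch_props(6)[OF partition_loc(1)[OF pt i]] y by (auto simp: sd_def)
 have HF: "AE y\<in>pdom (c i) (W i) in lborel. H (cinv (c i) y) * sd (c i) y = F i y" if i: "i < n" for i
  using good_AE_patch[OF partition_loc(1)[OF pt i]]
 proof eventually_elim
  case (elim y)
  show ?case
  proof
   assume y: "y \<in> pdom (c i) (W i)"
   let ?x = "pinv (c i) (W i) y"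
   note pq' = patch_point[OF partition_loc(1)[OF pt i] y]
   have g: "lor (dU (c i) ?x v) (U ?x) = 0" for v using elim y pq' unfolding good_def by blast
   have "H (cinv (c i) y) = wedge trace_form (Du \<phi>) X (c i) ?x"
    unfolding H_def patch_props(9)[OF partition_loc(1)[OF pt i] y, symmetric] by (rule descend_eq[OF wedge_inv[OF \<phi>] pq'])
   thus "H (cinv (c i) y) * sd (c i) y = F i y"
    using sdp[OF i y] unfolding wedge_point[OF g] F_def f1_def f2_def u_def u1_def u2_def rep_in[OF y] by simp
  qed
 qed
 define Z where "Z i zz \<longleftrightarrow> C1 (loc (c i) (k i)) (fst zz) (snd zz) & supp_in (K i) (loc (c i) (k i)) &
   (ALL x. \<pi> x \<in> fst (c i) --> dform (k i) (c i) x ax1 = fst zz (snd (c i) (\<pi> x)) &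
    dform (k i) (c i) x ax2 = snd zz (snd (c i) (\<pi> x)))" for i zz
 have "\<forall>i\<in>{..<n}. EX zz. Z i zz"
  unfolding Z_def split_paired_Ex fst_conv snd_conv by (intro ballI partition_loc(5)[OF pt]) simp
 from bchoice[OF this] obtain zz where zz: "\<forall>i\<in>{..<n}. Z i (zz i)" ..
 define z1 z2 where "z1 i = fst (zz i)" and "z2 i = snd (zz i)" for i
 have z: "C1 (loc (c i) (k i)) (z1 i) (z2 i) & supp_in (K i) (loc (c i) (k i)) &
   (ALL x. \<pi> x \<in> fst (c i) --> dform (k i) (c i) x ax1 = z1 i (snd (c i) (\<pi> x)) & dform (k i) (c i) x ax2 = z2 i (snd (c i) (\<pi> x)))"
  if "i < n" for i using bspec[OF zz, of i] that unfolding Z_def z1_def z2_def by simp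
 define E where "E i y = z1 i y * lor (f i y *v u i y) (u2 i y) - z2 i y * lor (f i y *v u i y) (u1 i y)" for i y
 \<comment> \<open>The factor 2 is that of F; the sign comes from the orientation convention in
   E.\<close>
 have LS: "(LI y. loc (c i) (k i) y * F i y) = - 2 * integral\<^sup>L lborel (E i)"
  "lint (%y. loc (c i) (k i) y * F i y)" "lint (E i)" if i: "i < n" for i
 proof -
  note pl = partition_loc[OF pt i]
  have zi: "C1 (loc (c i) (k i)) (z1 i) (z2 i)" "supp_in (K i) (loc (c i) (k i))" using z[OF i] by blast+
  note S = local_stokes_rep[OF \<phi> pl(1) zi(1) pl(2,3) zi(2), folded u_def u1_def u2_def f_def f1_def f2_def]
  have e: "(%y. loc (c i) (k i) y * F i y) = (%y. 2 * (loc (c i) (k i) y * (lor (f1 i y *v u i y) (u2 i y) - lor (f2 i y *v u i y) (u1 i y))))"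
   by (simp add: F_def fun_eq_iff)
  have e': "E i = (%y. - (z2 i y * lor (f i y *v u i y) (u1 i y) - z1 i y * lor (f i y *v u i y) (u2 i y)))"
   by (simp add: E_def fun_eq_iff)
  show "lint (%y. loc (c i) (k i) y * F i y)" unfolding e using S(2) by simp
  show "lint (E i)" unfolding e' using S(3) by (rule Bochner_Integration.integrable_minus)
  show "(LI y. loc (c i) (k i) y * F i y) = - 2 * integral\<^sup>L lborel (E i)"
   unfolding e e' Bochner_Integration.integral_minus Bochner_Integration.integral_mult_right_zero S(1) by simp
 qed
 note P = partition_integral[OF pt Fm HF LS(2)]
 show "integrable area_c H" by (rule P(1))
 have P2: "integral\<^sup>L area_c H = (\<Sum>i<n. LI y. loc (c i) (k i) y * F i y)" by (rule P(2))
 have HE: "integrable area_c (Hi i) & integral\<^sup>L area_c (Hi i) = integral\<^sup>L lborel (E i)" if i: "i < n" for i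
 proof -
  note pl = partition_loc[OF pt i] and pp = patch_props[OF partition_loc(1)[OF pt i]]
  let ?O = "snd (c i) ` fst (c i)"
  have zi: "C1 (loc (c i) (k i)) (z1 i) (z2 i)" "supp_in (K i) (loc (c i) (k i))" using z[OF i] by blast+
  have zd: "dform (k i) (c i) x ax1 = z1 i (snd (c i) (\<pi> x))" "dform (k i) (c i) x ax2 = z2 i (snd (c i) (\<pi> x))"
   if "\<pi> x \<in> fst (c i)" for x using z[OF i] that by blast+
  define S where "S = cinv (c i) ` K i"
  have KO: "K i \<subseteq> ?O" using pl(3) pp(6) by blast
  have "compact S" unfolding S_def
   by (rule compact_continuous_image[OF continuous_on_subset[OF homeomorphism_cont2[OF chart_homeo[OF pp(1)]] KO] pl(2)])
  hence oS: "open (- S)" by (simp add: compact_imp_closed open_Compl)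
  have zS: "k i m = 0" if "m \<in> - S" for m
  proof (rule ccontr)
   assume "k i m ~= 0"
   hence "m \<in> fst (c i)" "snd (c i) m \<in> K i" using pl(6)[of m] by auto
   hence "m \<in> S" using cinv_simps(1)[OF pp(1)] unfolding S_def by force
   thus False using that by simp
  qed
  \<comment> \<open>The complement of the support is open, so there not only k i but also its
    differential vanishes.\<close>
  have Hz: "Hi i m = 0" if m: "m \<notin> S" for m
  proof -
   obtain c' x' where c': "c' \<in> charts M" "m \<in> fst c'" "\<pi> x' = m" "!!F. desc F m = F c' x'"
    by (rule descend_choice[of m]) blast
   have "dform (k i) c' x' v = 0" for v
    by (rule dform_zero[OF pl(4) c'(1) _ oS]) (use c' m zS in auto)
   thus ?thesis unfolding Hi_def c'(4) wedge_density_def by simp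
  qed
  have SO: "S \<subseteq> fst (c i)" unfolding S_def using KO cinv_simps(3)[OF pp(1)] by blast
  have 1: "Hi i m = 0" if "m \<notin> fst (c i)" for m using Hz SO that by blast
  have zm: "z1 i \<in> bor" "z2 i \<in> bor"
   using zi(1) by (auto simp: C1_def intro: borel_measurable_continuous_onI)
  have 2: "E i \<in> bor"
   unfolding E_def[abs_def] by (intro borel_measurable_times borel_measurable_diff bl mb zm i)
  have 3: "Hi i (cinv (c i) y) * sd (c i) y = E i y" if y: "y \<in> ?O" for y
  proof (cases "y \<in> pdom (c i) (W i)")
   case True
   let ?x = "pinv (c i) (W i) y"
   note pq' = patch_point[OF pl(1) True]
   have "Hi i (cinv (c i) y) = wedge (*) (dform (k i)) (\<theta> \<phi>) (c i) ?x"
    unfolding Hi_def pp(9)[OF True, symmetric] by (rule descend_eq[OF wedge_inv_scalar[OF \<phi> pl(4)] pq'])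
   thus ?thesis
    using sdp[OF i True] unfolding wedge_density_def zd[OF pq'(2)] pp(8)[OF True] \<theta>_def E_def f_def u_def u1_def u2_def rep_in[OF True]
    by simp
  next
   case False
   have "cinv (c i) y \<notin> S"
   proof
    assume "cinv (c i) y \<in> S"
    then obtain y' where y': "y' \<in> K i" "cinv (c i) y = cinv (c i) y'" unfolding S_def by blast
    hence "y = y'" using cinv_simps(2)[OF pp(1) y] cinv_simps(2)[OF pp(1), of y'] KO by auto
    thus False using y'(1) pl(3) False by blast
   qed
   thus ?thesis using Hz by (simp add: E_def u1_def u2_def rep_out[OF False] lor_bil)
  qed
  have e: "(%y. indicator ?O y * E i y) = E i"
  proof
   fix y show "indicator ?O y * E i y = E i y"
   proof (cases "y \<in> ?O")
    case False
    hence "y \<notin> pdom (c i) (W i)" using pp(6) by blast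
    thus ?thesis by (simp add: E_def u1_def u2_def rep_out lor_bil)
   qed simp
  qed
  have 4: "lint (%y. indicator ?O y * E i y)" unfolding e by (rule LS(3)[OF i])
  have h3: "AE y\<in>?O in lborel. Hi i (cinv (c i) y) * sd (c i) y = E i y" using 3 by simp
  from chart_integral[OF pp(1), of "Hi i", OF 1 2 h3 4] show ?thesis unfolding e by blast
 qed
 \<comment> \<open>\<open>descend\<close> chooses chart and point from m alone, hence alike for all
   i, so the differentials add up to that of the constant 1.\<close>
 have "(\<Sum>i<n. Hi i m) = 0" for m
 proof -
  obtain c' x' where c': "c' \<in> charts M" "m \<in> fst c'" "\<pi> x' = m" "!!F. desc F m = F c' x'"
   by (rule descend_choice[of m]) blast
  have d0: "(\<Sum>i<n. dform (k i) c' x' v) = 0" for v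
   by (rule sum_dform_const[OF _ _ _ c'(1)]) (use pt c' in "auto simp: partition_def")
  have "(\<Sum>i<n. Hi i m) = ((\<Sum>i<n. dform (k i) c' x' ax1) * \<theta> \<phi> c' x' ax2
   - (\<Sum>i<n. dform (k i) c' x' ax2) * \<theta> \<phi> c' x' ax1) / sqrt (det (gram M c' (\<pi> x')))"
   unfolding Hi_def c'(4) wedge_density_def
   by (simp only: sum_divide_distrib[symmetric] sum_subtractf sum_distrib_right)
  thus ?thesis unfolding d0 by simp
 qed
 hence "(\<integral>m. (\<Sum>i<n. Hi i m) \<partial>area_c) = 0" by simp
 moreover have "(\<integral>m. (\<Sum>i<n. Hi i m) \<partial>area_c) = (\<Sum>i<n. integral\<^sup>L lborel (E i))"
  using HE by (subst Bochner_Integration.integral_sum) auto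
 ultimately have "(\<Sum>i<n. integral\<^sup>L lborel (E i)) = 0" by simp
 thus "integral\<^sup>L area_c H = 0"
  unfolding P2 using LS(1) by (simp add: sum_negf sum_distrib_left[symmetric])
qed

end

section \<open>The integrand of J_q as a Borel function of local data\<close>

definition q_tr :: "real => real => real => ('v => 'v => real) => 'v => 'v => real" where
 "q_tr g1 g2 g3 h a b = g1 * h a a + g2 * h a b + g2 * h b a + g3 * h b b"

text \<open>If g1, g2, g3 are the entries of the inverse Gram matrix and a, b the values of a map on
  the coordinate vectors, \<open>q_tr\<close> and \<open>q_det\<close> are the trace and determinant
  of \<open>Nmat\<close>.\<close>

definition q_det :: "real => real => real => ('v => 'v => real) => 'v => 'v => real" where
 "q_det g1 g2 g3 h a b = (g1 * g3 - g2 * g2) * (h a a * h b b - h a b * h b a)"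

text \<open>The map Q(A)^(p-2) A written as in \<open>Q_powr_map_interp\<close>; x is the value of A
  at the vector in question.\<close>

definition S_vec :: "real => real => real => real => real^3 => real^3 => real^3 => real^3" where
 "S_vec p g1 g2 g3 a b x = interp0 ((p - 1 - 1) / 2) (q_tr g1 g2 g3 lor a b) (q_det g1 g2 g3 lor a b) *\<^sub>R x +
  interp1 ((p - 1 - 1) / 2) (q_tr g1 g2 g3 lor a b) (q_det g1 g2 g3 lor a b) *\<^sub>R
   ((g1 * lor a x + g2 * lor b x) *\<^sub>R a + (g2 * lor a x + g3 * lor b x) *\<^sub>R b)"

text \<open>The arguments s and t are the coordinates of the rotated vector before division by the
  square root of the Gram determinant.\<close>

definition V_vec :: "real => real => real => real => real^3 => real^3 => real^3 => real => real => real^3^3" where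
 "V_vec p e f g u a b s t = mcross (inverse (sqrt (e * g - f * f)) *\<^sub>R
  (s *\<^sub>R S_vec p (g / (e * g - f * f)) (- f / (e * g - f * f)) (e / (e * g - f * f)) a b a +
  t *\<^sub>R S_vec p (g / (e * g - f * f)) (- f / (e * g - f * f)) (e / (e * g - f * f)) a b b)) u"

text \<open>The integrand of \<open>J\<^sub>q\<close> in terms of the metric coefficients \<open>e, f, g\<close>, the lift \<open>u\<close>, its partial
 derivatives \<open>a, b\<close> and the components \<open>x, y\<close> of \<open>D\<^sub>u\<psi>\<close>; in this form it is visibly a Borel function.\<close>

definition dens :: "real => real => real => real => real => real^3 => real^3 => real^3 => real^3^3 => real^3^3 => real" where
 "dens p q e f g u a b x y =
  (let k = e * g - f * f; v = V_vec p e f g u a b f (- e) + x; w = V_vec p e f g u a b g (- f) + y;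
    T = q_tr (g / k) (- f / k) (e / k) trace_form v w; D = q_det (g / k) (- f / k) (e / k) trace_form v w
  in eig1 T D powr (q/2) + eig2 T D powr (q/2))"

lemma borel_q_tr:
 fixes h :: "'v::euclidean_space => 'v => real"
 assumes h: "bilinear h" and [measurable]: "g1 \<in> borel_measurable N" "g2 \<in> borel_measurable N" "g3 \<in> borel_measurable N"
  and v: "a \<in> borel_measurable N" "b \<in> borel_measurable N"
 shows "(%y. q_tr (g1 y) (g2 y) (g3 y) h (a y) (b y)) \<in> borel_measurable N" (is ?P1)
  "(%y. q_det (g1 y) (g2 y) (g3 y) h (a y) (b y)) \<in> borel_measurable N" (is ?P2)
proof -
 note [measurable] = borel_bilinear[OF h v(1) v(1)] borel_bilinear[OF h v(1) v(2)] borel_bilinear[OF h v(2) v(1)] borel_bilinear[OF h v(2) v(2)]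
 show ?P1
  ?P2
  unfolding q_tr_def q_det_def by measurable
qed

lemma borel_interp:
 assumes [measurable]: "T \<in> borel_measurable N" "D \<in> borel_measurable N"
 shows "(%y. eig1 (T y) (D y)) \<in> borel_measurable N" (is ?P1) "(%y. eig2 (T y) (D y)) \<in> borel_measurable N" (is ?P2)
  "(%y. interp1 r (T y) (D y)) \<in> borel_measurable N" (is ?P3) "(%y. interp0 r (T y) (D y)) \<in> borel_measurable N" (is ?P4)
proof -
 show 1[measurable]: ?P1 ?P2
  unfolding eig1_def eig2_def by measurable
 show [measurable]: ?P3 unfolding interp1_def by measurable
 show ?P4 unfolding interp0_def by measurable
qed

lemma borel_S_vec:
 assumes g[measurable]: "g1 \<in> borel_measurable N" "g2 \<in> borel_measurable N" "g3 \<in> borel_measurable N"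
  and v[measurable]: "a \<in> borel_measurable N" "b \<in> borel_measurable N" "x \<in> borel_measurable N"
 shows "(%y. S_vec p (g1 y) (g2 y) (g3 y) (a y) (b y) (x y)) \<in> borel_measurable N"
proof -
 note [measurable] = borel_bilinear[OF bilinear_lor v(1) v(3)] borel_bilinear[OF bilinear_lor v(2) v(3)]
  borel_interp(3,4)[OF borel_q_tr[OF bilinear_lor g v(1,2)]]
 show ?thesis unfolding S_vec_def by measurable
qed

lemma borel_V_vec:
 assumes [measurable]: "e \<in> borel_measurable N" "f \<in> borel_measurable N" "g \<in> borel_measurable N" "s \<in> borel_measurable N" "t \<in> borel_measurable N"
  and u[measurable]: "u \<in> borel_measurable N" and ab[measurable]: "a \<in> borel_measurable N" "b \<in> borel_measurable N"
 shows "(%y. V_vec p (e y) (f y) (g y) (u y) (a y) (b y) (s y) (t y)) \<in> borel_measurable N"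
proof -
 have g: "(%y. g y / (e y * g y - f y * f y)) \<in> borel_measurable N" "(%y. - f y / (e y * g y - f y * f y)) \<in> borel_measurable N"
  "(%y. e y / (e y * g y - f y * f y)) \<in> borel_measurable N" by measurable
 note [measurable] = borel_S_vec[OF g ab ab(1)] borel_S_vec[OF g ab ab(2)]
 show ?thesis unfolding V_vec_def by (rule borel_bilinear[OF bilinear_mcross _ u]) measurable
qed

lemma borel_dens:
 assumes e[measurable]: "e \<in> borel_measurable N" "f \<in> borel_measurable N" "g \<in> borel_measurable N"
  and u[measurable]: "u \<in> borel_measurable N" and ab[measurable]: "a \<in> borel_measurable N" "b \<in> borel_measurable N"
  and [measurable]: "x \<in> borel_measurable N" "z \<in> borel_measurable N"
 shows "(%y. dens p q (e y) (f y) (g y) (u y) (a y) (b y) (x y) (z y)) \<in> borel_measurable N"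
proof -
 have g: "(%y. g y / (e y * g y - f y * f y)) \<in> borel_measurable N" "(%y. - f y / (e y * g y - f y * f y)) \<in> borel_measurable N"
  "(%y. e y / (e y * g y - f y * f y)) \<in> borel_measurable N" by measurable
 have m: "(%y. - e y) \<in> borel_measurable N" "(%y. - f y) \<in> borel_measurable N" by measurable
 note [measurable] = borel_V_vec[OF e e(2) m(1) u ab] borel_V_vec[OF e e(3) m(2) u ab]
 have v: "(%y. V_vec p (e y) (f y) (g y) (u y) (a y) (b y) (f y) (- e y) + x y) \<in> borel_measurable N"
  "(%y. V_vec p (e y) (f y) (g y) (u y) (a y) (b y) (g y) (- f y) + z y) \<in> borel_measurable N" by measurable
 note [measurable] = borel_interp(1,2)[OF borel_q_tr[OF bilinear_trace_form g v]]
 show ?thesis unfolding dens_def Let_def by measurable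
qed

lemma (in ip_pair) Nmat_q:
 assumes "matrix_inv G $ 2 $ 1 = matrix_inv G $ 1 $ 2"
 shows "trace (Nmat A) = q_tr (matrix_inv G $ 1 $ 1) (matrix_inv G $ 1 $ 2) (matrix_inv G $ 2 $ 2) h (A ax1) (A ax2)" (is ?P1)
  "det (Nmat A) = q_det (matrix_inv G $ 1 $ 1) (matrix_inv G $ 1 $ 2) (matrix_inv G $ 2 $ 2) h (A ax1) (A ax2)" (is ?P2)
  "ipm A A = q_tr (matrix_inv G $ 1 $ 1) (matrix_inv G $ 1 $ 2) (matrix_inv G $ 2 $ 2) h (A ax1) (A ax2)" (is ?P3)
proof -
 show t: ?P3
  using assms by (simp add: q_tr_def ipm_def sum_2)
 show ?P1
  using assms by (simp add: trace_def sum_2 Nmat_def matrix_matrix_mult_def q_tr_def Kmat_def)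
 have "det (Nmat A) = det (matrix_inv G) * det (Kmat A)" unfolding Nmat_def by (rule det_mul)
 thus ?P2
  using assms by (simp add: det_2 q_det_def Kmat_def)
qed

context pt begin

lemma inv_sym: "matrix_inv G $ 2 $ 1 = matrix_inv G $ 1 $ 2" by (simp only: matrix_inv_G)

definition "S = Q_powr_map g (tangent_H u) lor (p - 1) A"

lemma S_linear: "linear S"
proof -
 obtain s t B C b c where sv: "T.svd2 A s t B C b c" using T.svd2_exists[OF A(1) AW] by blast
 show ?thesis unfolding S_def T.Q_powr_map_svd2[OF sv] by (rule linearI) (simp_all add: T.bil algebra_simps)
qed

lemma S_axis: "S (axis i 1) = S_vec p (matrix_inv G $ 1 $ 1) (matrix_inv G $ 1 $ 2) (matrix_inv G $ 2 $ 2) (A ax1) (A ax2) (A (axis i 1))"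
proof -
 have N: "T.Nmat A *v axis i 1 = (matrix_inv G $ 1 $ 1 * lor (A ax1) (A (axis i 1)) + matrix_inv G $ 1 $ 2 * lor (A ax2) (A (axis i 1))) *\<^sub>R axis 1 1
  + (matrix_inv G $ 1 $ 2 * lor (A ax1) (A (axis i 1)) + matrix_inv G $ 2 $ 2 * lor (A ax2) (A (axis i 1))) *\<^sub>R axis 2 1"
 proof -
  have "T.Nmat A *v axis i 1 = (\<chi> k. \<Sum>l\<in>UNIV. matrix_inv G $ k $ l * lor (A (axis l 1)) (A (axis i 1)))"
   by (simp add: matrix_vector_mult_basis column_def T.Nmat_def matrix_matrix_mult_def T.Kmat_def)
  thus ?thesis using inv_sym by (simp add: vec_eq_iff forall_2 sum_2 axis_def)
 qed
 show ?thesis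
  unfolding S_def T.Q_powr_map_interp[OF A(1) AW] S_vec_def N T.Nmat_q(1,2)[OF inv_sym]
  by (simp only: linear_add[OF A(1)] linear_scale[OF A(1)])
qed

lemma V_axis:
 "V ax1 = V_vec p (G$1$1) (G$1$2) (G$2$2) u (A ax1) (A ax2) (G$1$2) (- G$1$1)"
 "V ax2 = V_vec p (G$1$1) (G$1$2) (G$2$2) u (A ax1) (A ax2) (G$2$2) (- G$1$2)"
proof -
 let ?r = "inverse (sqrt (G$1$1 * G$2$2 - G$1$2 * G$1$2))"
 have c: "rot G ax1 = ?r *\<^sub>R (G$1$2 *\<^sub>R axis 1 1 + (- G$1$1) *\<^sub>R axis 2 1)"
  "rot G ax2 = ?r *\<^sub>R (G$2$2 *\<^sub>R axis 1 1 + (- G$1$2) *\<^sub>R axis 2 1)"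
  unfolding matrix_inv_G(5) rot_def matrix_vector_mult_basis column_def
  by (simp_all add: vec_eq_iff forall_2 axis_def G21[OF G(1,3)])
 note l = linear_add[OF S_linear] linear_scale[OF S_linear]
 show "V ax1 = V_vec p (G$1$1) (G$1$2) (G$2$2) u (A ax1) (A ax2) (G$1$2) (- G$1$1)"
  "V ax2 = V_vec p (G$1$1) (G$1$2) (G$2$2) u (A ax1) (A ax2) (G$2$2) (- G$1$2)"
  unfolding V_def S_def[symmetric] c l S_axis V_vec_def matrix_inv_G by (rule refl)+
qed

lemma TrQ_dens:
 assumes B: "linear B" "!!v. B v \<in> p_space u"
 shows "TrQ_powr g (p_space u) trace_form q (%v. V v + B v) =
  dens p q (G$1$1) (G$1$2) (G$2$2) u (A ax1) (A ax2) (B ax1) (B ax2)"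
proof -
 have VB: "linear (%v. V v + B v)" "!!v. V v + B v \<in> p_space u"
  using V_props B P.EE(8) by (auto intro: linear_compose_add subspace_add)
 show ?thesis
  unfolding P.TrQ_powr_eig[OF VB] P.Nmat_q(1,2)[OF inv_sym] V_axis dens_def Let_def matrix_inv_G(1-4) ..
qed

end

lemma bilinear_bound:
 fixes h :: "'a::euclidean_space => 'b::euclidean_space => 'c::euclidean_space"
 assumes "bilinear h" obtains C where "C >= 0" "!!a b. norm (h a b) <= C * norm a * norm b"
proof -
 have "bounded_bilinear h" using assms by (simp add: bilinear_conv_bounded_bilinear)
 from bounded_bilinear.nonneg_bounded[OF this] obtain C where "C >= 0" "!!a b. norm (h a b) <= norm a * norm b * C" by blast
 thus thesis by (intro that[of C]) (simp_all add: mult_ac)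
qed

lemma q_tr_bound:
 fixes h :: "'a::euclidean_space => 'a => real"
 assumes h: "bilinear h"
 obtains C where "C >= 0" "!!g1 g2 g3 k a b. \<bar>g1\<bar> <= k ==> \<bar>g2\<bar> <= k ==> \<bar>g3\<bar> <= k ==> q_tr g1 g2 g3 h a b <= C * k * (norm a + norm b)^2"
proof -
 obtain C where C: "C >= 0" "!!a b. norm (h a b) <= C * norm a * norm b" by (rule bilinear_bound[OF h]) blast
 show thesis
 proof (rule that[OF C(1)])
  fix g1 g2 g3 k :: real and a b :: 'a assume g: "\<bar>g1\<bar> <= k" "\<bar>g2\<bar> <= k" "\<bar>g3\<bar> <= k"
  have b: "g' * h x y <= k * (C * norm x * norm y)" if "\<bar>g'\<bar> <= k" for g' x y
  proof -
   have "g' * h x y <= \<bar>g'\<bar> * \<bar>h x y\<bar>" by (metis abs_ge_self abs_mult)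
   also have "... <= k * (C * norm x * norm y)" using that C(2)[of x y] by (intro mult_mono) auto
   finally show ?thesis .
  qed
  have "q_tr g1 g2 g3 h a b <= k * (C * norm a * norm a) + k * (C * norm a * norm b) + k * (C * norm b * norm a) + k * (C * norm b * norm b)"
   unfolding q_tr_def by (intro add_mono b g)
  also have "... = C * k * (norm a + norm b)^2" by (simp add: power2_eq_square algebra_simps)
  finally show "q_tr g1 g2 g3 h a b <= C * k * (norm a + norm b)^2" .
 qed
qed

lemma powr_half_bound:
 fixes x y k p :: real
 assumes "0 <= T" "T <= k * (x + y)^2" "x >= 0" "y >= 0" "k >= 0" "p > 0"
 shows "T powr (p/2) <= k powr (p/2) * 2 powr p * (x powr p + y powr p)"
proof -
 have "T powr (p/2) <= (k * (x + y)^2) powr (p/2)" using assms by (intro powr_mono2) auto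
 also have "... = k powr (p/2) * (x + y) powr p"
 proof (cases "x + y = 0")
  case False
  hence "x + y > 0" using assms by linarith
  hence "((x + y)^2) powr (p/2) = (x + y) powr p" by (simp add: powr_powr flip: powr_numeral)
  thus ?thesis using assms by (simp add: powr_mult)
 qed simp
 also have "... <= k powr (p/2) * (2 powr p * (x powr p + y powr p))"
  using assms by (intro mult_left_mono powr_add_le) auto
 finally show ?thesis by (simp add: mult_ac)
qed

context surf begin

lemma hodge_rot:
 assumes c: "c \<in> charts M" "\<pi> x \<in> fst c" and \<alpha>: "linear (\<alpha> c x)"
 shows "hodge M \<pi> \<alpha> c x v = \<alpha> c x (rot (gram M c (\<pi> x)) v)"
proof -
 let ?G = "gram M c (\<pi> x)"
 note g = gram_props[OF c]
 have s: "?G$2$1 = ?G$1$2" using arg_cong[OF g(1), of "%A. A$1$2"] by (simp add: transpose_def)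
 have d: "sqrt (det ?G) / det ?G = inverse (sqrt (det ?G))" using g(3) by (simp add: field_simps)
 have sc: "sqrt (det ?G) * (a / det ?G * y - b / det ?G * z) = inverse (sqrt (det ?G)) * (a * y - b * z)" for a b y z
  unfolding d[symmetric] by (simp add: diff_divide_distrib algebra_simps)
 have "rot ?G v $ 1 = inverse (sqrt (det ?G)) * (?G$2$2 * v$2 - (- ?G$1$2) * v$1)"
  "rot ?G v $ 2 = inverse (sqrt (det ?G)) * ((- ?G$1$2) * v$2 - ?G$1$1 * v$1)"
  by (simp_all add: rot_def matrix_vector_mult_def sum_2 s algebra_simps)
 moreover have "hodge M \<pi> \<alpha> c x v = (inverse (sqrt (det ?G)) * (?G$2$2 * v$2 - (- ?G$1$2) * v$1)) *\<^sub>R \<alpha> c x ax1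
  + (inverse (sqrt (det ?G)) * ((- ?G$1$2) * v$2 - ?G$1$1 * v$1)) *\<^sub>R \<alpha> c x ax2"
  unfolding hodge_def sum_2 sc[symmetric] g(4) by (simp add: s)
 ultimately show ?thesis by (subst linear_vec2[OF \<alpha>]) (simp only:)
qed

lemma completion_integral_cong:
 fixes F H :: "'m => real"
 assumes H: "integrable area_c H" and ae: "AE m in area M. F m = H m"
 shows "integrable area_c F" "integral\<^sup>L area_c F = integral\<^sup>L area_c H" (is ?P1)
proof -
 have Hm: "H \<in> borel_measurable area_c" using H by auto
 obtain H' where H': "H' \<in> borel_measurable (area M)" "AE m in area M. H m = H' m"
  using completion_ex_borel_measurable_real[OF Hm] by blast
 have Fm: "F \<in> borel_measurable area_c"
  by (rule completion_measurable_AE[OF H'(1)]) (use ae H'(2) in eventually_elim, simp)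
 note ae' = AE_completion[OF ae]
 show "integrable area_c F"
  by (rule integrable_cong_AE_imp[OF H Fm]) (use ae' in eventually_elim, simp)
 show ?P1
  by (rule integral_cong_AE[OF Fm Hm ae'])
qed

end

lemma gram_isometry:
 fixes G' J :: "real^2^2"
 assumes "G = transpose J ** G' ** J"
 shows "(J *v v) \<bullet> (G' *v (J *v w)) = v \<bullet> (G *v w)"
proof -
 have e: "G *v w = transpose J *v (G' *v (J *v w))" by (simp add: assms matrix_vector_mul_assoc matrix_mul_assoc del: transpose_matrix_vector)
 have "z \<bullet> (J *v v) = (transpose J *v z) \<bullet> v" for z unfolding transpose_matrix_vector dot_lmul_matrix ..
 thus ?thesis by (simp only: inner_commute[of "J *v v"] e inner_commute[of v])
qed

section \<open>Invariance and integrability of the integrand of J_q\<close>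

context hmap begin

definition J :: "('c => real^3^3) => 'm chart => 'c => real" where
 "J F c x = TrQ_powr (tan_ip M c (\<pi> x)) (p_space (U x)) trace_form q (%v. V_form M \<pi> \<rho> U p c x v + Du F c x v)"

lemma pt_good:
 assumes c: "c \<in> charts M" "\<pi> x \<in> fst c" and g: "good (\<pi> x)"
 shows "pt (tan_ip M c (\<pi> x)) (gram M c (\<pi> x)) (U x) (dU c x) p q"
proof
 show "tan_ip M c (\<pi> x) = (%v w. v \<bullet> (gram M c (\<pi> x) *v w))" by (simp add: tan_ip_def fun_eq_iff)
 show "lor (dU c x v) (U x) = 0" for v using g c unfolding good_def by blast
 show "transpose (gram M c (\<pi> x)) = gram M c (\<pi> x)" "det (gram M c (\<pi> x)) > 0" by (rule gram_props[OF c])+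
 show "v \<bullet> (gram M c (\<pi> x) *v v) > 0" if "v ~= 0" for v by (rule gram_props(2)[OF c that])
 note d = one_form_linear[OF dU_one c]
 show "dU c x (a + b) = dU c x a + dU c x b" "dU c x (r *\<^sub>R a) = r *\<^sub>R dU c x a" for a b r
  by (rule linear_add[OF d], rule linear_scale[OF d])
qed (rule UH pq)+

lemma V_eq:
 assumes c: "c \<in> charts M" "\<pi> x \<in> fst c" and g: "good (\<pi> x)"
 shows "V_form M \<pi> \<rho> U p c x = pt.V (tan_ip M c (\<pi> x)) (gram M c (\<pi> x)) (U x) (dU c x) p"
proof
 fix v
 interpret L: pt "tan_ip M c (\<pi> x)" "gram M c (\<pi> x)" "U x" "dU c x" p q by (rule pt_good[OF assms])
 have S: "S_form M \<pi> \<rho> U p c x = L.S" by (simp add: S_form_def L.S_def)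
 have "linear (S_form M \<pi> \<rho> U p c x)" unfolding S by (rule L.S_linear)
 from hodge_rot[where \<alpha>="S_form M \<pi> \<rho> U p", OF c this] show "V_form M \<pi> \<rho> U p c x v = L.V v"
  unfolding V_form_def S L.V_def L.S_def by simp
qed

lemma Du_p_space: "Du F c x v \<in> p_space (U x)"
proof -
 have "lor (A *v U x + r *\<^sub>R U x) (U x) = lor (A *v U x) (U x) - r" for A :: "real^3^3" and r by (simp add: lor_bil UU)
 hence "A *v U x + lor (A *v U x) (U x) *\<^sub>R U x \<in> tangent_H (U x)" for A :: "real^3^3" by (simp add: tangent_H_def)
 moreover have "mcross (a + r *\<^sub>R U x) (U x) = mcross a (U x)" for a r
  by (simp add: mcross_add mcross_scale) (simp add: vec_eq_iff mcross_def)
 ultimately show ?thesis unfolding Du_form_def p_proj_def p_space_def mem_Collect_eq by metis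
qed

text \<open>\<open>Q_transport\<close> is applied twice: to dU, which shows that the form S is
  equivariant, and then to V plus the differential of F. Between the two,
  \<open>rot_equivariant\<close> moves the Hodge star across the change of chart.\<close>

lemma J_inv:
 assumes F: "F \<in> PS" and g: "good m" shows "inv_at (J F) m"
 unfolding inv_at_def
proof (intro ballI allI impI)
 fix c c' x \<gamma> assume c: "c \<in> charts M" "c' \<in> charts M" and \<gamma>: "\<gamma> \<in> deck \<pi>" and x: "\<pi> x = m & m \<in> fst c & m \<in> fst c'"
 let ?J = "trans_jac c c' (\<pi> x)" let ?x = "\<gamma> x"
 have x': "\<pi> ?x = \<pi> x" by (rule deck_pi[OF \<gamma>])
 have cx: "\<pi> x \<in> fst c" "\<pi> x \<in> fst c'" "\<pi> ?x \<in> fst c'" "good (\<pi> x)" "good (\<pi> ?x)" using x x' g by auto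
 interpret L: pt "tan_ip M c (\<pi> x)" "gram M c (\<pi> x)" "U x" "dU c x" p q by (rule pt_good[OF c(1) cx(1,4)])
 interpret L': pt "tan_ip M c' (\<pi> ?x)" "gram M c' (\<pi> ?x)" "U ?x" "dU c' ?x" p q by (rule pt_good[OF c(2) cx(3,5)])
 note R = \<rho>[OF \<gamma>]
 note jp = jac_props[OF c cx(1,2)]
 have iso: "tan_ip M c' (\<pi> ?x) (?J *v v) (?J *v w) = tan_ip M c (\<pi> x) v w" for v w
  unfolding tan_ip_def x' by (rule gram_isometry[OF jp(2)])
 have inv: "invertible ?J" by (rule jac_surj(2)[OF c cx(1,2)])
 have dUc: "dU c' ?x (?J *v v) = \<rho> \<gamma> *v dU c x v" for v
  using one_form_change[OF dU_one c cx(1,2) \<gamma>] by (simp add: std_act_def)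
 have Rlin: "linear ((*v) (\<rho> \<gamma>))" by (rule matrix_vector_mul_linear)
 have RT: "\<rho> \<gamma> *v w \<in> tangent_H (U ?x)" if "w \<in> tangent_H (U x)" for w
  using that by (simp add: tangent_H_def U_deck[OF \<gamma>] SO21_lor[OF R])
 have S: "L'.S (?J *v v) = \<rho> \<gamma> *v L.S v" for v
  unfolding L.S_def L'.S_def
  by (rule Q_transport(2)[OF L.T.ip_pair_axioms L'.T.ip_pair_axioms L.A(1) L.AW dUc iso inv Rlin SO21_lor[OF R] RT])
 have V: "L'.V (?J *v v) = ad_act \<rho> \<gamma> (L.V v)" for v
 proof -
  have r: "rot (gram M c' (\<pi> ?x)) (?J *v v) = ?J *v rot (gram M c (\<pi> x)) v"
   unfolding x' by (rule rot_equivariant[OF jp(2,1) gram_props(3)[OF c(2) cx(2)]])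
  have "L'.V (?J *v v) = mcross (L'.S (?J *v rot (gram M c (\<pi> x)) v)) (U ?x)"
   unfolding L'.V_def L'.S_def r ..
  hence "L'.V (?J *v v) = mcross (\<rho> \<gamma> *v L.S (rot (gram M c (\<pi> x)) v)) (\<rho> \<gamma> *v U x)"
   unfolding S unfolding U_deck[OF \<gamma>] .
  thus ?thesis unfolding mcross_equivariant[OF R] ad_act_def L.V_def L.S_def .
 qed
 have ad_add: "ad_act \<rho> \<gamma> (A + B) = ad_act \<rho> \<gamma> A + ad_act \<rho> \<gamma> B" for A B
  by (simp add: ad_act_def matrix_add_ldistrib) (simp add: vec_eq_iff matrix_matrix_mult_def sum.distrib distrib_right)
 have ad_scale: "ad_act \<rho> \<gamma> (r *\<^sub>R A) = r *\<^sub>R ad_act \<rho> \<gamma> A" for A r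
  by (simp add: ad_act_def vec_eq_iff matrix_matrix_mult_def sum_distrib_left sum_distrib_right mult_ac)
 have adlin: "linear (ad_act \<rho> \<gamma>)" by (rule linearI) (simp_all add: ad_add ad_scale)
 have adp: "ad_act \<rho> \<gamma> A \<in> p_space (U ?x)" if A: "A \<in> p_space (U x)" for A
 proof -
  obtain w where w: "A = mcross w (U x)" "w \<in> tangent_H (U x)" using A by (auto simp: p_space_def)
  have "ad_act \<rho> \<gamma> A = mcross (\<rho> \<gamma> *v w) (U ?x)" unfolding w(1) U_deck[OF \<gamma>] mcross_equivariant[OF R] ad_act_def ..
  thus ?thesis using RT[OF w(2)] by (auto simp: p_space_def)
 qed
 have B: "linear (Du F c x)" by (rule one_form_linear[OF Du_one[OF F] c(1) cx(1)])
 have VB: "linear (%v. L.V v + Du F c x v)" "!!v. L.V v + Du F c x v \<in> p_space (U x)"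
  by (rule linear_compose_add[OF L.V_props(1) B]) (rule subspace_add[OF L.P.EE(8) L.V_props(2) Du_p_space])
 have VJ: "L'.V (?J *v v) + Du F c' ?x (?J *v v) = ad_act \<rho> \<gamma> (L.V v + Du F c x v)" for v
  unfolding V one_form_change[OF Du_one[OF F] c cx(1,2) \<gamma>] ad_add ..
 show "J F c' ?x = J F c x"
  unfolding J_def V_eq[OF c(1) cx(1,4)] V_eq[OF c(2) cx(3,5)]
  by (rule Q_transport(1)[OF L.P.ip_pair_axioms L'.P.ip_pair_axioms VB VJ iso inv adlin ad_trace[OF \<gamma>] adp])
qed

lemma rep_cinv_borel:
 assumes P: "patch M \<pi> c W" and f: "continuous_on (snd c ` fst c) (%y. f (cinv c y) :: real)"
 shows "rep c W (%x. f (\<pi> x)) \<in> bor"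
proof -
 note pp = patch_props[OF P]
 have "(%y. indicator (pdom c W) y *\<^sub>R f (cinv c y)) \<in> bor"
  by (rule borel_measurable_continuous_on_indicator[OF _ continuous_on_subset[OF f pp(6)]]) (use pp(5) in auto)
 moreover have "(%y. indicator (pdom c W) y *\<^sub>R f (cinv c y)) = rep c W (%x. f (\<pi> x))"
  using pp(9) by (auto simp: rep_def indicator_def fun_eq_iff)
 ultimately show ?thesis by simp
qed

lemma compact_bound:
 fixes f :: "real^2 => 'v::real_normed_vector"
 assumes "continuous_on S f" "compact K" "K \<subseteq> S"
 obtains B where "B >= 0" "!!y. y \<in> K ==> norm (f y) <= B"
proof -
 have "compact (f ` K)" by (rule compact_continuous_image[OF continuous_on_subset[OF assms(1,3)] assms(2)])
 then obtain B where "!!y. y \<in> K ==> norm (f y) <= B" using compact_imp_bounded bounded_iff by (metis imageI)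
 thus thesis by (intro that[of "max B 0"]) (auto intro: max.coboundedI1)
qed

lemma gram_entries:
 assumes c: "c \<in> charts M"
 shows "continuous_on (snd c ` fst c) (%y. gram M c (cinv c y) $ i $ j)"
  "continuous_on (snd c ` fst c) (%y. matrix_inv (gram M c (cinv c y)) $ i $ j)" (is ?P1)
proof -
 show g: "continuous_on (snd c ` fst c) (%y. gram M c (cinv c y) $ i $ j)" for i j
  by (intro continuous_intros gram_continuous[OF c])
 have d: "continuous_on (snd c ` fst c) (%y. det (gram M c (cinv c y)))" unfolding det_2 by (intro continuous_intros g)
 have d0: "det (gram M c (cinv c y)) ~= 0" if "y \<in> snd c ` fst c" for y
  using gram_props(3)[OF c cinv_simps(3)[OF c that]] by simp
 have "continuous_on (snd c ` fst c) (%y. (if i = j then gram M c (cinv c y) $ (if i = 1 then 2 else 1) $ (if i = 1 then 2 else 1)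
   else - gram M c (cinv c y) $ i $ j) / det (gram M c (cinv c y)))"
  by (cases "i = j") (use d0 in "auto intro!: continuous_intros g d")
 thus ?P1
  by (rule continuous_on_eq) (use gram_props(4)[OF c cinv_simps(3)[OF c]] in auto)
qed

definition dens_rep :: "('c => real^3^3) => 'm chart => 'c set => real^2 => real" where
 "dens_rep F c W y = dens p q (rep c W (%x. gram M c (\<pi> x) $ 1 $ 1) y) (rep c W (%x. gram M c (\<pi> x) $ 1 $ 2) y)
  (rep c W (%x. gram M c (\<pi> x) $ 2 $ 2) y) (rep c W U y) (rep c W (%x. dU c x ax1) y) (rep c W (%x. dU c x ax2) y)
  (mcross (rep c W (%x. dP F c x ax1) y *v rep c W U y) (rep c W U y))
  (mcross (rep c W (%x. dP F c x ax2) y *v rep c W U y) (rep c W U y))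
  * rep c W (%x. sqrt (det (gram M c (\<pi> x)))) y"

lemma dens_rep_borel:
 assumes F: "F \<in> PS" and P: "patch M \<pi> c W"
 shows "dens_rep F c W \<in> bor"
proof -
 note ge = gram_entries(1)[OF patch_props(1)[OF P]]
 have s: "continuous_on (snd c ` fst c) (%y. sqrt (det (gram M c (cinv c y))))"
  unfolding det_2 by (intro continuous_intros ge)
 note u = rep_measurable[OF weak_d_local(2)[OF UW P]]
 note f = rep_measurable[OF weak_d_local(3)[OF PS_D(1)[OF F] P]]
 show ?thesis
  unfolding dens_rep_def[abs_def]
  by (intro borel_measurable_times borel_dens rep_cinv_borel[OF P ge] rep_cinv_borel[OF P s]
   rep_measurable[OF weak_d_local(3)[OF UW P]] borel_bilinear[OF bilinear_mcross] borel_bilinear[OF bilinear_matvec] u f)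
qed

lemma J_dens:
 assumes F: "F \<in> PS" and P: "patch M \<pi> c W" and y: "y \<in> pdom c W" and g: "good (\<pi> (pinv c W y))"
 shows "J F c (pinv c W y) * sd c y = dens_rep F c W y" "desc (J F) (cinv c y) * sd c y = dens_rep F c W y" (is ?P1)
proof -
 let ?x = "pinv c W y"
 note c = patch_point[OF P y]
 interpret L: pt "tan_ip M c (\<pi> ?x)" "gram M c (\<pi> ?x)" "U ?x" "dU c ?x" p q by (rule pt_good[OF c g])
 have e: "desc (J F) (cinv c y) = J F c ?x"
  unfolding patch_props(9)[OF P y, symmetric] by (rule descend_eq[OF J_inv[OF F g] c])
 have "J F c ?x = dens p q (gram M c (\<pi> ?x) $ 1 $ 1) (gram M c (\<pi> ?x) $ 1 $ 2) (gram M c (\<pi> ?x) $ 2 $ 2) (U ?x)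
  (dU c ?x ax1) (dU c ?x ax2) (Du F c ?x ax1) (Du F c ?x ax2)"
  unfolding J_def V_eq[OF c g] by (rule L.TrQ_dens[OF one_form_linear[OF Du_one[OF F] c] Du_p_space])
 thus "J F c ?x * sd c y = dens_rep F c W y"
  unfolding dens_rep_def rep_in[OF y] Du_form_def p_proj_def by (simp add: sd_def patch_props(9)[OF P y])
 thus ?P1 unfolding e .
qed

definition growth :: "('c => real^3^3) => 'm chart => 'c => real" where
 "growth F c x = norm (dU c x ax1) powr p + norm (dU c x ax2) powr p +
  norm (dP F c x ax1) powr p + norm (dP F c x ax2) powr p + 1"

text \<open>On the compact set K the metric, the area density and U are bounded, so the pointwise
  estimate \<open>bound\<close> leaves only p-th powers of derivatives, which are integrable over
  K.\<close>

lemma dens_bound: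
 assumes F: "F \<in> PS" and P: "patch M \<pi> c W" and K: "compact K" "K \<subseteq> pdom c W"
 obtains C where "C >= 0" "!!y. y \<in> K ==> good (\<pi> (pinv c W y)) ==> \<bar>dens_rep F c W y\<bar> <=
  C * growth F c (pinv c W y)"
proof -
 note pp = patch_props[OF P]
 have KO: "K \<subseteq> snd c ` fst c" using K(2) pp(6) by blast
 obtain k1 where k1: "k1 >= 0" "!!y. y \<in> K ==> norm (matrix_inv (gram M c (cinv c y)) $ 1 $ 1) <= k1"
  by (rule compact_bound[OF gram_entries(2)[OF pp(1)] K(1) KO]) blast
 obtain k2 where k2: "k2 >= 0" "!!y. y \<in> K ==> norm (matrix_inv (gram M c (cinv c y)) $ 1 $ 2) <= k2"
  by (rule compact_bound[OF gram_entries(2)[OF pp(1)] K(1) KO]) blast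
 obtain k3 where k3: "k3 >= 0" "!!y. y \<in> K ==> norm (matrix_inv (gram M c (cinv c y)) $ 2 $ 2) <= k3"
  by (rule compact_bound[OF gram_entries(2)[OF pp(1)] K(1) KO]) blast
 define k where "k = k1 + k2 + k3"
 have k: "k >= 0" using k1 k2 k3 by (simp add: k_def)
 obtain sb where sb: "sb >= 0" "!!y. y \<in> K ==> norm (sd c y) <= sb"
  by (rule compact_bound[OF sd_continuous[OF pp(1)] K(1) KO]) blast
 obtain ub where ub: "ub >= 0" "!!y. y \<in> K ==> norm (U (pinv c W y)) <= ub"
  by (rule compact_bound[OF continuous_on_compose2[OF Uc pp(10)] K(1,2)]) auto
 obtain cm where cm: "cm >= 0" "!!a b. norm (mcross a b) <= cm * norm a * norm b" by (rule bilinear_bound[OF bilinear_mcross]) blast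
 obtain cv where cv: "cv >= 0" "!!(A::real^3^3) b. norm (A *v b) <= cv * norm A * norm b" by (rule bilinear_bound[OF bilinear_matvec]) blast
 obtain cl where cl: "cl >= 0" "!!g1 g2 g3 k a b. \<bar>g1\<bar> <= k ==> \<bar>g2\<bar> <= k ==> \<bar>g3\<bar> <= k ==> q_tr g1 g2 g3 lor a b <= cl * k * (norm a + norm b)^2"
  by (rule q_tr_bound[OF bilinear_lor]) blast
 obtain ct where ct: "ct >= 0" "!!g1 g2 g3 k a b. \<bar>g1\<bar> <= k ==> \<bar>g2\<bar> <= k ==> \<bar>g3\<bar> <= k ==> q_tr g1 g2 g3 trace_form a b <= ct * k * (norm a + norm b)^2"
  by (rule q_tr_bound[OF bilinear_trace_form]) blast
 \<comment> \<open>A bound on K for the projection taking a matrix A to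
   \<open>mcross (A *v U x) (U x)\<close>.\<close>
 define cb where "cb = cm * (cv * ub) * ub"
 have cb: "cb >= 0" using cm cv ub by (simp add: cb_def)
 define C0 where "C0 = 2 * 2 powr (q/2) * (8::real) powr (q/2)"
 define C1 where "C1 = (cl * k) powr (p/2) * 2 powr p + (ct * k * cb^2) powr (p/2) * 2 powr p + 1"
 have C: "C0 >= 0" "C1 >= 1" by (simp_all add: C0_def C1_def)
 show thesis
 proof (rule that[of "C0 * C1 * sb"])
  show "C0 * C1 * sb >= 0" using C sb by simp
  fix y assume yK: "y \<in> K" and g: "good (\<pi> (pinv c W y))"
  have y: "y \<in> pdom c W" using yK K by blast
  let ?x = "pinv c W y"
  note c = patch_point[OF P y]
  have xy: "\<pi> ?x = cinv c y" by (rule pp(9)[OF y])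
  interpret L: pt "tan_ip M c (\<pi> ?x)" "gram M c (\<pi> ?x)" "U ?x" "dU c ?x" p q by (rule pt_good[OF c g])
  let ?B = "Du F c ?x" let ?d = "dP F c ?x"
  have B: "linear ?B" "!!v. ?B v \<in> p_space (U ?x)" by (rule one_form_linear[OF Du_one[OF F] c]) (rule Du_p_space)
  note Lb = L.bound[OF B]
  have gi: "\<bar>matrix_inv (gram M c (\<pi> ?x)) $ 1 $ 1\<bar> <= k" "\<bar>matrix_inv (gram M c (\<pi> ?x)) $ 1 $ 2\<bar> <= k" "\<bar>matrix_inv (gram M c (\<pi> ?x)) $ 2 $ 2\<bar> <= k"
   unfolding xy using k1(1) k2(1) k3(1) k1(2)[OF yK] k2(2)[OF yK] k3(2)[OF yK] by (simp_all add: k_def)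
  let ?a = "%i. norm (dU c ?x (axis i 1))" let ?b = "%i. norm (?d (axis i 1))"
  have Bn: "norm (?B v) <= cb * norm (?d v)" for v
  proof -
   have "norm (?B v) <= cm * norm (?d v *v U ?x) * norm (U ?x)" unfolding Du_form_def p_proj_def by (rule cm(2))
   also have "... <= cm * (cv * norm (?d v) * ub) * ub"
   proof (intro mult_mono order_refl)
    have "norm (?d v *v U ?x) <= cv * norm (?d v) * norm (U ?x)" by (rule cv(2))
    also have "... <= cv * norm (?d v) * ub" using ub(2)[OF yK] cv by (intro mult_left_mono) auto
    finally show "norm (?d v *v U ?x) <= cv * norm (?d v) * ub" .
   qed (use cm cv ub yK in auto)
   finally show ?thesis by (simp add: cb_def mult_ac)
  qed
  have I1: "L.T.ipm (dU c ?x) (dU c ?x) powr (p/2) <= (cl * k) powr (p/2) * 2 powr p * (?a 1 powr p + ?a 2 powr p)"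
   using Lb(3) cl(2)[OF gi, of "dU c ?x ax1" "dU c ?x ax2"] cl(1) k pq
   by (intro powr_half_bound) (simp_all add: L.T.Nmat_q(3)[OF L.inv_sym])
  have "L.P.ipm ?B ?B <= ct * k * (norm (?B ax1) + norm (?B ax2))^2"
   unfolding L.P.Nmat_q(3)[OF L.inv_sym] by (rule ct(2)[OF gi])
  also have "... <= ct * k * (cb * ?b 1 + cb * ?b 2)^2"
   using ct(1) k Bn by (intro mult_left_mono power_mono add_mono) auto
  also have "... = ct * k * cb^2 * (?b 1 + ?b 2)^2" by (simp add: distrib_left[symmetric] power_mult_distrib)
  finally have I2: "L.P.ipm ?B ?B powr (p/2) <= (ct * k * cb^2) powr (p/2) * 2 powr p * (?b 1 powr p + ?b 2 powr p)"
   using Lb(4) ct(1) k pq by (intro powr_half_bound) auto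
  let ?N = "?a 1 powr p + ?a 2 powr p + ?b 1 powr p + ?b 2 powr p + 1"
  have "L.T.ipm (dU c ?x) (dU c ?x) powr (p/2) + L.P.ipm ?B ?B powr (p/2) + 1 <=
   (cl * k) powr (p/2) * 2 powr p * ?N + (ct * k * cb^2) powr (p/2) * 2 powr p * ?N + 1 * ?N"
  proof (intro add_mono)
   show "L.T.ipm (dU c ?x) (dU c ?x) powr (p/2) <= (cl * k) powr (p/2) * 2 powr p * ?N"
    by (rule order_trans[OF I1]) (intro mult_left_mono, auto)
   show "L.P.ipm ?B ?B powr (p/2) <= (ct * k * cb^2) powr (p/2) * 2 powr p * ?N"
    by (rule order_trans[OF I2]) (intro mult_left_mono, auto)
  qed simp
  also have "... = C1 * ?N" by (simp only: C1_def distrib_right)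
  finally have S: "L.T.ipm (dU c ?x) (dU c ?x) powr (p/2) + L.P.ipm ?B ?B powr (p/2) + 1 <= C1 * ?N" .
  have "TrQ_powr (tan_ip M c (\<pi> ?x)) (p_space (U ?x)) trace_form q (%v. L.V v + ?B v) <= C0 * (C1 * ?N)"
   by (rule order_trans[OF Lb(1)[folded C0_def] mult_left_mono[OF S C(1)]])
  moreover have d: "dens_rep F c W y = TrQ_powr (tan_ip M c (\<pi> ?x)) (p_space (U ?x)) trace_form q (%v. L.V v + ?B v) * sd c y"
   unfolding J_dens(1)[OF F P y g, symmetric] J_def V_eq[OF c g] ..
  ultimately have "\<bar>dens_rep F c W y\<bar> <= C0 * (C1 * ?N) * sb"
   unfolding d abs_mult using Lb(2) sb(2)[OF yK] sb(1) by (intro mult_mono) auto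
  thus "\<bar>dens_rep F c W y\<bar> <= C0 * C1 * sb * growth F c ?x" by (simp only: growth_def mult_ac)
 qed
qed

lemma J_integrable:
 assumes F: "F \<in> PS"
 shows "integrable area_c (desc (J F))"
proof -
 obtain n c W K h where pt: "partition n c W K h" using partition_exists by (elim exE) (rule that)
 show ?thesis
 proof (rule partition_integral(1)[OF pt, where f="%i. dens_rep F (c i) (W i)"])
  fix i assume i: "i < n"
  note pl = partition_loc[OF pt i]
  show b: "dens_rep F (c i) (W i) \<in> bor" by (rule dens_rep_borel[OF F pl(1)])
  show "AE y\<in>pdom (c i) (W i) in lborel. desc (J F) (cinv (c i) y) * sd (c i) y = dens_rep F (c i) (W i) y"
   using good_AE_patch[OF pl(1)] by eventually_elim (use J_dens(2)[OF F pl(1)] in blast)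
  obtain C where C: "C >= 0" "!!y. y \<in> K i ==> good (\<pi> (pinv (c i) (W i) y)) ==> \<bar>dens_rep F (c i) (W i) y\<bar> <=
   C * growth F (c i) (pinv (c i) (W i) y)"
   by (rule dens_bound[OF F pl(1,2,3)]) blast
  from pl(5) obtain z1 z2 where z: "C1 (loc (c i) (h i)) z1 z2" "supp_in (K i) (loc (c i) (h i))" by blast
  note zc = C1_continuous[OF z(1), of UNIV]
  obtain B where B: "B >= 0" "!!y. \<bar>loc (c i) (h i) y\<bar> <= B" using bounded_compact_supp[OF zc pl(2) z(2)] by metis
  have zm: "loc (c i) (h i) \<in> bor" by (rule borel_measurable_continuous_onI[OF zc])
  let ?x = "%y. pinv (c i) (W i) y"
  have I: "lint (%y. indicator (K i) y * norm (dU (c i) (?x y) (axis j 1)) powr p)"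
   "lint (%y. indicator (K i) y * norm (dP F (c i) (?x y) (axis j 1)) powr p)" for j
   using weak_d_local(3)[OF UW pl(1), of j] weak_d_local(3)[OF PS_D(1)[OF F] pl(1), of j] pl(2,3)
   by (simp_all add: loc_Lp_def set_integrable_def)
  have "lint (%y. B * (C * (indicator (K i) y * growth F (c i) (?x y))))"
   unfolding growth_def distrib_left mult_1_right
   by (intro integrable_mult_right Bochner_Integration.integrable_add I integrable_indicator_compact pl(2))
  thus "lint (%y. loc (c i) (h i) y * dens_rep F (c i) (W i) y)"
  proof (rule Bochner_Integration.integrable_bound)
   show "(%y. loc (c i) (h i) y * dens_rep F (c i) (W i) y) \<in> borel_measurable lborel" using zm b by simp
   show "AE y in lborel. norm (loc (c i) (h i) y * dens_rep F (c i) (W i) y) <= norm (B * (C * (indicator (K i) y * growth F (c i) (?x y))))"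
    using good_AE_patch[OF pl(1)]
   proof eventually_elim
    case (elim y)
    show ?case
    proof (cases "y \<in> K i")
     case True
     hence "good (\<pi> (?x y))" using elim pl(3) by blast
     from C(2)[OF True this] have "\<bar>loc (c i) (h i) y\<bar> * \<bar>dens_rep F (c i) (W i) y\<bar> <= B * (C * growth F (c i) (?x y))"
      using B by (intro mult_mono) auto
     moreover have "0 <= growth F (c i) (?x y)" by (simp add: growth_def)
     ultimately show ?thesis using True B(1) C(1) by (simp add: abs_mult)
    next
     case False thus ?thesis using z(2) by (simp add: supp_in_def)
    qed
   qed
  qed
 qed
qed

end

section \<open>Closedness and minimality\<close>

lemma weak_partial_zero:
 "weak_partial S i (%y. 0 :: 'v::euclidean_space) (%y. 0)"
 by (simp add: weak_partial_def loc_Lp_def set_borel_measurable_def set_integrable_def set_lebesgue_integral_def)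

context hmap begin

lemma zero_diff: "weak_differential M \<pi> (%x. 0 :: real^3^3) (%c x v. 0)"
 by (simp add: weak_differential_def weak_partial_zero)

lemma zero_PS: "(%x. 0) \<in> PS"
proof -
 have "oform (ad_act \<rho>) (%c x v. 0)" by (rule one_formI) (simp_all add: ad_act_def linear_iff)
 moreover have "loc_Lp S p (%y. 0 :: real^3^3)" for S by (simp add: loc_Lp_def set_borel_measurable_def set_integrable_def)
 ultimately have "W1p_section M \<pi> (ad_act \<rho>) p (%x. 0)"
  unfolding W1p_section_def bundle_section_def using zero_diff by (intro conjI exI[of _ "%c x v. 0"]) (simp_all add: ad_act_def)
 moreover have "mcross 0 a = 0" for a by (simp add: vec_eq_iff mcross_def sharp_def forall_3)
 ultimately show ?thesis by (simp add: p_sections_def p_proj_def so21_def lor_bil)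
qed

text \<open>Even for the zero section \<open>weak_d\<close> is a choice, which is known to vanish
  only almost everywhere.\<close>

lemma d_zero_AE: "AE m in area M. \<forall>c\<in>charts M. ALL x. \<pi> x = m & m \<in> fst c --> (ALL v. dP (%x. 0) c x v = 0)"
proof (rule AE_M)
 fix c W assume P: "patch M \<pi> c W"
 note W0 = PS_D(1)[OF zero_PS]
 from weak_d_AE[OF W0 zero_diff P, of 1] weak_d_AE[OF W0 zero_diff P, of 2]
 show "AE y\<in>pdom c W in lborel. (\<forall>c'\<in>charts M. ALL x. \<pi> x = \<pi> (pinv c W y) & \<pi> (pinv c W y) \<in> fst c' -->
  (ALL v. dP (%x. 0) c' x v = 0))"
 proof eventually_elim
  case (elim y)
  show ?case
  proof (intro impI ballI allI)
   fix c' x v assume y: "y \<in> pdom c W" and c': "c' \<in> charts M" "\<pi> x = \<pi> (pinv c W y) & \<pi> (pinv c W y) \<in> fst c'"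
   show "dP (%x. 0) c' x v = 0"
    by (rule form_vanish[OF weak_d_props(1)[OF W0] patch_point[OF P y], where Q="%x a. a = 0"])
     (use c' y elim in "auto simp: ad_act_def")
  qed
 qed
qed

text \<open>The second quarter turn, added to the one in \<open>V\<close>, gives minus the
  identity.\<close>

lemma QV_hodge:
 assumes c: "c \<in> charts M" "\<pi> x \<in> fst c" and g: "good (\<pi> x)"
 shows "hodge M \<pi> (QV_form M \<pi> \<rho> U p q) c x v = - (2 powr ((q - 2) / 2)) *\<^sub>R X c x v"
proof -
 interpret L: pt "tan_ip M c (\<pi> x)" "gram M c (\<pi> x)" "U x" "dU c x" p q by (rule pt_good[OF assms])
 have Q: "QV_form M \<pi> \<rho> U p q c x = (%v. L.\<kappa> *\<^sub>R mcross (dU c x (rot (gram M c (\<pi> x)) v)) (U x))"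
  unfolding QV_form_def V_eq[OF assms] by (rule L.QV_eq)
 have "linear (%v. mcross (dU c x (rot (gram M c (\<pi> x)) v)) (U x))"
  using linear_compose[OF linear_rot L.linear_X, of "gram M c (\<pi> x)"] by (simp add: o_def)
 hence "linear (QV_form M \<pi> \<rho> U p q c x)" unfolding Q by (rule linear_compose_scale_right)
 from hodge_rot[where \<alpha>="QV_form M \<pi> \<rho> U p q", OF c this] show ?thesis
  unfolding Q rot_rot[OF L.G(1,3)] X_def by (simp add: linear_neg[OF L.A(1)] linear_neg[OF linear_mcross])
qed

lemma closed:
 "weakly_Du_closed M \<pi> \<rho> U p (hodge M \<pi> (QV_form M \<pi> \<rho> U p q))"
 unfolding weakly_Du_closed_def surf_integrable_def surf_integral_def
proof
 fix \<phi> assume \<phi>: "\<phi> \<in> PS"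
 let ?k = "- (2 powr ((q - 2) / 2))" let ?H = "desc (wedge trace_form (Du \<phi>) X)"
 let ?F = "desc (wedge trace_form (Du \<phi>) (hodge M \<pi> (QV_form M \<pi> \<rho> U p q)))"
 have i: "integrable area_c (%m. ?k * ?H m)" using stokes(1)[OF \<phi>] by simp
 have ae: "AE m in area M. ?F m = ?k * ?H m"
  using good_AE
 proof eventually_elim
  case (elim m)
  obtain c x where c: "c \<in> charts M" "m \<in> fst c" "\<pi> x = m" "!!F. desc F m = F c x"
   by (rule descend_choice[of m]) blast
  have q: "hodge M \<pi> (QV_form M \<pi> \<rho> U p q) c x v = ?k *\<^sub>R X c x v" for v
   by (rule QV_hodge) (use c elim in auto)
  have t: "trace_form A (r *\<^sub>R B) = r * trace_form A B" for A B r
   unfolding trace_form_sym[of A] trace_form_scale ..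
  show ?case unfolding c(4) wedge_density_def q t by (simp only: right_diff_distrib[symmetric] times_divide_eq_right)
 qed
 note C = completion_integral_cong[OF i ae]
 show "integrable area_c ?F & integral\<^sup>L area_c ?F = 0"
  using C stokes(2)[OF \<phi>] by simp
qed

lemma minimal:
 assumes \<psi>: "\<psi> \<in> PS"
 shows "Jq M \<pi> \<rho> U p q (%x. 0) <= Jq M \<pi> \<rho> U p q \<psi>"
proof -
 have Jq: "Jq M \<pi> \<rho> U p q \<phi> = integral\<^sup>L area_c (desc (J \<phi>))" for \<phi>
  by (simp add: Jq_def surf_integral_def J_def[abs_def])
 let ?k = "q * 2 powr ((q - 2) / 2)" let ?H = "desc (wedge trace_form (Du \<psi>) X)"
 let ?J0 = "desc (J (%x. 0))"
 have i: "integrable area_c (%m. ?J0 m - ?k * ?H m)"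
  using stokes(1)[OF \<psi>] J_integrable[OF zero_PS] by simp
 have "AE m in area M. ?J0 m - ?k * ?H m <= desc (J \<psi>) m"
  using good_AE d_zero_AE
 proof eventually_elim
  case (elim m)
  obtain c x where c: "c \<in> charts M" "m \<in> fst c" "\<pi> x = m" "!!F. desc F m = F c x"
   by (rule descend_choice[of m]) blast
  have cx: "c \<in> charts M" "\<pi> x \<in> fst c" "good (\<pi> x)" using c elim by auto
  interpret L: pt "tan_ip M c (\<pi> x)" "gram M c (\<pi> x)" "U x" "dU c x" p q by (rule pt_good[OF cx])
  have "dP (%x. 0) c x v = 0" for v using elim(2) c by blast
  hence D0: "Du (%x. 0) c x v = 0" for v
   by (simp add: Du_form_def p_proj_def) (simp add: vec_eq_iff mcross_def sharp_def forall_3)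
  note B = one_form_linear[OF Du_one[OF \<psi>] cx(1,2)]
  \<comment> \<open>Exchanging the two forms reverses the sign of the wedge; the linear term is thus
    - ?k times the Stokes density.\<close>
  have s: "trace_form (L.X ax1) (Du \<psi> c x ax2) - trace_form (L.X ax2) (Du \<psi> c x ax1)
   = - (trace_form (Du \<psi> c x ax1) (X c x ax2) - trace_form (Du \<psi> c x ax2) (X c x ax1))"
   unfolding X_def trace_form_sym[of "Du \<psi> c x _"] by simp
  have w: "?H m = (trace_form (Du \<psi> c x ax1) (X c x ax2) - trace_form (Du \<psi> c x ax2) (X c x ax1))
   / sqrt (det (gram M c (\<pi> x)))" unfolding c(4) wedge_density_def ..
  show ?case
   using L.convex[OF B Du_p_space]
   unfolding s minus_divide_left[symmetric] w[symmetric]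
   unfolding c(4)[of "J _"] J_def V_eq[OF cx] D0 by simp
 qed
 hence "integral\<^sup>L area_c (%m. ?J0 m - ?k * ?H m) <= integral\<^sup>L area_c (desc (J \<psi>))"
  by (intro integral_mono_AE i J_integrable[OF \<psi>] AE_completion)
 thus ?thesis unfolding Jq using stokes[OF \<psi>] J_integrable[OF zero_PS] by simp
qed

end

section \<open>Independence of the Sobolev class from the lift\<close>

lemma loc_Lp_linear:
 fixes f :: "real^2 => 'v::euclidean_space" and L :: "'v => 'w::euclidean_space"
 assumes L: "bounded_linear L" and f: "loc_Lp S p f" and p: "p >= 0"
 shows "loc_Lp S p (%y. L (f y))"
 unfolding loc_Lp_def
proof (intro conjI allI impI)
 have fm: "(%y. indicat_real S y *\<^sub>R f y) \<in> bor" using f by (simp add: loc_Lp_def set_borel_measurable_def)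
 have Lm: "L \<in> bor" by (intro borel_measurable_continuous_onI linear_continuous_on L)
 have "(%y. L (indicat_real S y *\<^sub>R f y)) \<in> bor" using measurable_compose[OF fm Lm] .
 hence m: "(%y. indicat_real S y *\<^sub>R L (f y)) \<in> bor"
  by (simp add: linear_scale[OF bounded_linear.linear[OF L]])
 thus "set_borel_measurable borel S (%y. L (f y))" by (simp add: set_borel_measurable_def)
 obtain C where C: "C >= 0" "!!x. norm (L x) <= norm x * C" using bounded_linear.nonneg_bounded[OF L] by blast
 fix K assume K: "compact K & K \<subseteq> S"
 hence Kb: "K \<in> sets borel" by (simp add: borel_compact)
 have "(%y. indicat_real K y *\<^sub>R norm (indicat_real S y *\<^sub>R L (f y)) powr p) \<in> bor" using m Kb by measurable
 moreover have "(%y. indicat_real K y *\<^sub>R norm (indicat_real S y *\<^sub>R L (f y)) powr p) = (%y. indicat_real K y *\<^sub>R norm (L (f y)) powr p)"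
  using K by (auto simp: indicator_def fun_eq_iff)
 ultimately have gm: "(%y. indicat_real K y *\<^sub>R norm (L (f y)) powr p) \<in> borel_measurable lborel" by simp
 have "lint (%y. C powr p * (indicat_real K y *\<^sub>R norm (f y) powr p))"
  using f K unfolding loc_Lp_def set_integrable_def by (intro integrable_mult_right) blast
 thus "set_integrable lborel K (%y. norm (L (f y)) powr p)"
  unfolding set_integrable_def
 proof (rule Bochner_Integration.integrable_bound[OF _ gm])
  show "AE y in lborel. norm (indicat_real K y *\<^sub>R norm (L (f y)) powr p) <= norm (C powr p * (indicat_real K y *\<^sub>R norm (f y) powr p))"
  proof (rule AE_I2)
   fix y
   have "norm (L (f y)) powr p <= (norm (f y) * C) powr p" by (rule powr_mono2[OF p norm_ge_zero C(2)])
   also have "... = C powr p * norm (f y) powr p" using C(1) by (simp add: powr_mult mult.commute)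
   finally have "norm (L (f y)) powr p <= C powr p * norm (f y) powr p" .
   thus "norm (indicat_real K y *\<^sub>R norm (L (f y)) powr p) <= norm (C powr p * (indicat_real K y *\<^sub>R norm (f y) powr p))"
    by (simp add: indicator_def)
  qed
 qed
qed

lemma weak_partial_linear:
 fixes f f' :: "real^2 => 'v::euclidean_space" and L :: "'v => 'w::euclidean_space"
 assumes L: "bounded_linear L" and w: "weak_partial S i f f'"
 shows "weak_partial S i (%y. L (f y)) (%y. L (f' y))"
 unfolding weak_partial_def
proof (intro conjI allI impI)
 have l: "loc_Lp S 1 f" "loc_Lp S 1 f'" using w by (auto simp: weak_partial_def)
 show "loc_Lp S 1 (%y. L (f y))" "loc_Lp S 1 (%y. L (f' y))" by (rule loc_Lp_linear[OF L l(1)], simp) (rule loc_Lp_linear[OF L l(2)], simp)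
 fix n assume n: "test_function S n"
 obtain K where K: "C1 n (%y. pd 1 n y) (%y. pd 2 n y)"
  "compact K" "K \<subseteq> S" "supp_in K n" by (rule test_function_C1[OF n])
 have i: "i = 1 \<or> i = 2" by (rule exhaust_2)
 have d: "cont (%y. pd i n y)" "supp_in K (%y. pd i n y)"
  using i K(1) C1_supp_deriv[OF K(1,2,4)] by (auto simp: C1_def)
 have e: "(LINT y:S|lborel. h y *\<^sub>R L (k y)) = L (LINT y:S|lborel. h y *\<^sub>R k y)"
  if "loc_Lp S 1 k" "cont h" "supp_in K h" for h :: plane and k
 proof -
  have "lint (%y. indicat_real S y *\<^sub>R (h y *\<^sub>R k y))"
   using loc_Lp_mult_integrable[OF that(1,2) K(2,3) that(3)] by (simp add: mult.commute)
  from integral_bounded_linear[OF L this] show ?thesis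
   by (simp add: set_lebesgue_integral_def linear_scale[OF bounded_linear.linear[OF L]])
 qed
 have "(LINT y:S|lborel. pd i n y *\<^sub>R f y) = - (LINT y:S|lborel. n y *\<^sub>R f' y)"
  using w n by (simp add: weak_partial_def)
 from arg_cong[OF this, of L] show "(LINT y:S|lborel. pd i n y *\<^sub>R L (f y)) = - (LINT y:S|lborel. n y *\<^sub>R L (f' y))"
  unfolding e[OF l(1) d] e[OF l(2) C1_continuous[OF K(1)] K(4)] by (simp add: linear_neg[OF bounded_linear.linear[OF L]])
qed

lemma equivariant_liftD:
 assumes U: "equivariant_lift \<pi> \<Gamma> u \<rho> U"
 shows "cont U" "range U \<subseteq> hyperboloid" "u (\<pi> x) = orbit \<Gamma> (U x)" (is ?P1) "\<gamma> \<in> deck \<pi> ==> \<rho> \<gamma> \<in> \<Gamma>"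
  "\<gamma> \<in> deck \<pi> ==> U (\<gamma> x) = \<rho> \<gamma> *v U x" "bundle_section \<pi> (std_act \<rho>) U" (is ?P2)
proof -
 note D = U[unfolded equivariant_lift_def]
 note D2 = conjunct2[OF D] note D3 = conjunct2[OF D2] note D4 = conjunct2[OF D3]
 show "cont U" by (rule conjunct1[OF D])
 show "range U \<subseteq> hyperboloid" by (rule conjunct1[OF D2])
 show ?P1 by (rule spec[OF conjunct1[OF D3]])
 show "\<gamma> \<in> deck \<pi> ==> \<rho> \<gamma> \<in> \<Gamma>" using conjunct1[OF D4] by blast
 show b: ?P2 by (rule conjunct2[OF conjunct2[OF D4]])
 show "\<gamma> \<in> deck \<pi> ==> U (\<gamma> x) = \<rho> \<gamma> *v U x" using b unfolding bundle_section_def std_act_def by blast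
qed

text \<open>The lift and the representation are determined by \<open>u\<close> up to one element of \<open>\<Gamma>\<close>, so the Sobolev class
 of any lift is that of the lift in the definition of \<open>sobolev_map\<close>.\<close>

lemma (in surf) lift_W1p:
 assumes G: "closed_surface_group \<Gamma>" and s: "sobolev_map M \<pi> \<Gamma> p u" and U: "equivariant_lift \<pi> \<Gamma> u \<rho> U" and p: "p > 2"
 shows "W1p_section M \<pi> (std_act \<rho>) p U"
proof -
 from s obtain \<rho>' U' where "equivariant_lift \<pi> \<Gamma> u \<rho>' U' & W1p_section M \<pi> (std_act \<rho>') p U'"
  unfolding sobolev_map_def by blast
 hence U': "equivariant_lift \<pi> \<Gamma> u \<rho>' U'" and W': "W1p_section M \<pi> (std_act \<rho>') p U'" by blast+
 note e = equivariant_liftD[OF U] and e' = equivariant_liftD[OF U']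
 have conn: "connected (UNIV :: 'c set)"
  by (intro path_connected_imp_connected simply_connected_imp_path_connected_UNIV)
   (use uc in "simp add: universal_covering_def")
 have orb: "orbit \<Gamma> (U x) = orbit \<Gamma> (U' x)" for x using e(3)[of x] e'(3)[of x] by simp
 from lifts_differ_by_constant[OF G conn e(1,2) e'(1,2) orb] obtain L where L: "L \<in> \<Gamma>" "!!x. U x = L *v U' x" by blast
 note GS = group_facts(1)[OF G] and Gm = group_facts(3)[OF G] and Gi = group_facts(4)[OF G] and free = group_facts(5)[OF G]
 \<comment> \<open>Both products belong to \<Gamma> and agree at the point U' x. Since \<Gamma> acts
   freely, they are equal; so L intertwines the two representations.\<close>
 have comm: "L ** \<rho>' \<gamma> = \<rho> \<gamma> ** L" if g: "\<gamma> \<in> deck \<pi>" for \<gamma>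
 proof -
  let ?A = "\<rho> \<gamma> ** L"
  have A: "?A \<in> \<Gamma>" using e(4)[OF g] L(1) Gm by blast
  note Ai = SO21_inv(2,3)[OF subsetD[OF GS A]]
  obtain x :: 'c where True by blast
  have "?A *v U' x = L *v (\<rho>' \<gamma> *v U' x)"
   using e(5)[OF g, of x] e'(5)[OF g, of x] L(2)[of x] L(2)[of "\<gamma> x"] by (simp add: matrix_vector_mul_assoc)
  hence "matrix_inv ?A *v (?A *v U' x) = (matrix_inv ?A ** (L ** \<rho>' \<gamma>)) *v U' x" by (simp add: matrix_vector_mul_assoc matrix_mul_assoc)
  hence "(matrix_inv ?A ** (L ** \<rho>' \<gamma>)) *v U' x = U' x" by (simp add: matrix_vector_mul_assoc Ai)
  hence "matrix_inv ?A ** (L ** \<rho>' \<gamma>) = mat 1"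
   by (intro free[where X="U' x"]) (use A Gi Gm L(1) e'(2,4) g in auto)
  hence "?A ** (matrix_inv ?A ** (L ** \<rho>' \<gamma>)) = ?A" by simp
  thus ?thesis by (simp add: matrix_mul_assoc Ai)
 qed
 from W' obtain \<alpha> where \<alpha>: "oform (std_act \<rho>') \<alpha>" "weak_differential M \<pi> U' \<alpha>"
  "!!c W. patch M \<pi> c W ==> loc_Lp (pdom c W) p (%y. U' (pinv c W y))"
  "!!c W i. patch M \<pi> c W ==> loc_Lp (pdom c W) p (%y. \<alpha> c (pinv c W y) (axis i 1))"
  unfolding W1p_section_def by blast
 have bl: "bounded_linear ((*v) L)" by (rule matrix_vector_mul_bounded_linear)
 have "oform (std_act \<rho>) (%c x v. L *v \<alpha> c x v)"
  unfolding one_form_def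
 proof (intro ballI allI impI conjI)
  fix c x assume c: "c \<in> charts M" "\<pi> x \<in> fst c"
  have "linear (\<alpha> c x)" by (rule one_form_linear[OF \<alpha>(1) c])
  from linear_compose[OF this matrix_vector_mul_linear, of L] show "linear (%v. L *v \<alpha> c x v)" by (simp add: o_def)
  show "L *v \<alpha> c (\<gamma> x) v = std_act \<rho> \<gamma> (L *v \<alpha> c x v)" if g: "\<gamma> \<in> deck \<pi>" for \<gamma> v
  proof -
   have "\<alpha> c (\<gamma> x) v = \<rho>' \<gamma> *v \<alpha> c x v" using \<alpha>(1) c g unfolding one_form_def std_act_def by blast
   thus ?thesis by (simp add: std_act_def matrix_vector_mul_assoc comm[OF g])
  qed
  show "L *v \<alpha> c x v = L *v \<alpha> c' x (trans_jac c c' (\<pi> x) *v v)" if "c' \<in> charts M" "\<pi> x \<in> fst c'" for c' v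
  proof -
   have "\<alpha> c x v = \<alpha> c' x (trans_jac c c' (\<pi> x) *v v)" using \<alpha>(1) c that unfolding one_form_def by blast
   thus ?thesis by simp
  qed
 qed
 moreover have "weak_differential M \<pi> U (%c x v. L *v \<alpha> c x v)"
  unfolding weak_differential_def L(2)
  using \<alpha>(2) unfolding weak_differential_def by (intro allI impI weak_partial_linear[OF bl]) blast
 moreover have "loc_Lp (pdom c W) p (%y. U (pinv c W y))"
  "loc_Lp (pdom c W) p (%y. L *v \<alpha> c (pinv c W y) (axis i 1))" if "patch M \<pi> c W" for c W i
  unfolding L(2) using p by (auto intro!: loc_Lp_linear[OF bl] \<alpha>(3,4) that)
 ultimately show ?thesis using e(6) unfolding W1p_section_def by blast
qed

theorem theorem3p8:
  fixes M :: "'m::{t2_space,second_countable_topology} rsurface"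
    and \<pi> :: "'c::topological_space \<Rightarrow> 'm"
    and \<Gamma> :: "(real^3^3) set"
    and u :: "'m \<Rightarrow> (real^3) set"
    and \<rho> :: "('c \<Rightarrow> 'c) \<Rightarrow> real^3^3"
    and U :: "'c \<Rightarrow> real^3"
    and p q :: real
  assumes "closed_oriented_riemannian_surface M"
    and "universal_covering \<pi>"
    and "closed_surface_group \<Gamma>"
    and "p > 2" and "1 / p + 1 / q = 1"
    and "sobolev_map M \<pi> \<Gamma> p u"
    and "equivariant_lift \<pi> \<Gamma> u \<rho> U"
    and "Jp_euler_lagrange M \<pi> \<rho> U p"
  shows "is_arg_min (Jq M \<pi> \<rho> U p q) (\<lambda>\<psi>. \<psi> \<in> p_sections M \<pi> \<rho> U p) (\<lambda>x. 0) \<and>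
    weakly_Du_closed M \<pi> \<rho> U p (hodge M \<pi> (QV_form M \<pi> \<rho> U p q))"
proof -
  interpret surf M \<pi> by unfold_locales fact+
  note group_facts(1)[OF assms(3)]
  then interpret hmap M \<pi> \<rho> U p q
    using assms(4,5) equivariant_liftD[OF assms(7)] lift_W1p[OF assms(3,6,7,4)] by unfold_locales blast+
  show ?thesis
    using zero_PS minimal closed by (auto simp: is_arg_min_def not_less)
qed

end
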